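(* Let $G$ be a compact group with unit $e$, endowed with a continuous length function $\ell$ such that $\ell(hgh^{-1})=\ell(g)$ for all $g,h\in G$. Let $\mathscr{G}$ be a nonempty collection of closed subgroups of $G$ which is closed for the Hausdorff distance $\mathsf{Haus}_\ell$ induced by $\ell$. Let $F$ be an admissible function. Let $\mathcal{C}$ be the class of all $F$-quasi-Leibniz quantum compact metric spaces $(\mathfrak{A},\mathsf{L})$ for which there exist $H\in\mathscr{G}$ and a strongly continuous ergodic action $\alpha$ of $H$ on $\mathfrak{A}$ such that: (i) for all $a\in\mathfrak{sa}(\mathfrak{A})$, $$\mathsf{L}(a)\ge\sup\left\{\frac{\|a-\alpha^h(a)\|_{\mathfrak{A}}}{\ell(h)}:h\in H\setminus\{e\}\right\};$$ (ii) for all $h\in H$, the automorphism $\alpha^h$ is $1$-Lipschitz, i.e. $\mathsf{L}\circ\alpha^h\le\mathsf{L}$. Then the class $\mathcal{C}$ is not empty and is closed for the dual propinquity $\Lambda^\ast_F$.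
   Context: For a unital C*-algebra $\mathfrak{A}$: $1_{\mathfrak{A}}$ is its unit, $\mathfrak{sa}(\mathfrak{A})$ its self-adjoint part, $\mathscr{S}(\mathfrak{A})$ its state space; $a\circ b=\frac{ab+ba}{2}$ and $\{a,b\}=\frac{ab-ba}{2i}$ are the Jordan and Lie products of $a,b\in\mathfrak{sa}(\mathfrak{A})$. A function $F:[0,\infty]^4\to[0,\infty]$ is admissible when it is weakly increasing for the product order and $xl_y+yl_x\le F(x,y,l_x,l_y)$ for all $x,y,l_x,l_y\ge0$. An $F$-quasi-Leibniz quantum compact metric space $(\mathfrak{A},\mathsf{L})$ is a unital C*-algebra $\mathfrak{A}$ with a seminorm $\mathsf{L}$ defined on a dense Jordan-Lie subalgebra $\mathrm{dom}(\mathsf{L})$ of $\mathfrak{sa}(\mathfrak{A})$ such that: (1) $\{a\in\mathrm{dom}(\mathsf{L}):\mathsf{L}(a)=0\}=\mathbb{R}1_{\mathfrak{A}}$; (2) the Monge-Kantorovich metric $\mathsf{mk}_{\mathsf{L}}(\varphi,\psi)=\sup\{|\varphi(a)-\psi(a)|:a\in\mathrm{dom}(\mathsf{L}),\mathsf{L}(a)\le1\}$ metrizes the weak* topology of $\mathscr{S}(\mathfrak{A})$; (3) $\max\{\mathsf{L}(a\circ b),\mathsf{L}(\{a,b\})\}\le F(\|a\|_{\mathfrak{A}},\|b\|_{\mathfrak{A}},\mathsf{L}(a),\mathsf{L}(b))$ for all $a,b\in\mathrm{dom}(\mathsf{L})$; (4) $\mathsf{L}$ is lower semicontinuous on $\mathfrak{sa}(\mathfrak{A})$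 for the norm, where $\mathsf{L}(a)=\infty$ for $a\in\mathfrak{sa}(\mathfrak{A})\setminus\mathrm{dom}(\mathsf{L})$. A quantum isometry $\pi:(\mathfrak{A},\mathsf{L}_{\mathfrak{A}})\to(\mathfrak{B},\mathsf{L}_{\mathfrak{B}})$ is a surjective *-homomorphism with $\mathsf{L}_{\mathfrak{B}}(b)=\inf\{\mathsf{L}_{\mathfrak{A}}(a):a\in\mathfrak{sa}(\mathfrak{A}),\pi(a)=b\}$ for all $b\in\mathfrak{sa}(\mathfrak{B})$. An $F$-tunnel $\tau=(\mathfrak{D},\mathsf{L}_{\mathfrak{D}},\pi_{\mathfrak{A}},\pi_{\mathfrak{B}})$ from $(\mathfrak{A},\mathsf{L}_{\mathfrak{A}})$ to $(\mathfrak{B},\mathsf{L}_{\mathfrak{B}})$ is an $F$-quasi-Leibniz quantum compact metric space $(\mathfrak{D},\mathsf{L}_{\mathfrak{D}})$ with quantum isometries $\pi_{\mathfrak{A}},\pi_{\mathfrak{B}}$ from it onto $(\mathfrak{A},\mathsf{L}_{\mathfrak{A}})$ and $(\mathfrak{B},\mathsf{L}_{\mathfrak{B}})$. Its extent $\chi(\tau)$ is the maximum of the Hausdorff distances, for $\mathsf{mk}_{\mathsf{L}_{\mathfrak{D}}}$, between $\mathscr{S}(\mathfrak{D})$ and $\{\varphi\circ\pi:\varphi\in\mathscr{S}(\mathfrak{E})\}$ over $(\pi,\mathfrak{E})\in\{(\pi_{\mathfrak{A}},\mathfrak{A}),(\pi_{\mathfrak{B}},\mathfrak{B})\}$. The dual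 propinquity $\Lambda^\ast_F((\mathfrak{A},\mathsf{L}_{\mathfrak{A}}),(\mathfrak{B},\mathsf{L}_{\mathfrak{B}}))$ is the infimum of $\chi(\tau)$ over all $F$-tunnels $\tau$ from $(\mathfrak{A},\mathsf{L}_{\mathfrak{A}})$ to $(\mathfrak{B},\mathsf{L}_{\mathfrak{B}})$. A class $\mathcal{C}$ of $F$-quasi-Leibniz quantum compact metric spaces is closed for $\Lambda^\ast_F$ if every $F$-quasi-Leibniz quantum compact metric space which is the $\Lambda^\ast_F$-limit of a sequence in $\mathcal{C}$ is in $\mathcal{C}$. A length function on a group $G$ with unit $e$ is $\ell:G\to[0,\infty)$ with $\ell(g)=0\Leftrightarrow g=e$, $\ell(g^{-1})=\ell(g)$, $\ell(gh)\le\ell(g)+\ell(h)$; $\mathsf{Haus}_\ell$ is the Hausdorff distance on closed subsets of $G$ for the distance $(g,h)\mapsto\ell(h^{-1}g)$. Suprema of the empty set of nonnegative reals are $0$. An action of a group on a C*-algebra is by *-automorphisms; it is strongly continuous when $g\mapsto\alpha^g(a)$ is norm continuous for each $a\in\mathfrak{A}$, and ergodic when its only fixed points are the elements of $\mathbb{C}1_{\mathfrak{A}}$.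
   Formalization: The formal theorem also assumes F is finite at some point with all four arguments positive (if F is infinite at all such points, closedness can fail), and all C*-algebras, tunnels included, live on one underlying type of at least continuum size, which loses nothing up to isomorphism. *)

theory Defs
  imports
    "HOL-Analysis.Analysis"
    "HOL-Library.Equipollence"
    "HOL-Algebra.Module"
    "HOL-Algebra.Group_Action"
begin

section \<open>Compact groups with a length function\<close>

text \<open>The Hausdorff property is not part of the definition; for a group carrying a continuous
  length function it follows from the remaining axioms.\<close>

locale topological_group = group G for G (structure) +
  fixes T :: "'g topology"
  assumes topspace_carrier: "topspace T = carrier G"
    and continuous_mult: "continuous_map (prod_topology T T) T (\<lambda>(x, y). x \<otimes> y)"
    and continuous_inv: "continuous_map T T (\<lambda>x. inv x)"

definition length_function :: "'g monoid \<Rightarrow> ('g \<Rightarrow> real) \<Rightarrow> bool" where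
  "length_function G ell \<longleftrightarrow>
     (\<forall>g\<in>carrier G. 0 \<le> ell g \<and> (ell g = 0 \<longleftrightarrow> g = \<one>\<^bsub>G\<^esub>) \<and> ell (inv\<^bsub>G\<^esub> g) = ell g) \<and>
     (\<forall>g\<in>carrier G. \<forall>h\<in>carrier G. ell (g \<otimes>\<^bsub>G\<^esub> h) \<le> ell g + ell h)"

text \<open>With values in \<open>[0, \<infinity>]\<close>, where an infimum over the empty set is \<open>\<infinity>\<close>, a nonempty set is at
  distance \<open>\<infinity>\<close> from the empty set.\<close>

definition hausdorff_dist :: "('x \<Rightarrow> 'x \<Rightarrow> ennreal) \<Rightarrow> 'x set \<Rightarrow> 'x set \<Rightarrow> ennreal" where
  "hausdorff_dist d S S' = max (SUP x\<in>S. INF y\<in>S'. d x y) (SUP y\<in>S'. INF x\<in>S. d x y)"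

definition length_dist :: "'g monoid \<Rightarrow> ('g \<Rightarrow> real) \<Rightarrow> 'g \<Rightarrow> 'g \<Rightarrow> ennreal" where
  "length_dist G ell g h = ennreal (ell (inv\<^bsub>G\<^esub> h \<otimes>\<^bsub>G\<^esub> g))"

definition hausdorff_closed ::
    "'g monoid \<Rightarrow> 'g topology \<Rightarrow> ('g \<Rightarrow> real) \<Rightarrow> 'g set set \<Rightarrow> bool" where
  "hausdorff_closed G T ell \<G> \<longleftrightarrow>
     (\<forall>(S :: nat \<Rightarrow> 'g set) K.
        (\<forall>n. S n \<in> \<G>) \<and> closedin T K \<and>
        (\<lambda>n. hausdorff_dist (length_dist G ell) (S n) K) \<longlonglongrightarrow> 0 \<longrightarrow> K \<in> \<G>)"

section \<open>Unital C*-algebras\<close>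

definition complex_ring :: "complex ring" where
  "complex_ring = \<lparr>carrier = UNIV, mult = (*), one = 1, zero = 0, add = (+)\<rparr>"

record 'a cstar = "(complex, 'a) module" +
  adj :: "'a \<Rightarrow> 'a"
  cnorm :: "'a \<Rightarrow> real"

definition norm_dist :: "'a cstar \<Rightarrow> 'a \<Rightarrow> 'a \<Rightarrow> real" where
  "norm_dist A a b = (if a \<in> carrier A \<and> b \<in> carrier A then cnorm A (a \<ominus>\<^bsub>A\<^esub> b) else 0)"

definition norm_topology :: "'a cstar \<Rightarrow> 'a topology" where
  "norm_topology A = Metric_space.mtopology (carrier A) (norm_dist A)"

locale unital_cstar_algebra = ring A + scalar: module complex_ring A
  for A :: "'a cstar" (structure) +
  assumes smult_mult_left: "\<lbrakk>a \<in> carrier A; b \<in> carrier A\<rbrakk> \<Longrightarrow> (c \<odot> a) \<otimes> b = c \<odot> (a \<otimes> b)"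
    and smult_mult_right: "\<lbrakk>a \<in> carrier A; b \<in> carrier A\<rbrakk> \<Longrightarrow> a \<otimes> (c \<odot> b) = c \<odot> (a \<otimes> b)"
    and one_neq_zero: "\<one> \<noteq> \<zero>"
    and adj_closed: "a \<in> carrier A \<Longrightarrow> adj A a \<in> carrier A"
    and adj_adj: "a \<in> carrier A \<Longrightarrow> adj A (adj A a) = a"
    and adj_add: "\<lbrakk>a \<in> carrier A; b \<in> carrier A\<rbrakk> \<Longrightarrow> adj A (a \<oplus> b) = adj A a \<oplus> adj A b"
    and adj_smult: "a \<in> carrier A \<Longrightarrow> adj A (c \<odot> a) = cnj c \<odot> adj A a"
    and adj_mult: "\<lbrakk>a \<in> carrier A; b \<in> carrier A\<rbrakk> \<Longrightarrow> adj A (a \<otimes> b) = adj A b \<otimes> adj A a"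
    and cnorm_nonneg: "a \<in> carrier A \<Longrightarrow> 0 \<le> cnorm A a"
    and cnorm_eq_zero: "a \<in> carrier A \<Longrightarrow> cnorm A a = 0 \<longleftrightarrow> a = \<zero>"
    and cnorm_triangle: "\<lbrakk>a \<in> carrier A; b \<in> carrier A\<rbrakk> \<Longrightarrow> cnorm A (a \<oplus> b) \<le> cnorm A a + cnorm A b"
    and cnorm_smult: "a \<in> carrier A \<Longrightarrow> cnorm A (c \<odot> a) = cmod c * cnorm A a"
    and cnorm_mult: "\<lbrakk>a \<in> carrier A; b \<in> carrier A\<rbrakk> \<Longrightarrow> cnorm A (a \<otimes> b) \<le> cnorm A a * cnorm A b"
    and cstar_identity: "a \<in> carrier A \<Longrightarrow> cnorm A (adj A a \<otimes> a) = (cnorm A a)\<^sup>2"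
    and complete: "Metric_space.mcomplete (carrier A) (norm_dist A)"

definition self_adjoint :: "'a cstar \<Rightarrow> 'a set" where
  "self_adjoint A = {a \<in> carrier A. adj A a = a}"

definition jordan_prod :: "'a cstar \<Rightarrow> 'a \<Rightarrow> 'a \<Rightarrow> 'a" where
  "jordan_prod A a b = (1 / 2) \<odot>\<^bsub>A\<^esub> (a \<otimes>\<^bsub>A\<^esub> b \<oplus>\<^bsub>A\<^esub> b \<otimes>\<^bsub>A\<^esub> a)"

definition lie_prod :: "'a cstar \<Rightarrow> 'a \<Rightarrow> 'a \<Rightarrow> 'a" where
  "lie_prod A a b = (1 / (2 * \<i>)) \<odot>\<^bsub>A\<^esub> (a \<otimes>\<^bsub>A\<^esub> b \<ominus>\<^bsub>A\<^esub> b \<otimes>\<^bsub>A\<^esub> a)"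

text \<open>Homomorphisms in \<^const>\<open>ring_hom\<close> preserve the unit, which is automatic for the surjective
  *-homomorphisms considered here.\<close>

definition star_hom :: "'a cstar \<Rightarrow> 'b cstar \<Rightarrow> ('a \<Rightarrow> 'b) set" where
  "star_hom A B = {h \<in> ring_hom A B. \<forall>a\<in>carrier A.
     (\<forall>c. h (c \<odot>\<^bsub>A\<^esub> a) = c \<odot>\<^bsub>B\<^esub> h a) \<and> h (adj A a) = adj B (h a)}"

text \<open>States are extensional functions, so that two states are equal as soon as they agree on the
  carrier.\<close>

definition states :: "'a cstar \<Rightarrow> ('a \<Rightarrow> complex) set" where
  "states A = {\<phi> \<in> extensional (carrier A).
     (\<forall>a\<in>carrier A. \<forall>b\<in>carrier A. \<phi> (a \<oplus>\<^bsub>A\<^esub> b) = \<phi> a + \<phi> b) \<and>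
     (\<forall>c. \<forall>a\<in>carrier A. \<phi> (c \<odot>\<^bsub>A\<^esub> a) = c * \<phi> a) \<and>
     (\<forall>a\<in>carrier A. \<phi> (adj A a \<otimes>\<^bsub>A\<^esub> a) \<in> \<real>\<^sub>\<ge>\<^sub>0) \<and>
     \<phi> \<one>\<^bsub>A\<^esub> = 1}"

definition weak_star_topology :: "'a cstar \<Rightarrow> ('a \<Rightarrow> complex) topology" where
  "weak_star_topology A = subtopology (product_topology (\<lambda>_. euclidean) (carrier A)) (states A)"

section \<open>Quasi-Leibniz quantum compact metric spaces\<close>

definition admissible :: "(ennreal \<Rightarrow> ennreal \<Rightarrow> ennreal \<Rightarrow> ennreal \<Rightarrow> ennreal) \<Rightarrow> bool" where
  "admissible F \<longleftrightarrow>
     (\<forall>x x' y y' lx lx' ly ly'. x \<le> x' \<and> y \<le> y' \<and> lx \<le> lx' \<and> ly \<le> ly' \<longrightarrow>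
        F x y lx ly \<le> F x' y' lx' ly') \<and>
     (\<forall>x y lx ly. x * ly + y * lx \<le> F x y lx ly)"

text \<open>A seminorm \<open>L\<close> defined on a subspace of the self-adjoint part is encoded as a function with
  values in \<open>[0, \<infinity>]\<close> that is \<open>\<infinity>\<close> on the self-adjoint elements outside its domain; its values
  at elements that are not self-adjoint are irrelevant.\<close>

definition lip_dom :: "'a cstar \<Rightarrow> ('a \<Rightarrow> ennreal) \<Rightarrow> 'a set" where
  "lip_dom A L = {a \<in> self_adjoint A. L a < \<infinity>}"

definition seminorm_on_dom :: "'a cstar \<Rightarrow> ('a \<Rightarrow> ennreal) \<Rightarrow> bool" where
  "seminorm_on_dom A L \<longleftrightarrow>
     (\<forall>a\<in>lip_dom A L. \<forall>b\<in>lip_dom A L. L (a \<oplus>\<^bsub>A\<^esub> b) \<le> L a + L b) \<and>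
     (\<forall>a\<in>lip_dom A L. \<forall>t :: real. L (complex_of_real t \<odot>\<^bsub>A\<^esub> a) = ennreal \<bar>t\<bar> * L a)"

definition jordan_lie_subalgebra :: "'a cstar \<Rightarrow> 'a set \<Rightarrow> bool" where
  "jordan_lie_subalgebra A S \<longleftrightarrow>
     S \<subseteq> self_adjoint A \<and> \<zero>\<^bsub>A\<^esub> \<in> S \<and>
     (\<forall>a\<in>S. \<forall>t :: real. complex_of_real t \<odot>\<^bsub>A\<^esub> a \<in> S) \<and>
     (\<forall>a\<in>S. \<forall>b\<in>S. a \<oplus>\<^bsub>A\<^esub> b \<in> S \<and> jordan_prod A a b \<in> S \<and> lie_prod A a b \<in> S)"

definition mk_dist :: "'a cstar \<Rightarrow> ('a \<Rightarrow> ennreal) \<Rightarrow> ('a \<Rightarrow> complex) \<Rightarrow> ('a \<Rightarrow> complex) \<Rightarrow> ennreal" where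
  "mk_dist A L \<phi> \<psi> = (SUP a\<in>{a \<in> lip_dom A L. L a \<le> 1}. ennreal (cmod (\<phi> a - \<psi> a)))"

definition metrizes :: "('x \<Rightarrow> 'x \<Rightarrow> ennreal) \<Rightarrow> 'x topology \<Rightarrow> bool" where
  "metrizes d X \<longleftrightarrow>
     (\<forall>x\<in>topspace X. \<forall>y\<in>topspace X. d x y < \<infinity>) \<and>
     Metric_space (topspace X) (\<lambda>x y. enn2real (d x y)) \<and>
     Metric_space.mtopology (topspace X) (\<lambda>x y. enn2real (d x y)) = X"

definition lower_semicontinuous :: "'x topology \<Rightarrow> ('x \<Rightarrow> ennreal) \<Rightarrow> bool" where
  "lower_semicontinuous X f \<longleftrightarrow> (\<forall>c. openin X {x \<in> topspace X. c < f x})"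

definition qcms ::
    "(ennreal \<Rightarrow> ennreal \<Rightarrow> ennreal \<Rightarrow> ennreal \<Rightarrow> ennreal) \<Rightarrow> 'a cstar \<Rightarrow> ('a \<Rightarrow> ennreal) \<Rightarrow> bool" where
  "qcms F A L \<longleftrightarrow>
     unital_cstar_algebra A \<and>
     jordan_lie_subalgebra A (lip_dom A L) \<and>
     self_adjoint A \<subseteq> norm_topology A closure_of lip_dom A L \<and>
     seminorm_on_dom A L \<and>
     {a \<in> lip_dom A L. L a = 0} = {complex_of_real t \<odot>\<^bsub>A\<^esub> \<one>\<^bsub>A\<^esub> | t :: real. True} \<and>
     metrizes (mk_dist A L) (weak_star_topology A) \<and>
     (\<forall>a\<in>lip_dom A L. \<forall>b\<in>lip_dom A L.
        max (L (jordan_prod A a b)) (L (lie_prod A a b))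
          \<le> F (ennreal (cnorm A a)) (ennreal (cnorm A b)) (L a) (L b)) \<and>
     lower_semicontinuous (subtopology (norm_topology A) (self_adjoint A)) L"

section \<open>The dual propinquity\<close>

definition quantum_isometry ::
    "'a cstar \<Rightarrow> ('a \<Rightarrow> ennreal) \<Rightarrow> 'b cstar \<Rightarrow> ('b \<Rightarrow> ennreal) \<Rightarrow> ('a \<Rightarrow> 'b) \<Rightarrow> bool" where
  "quantum_isometry A LA B LB \<pi> \<longleftrightarrow>
     \<pi> \<in> star_hom A B \<and> \<pi> ` carrier A = carrier B \<and>
     (\<forall>b\<in>self_adjoint B. LB b = (INF a\<in>{a \<in> self_adjoint A. \<pi> a = b}. LA a))"

definition tunnels ::
    "(ennreal \<Rightarrow> ennreal \<Rightarrow> ennreal \<Rightarrow> ennreal \<Rightarrow> ennreal) \<Rightarrow>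
     'a cstar \<Rightarrow> ('a \<Rightarrow> ennreal) \<Rightarrow> 'b cstar \<Rightarrow> ('b \<Rightarrow> ennreal) \<Rightarrow>
     ('d cstar \<times> ('d \<Rightarrow> ennreal) \<times> ('d \<Rightarrow> 'a) \<times> ('d \<Rightarrow> 'b)) set" where
  "tunnels F A LA B LB = {(D, LD, \<pi>A, \<pi>B).
     qcms F D LD \<and> quantum_isometry D LD A LA \<pi>A \<and> quantum_isometry D LD B LB \<pi>B}"

definition pullback_states :: "'d cstar \<Rightarrow> 'a cstar \<Rightarrow> ('d \<Rightarrow> 'a) \<Rightarrow> ('d \<Rightarrow> complex) set" where
  "pullback_states D A \<pi> = (\<lambda>\<phi>. compose (carrier D) \<phi> \<pi>) ` states A"

definition extent ::
    "'a cstar \<Rightarrow> 'b cstar \<Rightarrow> 'd cstar \<times> ('d \<Rightarrow> ennreal) \<times> ('d \<Rightarrow> 'a) \<times> ('d \<Rightarrow> 'b) \<Rightarrow> ennreal" where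
  "extent A B \<tau> = (case \<tau> of (D, LD, \<pi>A, \<pi>B) \<Rightarrow>
     max (hausdorff_dist (mk_dist D LD) (states D) (pullback_states D A \<pi>A))
         (hausdorff_dist (mk_dist D LD) (states D) (pullback_states D B \<pi>B)))"

text \<open>All algebras, including those of the tunnels, have their carriers in one type \<open>'a\<close>. Since the
  state space of a quantum compact metric space is metrizable, its algebra is separable and has at
  most the cardinality of the continuum. Hence, if \<open>'a\<close> has at least that cardinality, every tunnel
  is isomorphic to one over \<open>'a\<close> with the same extent, and the infimum below is the infimum over
  all tunnels.\<close>

definition dual_propinquity ::
    "(ennreal \<Rightarrow> ennreal \<Rightarrow> ennreal \<Rightarrow> ennreal \<Rightarrow> ennreal) \<Rightarrow>
     'a cstar \<Rightarrow> ('a \<Rightarrow> ennreal) \<Rightarrow> 'a cstar \<Rightarrow> ('a \<Rightarrow> ennreal) \<Rightarrow> ennreal" where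
  "dual_propinquity F A LA B LB =
     (INF \<tau>\<in>(tunnels F A LA B LB
              :: ('a cstar \<times> ('a \<Rightarrow> ennreal) \<times> ('a \<Rightarrow> 'a) \<times> ('a \<Rightarrow> 'a)) set). extent A B \<tau>)"

definition propinquity_closed ::
    "(ennreal \<Rightarrow> ennreal \<Rightarrow> ennreal \<Rightarrow> ennreal \<Rightarrow> ennreal) \<Rightarrow> ('a cstar \<times> ('a \<Rightarrow> ennreal)) set \<Rightarrow> bool" where
  "propinquity_closed F \<C> \<longleftrightarrow>
     (\<forall>(A :: nat \<Rightarrow> 'a cstar) (LA :: nat \<Rightarrow> 'a \<Rightarrow> ennreal) B LB.
        (\<forall>n. (A n, LA n) \<in> \<C>) \<and> qcms F B LB \<and>
        (\<lambda>n. dual_propinquity F (A n) (LA n) B LB) \<longlonglongrightarrow> 0 \<longrightarrow> (B, LB) \<in> \<C>)"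

section \<open>Ergodic actions\<close>

text \<open>In HOL-Algebra, \<^const>\<open>group_action\<close> includes the convention that each \<open>\<alpha> h\<close> is extensional
  on the carrier of \<open>A\<close>.\<close>

definition cstar_action :: "'g monoid \<Rightarrow> 'g set \<Rightarrow> 'a cstar \<Rightarrow> ('g \<Rightarrow> 'a \<Rightarrow> 'a) \<Rightarrow> bool" where
  "cstar_action G H A \<alpha> \<longleftrightarrow>
     group_action (G\<lparr>carrier := H\<rparr>) (carrier A) \<alpha> \<and> (\<forall>h\<in>H. \<alpha> h \<in> star_hom A A)"

definition strongly_continuous ::
    "'g topology \<Rightarrow> 'g set \<Rightarrow> 'a cstar \<Rightarrow> ('g \<Rightarrow> 'a \<Rightarrow> 'a) \<Rightarrow> bool" where
  "strongly_continuous T H A \<alpha> \<longleftrightarrow>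
     (\<forall>a\<in>carrier A. continuous_map (subtopology T H) (norm_topology A) (\<lambda>h. \<alpha> h a))"

definition ergodic :: "'g set \<Rightarrow> 'a cstar \<Rightarrow> ('g \<Rightarrow> 'a \<Rightarrow> 'a) \<Rightarrow> bool" where
  "ergodic H A \<alpha> \<longleftrightarrow>
     {a \<in> carrier A. \<forall>h\<in>H. \<alpha> h a = a} = {c \<odot>\<^bsub>A\<^esub> \<one>\<^bsub>A\<^esub> | c :: complex. True}"

definition ergodic_lipschitz_class ::
    "'g monoid \<Rightarrow> 'g topology \<Rightarrow> ('g \<Rightarrow> real) \<Rightarrow> 'g set set \<Rightarrow>
     (ennreal \<Rightarrow> ennreal \<Rightarrow> ennreal \<Rightarrow> ennreal \<Rightarrow> ennreal) \<Rightarrow> ('a cstar \<times> ('a \<Rightarrow> ennreal)) set" where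
  "ergodic_lipschitz_class G T ell \<G> F = {(A, L). qcms F A L \<and>
     (\<exists>H\<in>\<G>. \<exists>\<alpha>. cstar_action G H A \<alpha> \<and> strongly_continuous T H A \<alpha> \<and> ergodic H A \<alpha> \<and>
        (\<forall>a\<in>self_adjoint A.
           L a \<ge> (SUP h\<in>H - {\<one>\<^bsub>G\<^esub>}. ennreal (cnorm A (a \<ominus>\<^bsub>A\<^esub> \<alpha> h a) / ell h))) \<and>
        (\<forall>h\<in>H. \<forall>a\<in>self_adjoint A. L (\<alpha> h a) \<le> L a))}"

end

theory Submission
  imports Defs "HOL-Real_Asymp.Real_Asymp"
begin

text \<open>Let \<open>(A n, LA n)\<close> converge to \<open>(B, LB)\<close>, with actions of subgroups \<open>H n\<close> in the collection, and
  fix a nonprincipal ultrafilter on \<open>\<nat>\<close>. Since \<open>G\<close> is compact, the \<open>H n\<close> converge along it to a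
  subgroup \<open>H\<close> in the collection. A tunnel of small extent lifts a Lipschitz element of \<open>B\<close> and pushes
  it down to \<open>A n\<close>; up to a small norm, neither operation depends on choices or changes the norm.
  Moving a sequence \<open>g n \<in> H n\<close> with limit \<open>g\<close> through the tunnels therefore gives, in the ultralimit, a
  relation on \<open>B\<close> that is the graph of a *-homomorphism: it is densely defined because Lipschitz balls
  are compact modulo scalars, and depends only on \<open>g\<close> by hypothesis (i). The automorphism of \<open>g\<close> is its
  continuous extension. Hypotheses (i) and (ii) pass to the limit by
  lower semicontinuity. For ergodicity, an element of \<open>B\<close> fixed by \<open>H\<close> is approximated by elements of
  \<open>A n\<close> that are almost fixed by \<open>H n\<close>, and an almost fixed Lipschitz element of an ergodic action is
  almost a scalar. The class is nonempty because it contains the algebra of scalars.\<close>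

section \<open>Algebraic identities by linear functionals\<close>

text \<open>Every comparison across a tunnel rests on one estimate: a self-adjoint \<open>d\<close>
  with Lipschitz constant at most \<open>l\<close> satisfies
  \<open>norm d <= norm (\<pi> d) + l * \<epsilon>\<close>. Two lifts of one element differ by a
  Lipschitz element of the kernel of \<open>\<pi>\<close>, so their distance vanishes with the
  extent. The estimate needs states that norm self-adjoint elements and contractive *-homomorphisms.
  Both come from the C*-axioms without spectra: square roots are fixed points of contractions,
  positivity is a norm inequality, and states arise from maximal cones.

  Multiplicativity of the limit demands that products of lifts with uniform Lipschitz bounds again
  have uniform bounds. \<open>F\<close> may take the value infinity, but finiteness at a single
  point with positive coordinates suffices: small multiples of the factors lie below that point, and
  the Jordan and Lie products are homogeneous of degree two.

  Invariance of \<open>ell\<close> under conjugation makes its metric invariant on both sides; hence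
  products of convergent sequences of group elements converge, and the limit automorphisms compose
  as an action.\<close>

definition linear_functional :: "'a cstar \<Rightarrow> ('a \<Rightarrow> complex) \<Rightarrow> bool" where
  "linear_functional A f \<longleftrightarrow>
     (\<forall>a\<in>carrier A. \<forall>b\<in>carrier A. f (a \<oplus>\<^bsub>A\<^esub> b) = f a + f b) \<and>
     (\<forall>c. \<forall>a\<in>carrier A. f (c \<odot>\<^bsub>A\<^esub> a) = c * f a)"

lemma complex_ring_simps [simp]:
  "carrier complex_ring = UNIV" "mult complex_ring = (*)" "monoid.one complex_ring = 1"
  "zero complex_ring = 0" "add complex_ring = (+)"
  by (simp_all add: complex_ring_def)

context unital_cstar_algebra
begin

lemma smult_closed [simp, intro]: "a \<in> carrier A \<Longrightarrow> c \<odot> a \<in> carrier A"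
  using scalar.smult_closed by simp

lemma smult_add_left: "a \<in> carrier A \<Longrightarrow> (c + d) \<odot> a = c \<odot> a \<oplus> d \<odot> a"
  using scalar.smult_l_distr[of c d a] by simp

lemma smult_add_right:
  "\<lbrakk>a \<in> carrier A; b \<in> carrier A\<rbrakk> \<Longrightarrow> c \<odot> (a \<oplus> b) = c \<odot> a \<oplus> c \<odot> b"
  using scalar.smult_r_distr[of c a b] by simp

lemma smult_smult: "a \<in> carrier A \<Longrightarrow> c \<odot> (d \<odot> a) = (c * d) \<odot> a"
  using scalar.smult_assoc1[of c d a] by simp

lemma smult_one [simp]: "a \<in> carrier A \<Longrightarrow> 1 \<odot> a = a"
  using scalar.smult_one[of a] by simp

lemma smult_zero_left [simp]: "a \<in> carrier A \<Longrightarrow> 0 \<odot> a = \<zero>"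
  using scalar.smult_l_null[of a] by simp

lemma smult_zero_right [simp]: "c \<odot> \<zero> = \<zero>"
  using scalar.smult_r_null[of c] by simp

lemma a_inv_eq_smult: "a \<in> carrier A \<Longrightarrow> \<ominus> a = (- 1) \<odot> a"
  using smult_add_left[of a "-1" 1] by (intro minus_equality) auto

lemma minus_eq_smult: "\<lbrakk>a \<in> carrier A; b \<in> carrier A\<rbrakk> \<Longrightarrow> a \<ominus> b = a \<oplus> (- 1) \<odot> b"
  by (simp add: a_minus_def a_inv_eq_smult)

lemma minus_eq_zero_iff: "\<lbrakk>a \<in> carrier A; b \<in> carrier A\<rbrakk> \<Longrightarrow> a \<ominus> b = \<zero> \<longleftrightarrow> a = b"
  by (metis a_minus_def add.inv_closed minus_equality minus_minus r_neg)

text \<open>A subspace \<open>M\<close> that is maximal among those missing \<open>x\<close> is a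
  complement of the line through \<open>x\<close>. Every \<open>y\<close> is thus a unique multiple
  of \<open>x\<close> modulo \<open>M\<close>, and this coefficient is the functional.\<close>

lemma linear_functional_separates_zero:
  assumes x: "x \<in> carrier A" "x \<noteq> \<zero>"
  shows "\<exists>f. linear_functional A f \<and> f x \<noteq> 0"
proof -
  define \<S> where "\<S> = {M. M \<subseteq> carrier A \<and> \<zero> \<in> M \<and> (\<forall>a\<in>M. \<forall>b\<in>M. a \<oplus> b \<in> M) \<and>
      (\<forall>c. \<forall>a\<in>M. c \<odot> a \<in> M) \<and> x \<notin> M}"
  have "\<exists>M\<in>\<S>. \<forall>X\<in>\<S>. M \<subseteq> X \<longrightarrow> X = M"
  proof (rule subset_Zorn_nonempty)
    show "\<S> \<noteq> {}" unfolding \<S>_def using x by (auto intro!: exI[of _ "{\<zero>}"])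
    fix C assume C: "C \<noteq> {}" "subset.chain \<S> C"
    have sub: "C \<subseteq> \<S>" using C(2) by (simp add: subset_chain_def)
    have ch: "\<And>X Y. X \<in> C \<Longrightarrow> Y \<in> C \<Longrightarrow> X \<subseteq> Y \<or> Y \<subseteq> X"
      using C(2) by (auto simp: subset_chain_def)
    have "a \<oplus> b \<in> \<Union>C" if ab: "a \<in> \<Union>C" "b \<in> \<Union>C" for a b
    proof -
      obtain X Y where "X \<in> C" "a \<in> X" "Y \<in> C" "b \<in> Y" using ab by blast
      then obtain Z where "Z \<in> C" "a \<in> Z" "b \<in> Z" using ch[of X Y] by blast
      then have "a \<oplus> b \<in> Z" using sub unfolding \<S>_def by blast
      then show ?thesis using \<open>Z \<in> C\<close> by blast
    qed
    moreover have "\<Union>C \<subseteq> carrier A" "\<zero> \<in> \<Union>C" "x \<notin> \<Union>C"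
      using sub C(1) unfolding \<S>_def by blast+
    moreover have "c \<odot> a \<in> \<Union>C" if "a \<in> \<Union>C" for a c
      using that sub unfolding \<S>_def by blast
    ultimately show "\<Union>C \<in> \<S>" unfolding \<S>_def by blast
  qed
  then obtain M where M: "M \<in> \<S>" and max: "\<And>X. X \<in> \<S> \<Longrightarrow> M \<subseteq> X \<Longrightarrow> X = M" by blast
  have Mc: "M \<subseteq> carrier A" and M0: "\<zero> \<in> M"
    and Ma: "\<And>a b. a \<in> M \<Longrightarrow> b \<in> M \<Longrightarrow> a \<oplus> b \<in> M"
    and Ms: "\<And>c a. a \<in> M \<Longrightarrow> c \<odot> a \<in> M" and Mx: "x \<notin> M"
    using M unfolding \<S>_def by auto
  have ex: "\<exists>c. y \<oplus> (- c) \<odot> x \<in> M" if y: "y \<in> carrier A" for y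
  proof (cases "y \<in> M")
    case True
    then show ?thesis using x y by (intro exI[of _ 0]) simp
  next
    case False
    define N where "N = {m \<oplus> d \<odot> y | m d. m \<in> M}"
    have MN: "M \<subseteq> N"
    proof
      fix m assume "m \<in> M"
      then show "m \<in> N" unfolding N_def using y Mc by (intro CollectI exI[of _ m] exI[of _ 0]) auto
    qed
    have yN: "y \<in> N" unfolding N_def using y M0
      by (intro CollectI exI[of _ \<zero>] exI[of _ 1]) auto
    have "N \<notin> \<S>" using max[of N] MN yN False by blast
    moreover have "N \<subseteq> carrier A" unfolding N_def using Mc y by auto
    moreover have "a \<oplus> b \<in> N" if ab: "a \<in> N" "b \<in> N" for a b
    proof -
      obtain m d m' d' where *: "m \<in> M" "m' \<in> M" "a = m \<oplus> d \<odot> y" "b = m' \<oplus> d' \<odot> y"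
        using ab unfolding N_def by blast
      then have mc: "m \<in> carrier A" "m' \<in> carrier A" using Mc by auto
      have "a \<oplus> b = (m \<oplus> m') \<oplus> (d + d') \<odot> y" 
        unfolding *(3,4) using mc y by (simp add: smult_add_left a_ac)
      then show ?thesis unfolding N_def using Ma * by blast
    qed
    moreover have "c \<odot> a \<in> N" if a: "a \<in> N" for a c
    proof -
      obtain m d where *: "m \<in> M" "a = m \<oplus> d \<odot> y" using a unfolding N_def by blast
      then have mc: "m \<in> carrier A" using Mc by auto
      have "c \<odot> a = c \<odot> m \<oplus> (c * d) \<odot> y" 
        unfolding *(2) using mc y by (simp add: smult_add_right smult_smult)
      then show ?thesis unfolding N_def using Ms * by blast
    qed
    \<comment> \<open>\<open>N\<close> contains \<open>M\<close> and \<open>y\<close>, so it exceeds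
      the maximal \<open>M\<close>; of the conditions in \<open>\<S>\<close> it can only violate
      \<open>x \<notin> N\<close>.\<close>
    ultimately have "x \<in> N" using MN M0 unfolding \<S>_def by blast
    then obtain m d where md: "m \<in> M" "x = m \<oplus> d \<odot> y" unfolding N_def by blast
    have d: "d \<noteq> 0" using md Mx Mc y by auto
    have mc: "m \<in> carrier A" using md Mc by auto
    have "y \<oplus> (- (1 / d)) \<odot> x = (- (1/d)) \<odot> m \<oplus> (y \<oplus> (-1) \<odot> y)"
      unfolding md(2) using mc y d by (simp add: smult_add_right smult_smult a_ac)
    also have "y \<oplus> (-1) \<odot> y = \<zero>" using y by (simp flip: a_inv_eq_smult add: r_neg)
    finally show ?thesis using Ms[OF md(1)] mc by (intro exI[of _ "1/d"]) simp
  qed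
  have uniq: "c = d" if y: "y \<in> carrier A" and c: "y \<oplus> (- c) \<odot> x \<in> M" and d: "y \<oplus> (- d) \<odot> x \<in> M"
    for y c d
  proof (rule ccontr)
    assume cd: "c \<noteq> d"
    have "(y \<oplus> (- c) \<odot> x) \<oplus> (- 1) \<odot> (y \<oplus> (- d) \<odot> x) = (y \<oplus> (-1) \<odot> y) \<oplus> (d + (- c)) \<odot> x"
      using x y unfolding smult_add_left[OF x(1)] by (simp add: smult_add_right smult_smult a_ac)
    also have "\<dots> = (d - c) \<odot> x" using x y by (simp flip: a_inv_eq_smult add: r_neg)
    finally have "(d - c) \<odot> x \<in> M" using Ma c Ms[OF d] by metis
    then have "(1 / (d - c)) \<odot> ((d - c) \<odot> x) \<in> M" by (rule Ms)
    then show False using x cd Mx by (simp add: smult_smult)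
  qed
  define f where "f y = (THE c. y \<oplus> (- c) \<odot> x \<in> M)" for y
  have fM: "y \<oplus> (- f y) \<odot> x \<in> M" if "y \<in> carrier A" for y
    unfolding f_def using ex[OF that] uniq[OF that] by (metis (mono_tags, lifting) theI)
  have f_eq: "f y = c" if "y \<in> carrier A" "y \<oplus> (- c) \<odot> x \<in> M" for y c
    using fM uniq that by blast
  have "f (a \<oplus> b) = f a + f b" if ab: "a \<in> carrier A" "b \<in> carrier A" for a b
  proof (rule f_eq)
    have "a \<oplus> b \<oplus> (- (f a + f b)) \<odot> x = (a \<oplus> (- f a) \<odot> x) \<oplus> (b \<oplus> (- f b) \<odot> x)"
      using smult_add_left[OF x(1), of "- f a" "- f b"] ab x by (simp add: a_ac)
    then show "a \<oplus> b \<oplus> (- (f a + f b)) \<odot> x \<in> M" using Ma fM ab by simp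
  qed (use ab in simp)
  moreover have "f (c \<odot> a) = c * f a" if a: "a \<in> carrier A" for a c
  proof (rule f_eq)
    have "c \<odot> a \<oplus> (- (c * f a)) \<odot> x = c \<odot> (a \<oplus> (- f a) \<odot> x)"
      using a x by (simp add: smult_add_right smult_smult)
    then show "c \<odot> a \<oplus> (- (c * f a)) \<odot> x \<in> M" using Ms fM a by simp
  qed (use a in simp)
  moreover have "f x = 1" 
    by (rule f_eq) (use x M0 in \<open>simp_all flip: a_inv_eq_smult add: r_neg\<close>)
  ultimately show ?thesis unfolding linear_functional_def by (intro exI[of _ f]) auto
qed

lemma linear_functional_add: "linear_functional A f \<Longrightarrow> a \<in> carrier A \<Longrightarrow> b \<in> carrier A \<Longrightarrow> f (a \<oplus> b) = f a + f b"
  and linear_functional_smult: "linear_functional A f \<Longrightarrow> a \<in> carrier A \<Longrightarrow> f (c \<odot> a) = c * f a"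
  by (auto simp: linear_functional_def)

lemma linear_functional_zero: "linear_functional A f \<Longrightarrow> f \<zero> = 0"
  using linear_functional_smult[of f "\<zero>" 0] by simp

lemma linear_functional_a_inv: "linear_functional A f \<Longrightarrow> a \<in> carrier A \<Longrightarrow> f (\<ominus> a) = - f a"
  by (simp add: a_inv_eq_smult linear_functional_smult)

lemma linear_functional_minus: "linear_functional A f \<Longrightarrow> a \<in> carrier A \<Longrightarrow> b \<in> carrier A \<Longrightarrow> f (a \<ominus> b) = f a - f b"
  by (simp add: minus_eq_smult linear_functional_smult linear_functional_add)

lemmas linear_functional_simps =
  linear_functional_add linear_functional_smult linear_functional_zero
  linear_functional_a_inv linear_functional_minus

text \<open>The standard route to identities below: both sides are linear combinations of monomials
  in noncommuting factors, and a functional turns the identity into one between complex numbers,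
  which field arithmetic decides.\<close>

lemma eq_by_functionals:
  assumes "a \<in> carrier A" "b \<in> carrier A" "\<And>f. linear_functional A f \<Longrightarrow> f a = f b"
  shows "a = b"
proof (rule ccontr)
  assume "a \<noteq> b"
  then have "a \<ominus> b \<noteq> \<zero>" using assms(1,2) by (simp add: minus_eq_zero_iff)
  then obtain f where "linear_functional A f" "f (a \<ominus> b) \<noteq> 0"
    using linear_functional_separates_zero[of "a \<ominus> b"] assms(1,2) by auto
  then show False using assms by (simp add: linear_functional_simps)
qed

lemma mult_minus_right: "\<lbrakk>a \<in> carrier A; b \<in> carrier A; c \<in> carrier A\<rbrakk> \<Longrightarrow> a \<otimes> (b \<ominus> c) = a \<otimes> b \<ominus> a \<otimes> c"
  by (simp add: a_minus_def r_distr r_minus)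

lemma mult_minus_left: "\<lbrakk>a \<in> carrier A; b \<in> carrier A; c \<in> carrier A\<rbrakk> \<Longrightarrow> (a \<ominus> b) \<otimes> c = a \<otimes> c \<ominus> b \<otimes> c"
  by (simp add: a_minus_def l_distr l_minus)

declare adj_closed [simp, intro]
declare adj_adj [simp]

lemma adj_one [simp]: "adj A \<one> = \<one>"
proof -
  have "adj A (adj A \<one> \<otimes> \<one>) = adj A \<one> \<otimes> adj A (adj A \<one>)" by (rule adj_mult) auto
  then show ?thesis by simp
qed

lemma adj_zero [simp]: "adj A \<zero> = \<zero>"
  using adj_smult[of \<zero> 0] by simp

lemma adj_a_inv: "a \<in> carrier A \<Longrightarrow> adj A (\<ominus> a) = \<ominus> adj A a"
  by (simp add: a_inv_eq_smult adj_smult)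

lemma adj_minus: "\<lbrakk>a \<in> carrier A; b \<in> carrier A\<rbrakk> \<Longrightarrow> adj A (a \<ominus> b) = adj A a \<ominus> adj A b"
  by (simp add: minus_eq_smult adj_smult adj_add)

lemmas adj_simps = adj_add adj_smult adj_mult adj_a_inv adj_minus

lemmas expand_simps = l_distr r_distr mult_minus_left mult_minus_right l_minus r_minus
  smult_mult_left smult_mult_right m_assoc

section \<open>Elementary properties of the norm\<close>

lemma cnorm_zero [simp]: "cnorm A \<zero> = 0"
  using cnorm_eq_zero by simp

text \<open>By the C*-identity the square of the norm of \<open>b\<close> is at most the product of
  the norms of \<open>adj A b\<close> and \<open>b\<close>; cancel, and exchange \<open>b\<close>
  with its adjoint.\<close>

lemma cnorm_adj [simp]: assumes "a \<in> carrier A" shows "cnorm A (adj A a) = cnorm A a"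
proof -
  have le: "cnorm A b \<le> cnorm A (adj A b)" if b: "b \<in> carrier A" for b
  proof (cases "cnorm A b = 0")
    case True then show ?thesis using b cnorm_nonneg by simp
  next
    case False
    have "cnorm A b * cnorm A b \<le> cnorm A (adj A b) * cnorm A b"
      using cstar_identity[OF b] cnorm_mult[of "adj A b" b] b by (simp add: power2_eq_square)
    then show ?thesis using False cnorm_nonneg[OF b] by simp
  qed
  show ?thesis using le[of a] le[of "adj A a"] assms by simp
qed

lemma cnorm_one [simp]: "cnorm A \<one> = 1"
  using cstar_identity[of \<one>] cnorm_eq_zero[of \<one>] one_neq_zero by (simp add: power2_eq_square)

lemma cnorm_a_inv [simp]: "a \<in> carrier A \<Longrightarrow> cnorm A (\<ominus> a) = cnorm A a"
  by (simp add: a_inv_eq_smult cnorm_smult)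

lemma cnorm_minus: "\<lbrakk>a \<in> carrier A; b \<in> carrier A\<rbrakk> \<Longrightarrow> cnorm A (a \<ominus> b) \<le> cnorm A a + cnorm A b"
  using cnorm_triangle[of a "\<ominus> b"] by (simp add: a_minus_def)

lemma cnorm_minus_commute: "\<lbrakk>a \<in> carrier A; b \<in> carrier A\<rbrakk> \<Longrightarrow> cnorm A (a \<ominus> b) = cnorm A (b \<ominus> a)"
  using cnorm_a_inv[of "a \<ominus> b"] by (simp add: a_minus_def minus_add a_comm)

lemma cnorm_minus_triangle:
  assumes "a \<in> carrier A" "b \<in> carrier A" "c \<in> carrier A"
  shows "cnorm A (a \<ominus> c) \<le> cnorm A (a \<ominus> b) + cnorm A (b \<ominus> c)"
proof -
  have "a \<ominus> c = (a \<ominus> b) \<oplus> (b \<ominus> c)"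
    by (rule eq_by_functionals) (use assms in \<open>auto simp: linear_functional_simps\<close>)
  then show ?thesis using cnorm_triangle[of "a \<ominus> b" "b \<ominus> c"] assms by simp
qed

lemma cnorm_triangle_diff:
  assumes "a \<in> carrier A" "b \<in> carrier A"
  shows "cnorm A a \<le> cnorm A b + cnorm A (a \<ominus> b)"
proof -
  have "a = b \<oplus> (a \<ominus> b)"
    by (rule eq_by_functionals) (use assms in \<open>auto simp: linear_functional_simps\<close>)
  then show ?thesis using cnorm_triangle[of b "a \<ominus> b"] assms by simp
qed

lemma cnorm_minus_eq_zero: "\<lbrakk>a \<in> carrier A; b \<in> carrier A\<rbrakk> \<Longrightarrow> cnorm A (a \<ominus> b) = 0 \<longleftrightarrow> a = b"
  by (simp add: cnorm_eq_zero minus_eq_zero_iff)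

lemma cnorm_mult_le:
  "\<lbrakk>a \<in> carrier A; b \<in> carrier A; cnorm A a \<le> r; cnorm A b \<le> s\<rbrakk> \<Longrightarrow> cnorm A (a \<otimes> b) \<le> r * s"
  using cnorm_mult[of a b] cnorm_nonneg[of a] cnorm_nonneg[of b]
  by (meson mult_mono order_trans)

lemma norm_dist_eq: "\<lbrakk>a \<in> carrier A; b \<in> carrier A\<rbrakk> \<Longrightarrow> norm_dist A a b = cnorm A (a \<ominus> b)"
  by (simp add: norm_dist_def)

lemma norm_metric: "Metric_space (carrier A) (norm_dist A)"
proof
  fix x y z
  show "0 \<le> norm_dist A x y" "norm_dist A x y = norm_dist A y x"
    by (auto simp: norm_dist_def cnorm_nonneg cnorm_minus_commute)
  assume "x \<in> carrier A" "y \<in> carrier A"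
  then show "norm_dist A x y = 0 \<longleftrightarrow> x = y"
    by (simp add: norm_dist_def cnorm_minus_eq_zero)
  assume "z \<in> carrier A"
  then show "norm_dist A x z \<le> norm_dist A x y + norm_dist A y z"
    using \<open>x \<in> carrier A\<close> \<open>y \<in> carrier A\<close> by (simp add: norm_dist_def cnorm_minus_triangle)
qed

lemma Cauchy_converges:
  assumes s: "\<And>n. s n \<in> carrier A"
    and C: "\<And>e. e > 0 \<Longrightarrow> \<exists>N. \<forall>m\<ge>N. \<forall>n\<ge>N. cnorm A (s m \<ominus> s n) < e"
  shows "\<exists>x\<in>carrier A. (\<lambda>n. cnorm A (s n \<ominus> x)) \<longlonglongrightarrow> 0"
proof -
  interpret M: Metric_space "carrier A" "norm_dist A" by (rule norm_metric)
  have "M.MCauchy s" unfolding M.MCauchy_def using s C by (auto simp: norm_dist_eq)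
  then obtain x where "limitin M.mtopology s x sequentially" using complete unfolding M.mcomplete_def by blast
  then have x: "x \<in> carrier A" "\<And>e. e > 0 \<Longrightarrow> \<exists>N. \<forall>n\<ge>N. norm_dist A (s n) x < e"
    unfolding M.limit_metric_sequentially by blast+
  have "(\<lambda>n. cnorm A (s n \<ominus> x)) \<longlonglongrightarrow> 0"
  proof (rule LIMSEQ_I)
    fix r :: real assume "r > 0"
    from x(2)[OF this] show "\<exists>no. \<forall>n\<ge>no. norm (cnorm A (s n \<ominus> x) - 0) < r"
      using s x(1) by (simp add: norm_dist_eq cnorm_nonneg)
  qed
  then show ?thesis using x by blast
qed

lemma limit_unique:
  assumes F: "F \<noteq> bot" and c: "\<And>n. s n \<in> carrier A" "x \<in> carrier A" "y \<in> carrier A"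
    and lim: "((\<lambda>n. cnorm A (s n \<ominus> x)) \<longlongrightarrow> 0) F" "((\<lambda>n. cnorm A (s n \<ominus> y)) \<longlongrightarrow> 0) F"
  shows "x = y"
proof -
  have "((\<lambda>n. cnorm A (s n \<ominus> x) + cnorm A (s n \<ominus> y)) \<longlongrightarrow> 0 + 0) F" by (intro tendsto_add lim)
  moreover have "cnorm A (x \<ominus> y) \<le> cnorm A (s n \<ominus> x) + cnorm A (s n \<ominus> y)" for n
    using cnorm_minus_triangle[of x "s n" y] c cnorm_minus_commute[of x "s n"] by auto
  ultimately have "cnorm A (x \<ominus> y) \<le> 0"
    using F by (intro tendsto_lowerbound[where F = F]) auto
  then show ?thesis using c cnorm_nonneg[of "x \<ominus> y"] cnorm_minus_eq_zero[of x y] by simp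
qed

end

section \<open>Norm limits\<close>

text \<open>The algebra may change with the index, so for bounded sequences and an ultrafilter
  \<open>F\<close> this is equality in the ultraproduct; for a constant family and a constant
  \<open>y\<close> it is norm convergence.\<close>

definition near :: "'i filter \<Rightarrow> ('i \<Rightarrow> 'a cstar) \<Rightarrow> ('i \<Rightarrow> 'a) \<Rightarrow> ('i \<Rightarrow> 'a) \<Rightarrow> bool" where
  "near F X x y \<longleftrightarrow> ((\<lambda>i. cnorm (X i) (x i \<ominus>\<^bsub>X i\<^esub> y i)) \<longlongrightarrow> 0) F"

locale cstar_family =
  fixes X :: "'i \<Rightarrow> 'a cstar"
  assumes cstar: "unital_cstar_algebra (X i)"
begin

sublocale C: unital_cstar_algebra "X i" for i by (rule cstar)

lemma near_if_bounded:
  assumes "\<And>i. x i \<in> carrier (X i)" "\<And>i. y i \<in> carrier (X i)"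
    and "\<forall>\<^sub>F i in F. cnorm (X i) (x i \<ominus>\<^bsub>X i\<^esub> y i) \<le> g i" "(g \<longlongrightarrow> 0) F"
  shows "near F X x y"
  unfolding near_def
  by (rule tendsto_sandwich[OF _ assms(3) tendsto_const assms(4)]) (use assms in \<open>auto simp: C.cnorm_nonneg\<close>)

lemma near_refl: "(\<And>i. x i \<in> carrier (X i)) \<Longrightarrow> near F X x x"
  by (simp add: near_def a_minus_def C.r_neg)

lemma near_sym:
  "\<lbrakk>\<And>i. x i \<in> carrier (X i); \<And>i. y i \<in> carrier (X i); near F X x y\<rbrakk> \<Longrightarrow> near F X y x"
  by (simp add: near_def C.cnorm_minus_commute)

lemma near_trans:
  assumes "\<And>i. x i \<in> carrier (X i)" "\<And>i. y i \<in> carrier (X i)" "\<And>i. z i \<in> carrier (X i)"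
    and "near F X x y" "near F X y z"
  shows "near F X x z"
proof (rule near_if_bounded)
  show "((\<lambda>i. cnorm (X i) (x i \<ominus>\<^bsub>X i\<^esub> y i) + cnorm (X i) (y i \<ominus>\<^bsub>X i\<^esub> z i)) \<longlongrightarrow> 0) F"
    using tendsto_add[OF assms(4,5)[unfolded near_def]] by simp
qed (intro always_eventually allI C.cnorm_minus_triangle assms | fact)+

lemma near_add:
  assumes c: "\<And>i. x i \<in> carrier (X i)" "\<And>i. y i \<in> carrier (X i)"
    "\<And>i. u i \<in> carrier (X i)" "\<And>i. v i \<in> carrier (X i)"
    and "near F X x y" "near F X u v"
  shows "near F X (\<lambda>i. x i \<oplus>\<^bsub>X i\<^esub> u i) (\<lambda>i. y i \<oplus>\<^bsub>X i\<^esub> v i)"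
proof (rule near_if_bounded)
  show "((\<lambda>i. cnorm (X i) (x i \<ominus>\<^bsub>X i\<^esub> y i) + cnorm (X i) (u i \<ominus>\<^bsub>X i\<^esub> v i)) \<longlongrightarrow> 0) F"
    using tendsto_add[OF assms(5,6)[unfolded near_def]] by simp
  have "cnorm (X i) ((x i \<oplus>\<^bsub>X i\<^esub> u i) \<ominus>\<^bsub>X i\<^esub> (y i \<oplus>\<^bsub>X i\<^esub> v i))
      \<le> cnorm (X i) (x i \<ominus>\<^bsub>X i\<^esub> y i) + cnorm (X i) (u i \<ominus>\<^bsub>X i\<^esub> v i)" for i
  proof -
    have "(x i \<oplus>\<^bsub>X i\<^esub> u i) \<ominus>\<^bsub>X i\<^esub> (y i \<oplus>\<^bsub>X i\<^esub> v i) = (x i \<ominus>\<^bsub>X i\<^esub> y i) \<oplus>\<^bsub>X i\<^esub> (u i \<ominus>\<^bsub>X i\<^esub> v i)"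
      by (rule C.eq_by_functionals) (use c in \<open>auto simp: C.linear_functional_simps\<close>)
    then show ?thesis using C.cnorm_triangle[of "x i \<ominus>\<^bsub>X i\<^esub> y i" i "u i \<ominus>\<^bsub>X i\<^esub> v i"] c by simp
  qed
  then show "\<forall>\<^sub>F i in F. cnorm (X i) ((x i \<oplus>\<^bsub>X i\<^esub> u i) \<ominus>\<^bsub>X i\<^esub> (y i \<oplus>\<^bsub>X i\<^esub> v i))
      \<le> cnorm (X i) (x i \<ominus>\<^bsub>X i\<^esub> y i) + cnorm (X i) (u i \<ominus>\<^bsub>X i\<^esub> v i)" by simp
qed (use c in auto)

lemma near_smult:
  assumes c: "\<And>i. x i \<in> carrier (X i)" "\<And>i. y i \<in> carrier (X i)" and "near F X x y"
  shows "near F X (\<lambda>i. s \<odot>\<^bsub>X i\<^esub> x i) (\<lambda>i. s \<odot>\<^bsub>X i\<^esub> y i)"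
proof (rule near_if_bounded)
  show "((\<lambda>i. cmod s * cnorm (X i) (x i \<ominus>\<^bsub>X i\<^esub> y i)) \<longlongrightarrow> 0) F"
    using tendsto_mult_left[OF assms(3)[unfolded near_def], of "cmod s"] by simp
  have "s \<odot>\<^bsub>X i\<^esub> x i \<ominus>\<^bsub>X i\<^esub> s \<odot>\<^bsub>X i\<^esub> y i = s \<odot>\<^bsub>X i\<^esub> (x i \<ominus>\<^bsub>X i\<^esub> y i)" for i
    by (rule C.eq_by_functionals) (use c in \<open>auto simp: C.linear_functional_simps algebra_simps\<close>)
  then show "\<forall>\<^sub>F i in F. cnorm (X i) (s \<odot>\<^bsub>X i\<^esub> x i \<ominus>\<^bsub>X i\<^esub> s \<odot>\<^bsub>X i\<^esub> y i) \<le> cmod s * cnorm (X i) (x i \<ominus>\<^bsub>X i\<^esub> y i)"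
    using c by (simp add: C.cnorm_smult)
qed (use c in auto)

lemma near_minus:
  assumes c: "\<And>i. x i \<in> carrier (X i)" "\<And>i. y i \<in> carrier (X i)"
    "\<And>i. u i \<in> carrier (X i)" "\<And>i. v i \<in> carrier (X i)"
    and "near F X x y" "near F X u v"
  shows "near F X (\<lambda>i. x i \<ominus>\<^bsub>X i\<^esub> u i) (\<lambda>i. y i \<ominus>\<^bsub>X i\<^esub> v i)"
  using near_add[OF c(1,2) _ _ assms(5) near_smult[OF c(3,4) assms(6), of "-1"]] c
  by (simp add: C.minus_eq_smult)

lemma near_adj:
  assumes c: "\<And>i. x i \<in> carrier (X i)" "\<And>i. y i \<in> carrier (X i)" and "near F X x y"
  shows "near F X (\<lambda>i. adj (X i) (x i)) (\<lambda>i. adj (X i) (y i))"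
  using assms(3) c by (simp add: near_def flip: C.adj_minus)

text \<open>In \<open>x u - y v = x (u - v) + (x - y) v\<close> only one factor of each product has
  to stay bounded.\<close>

lemma near_mult:
  assumes c: "\<And>i. x i \<in> carrier (X i)" "\<And>i. y i \<in> carrier (X i)"
    "\<And>i. u i \<in> carrier (X i)" "\<And>i. v i \<in> carrier (X i)"
    and near: "near F X x y" "near F X u v"
    and bdd: "\<forall>\<^sub>F i in F. cnorm (X i) (x i) \<le> K" "\<forall>\<^sub>F i in F. cnorm (X i) (v i) \<le> K"
  shows "near F X (\<lambda>i. x i \<otimes>\<^bsub>X i\<^esub> u i) (\<lambda>i. y i \<otimes>\<^bsub>X i\<^esub> v i)"
proof (rule near_if_bounded)
  show "((\<lambda>i. K * cnorm (X i) (u i \<ominus>\<^bsub>X i\<^esub> v i) + cnorm (X i) (x i \<ominus>\<^bsub>X i\<^esub> y i) * K) \<longlongrightarrow> 0) F"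
    using tendsto_add[OF tendsto_mult_left[OF near(2)[unfolded near_def], of K] tendsto_mult_right[OF near(1)[unfolded near_def], of K]]
    by simp
  show "\<forall>\<^sub>F i in F. cnorm (X i) (x i \<otimes>\<^bsub>X i\<^esub> u i \<ominus>\<^bsub>X i\<^esub> y i \<otimes>\<^bsub>X i\<^esub> v i)
      \<le> K * cnorm (X i) (u i \<ominus>\<^bsub>X i\<^esub> v i) + cnorm (X i) (x i \<ominus>\<^bsub>X i\<^esub> y i) * K"
    using bdd
  proof eventually_elim
    case (elim i)
    have "x i \<otimes>\<^bsub>X i\<^esub> u i \<ominus>\<^bsub>X i\<^esub> y i \<otimes>\<^bsub>X i\<^esub> v i
        = x i \<otimes>\<^bsub>X i\<^esub> (u i \<ominus>\<^bsub>X i\<^esub> v i) \<oplus>\<^bsub>X i\<^esub> (x i \<ominus>\<^bsub>X i\<^esub> y i) \<otimes>\<^bsub>X i\<^esub> v i"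
      by (rule C.eq_by_functionals) (use c in \<open>auto simp: C.linear_functional_simps C.expand_simps\<close>)
    moreover have "cnorm (X i) (x i \<otimes>\<^bsub>X i\<^esub> (u i \<ominus>\<^bsub>X i\<^esub> v i)) \<le> K * cnorm (X i) (u i \<ominus>\<^bsub>X i\<^esub> v i)"
      "cnorm (X i) ((x i \<ominus>\<^bsub>X i\<^esub> y i) \<otimes>\<^bsub>X i\<^esub> v i) \<le> cnorm (X i) (x i \<ominus>\<^bsub>X i\<^esub> y i) * K"
      using c elim by (auto intro!: C.cnorm_mult_le)
    ultimately show ?case
      using C.cnorm_triangle[of "x i \<otimes>\<^bsub>X i\<^esub> (u i \<ominus>\<^bsub>X i\<^esub> v i)" i "(x i \<ominus>\<^bsub>X i\<^esub> y i) \<otimes>\<^bsub>X i\<^esub> v i"] c by simp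
  qed
qed (use c in auto)

lemma near_cnorm_diff:
  assumes c: "\<And>i. x i \<in> carrier (X i)" "\<And>i. y i \<in> carrier (X i)" and "near F X x y"
  shows "((\<lambda>i. cnorm (X i) (x i) - cnorm (X i) (y i)) \<longlongrightarrow> 0) F"
proof (rule tendsto_rabs_zero_cancel, rule tendsto_sandwich[OF _ _ tendsto_const assms(3)[unfolded near_def]])
  have "\<bar>cnorm (X i) (x i) - cnorm (X i) (y i)\<bar> \<le> cnorm (X i) (x i \<ominus>\<^bsub>X i\<^esub> y i)" for i
    using C.cnorm_triangle_diff[of "x i" i "y i"] C.cnorm_triangle_diff[of "y i" i "x i"]
      C.cnorm_minus_commute[of "x i" i "y i"] c by auto
  then show "\<forall>\<^sub>F i in F. \<bar>cnorm (X i) (x i) - cnorm (X i) (y i)\<bar> \<le> cnorm (X i) (x i \<ominus>\<^bsub>X i\<^esub> y i)" by simp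
qed auto

end

context unital_cstar_algebra
begin

lemma const_family: "cstar_family (\<lambda>_. A)"
  by (simp add: cstar_family_def unital_cstar_algebra_axioms)

lemma near_cnorm:
  assumes "\<And>i. s i \<in> carrier A" "x \<in> carrier A" "near F (\<lambda>_. A) s (\<lambda>_. x)"
  shows "((\<lambda>i. cnorm A (s i)) \<longlongrightarrow> cnorm A x) F"
  using cstar_family.near_cnorm_diff[OF const_family assms(1) _ assms(3)] assms(2)
  by (simp add: LIM_zero_cancel)

lemma near_cnorm_le:
  assumes "F \<noteq> bot" "\<And>i. s i \<in> carrier A" "x \<in> carrier A" "near F (\<lambda>_. A) s (\<lambda>_. x)"
    "\<forall>\<^sub>F i in F. cnorm A (s i) \<le> r"
  shows "cnorm A x \<le> r"
  using tendsto_upperbound[OF near_cnorm[OF assms(2-4)] assms(5,1)] .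

lemma near_unique:
  assumes "F \<noteq> bot" "\<And>i. s i \<in> carrier A" "x \<in> carrier A" "y \<in> carrier A"
    "near F (\<lambda>_. A) s (\<lambda>_. x)" "near F (\<lambda>_. A) s (\<lambda>_. y)"
  shows "x = y"
  using assms unfolding near_def by (intro limit_unique[of F s x y])

text \<open>By continuity of the product; it lets commutation pass through the limits that define
  square roots and inverses.\<close>

lemma near_commute:
  assumes F: "F \<noteq> bot" and c: "\<And>i. s i \<in> carrier A" "x \<in> carrier A" "y \<in> carrier A"
    and near: "near F (\<lambda>_. A) s (\<lambda>_. x)" and comm: "\<And>i. s i \<otimes> y = y \<otimes> s i"
  shows "x \<otimes> y = y \<otimes> x"
proof -
  interpret K: cstar_family "\<lambda>_. A" by (rule const_family)
  define K where "K = cnorm A x + 1 + cnorm A y"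
  have "\<forall>\<^sub>F i in F. cnorm A (s i) < cnorm A x + 1"
    using near_cnorm[OF c(1,2) near] by (rule order_tendstoD) simp
  then have bd: "\<forall>\<^sub>F i in F. cnorm A (s i) \<le> K"
    unfolding K_def by eventually_elim (use cnorm_nonneg[OF c(3)] in auto)
  have Ky: "cnorm A y \<le> K" "cnorm A x \<le> K" using cnorm_nonneg[OF c(2)] cnorm_nonneg[OF c(3)] by (auto simp: K_def)
  have "near F (\<lambda>_. A) (\<lambda>i. s i \<otimes> y) (\<lambda>i. x \<otimes> y)"
    using K.near_mult[OF c(1) _ _ _ near K.near_refl[of "\<lambda>_. y"] bd] c Ky by simp
  moreover have "near F (\<lambda>_. A) (\<lambda>i. y \<otimes> s i) (\<lambda>i. y \<otimes> x)"
    using K.near_mult[OF _ _ c(1) _ K.near_refl[of "\<lambda>_. y"] near, of K] c Ky by simp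
  ultimately show ?thesis using near_unique[OF F, of "\<lambda>i. s i \<otimes> y"] c comm by simp
qed

lemma self_adjointD: "a \<in> self_adjoint A \<Longrightarrow> a \<in> carrier A" "a \<in> self_adjoint A \<Longrightarrow> adj A a = a"
  by (auto simp: self_adjoint_def)

lemma self_adjointI: "a \<in> carrier A \<Longrightarrow> adj A a = a \<Longrightarrow> a \<in> self_adjoint A"
  by (auto simp: self_adjoint_def)

lemma self_adjoint_simps [simp, intro]:
  "\<zero> \<in> self_adjoint A" "\<one> \<in> self_adjoint A"
  "\<lbrakk>a \<in> self_adjoint A; b \<in> self_adjoint A\<rbrakk> \<Longrightarrow> a \<oplus> b \<in> self_adjoint A"
  "\<lbrakk>a \<in> self_adjoint A; b \<in> self_adjoint A\<rbrakk> \<Longrightarrow> a \<ominus> b \<in> self_adjoint A"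
  "a \<in> self_adjoint A \<Longrightarrow> complex_of_real t \<odot> a \<in> self_adjoint A"
  "a \<in> self_adjoint A \<Longrightarrow> \<ominus> a \<in> self_adjoint A"
  "a \<in> self_adjoint A \<Longrightarrow> a \<otimes> a \<in> self_adjoint A"
  by (auto simp: self_adjoint_def adj_simps)

lemma self_adjoint_mult:
  "\<lbrakk>a \<in> self_adjoint A; b \<in> self_adjoint A; b \<otimes> a = a \<otimes> b\<rbrakk> \<Longrightarrow> a \<otimes> b \<in> self_adjoint A"
  by (auto simp: self_adjoint_def adj_simps)

lemma cnorm_square: "a \<in> self_adjoint A \<Longrightarrow> cnorm A (a \<otimes> a) = (cnorm A a)\<^sup>2"
  using cstar_identity[of a] by (simp add: self_adjoint_def)

lemma near_self_adjoint:
  assumes F: "F \<noteq> bot" and c: "\<And>i. s i \<in> self_adjoint A" "x \<in> carrier A" and near: "near F (\<lambda>_. A) s (\<lambda>_. x)"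
  shows "x \<in> self_adjoint A"
proof -
  interpret K: cstar_family "\<lambda>_. A" by (rule const_family)
  have "near F (\<lambda>_. A) s (\<lambda>_. adj A x)"
    using K.near_adj[of s "\<lambda>_. x", OF _ _ near] c by (simp add: self_adjointD)
  then have "x = adj A x" using near_unique[OF F, of s x "adj A x"] c near by (simp add: self_adjointD)
  then show ?thesis using c by (simp add: self_adjoint_def)
qed

section \<open>Square roots and positivity\<close>

text \<open>Banach's fixed point theorem. The set \<open>Q\<close> carries side conditions such as
  self-adjointness and commutation, which the fixed point inherits because \<open>Q\<close> is
  closed under limits.\<close>

lemma contraction_fixed_point:
  assumes Q: "Q \<subseteq> carrier A" "q \<in> Q"
    and closed: "\<And>s x. \<lbrakk>\<And>n. s n \<in> Q; x \<in> carrier A; near sequentially (\<lambda>_. A) s (\<lambda>_. x)\<rbrakk> \<Longrightarrow> x \<in> Q"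
    and f: "\<And>a. a \<in> Q \<Longrightarrow> f a \<in> Q"
    and contr: "\<And>a b. \<lbrakk>a \<in> Q; b \<in> Q\<rbrakk> \<Longrightarrow> cnorm A (f a \<ominus> f b) \<le> r * cnorm A (a \<ominus> b)"
    and r: "0 \<le> r" "r < 1"
  shows "\<exists>x\<in>Q. f x = x"
proof -
  define s where "s n = (f ^^ n) q" for n
  \<comment> \<open>The sum of the geometric series of step lengths, which bounds the distance of
    every iterate from \<open>q\<close>.\<close>
  define c where "c = cnorm A (f q \<ominus> q) / (1 - r)"
  have sQ: "s n \<in> Q" for n unfolding s_def by (induction n) (use Q f in auto)
  then have sc: "s n \<in> carrier A" for n using Q by auto
  have s0: "s 0 = q" and ss: "s (Suc n) = f (s n)" for n by (auto simp: s_def)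
  have b0: "cnorm A (s k \<ominus> s 0) \<le> c" for k
  proof (induction k)
    case 0
    have "f q \<in> carrier A" "q \<in> carrier A" using f[OF Q(2)] Q by auto
    then have "0 \<le> c" unfolding c_def using r cnorm_nonneg[of "f q \<ominus> q"] by simp
    then show ?case using sc[of 0] cnorm_minus_eq_zero[of "s 0" "s 0"] by simp
  next
    case (Suc k)
    have "cnorm A (s (Suc k) \<ominus> s 0) \<le> cnorm A (s (Suc k) \<ominus> s 1) + cnorm A (s 1 \<ominus> s 0)"
      by (intro cnorm_minus_triangle sc)
    also have "cnorm A (s (Suc k) \<ominus> s 1) \<le> r * cnorm A (s k \<ominus> s 0)"
      using contr[OF sQ[of k] sQ[of 0]] ss[of 0] ss[of k] by simp
    also have "\<dots> \<le> r * c" using Suc r by (intro mult_left_mono) auto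
    also have "cnorm A (s 1 \<ominus> s 0) = (1 - r) * c" using r ss[of 0] s0 by (simp add: c_def)
    finally show ?case by (simp add: algebra_simps)
  qed
  have b: "cnorm A (s (n + k) \<ominus> s n) \<le> r ^ n * c" for n k
  proof (induction n)
    case 0 then show ?case using b0 by simp
  next
    case (Suc n)
    have "cnorm A (s (Suc n + k) \<ominus> s (Suc n)) \<le> r * cnorm A (s (n + k) \<ominus> s n)"
      using contr[OF sQ[of "n+k"] sQ[of n]] ss by simp
    also have "\<dots> \<le> r * (r ^ n * c)" using Suc r by (intro mult_left_mono) auto
    finally show ?case by (simp add: algebra_simps)
  qed
  have lim: "(\<lambda>n. r ^ n * c) \<longlonglongrightarrow> 0" using r by (intro tendsto_mult_left_zero LIMSEQ_power_zero) auto
  have "\<exists>x\<in>carrier A. (\<lambda>n. cnorm A (s n \<ominus> x)) \<longlonglongrightarrow> 0"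
  proof (rule Cauchy_converges[OF sc])
    fix e :: real assume e: "e > 0"
    obtain N where N: "\<And>n. n \<ge> N \<Longrightarrow> r ^ n * c < e"
      using order_tendstoD(2)[OF lim e] by (auto simp: eventually_sequentially)
    have *: "cnorm A (s m \<ominus> s n) < e" if "n \<ge> N" "m \<ge> n" for m n
      using b[of n "m - n"] N[of n] that by simp
    show "\<exists>N. \<forall>m\<ge>N. \<forall>n\<ge>N. cnorm A (s m \<ominus> s n) < e"
      using * cnorm_minus_commute[OF sc sc] by (metis nle_le)
  qed
  then obtain x where x: "x \<in> carrier A" "(\<lambda>n. cnorm A (s n \<ominus> x)) \<longlonglongrightarrow> 0" by blast
  have xQ: "x \<in> Q" using closed[of s x] sQ x by (simp add: near_def)
  have "(\<lambda>n. cnorm A (s (Suc n) \<ominus> f x)) \<longlonglongrightarrow> 0"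
  proof (rule tendsto_sandwich[OF _ _ tendsto_const])
    show "\<forall>\<^sub>F n in sequentially. cnorm A (s (Suc n) \<ominus> f x) \<le> r * cnorm A (s n \<ominus> x)"
      using contr[OF sQ xQ] by (simp add: ss)
    show "(\<lambda>n. r * cnorm A (s n \<ominus> x)) \<longlonglongrightarrow> 0" using tendsto_mult_left[OF x(2), of r] by simp
  qed (use sc f[OF xQ] Q in \<open>auto simp: cnorm_nonneg\<close>)
  then have "f x = x" using limit_unique[of sequentially "\<lambda>n. s (Suc n)" "f x" x] sc x f[OF xQ] Q LIMSEQ_Suc[OF x(2)]
    by auto
  then show ?thesis using xQ by blast
qed

lemma lcomm: "\<lbrakk>a \<in> carrier A; b \<in> carrier A; c \<in> carrier A; a \<otimes> b = b \<otimes> a\<rbrakk> \<Longrightarrow> a \<otimes> (b \<otimes> c) = b \<otimes> (a \<otimes> c)"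
  by (metis m_assoc)

text \<open>\<open>(1 - b)^2 = 1 - x\<close> is the fixed point equation
  \<open>b = (x + b^2) / 2\<close>. On the ball of radius \<open>norm x\<close> the right-hand side
  is a contraction with constant \<open>norm x\<close>, since
  \<open>a^2 - b^2 = a (a - b) + (a - b) b\<close>. The commutation clause later makes roots of
  commuting elements commute.\<close>

lemma sqrt_one_minus:
  assumes x: "x \<in> self_adjoint A" "cnorm A x < 1"
  obtains b where "b \<in> self_adjoint A" "cnorm A b < 1" "(\<one> \<ominus> b) \<otimes> (\<one> \<ominus> b) = \<one> \<ominus> x"
    "\<And>y. \<lbrakk>y \<in> carrier A; x \<otimes> y = y \<otimes> x\<rbrakk> \<Longrightarrow> b \<otimes> y = y \<otimes> b"
proof -
  note xc = self_adjointD[OF x(1)]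
  define Y where "Y = {y \<in> carrier A. x \<otimes> y = y \<otimes> x}"
  define Q where "Q = {b \<in> self_adjoint A. cnorm A b \<le> cnorm A x \<and> (\<forall>y\<in>Y. b \<otimes> y = y \<otimes> b)}"
  define f where "f b = complex_of_real (1 / 2) \<odot> (x \<oplus> b \<otimes> b)" for b
  have Qc: "Q \<subseteq> carrier A" by (auto simp: Q_def self_adjointD)
  have "\<exists>b\<in>Q. f b = b"
  proof (rule contraction_fixed_point[OF Qc, of \<zero> f "cnorm A x"])
    show "\<zero> \<in> Q" using cnorm_nonneg[OF xc(1)] by (auto simp: Q_def Y_def)
  next
    fix s y assume s: "\<And>n::nat. s n \<in> Q" "y \<in> carrier A" "near sequentially (\<lambda>_. A) s (\<lambda>_. y)"
    have sc: "s n \<in> carrier A" "s n \<in> self_adjoint A" for n using s(1) Qc unfolding Q_def by auto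
    show "y \<in> Q"
      unfolding Q_def
      using near_self_adjoint[OF _ sc(2) s(2,3)] near_cnorm_le[OF _ sc(1) s(2,3), of "cnorm A x"]
        near_commute[OF _ sc(1) s(2) _ s(3)] s(1) unfolding Q_def Y_def by auto
  next
    fix b assume b: "b \<in> Q"
    then have bs: "b \<in> self_adjoint A" "cnorm A b \<le> cnorm A x" and bc: "b \<in> carrier A" using Qc by (auto simp: Q_def)
    have "cnorm A (x \<oplus> b \<otimes> b) \<le> cnorm A x + cnorm A x * cnorm A x"
      using cnorm_triangle[of x "b \<otimes> b"] cnorm_mult_le[OF bc bc bs(2) bs(2)] xc bc by auto
    also have "\<dots> \<le> 2 * cnorm A x" using x(2) cnorm_nonneg[OF xc(1)] by (simp add: mult_left_le)
    finally have "cnorm A (f b) \<le> cnorm A x" unfolding f_def using xc bc by (subst cnorm_smult) auto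
    moreover have "f b \<in> self_adjoint A" unfolding f_def using x bs by blast
    moreover have "f b \<otimes> y = y \<otimes> f b" if y: "y \<in> Y" for y
    proof -
      have *: "y \<in> carrier A" "x \<otimes> y = y \<otimes> x" "b \<otimes> y = y \<otimes> b" using y b by (auto simp: Y_def Q_def)
      then show ?thesis unfolding f_def using xc bc
        by (simp add: expand_simps lcomm[of b y b])
    qed
    ultimately show "f b \<in> Q" by (simp add: Q_def)
  next
    fix a b assume ab: "a \<in> Q" "b \<in> Q"
    then have c: "a \<in> carrier A" "b \<in> carrier A" "cnorm A a \<le> cnorm A x" "cnorm A b \<le> cnorm A x"
      using Qc by (auto simp: Q_def)
    have "f a \<ominus> f b = complex_of_real (1/2) \<odot> (a \<otimes> (a \<ominus> b) \<oplus> (a \<ominus> b) \<otimes> b)"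
      unfolding f_def by (rule eq_by_functionals) (use c xc in \<open>auto simp: linear_functional_simps expand_simps field_simps\<close>)
    then have "cnorm A (f a \<ominus> f b) = 1/2 * cnorm A (a \<otimes> (a \<ominus> b) \<oplus> (a \<ominus> b) \<otimes> b)"
      using c by (simp only: cnorm_smult a_closed m_closed minus_closed) simp
    also have "\<dots> \<le> 1/2 * (cnorm A (a \<otimes> (a \<ominus> b)) + cnorm A ((a \<ominus> b) \<otimes> b))"
      using cnorm_triangle[of "a \<otimes> (a \<ominus> b)" "(a \<ominus> b) \<otimes> b"] c by simp
    also have "\<dots> \<le> 1/2 * (cnorm A x * cnorm A (a \<ominus> b) + cnorm A (a \<ominus> b) * cnorm A x)"
      using c by (intro mult_left_mono add_mono cnorm_mult_le) auto
    finally show "cnorm A (f a \<ominus> f b) \<le> cnorm A x * cnorm A (a \<ominus> b)" by (simp add: algebra_simps)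
  qed (use x cnorm_nonneg[OF xc(1)] in auto)
  then obtain b where b: "b \<in> Q" "f b = b" by blast
  then have bs: "b \<in> self_adjoint A" "cnorm A b < 1" and bc: "b \<in> carrier A" using x Qc by (auto simp: Q_def)
  have "(\<one> \<ominus> b) \<otimes> (\<one> \<ominus> b) = \<one> \<ominus> x"
  proof (rule eq_by_functionals)
    fix \<phi> assume \<phi>: "linear_functional A \<phi>"
    have "\<phi> b = 1/2 * (\<phi> x + \<phi> (b \<otimes> b))" using arg_cong[OF b(2), of \<phi>] \<phi> xc bc
      by (simp add: f_def linear_functional_simps)
    then show "\<phi> ((\<one> \<ominus> b) \<otimes> (\<one> \<ominus> b)) = \<phi> (\<one> \<ominus> x)" using \<phi> xc bc
      by (simp add: linear_functional_simps expand_simps algebra_simps)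
  qed (use xc bc in auto)
  then show ?thesis using that[of b] bs b unfolding Q_def Y_def by blast
qed

text \<open>With \<open>z = b + ic\<close> one has \<open>z* z = b\<^sup>2 + c\<^sup>2\<close> and \<open>b = (z + z* )/2\<close>.\<close>

lemma cnorm_square_le_sum_squares:
  assumes b: "b \<in> self_adjoint A" and c: "c \<in> self_adjoint A" and comm: "c \<otimes> b = b \<otimes> c"
  shows "cnorm A (b \<otimes> b) \<le> cnorm A (b \<otimes> b \<oplus> c \<otimes> c)"
proof -
  note bc = self_adjointD[OF b] self_adjointD[OF c]
  define z where "z = b \<oplus> \<i> \<odot> c"
  have z: "z \<in> carrier A" unfolding z_def using bc by auto
  have "adj A z \<otimes> z = b \<otimes> b \<oplus> c \<otimes> c"
    unfolding z_def by (rule eq_by_functionals)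
      (use bc comm in \<open>auto simp: linear_functional_simps expand_simps adj_simps algebra_simps\<close>)
  then have zz: "(cnorm A z)\<^sup>2 = cnorm A (b \<otimes> b \<oplus> c \<otimes> c)" using cstar_identity[OF z] by simp
  have "b = (1 / 2) \<odot> (z \<oplus> adj A z)"
    unfolding z_def by (rule eq_by_functionals)
      (use bc comm in \<open>auto simp: linear_functional_simps expand_simps adj_simps\<close>)
  then have "cnorm A b = 1/2 * cnorm A (z \<oplus> adj A z)" using z by (metis a_closed adj_closed cnorm_smult norm_divide norm_numeral norm_one)
  also have "\<dots> \<le> cnorm A z" using cnorm_triangle[of z "adj A z"] z by simp
  finally have "(cnorm A b)\<^sup>2 \<le> (cnorm A z)\<^sup>2" using cnorm_nonneg bc by (intro power_mono) auto
  then show ?thesis using zz cnorm_square[OF b] by simp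
qed

end

section \<open>The cone of positive elements\<close>

text \<open>In spectral terms, \<open>norm (t - a) <= t\<close> places the spectrum of the
  self-adjoint \<open>a\<close> in \<open>[0, 2 t]\<close>. In this form sums are immediate by the
  triangle inequality, which they would not be with squares as the definition.\<close>

definition positive :: "'a cstar \<Rightarrow> 'a \<Rightarrow> bool" where
  "positive A a \<longleftrightarrow> a \<in> self_adjoint A \<and> (\<exists>t. cnorm A (complex_of_real t \<odot>\<^bsub>A\<^esub> \<one>\<^bsub>A\<^esub> \<ominus>\<^bsub>A\<^esub> a) \<le> t)"

context unital_cstar_algebra
begin

abbreviation real_unit :: "real \<Rightarrow> 'a" where
  "real_unit t \<equiv> complex_of_real t \<odot> \<one>"

lemma cnorm_of_real_smult: "a \<in> carrier A \<Longrightarrow> cnorm A (complex_of_real t \<odot> a) = \<bar>t\<bar> * cnorm A a"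
  by (simp add: cnorm_smult)

lemma smult_minus_right: "\<lbrakk>a \<in> carrier A; b \<in> carrier A\<rbrakk> \<Longrightarrow> c \<odot> (a \<ominus> b) = c \<odot> a \<ominus> c \<odot> b"
  by (rule eq_by_functionals) (auto simp: linear_functional_simps algebra_simps)

lemma cnorm_real_unit [simp]: "cnorm A (real_unit t) = \<bar>t\<bar>"
  by (simp add: cnorm_smult)

lemma positiveD: "positive A a \<Longrightarrow> a \<in> self_adjoint A" "positive A a \<Longrightarrow> a \<in> carrier A"
  "positive A a \<Longrightarrow> adj A a = a"
  by (auto simp: positive_def self_adjointD)

text \<open>For \<open>u < 1\<close> the element \<open>1 - u c^2\<close> is the square of some
  \<open>1 - b\<close> with \<open>b\<close> commuting with \<open>c\<close>; adding the square of
  \<open>sqrt u c\<close> gives the unit, so the inequality for sums of squares bounds it by 1. Then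
  \<open>u\<close> tends to 1.\<close>

lemma cnorm_one_minus_square:
  assumes c: "c \<in> self_adjoint A" and le: "cnorm A c \<le> 1"
  shows "cnorm A (\<one> \<ominus> c \<otimes> c) \<le> 1"
proof (rule field_le_epsilon)
  fix e :: real assume e: "e > 0"
  \<comment> \<open>\<open>u < 1\<close> provides the strict bound \<open>norm x < 1\<close> that
    the square root needs, and \<open>1 - u <= e\<close> is the price; \<open>max 0\<close> covers
    \<open>e > 1\<close>.\<close>
  define u where "u = max 0 (1 - e)"
  have u: "0 \<le> u" "u < 1" "1 - u \<le> e" using e by (auto simp: u_def)
  note cc = self_adjointD[OF c]
  have c1: "cnorm A (c \<otimes> c) \<le> 1" using cnorm_mult_le[OF cc(1) cc(1) le le] by simp
  define x where "x = complex_of_real u \<odot> (c \<otimes> c)"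
  have x: "x \<in> self_adjoint A" unfolding x_def using c by blast
  have "cnorm A x \<le> u" unfolding x_def using u cc c1 by (simp add: cnorm_smult mult_left_le)
  then have x1: "cnorm A x < 1" using u by simp
  obtain b where b: "b \<in> self_adjoint A" "(\<one> \<ominus> b) \<otimes> (\<one> \<ominus> b) = \<one> \<ominus> x"
    "\<And>y. \<lbrakk>y \<in> carrier A; x \<otimes> y = y \<otimes> x\<rbrakk> \<Longrightarrow> b \<otimes> y = y \<otimes> b"
    using sqrt_one_minus[OF x x1] by metis
  note bc = self_adjointD[OF b(1)]
  have bcomm: "b \<otimes> c = c \<otimes> b" by (rule b(3)) (use cc in \<open>auto simp: x_def expand_simps\<close>)
  define d where "d = complex_of_real (sqrt u) \<odot> c"
  have d: "d \<in> self_adjoint A" unfolding d_def using c by blast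
  have dd: "d \<otimes> d = x" unfolding d_def x_def using cc u
    by (simp add: smult_mult_left smult_mult_right smult_smult flip: of_real_mult)
  have "cnorm A ((\<one> \<ominus> b) \<otimes> (\<one> \<ominus> b)) \<le> cnorm A ((\<one> \<ominus> b) \<otimes> (\<one> \<ominus> b) \<oplus> d \<otimes> d)"
    by (rule cnorm_square_le_sum_squares[OF _ d])
      (use b(1) bc cc bcomm in \<open>auto simp: d_def expand_simps smult_minus_right\<close>)
  also have "(\<one> \<ominus> b) \<otimes> (\<one> \<ominus> b) \<oplus> d \<otimes> d = \<one>" unfolding b(2) dd
    by (rule eq_by_functionals) (use x in \<open>auto simp: linear_functional_simps self_adjointD\<close>)
  finally have 1: "cnorm A (\<one> \<ominus> x) \<le> 1" using b(2) by simp
  have "(\<one> \<ominus> c \<otimes> c) \<ominus> (\<one> \<ominus> x) = complex_of_real (u - 1) \<odot> (c \<otimes> c)" unfolding x_def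
    by (rule eq_by_functionals) (use cc in \<open>auto simp: linear_functional_simps algebra_simps\<close>)
  then have "cnorm A ((\<one> \<ominus> c \<otimes> c) \<ominus> (\<one> \<ominus> x)) = \<bar>u - 1\<bar> * cnorm A (c \<otimes> c)"
    using cc by (simp only: cnorm_smult m_closed norm_of_real)
  also have "\<dots> \<le> (1 - u) * 1" using u c1 by (intro mult_mono) (auto simp: cnorm_nonneg cc)
  finally have "cnorm A ((\<one> \<ominus> c \<otimes> c) \<ominus> (\<one> \<ominus> x)) \<le> e" using u by simp
  then show "cnorm A (\<one> \<ominus> c \<otimes> c) \<le> 1 + e"
    using 1 cnorm_triangle_diff[of "\<one> \<ominus> c \<otimes> c" "\<one> \<ominus> x"] cc x by (simp add: self_adjointD)
qed

text \<open>The previous bound rescaled by the norm of \<open>c\<close>: the square of this norm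
  witnesses positivity of \<open>c^2\<close>.\<close>

lemma cnorm_minus_square:
  assumes c: "c \<in> self_adjoint A"
  shows "cnorm A (real_unit ((cnorm A c)\<^sup>2) \<ominus> c \<otimes> c) \<le> (cnorm A c)\<^sup>2"
proof (cases "cnorm A c = 0")
  case True
  then have "c = \<zero>" using cnorm_eq_zero c by (simp add: self_adjointD)
  then show ?thesis by (simp add: cnorm_minus_eq_zero[THEN iffD2])
next
  case False
  note cc = self_adjointD[OF c]
  define t where "t = cnorm A c"
  have t: "t > 0" using False cnorm_nonneg[OF cc(1)] by (simp add: t_def)
  define d where "d = complex_of_real (1/t) \<odot> c"
  have d: "d \<in> self_adjoint A" unfolding d_def using c by blast
  have "cnorm A d = 1" unfolding d_def using t cc by (subst cnorm_of_real_smult) (simp_all add: t_def)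
  then have "cnorm A (\<one> \<ominus> d \<otimes> d) \<le> 1" using cnorm_one_minus_square[OF d] by simp
  moreover have "real_unit (t\<^sup>2) \<ominus> c \<otimes> c = complex_of_real (t\<^sup>2) \<odot> (\<one> \<ominus> d \<otimes> d)" unfolding d_def
    by (rule eq_by_functionals)
      (use cc t in \<open>auto simp: linear_functional_simps expand_simps field_simps power2_eq_square\<close>)
  ultimately show ?thesis using d t unfolding t_def[symmetric] by (simp add: cnorm_smult self_adjointD norm_power)
qed

lemma positive_square: "c \<in> self_adjoint A \<Longrightarrow> positive A (c \<otimes> c)"
  unfolding positive_def using cnorm_minus_square by blast

lemma positive_add:
  assumes "positive A a" "positive A b" shows "positive A (a \<oplus> b)"
proof -
  obtain s t where st: "cnorm A (real_unit s \<ominus> a) \<le> s" "cnorm A (real_unit t \<ominus> b) \<le> t"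
    using assms by (auto simp: positive_def)
  note c = positiveD[OF assms(1)] positiveD[OF assms(2)]
  have "real_unit (s + t) \<ominus> (a \<oplus> b) = (real_unit s \<ominus> a) \<oplus> (real_unit t \<ominus> b)"
    by (rule eq_by_functionals) (use c in \<open>auto simp: linear_functional_simps algebra_simps\<close>)
  then have "cnorm A (real_unit (s + t) \<ominus> (a \<oplus> b)) \<le> s + t"
    using st cnorm_triangle[of "real_unit s \<ominus> a" "real_unit t \<ominus> b"] c by auto
  then show ?thesis unfolding positive_def using c by blast
qed

lemma positive_smult:
  assumes "positive A a" "t \<ge> 0" shows "positive A (complex_of_real t \<odot> a)"
proof -
  obtain s where s: "cnorm A (real_unit s \<ominus> a) \<le> s"
    using assms by (auto simp: positive_def)
  note c = positiveD[OF assms(1)]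
  have "real_unit (t * s) \<ominus> complex_of_real t \<odot> a = complex_of_real t \<odot> (real_unit s \<ominus> a)"
    by (rule eq_by_functionals) (use c in \<open>auto simp: linear_functional_simps algebra_simps\<close>)
  then have "cnorm A (real_unit (t * s) \<ominus> complex_of_real t \<odot> a) = t * cnorm A (real_unit s \<ominus> a)"
    using c assms(2) by (simp add: cnorm_smult)
  then have "cnorm A (real_unit (t * s) \<ominus> complex_of_real t \<odot> a) \<le> t * s"
    using mult_left_mono[OF s assms(2)] by simp
  then show ?thesis unfolding positive_def using c by blast
qed

lemma positive_real_unit_iff: "positive A (real_unit t) \<longleftrightarrow> t \<ge> 0"
proof
  assume "positive A (real_unit t)"
  then obtain s where "cnorm A (real_unit s \<ominus> real_unit t) \<le> s" by (auto simp: positive_def)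
  moreover have "real_unit s \<ominus> real_unit t = real_unit (s - t)"
    by (rule eq_by_functionals) (auto simp: linear_functional_simps algebra_simps)
  ultimately have "\<bar>s - t\<bar> \<le> s" by (simp only: cnorm_real_unit)
  then show "t \<ge> 0" by simp
next
  assume "t \<ge> 0"
  then show "positive A (real_unit t)"
    using positive_smult[OF positive_square[of \<one>], of t] by simp
qed

text \<open>With \<open>t\<close> witnessing positivity, \<open>x + e = (t + e) (1 - z)\<close> for
  \<open>z = (t - x) / (t + e)\<close>, and the shift by \<open>e\<close> makes
  \<open>norm z\<close> strictly smaller than 1.\<close>

lemma positive_sqrt_shift:
  assumes x: "positive A x" and e: "e > 0"
  obtains w where "positive A w" "w \<otimes> w = x \<oplus> real_unit e"
    "\<And>y. \<lbrakk>y \<in> carrier A; x \<otimes> y = y \<otimes> x\<rbrakk> \<Longrightarrow> w \<otimes> y = y \<otimes> w"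
proof -
  obtain t where t: "cnorm A (real_unit t \<ominus> x) \<le> t" using x by (auto simp: positive_def)
  note xc = positiveD[OF x]
  have t0: "t \<ge> 0" using cnorm_nonneg[of "real_unit t \<ominus> x"] t xc by force
  define k where "k = sqrt (t + e)"
  have k: "k > 0" "k * k = t + e" using t0 e by (auto simp: k_def)
  define z where "z = complex_of_real (1 / (k * k)) \<odot> (real_unit t \<ominus> x)"
  have z: "z \<in> self_adjoint A" unfolding z_def using xc(1) by blast
  have "cnorm A z = cnorm A (real_unit t \<ominus> x) / (t + e)" unfolding z_def k(2) using xc t0 e
    by (subst cnorm_of_real_smult) auto
  also have "\<dots> < 1" using t t0 e by simp
  finally have z1: "cnorm A z < 1" .
  obtain b where b: "b \<in> self_adjoint A" "cnorm A b < 1" "(\<one> \<ominus> b) \<otimes> (\<one> \<ominus> b) = \<one> \<ominus> z"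
    "\<And>y. \<lbrakk>y \<in> carrier A; z \<otimes> y = y \<otimes> z\<rbrakk> \<Longrightarrow> b \<otimes> y = y \<otimes> b"
    using sqrt_one_minus[OF z z1] by metis
  note bc = self_adjointD[OF b(1)]
  define w where "w = complex_of_real k \<odot> (\<one> \<ominus> b)"
  have "real_unit k \<ominus> w = complex_of_real k \<odot> b" unfolding w_def
    by (rule eq_by_functionals) (use bc in \<open>auto simp: linear_functional_simps algebra_simps\<close>)
  then have "cnorm A (real_unit k \<ominus> w) \<le> k" using b(2) k(1) bc by (simp add: cnorm_smult mult_left_le)
  moreover have "w \<in> self_adjoint A" unfolding w_def using b(1) by blast
  ultimately have "positive A w" by (auto simp: positive_def)
  moreover have "w \<otimes> w = x \<oplus> real_unit e"
  proof -
    have "w \<otimes> w = complex_of_real (k * k) \<odot> ((\<one> \<ominus> b) \<otimes> (\<one> \<ominus> b))" unfolding w_def using bc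
      by (simp add: smult_mult_left smult_mult_right smult_smult)
    also have "\<dots> = complex_of_real (k * k) \<odot> (\<one> \<ominus> z)" using b(3) by simp
    also have "complex_of_real t + complex_of_real e \<noteq> 0"
      using t0 e unfolding of_real_add[symmetric] of_real_eq_0_iff by simp
    then have "complex_of_real (k * k) \<odot> (\<one> \<ominus> z) = x \<oplus> real_unit e" unfolding z_def k(2)
      by (intro eq_by_functionals) (use xc in \<open>auto simp: linear_functional_simps field_simps\<close>)
    finally show ?thesis .
  qed
  moreover have "w \<otimes> y = y \<otimes> w" if y: "y \<in> carrier A" "x \<otimes> y = y \<otimes> x" for y
  proof -
    have "z \<otimes> y = y \<otimes> z" unfolding z_def using y xc by (simp add: expand_simps)
    then have "b \<otimes> y = y \<otimes> b" using b(4) y by blast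
    then show ?thesis unfolding w_def using y bc by (simp add: expand_simps)
  qed
  ultimately show ?thesis using that by blast
qed

text \<open>For a square the norm serves as the witness of positivity, and \<open>x + e/2\<close> is
  a square; let \<open>e\<close> shrink. A witness that depends continuously on the element is what
  closedness of the cone needs.\<close>

lemma positive_cnorm:
  assumes x: "positive A x" shows "cnorm A (real_unit (cnorm A x) \<ominus> x) \<le> cnorm A x"
proof (rule field_le_epsilon)
  fix e :: real assume e: "e > 0"
  note xc = positiveD[OF x]
  obtain w where w: "positive A w" "w \<otimes> w = x \<oplus> real_unit (e/2)"
    using positive_sqrt_shift[OF x, of "e/2"] e by auto
  define n where "n = cnorm A x"
  define m where "m = (cnorm A w)\<^sup>2"
  have m: "m \<le> n + e/2" using cnorm_square[OF positiveD(1)[OF w(1)]] w(2) cnorm_triangle[of x "real_unit (e/2)"] xc e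
    unfolding cnorm_real_unit by (simp add: m_def n_def)
  have "cnorm A (real_unit m \<ominus> (x \<oplus> real_unit (e/2))) \<le> m"
    using cnorm_minus_square[OF positiveD(1)[OF w(1)]] w(2) by (simp add: m_def)
  moreover have "real_unit n \<ominus> x = (real_unit m \<ominus> (x \<oplus> real_unit (e/2))) \<oplus> real_unit (n + e/2 - m)"
    by (rule eq_by_functionals) (use xc in \<open>auto simp: linear_functional_simps algebra_simps\<close>)
  ultimately have "cnorm A (real_unit n \<ominus> x) \<le> m + \<bar>n + e/2 - m\<bar>"
    using cnorm_triangle[of "real_unit m \<ominus> (x \<oplus> real_unit (e/2))" "real_unit (n + e/2 - m)"] xc
    by (simp only: cnorm_real_unit) simp
  then show "cnorm A (real_unit (cnorm A x) \<ominus> x) \<le> cnorm A x + e" using m e unfolding n_def by simp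
qed

lemma positive_closed:
  assumes F: "F \<noteq> bot" and p: "\<And>i. positive A (p i)" and x: "x \<in> carrier A"
    and near: "near F (\<lambda>_. A) p (\<lambda>_. x)"
  shows "positive A x"
proof -
  interpret K: cstar_family "\<lambda>_. A" by (rule const_family)
  have pc: "p i \<in> carrier A" "p i \<in> self_adjoint A" for i using p positiveD by auto
  have lim: "((\<lambda>i. cnorm A (p i)) \<longlongrightarrow> cnorm A x) F" by (rule near_cnorm[OF pc(1) x near])
  have "((\<lambda>i. cnorm A (real_unit (cnorm A (p i)) \<ominus> real_unit (cnorm A x))) \<longlongrightarrow> 0) F"
  proof -
    have "real_unit s \<ominus> real_unit t = real_unit (s - t)" for s t
      by (rule eq_by_functionals) (auto simp: linear_functional_simps algebra_simps)
    then show ?thesis using lim by (simp add: tendsto_rabs_zero LIM_zero del: of_real_diff)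
  qed
  then have "near F (\<lambda>_. A) (\<lambda>i. real_unit (cnorm A (p i))) (\<lambda>_. real_unit (cnorm A x))" by (simp add: near_def)
  then have "near F (\<lambda>_. A) (\<lambda>i. real_unit (cnorm A (p i)) \<ominus> p i) (\<lambda>_. real_unit (cnorm A x) \<ominus> x)"
    by (rule K.near_minus[rotated 4]) (use near pc x in auto)
  then have "((\<lambda>i. cnorm A (real_unit (cnorm A (p i)) \<ominus> p i)) \<longlongrightarrow> cnorm A (real_unit (cnorm A x) \<ominus> x)) F"
    by (rule near_cnorm[rotated 2]) (use pc x in auto)
  then have "cnorm A (real_unit (cnorm A x) \<ominus> x) \<le> cnorm A x"
    by (rule tendsto_le[OF F lim]) (use p positive_cnorm in auto)
  moreover have "x \<in> self_adjoint A" by (rule near_self_adjoint[OF F pc(2) x near])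
  ultimately show ?thesis by (auto simp: positive_def)
qed

text \<open>The shifted factors have commuting roots \<open>b\<close> and \<open>d\<close>, so their
  product is the square of the self-adjoint \<open>b d\<close>; the shift is removed by closedness
  of the cone.\<close>

lemma positive_mult:
  assumes x: "positive A x" and y: "positive A y" and comm: "x \<otimes> y = y \<otimes> x"
  shows "positive A (x \<otimes> y)"
proof -
  interpret K: cstar_family "\<lambda>_. A" by (rule const_family)
  note c = positiveD[OF x] positiveD[OF y]
  define e :: "nat \<Rightarrow> real" where "e n = 1 / (real n + 1)" for n
  have e0: "e n > 0" for n by (simp add: e_def)
  have elim: "e \<longlonglongrightarrow> 0" unfolding e_def by real_asymp
  define p where "p n = (x \<oplus> real_unit (e n)) \<otimes> (y \<oplus> real_unit (e n))" for n
  have "positive A (p n)" for n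
  proof -
    obtain b where b: "positive A b" "b \<otimes> b = x \<oplus> real_unit (e n)"
      "\<And>z. \<lbrakk>z \<in> carrier A; x \<otimes> z = z \<otimes> x\<rbrakk> \<Longrightarrow> b \<otimes> z = z \<otimes> b"
      using positive_sqrt_shift[OF x e0] by metis
    obtain d where d: "positive A d" "d \<otimes> d = y \<oplus> real_unit (e n)"
      "\<And>z. \<lbrakk>z \<in> carrier A; y \<otimes> z = z \<otimes> y\<rbrakk> \<Longrightarrow> d \<otimes> z = z \<otimes> d"
      using positive_sqrt_shift[OF y e0] by metis
    note bd = positiveD[OF b(1)] positiveD[OF d(1)]
    have "x \<otimes> d = d \<otimes> x" using d(3)[of x] c comm by simp
    then have bdc: "b \<otimes> d = d \<otimes> b" using b(3)[of d] bd by simp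
    have "p n = (b \<otimes> d) \<otimes> (b \<otimes> d)" unfolding p_def b(2)[symmetric] d(2)[symmetric]
      using bd by (simp add: m_assoc bdc[symmetric] lcomm[of d b])
    then show ?thesis using positive_square[OF self_adjoint_mult[OF bd(1) bd(4)]] bdc by simp
  qed
  moreover have "near sequentially (\<lambda>_. A) p (\<lambda>_. x \<otimes> y)"
  proof (rule K.near_if_bounded)
    show "(\<lambda>n. e n * (cnorm A (x \<oplus> y) + e n)) \<longlonglongrightarrow> 0"
      using tendsto_mult[OF elim tendsto_add[OF tendsto_const elim]] by simp
    have "p n \<ominus> x \<otimes> y = complex_of_real (e n) \<odot> ((x \<oplus> y) \<oplus> real_unit (e n))" for n unfolding p_def
      by (rule eq_by_functionals) (use c in \<open>auto simp: linear_functional_simps expand_simps algebra_simps\<close>)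
    moreover have "cnorm A (complex_of_real (e n) \<odot> ((x \<oplus> y) \<oplus> real_unit (e n))) \<le> e n * (cnorm A (x \<oplus> y) + e n)" for n
      using c e0[of n] cnorm_triangle[of "x \<oplus> y" "real_unit (e n)"] by (simp add: cnorm_smult)
    ultimately show "\<forall>\<^sub>F n in sequentially. cnorm A (p n \<ominus> x \<otimes> y) \<le> e n * (cnorm A (x \<oplus> y) + e n)" by simp
  qed (use c in \<open>auto simp: p_def\<close>)
  ultimately show ?thesis using positive_closed[of sequentially p "x \<otimes> y"] c by auto
qed

text \<open>\<open>(u + e - a) (u + e + a) = (u + e)^2 - a^2\<close> is the square of a self-adjoint
  element commuting with \<open>a\<close>. Hence \<open>a^2\<close> plus a square is the scalar
  \<open>(u + e)^2\<close>, and the inequality for sums of squares applies.\<close>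

lemma order_bound_cnorm:
  assumes a: "a \<in> self_adjoint A" and p: "positive A (real_unit u \<ominus> a)" "positive A (real_unit u \<oplus> a)"
  shows "cnorm A a \<le> u"
proof -
  note ac = self_adjointD[OF a]
  have "real_unit u \<ominus> a \<oplus> (real_unit u \<oplus> a) = real_unit (2 * u)"
    by (rule eq_by_functionals) (use ac in \<open>auto simp: linear_functional_simps\<close>)
  then have u: "u \<ge> 0" using positive_add[OF p] positive_real_unit_iff[of "2*u"] by simp
  show ?thesis
  proof (rule field_le_epsilon)
    fix e :: real assume e: "e > 0"
    obtain b where b: "positive A b" "b \<otimes> b = real_unit u \<ominus> a \<oplus> real_unit e"
      "\<And>z. \<lbrakk>z \<in> carrier A; (real_unit u \<ominus> a) \<otimes> z = z \<otimes> (real_unit u \<ominus> a)\<rbrakk> \<Longrightarrow> b \<otimes> z = z \<otimes> b"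
      using positive_sqrt_shift[OF p(1) e] by metis
    obtain d where d: "positive A d" "d \<otimes> d = real_unit u \<oplus> a \<oplus> real_unit e"
      "\<And>z. \<lbrakk>z \<in> carrier A; (real_unit u \<oplus> a) \<otimes> z = z \<otimes> (real_unit u \<oplus> a)\<rbrakk> \<Longrightarrow> d \<otimes> z = z \<otimes> d"
      using positive_sqrt_shift[OF p(2) e] by metis
    note bd = positiveD[OF b(1)] positiveD[OF d(1)]
    have "d \<otimes> a = a \<otimes> d" by (rule d(3)) (use ac in \<open>auto simp: expand_simps\<close>)
    then have bdc: "b \<otimes> d = d \<otimes> b" by (intro b(3)) (use ac bd in \<open>auto simp: expand_simps\<close>)
    have ba: "b \<otimes> a = a \<otimes> b" by (rule b(3)) (use ac in \<open>auto simp: expand_simps\<close>)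
    have da: "d \<otimes> a = a \<otimes> d" by fact
    have "a \<otimes> a \<oplus> (b \<otimes> d) \<otimes> (b \<otimes> d) = a \<otimes> a \<oplus> (b \<otimes> b) \<otimes> (d \<otimes> d)"
      using bd by (simp add: m_assoc bdc[symmetric] lcomm[of d b])
    also have "\<dots> = real_unit ((u + e)\<^sup>2)" unfolding b(2) d(2)
      by (rule eq_by_functionals) (use ac in \<open>auto simp: linear_functional_simps expand_simps algebra_simps power2_eq_square\<close>)
    finally have eq: "a \<otimes> a \<oplus> (b \<otimes> d) \<otimes> (b \<otimes> d) = real_unit ((u + e)\<^sup>2)" .
    have "cnorm A (a \<otimes> a) \<le> cnorm A (a \<otimes> a \<oplus> (b \<otimes> d) \<otimes> (b \<otimes> d))"
      by (rule cnorm_square_le_sum_squares[OF a self_adjoint_mult[OF bd(1) bd(4)]])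
        (use bd bdc ba da ac in \<open>auto simp: m_assoc lcomm[of b a d] lcomm[of d a b]\<close>)
    then have "(cnorm A a)\<^sup>2 \<le> (u + e)\<^sup>2" unfolding eq cnorm_square[OF a] cnorm_real_unit by simp
    then show "cnorm A a \<le> u + e" using u e by (auto intro: power2_le_imp_le[of "cnorm A a" "u + e"])
  qed
qed

end

section \<open>Exact square roots and positivity of \<open>a* a\<close>\<close>

context unital_cstar_algebra
begin

text \<open>For commuting \<open>p, q \<ge> 0\<close> and \<open>e = p - q\<close> one has \<open>e\<^sup>2 \<le> (p + q)\<^sup>2\<close>, so that
  \<open>e\<^sup>4 \<le> (p\<^sup>2 - q\<^sup>2)\<^sup>2\<close>: square roots depend continuously on the element.\<close>

lemma cnorm_minus_power4_le:
  assumes p: "positive A p" and q: "positive A q" and comm: "p \<otimes> q = q \<otimes> p"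
    and eq: "p \<otimes> p \<ominus> q \<otimes> q = real_unit d"
  shows "cnorm A (p \<ominus> q) ^ 4 \<le> d\<^sup>2"
proof -
  note c = positiveD[OF p] positiveD[OF q]
  define e where "e = p \<ominus> q"
  have e: "e \<in> self_adjoint A" unfolding e_def using c by blast
  note ec = self_adjointD[OF e]
  have ee: "e \<otimes> e \<in> self_adjoint A" using e by blast
  define s where "s = p \<oplus> q"
  have sc: "s \<in> carrier A" using c by (simp add: s_def)
  have es: "e \<otimes> s = real_unit d" "s \<otimes> e = real_unit d"
    unfolding eq[symmetric] e_def s_def
    by (rule eq_by_functionals; use c comm in \<open>auto simp: linear_functional_simps expand_simps\<close>)+
  have "positive A (complex_of_real 4 \<odot> (p \<otimes> q))" using positive_mult[OF p q comm] by (rule positive_smult) simp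
  moreover have "complex_of_real 4 \<odot> (p \<otimes> q) = s \<otimes> s \<ominus> e \<otimes> e" unfolding s_def e_def
    by (rule eq_by_functionals) (use c comm in \<open>auto simp: linear_functional_simps expand_simps\<close>)
  ultimately have pos: "positive A (s \<otimes> s \<ominus> e \<otimes> e)" by simp
  have esc: "e \<otimes> s = s \<otimes> e" using es by simp
  have "positive A ((e \<otimes> e) \<otimes> (s \<otimes> s \<ominus> e \<otimes> e))"
    by (rule positive_mult[OF positive_square[OF e] pos])
      (use ec sc esc in \<open>auto simp: expand_simps lcomm[of e s]\<close>)
  moreover have "(e \<otimes> e) \<otimes> (s \<otimes> s \<ominus> e \<otimes> e) = real_unit (d\<^sup>2) \<ominus> (e \<otimes> e) \<otimes> (e \<otimes> e)"
  proof -
    have "(e \<otimes> e) \<otimes> (s \<otimes> s) = (e \<otimes> s) \<otimes> (e \<otimes> s)" using ec sc esc by (simp add: m_assoc lcomm[of e s])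
    also have "\<dots> = real_unit (d\<^sup>2)" unfolding es(1) by (simp add: smult_mult_left smult_smult power2_eq_square)
    finally show ?thesis using ec sc by (simp add: mult_minus_right)
  qed
  ultimately have 1: "positive A (real_unit (d\<^sup>2) \<ominus> (e \<otimes> e) \<otimes> (e \<otimes> e))" by simp
  have 2: "positive A (real_unit (d\<^sup>2) \<oplus> (e \<otimes> e) \<otimes> (e \<otimes> e))"
    by (intro positive_add positive_square ee) (simp only: positive_real_unit_iff zero_le_power2)
  have "cnorm A ((e \<otimes> e) \<otimes> (e \<otimes> e)) \<le> d\<^sup>2"
    by (rule order_bound_cnorm[OF _ 1 2]) (use ee in blast)
  then show ?thesis unfolding e_def[symmetric] using cnorm_square[OF ee] cnorm_square[OF e] by (simp flip: power_mult)
qed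

text \<open>The roots \<open>w n\<close> of \<open>x + \<epsilon> n\<close> commute with each other,
  because each commutes with everything that commutes with \<open>x\<close>. Their squares differ by
  scalars, so the fourth-power estimate makes them a Cauchy sequence.\<close>

lemma positive_sqrt:
  assumes x: "positive A x"
  obtains w where "positive A w" "w \<otimes> w = x"
    "\<And>y. \<lbrakk>y \<in> carrier A; x \<otimes> y = y \<otimes> x\<rbrakk> \<Longrightarrow> w \<otimes> y = y \<otimes> w"
proof -
  interpret K: cstar_family "\<lambda>_. A" by (rule const_family)
  note xc = positiveD[OF x]
  define \<epsilon> :: "nat \<Rightarrow> real" where "\<epsilon> n = 1 / (real n + 1)" for n
  have e0: "\<epsilon> n > 0" for n by (simp add: \<epsilon>_def)
  have elim: "\<epsilon> \<longlonglongrightarrow> 0" unfolding \<epsilon>_def by real_asymp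
  have "\<forall>n. \<exists>w. positive A w \<and> w \<otimes> w = x \<oplus> real_unit (\<epsilon> n) \<and>
      (\<forall>y\<in>carrier A. x \<otimes> y = y \<otimes> x \<longrightarrow> w \<otimes> y = y \<otimes> w)"
    using positive_sqrt_shift[OF x e0] by metis
  then obtain w where w: "\<And>n. positive A (w n)" "\<And>n. w n \<otimes> w n = x \<oplus> real_unit (\<epsilon> n)"
    "\<And>n y. \<lbrakk>y \<in> carrier A; x \<otimes> y = y \<otimes> x\<rbrakk> \<Longrightarrow> w n \<otimes> y = y \<otimes> w n" by metis
  have wc: "w n \<in> carrier A" for n using positiveD[OF w(1)] by simp
  have wx: "w n \<otimes> x = x \<otimes> w n" for n using w(3) xc by simp
  have ww: "w m \<otimes> w n = w n \<otimes> w m" for m n using w(3)[of "w n" m] wx wc by simp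
  have diff: "cnorm A (w m \<ominus> w n) ^ 4 \<le> (\<epsilon> m - \<epsilon> n)\<^sup>2" for m n
  proof (rule cnorm_minus_power4_le[OF w(1) w(1) ww])
    show "w m \<otimes> w m \<ominus> w n \<otimes> w n = real_unit (\<epsilon> m - \<epsilon> n)" unfolding w(2)
      by (rule eq_by_functionals) (use xc in \<open>auto simp: linear_functional_simps algebra_simps\<close>)
  qed
  have "\<exists>y\<in>carrier A. (\<lambda>n. cnorm A (w n \<ominus> y)) \<longlonglongrightarrow> 0"
  proof (rule Cauchy_converges[OF wc])
    fix r :: real assume r: "r > 0"
    then have "r\<^sup>2 > 0" by simp
    from order_tendstoD(2)[OF elim this] obtain N where N: "\<And>n. n \<ge> N \<Longrightarrow> \<epsilon> n < r\<^sup>2"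
      by (auto simp: eventually_sequentially)
    have "cnorm A (w m \<ominus> w n) < r" if "m \<ge> N" "n \<ge> N" for m n
    proof -
      have "\<bar>\<epsilon> m - \<epsilon> n\<bar> < r\<^sup>2" using N[OF that(1)] N[OF that(2)] e0[of m] e0[of n] by linarith
      then have "\<bar>\<epsilon> m - \<epsilon> n\<bar>\<^sup>2 < (r\<^sup>2)\<^sup>2" by (intro power_strict_mono) auto
      then have "cnorm A (w m \<ominus> w n) ^ 4 < r ^ 4" using diff[of m n] by (simp flip: power_mult)
      then show ?thesis using r by (meson less_eq_real_def power_less_imp_less_base)
    qed
    then show "\<exists>N. \<forall>m\<ge>N. \<forall>n\<ge>N. cnorm A (w m \<ominus> w n) < r" by blast
  qed
  then obtain y where y: "y \<in> carrier A" "near sequentially (\<lambda>_. A) w (\<lambda>_. y)" by (auto simp: near_def)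
  have "positive A y" using positive_closed[OF _ w(1) y] by simp
  moreover have "y \<otimes> z = z \<otimes> y" if "z \<in> carrier A" "x \<otimes> z = z \<otimes> x" for z
    using near_commute[OF _ wc y(1) that(1) y(2)] w(3)[OF that] by simp
  moreover have "y \<otimes> y = x"
  proof (rule near_unique[of sequentially "\<lambda>n. w n \<otimes> w n"])
    define K where "K = cnorm A y + 1"
    have "\<forall>\<^sub>F n in sequentially. cnorm A (w n) < K"
      unfolding K_def using near_cnorm[OF wc y] by (rule order_tendstoD) simp
    then have "\<forall>\<^sub>F n in sequentially. cnorm A (w n) \<le> K" by eventually_elim simp
    then show "near sequentially (\<lambda>_. A) (\<lambda>n. w n \<otimes> w n) (\<lambda>_. y \<otimes> y)"
      by (intro K.near_mult[where K = K]) (use wc y in \<open>auto simp: K_def\<close>)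
    show "near sequentially (\<lambda>_. A) (\<lambda>n. w n \<otimes> w n) (\<lambda>_. x)" unfolding w(2)
    proof (rule K.near_if_bounded)
      show "\<epsilon> \<longlonglongrightarrow> 0" by fact
      have "x \<oplus> real_unit (\<epsilon> n) \<ominus> x = real_unit (\<epsilon> n)" for n
        by (rule eq_by_functionals) (use xc in \<open>auto simp: linear_functional_simps\<close>)
      then show "\<forall>\<^sub>F n in sequentially. cnorm A (x \<oplus> real_unit (\<epsilon> n) \<ominus> x) \<le> \<epsilon> n"
        using e0 by (simp add: less_imp_le)
    qed (use xc in auto)
  qed (use wc xc y in auto)
  ultimately show ?thesis using that by blast
qed

text \<open>A Neumann series written as a fixed point: \<open>s + k = (s + t) (1 - e)\<close> with
  \<open>norm e < 1\<close>, and \<open>b = 1 + e b\<close> inverts \<open>1 - e\<close>. Working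
  inside the commutant of \<open>e\<close> makes the inverse two-sided.\<close>

lemma positive_shift_inverse:
  assumes k: "positive A k" and s: "s > 0"
  obtains r where "r \<in> carrier A" "r \<otimes> (real_unit s \<oplus> k) = \<one>" "(real_unit s \<oplus> k) \<otimes> r = \<one>"
proof -
  note kc = positiveD[OF k]
  obtain t where t: "cnorm A (real_unit t \<ominus> k) \<le> t" using k by (auto simp: positive_def)
  have t0: "t \<ge> 0" using cnorm_nonneg[of "real_unit t \<ominus> k"] t kc by force
  define e where "e = complex_of_real (1 / (s + t)) \<odot> (real_unit t \<ominus> k)"
  have e: "e \<in> carrier A" unfolding e_def using kc by auto
  have "cnorm A e = cnorm A (real_unit t \<ominus> k) / (s + t)" unfolding e_def using kc s t0
    by (subst cnorm_of_real_smult) auto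
  also have "\<dots> < 1" using t t0 s by simp
  finally have e1: "cnorm A e < 1" .
  define Q where "Q = {b \<in> carrier A. b \<otimes> e = e \<otimes> b}"
  have "\<exists>b\<in>Q. \<one> \<oplus> e \<otimes> b = b"
  proof (rule contraction_fixed_point[of Q \<zero> "\<lambda>b. \<one> \<oplus> e \<otimes> b" "cnorm A e"])
    fix a b assume ab: "a \<in> Q" "b \<in> Q"
    have "(\<one> \<oplus> e \<otimes> a) \<ominus> (\<one> \<oplus> e \<otimes> b) = e \<otimes> (a \<ominus> b)"
      by (rule eq_by_functionals) (use e ab in \<open>auto simp: linear_functional_simps expand_simps Q_def\<close>)
    then show "cnorm A ((\<one> \<oplus> e \<otimes> a) \<ominus> (\<one> \<oplus> e \<otimes> b)) \<le> cnorm A e * cnorm A (a \<ominus> b)"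
      using cnorm_mult[of e "a \<ominus> b"] e ab by (simp add: Q_def)
  next
    fix s x assume "\<And>n::nat. s n \<in> Q" "x \<in> carrier A" "near sequentially (\<lambda>_. A) s (\<lambda>_. x)"
    then show "x \<in> Q" using near_commute[of sequentially s x e] e by (auto simp: Q_def)
  qed (use e e1 cnorm_nonneg[OF e] in \<open>auto simp: Q_def expand_simps\<close>)
  then obtain b where b: "b \<in> carrier A" "b \<otimes> e = e \<otimes> b" "\<one> \<oplus> e \<otimes> b = b" by (auto simp: Q_def)
  define r where "r = complex_of_real (1 / (s + t)) \<odot> b"
  have nz: "complex_of_real s + complex_of_real t \<noteq> 0"
    using t0 s unfolding of_real_add[symmetric] of_real_eq_0_iff by simp
  have sk: "real_unit s \<oplus> k = complex_of_real (s + t) \<odot> (\<one> \<ominus> e)" unfolding e_def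
    by (rule eq_by_functionals) (use kc nz in \<open>auto simp: linear_functional_simps field_simps\<close>)
  have 1: "(\<one> \<ominus> e) \<otimes> b = \<one>"
  proof (rule eq_by_functionals)
    fix f assume f: "linear_functional A f"
    have "f b = f \<one> + f (e \<otimes> b)" using f b(1) e arg_cong[OF b(3)[symmetric], of f] by (simp add: linear_functional_simps)
    then show "f ((\<one> \<ominus> e) \<otimes> b) = f \<one>" using f b e by (simp add: linear_functional_simps expand_simps)
  qed (use b e in auto)
  have 2: "b \<otimes> (\<one> \<ominus> e) = \<one>" using 1 b e by (simp add: expand_simps)
  show ?thesis
  proof (rule that)
    show "r \<in> carrier A" unfolding r_def using b by auto
    show "r \<otimes> (real_unit s \<oplus> k) = \<one>" "(real_unit s \<oplus> k) \<otimes> r = \<one>" unfolding sk r_def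
      using b e nz 1 2 by (simp_all add: smult_mult_left smult_mult_right smult_smult)
  qed
qed

text \<open>The nonzero spectra of \<open>y* y\<close> and \<open>y y*\<close> agree; the inverse below is the classical
  \<open>(s - y y* )\<^sup>-\<^sup>1 = s\<^sup>-\<^sup>1 (1 + y (s - y* y)\<^sup>-\<^sup>1 y* )\<close>.\<close>

lemma mult_adj_eq_zero:
  assumes y: "y \<in> carrier A" and k: "positive A k" and yk: "adj A y \<otimes> y = \<ominus> k"
    and m: "positive A (y \<otimes> adj A y)"
  shows "y = \<zero>"
proof -
  define m' where "m' = y \<otimes> adj A y"
  define s where "s = cnorm A m'"
  have mp: "positive A m'" using m by (simp add: m'_def)
  note mc = positiveD[OF mp] and kc = positiveD[OF k]
  have "s = 0"
  proof (rule ccontr)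
    \<comment> \<open>The norm \<open>s\<close> of the positive \<open>m' = y y*\<close> ought to be
      a spectral value of \<open>m'\<close>. But \<open>s - y* y = s + k\<close> is invertible,
      hence so is \<open>g = s - m'\<close>, with inverse \<open>R\<close>; the rest turns this into
      the contradiction \<open>norm m' < s\<close>.\<close>
    assume "s \<noteq> 0"
    then have s: "s > 0" using cnorm_nonneg[OF mc(2)] by (simp add: s_def)
    obtain r where r: "r \<in> carrier A" "r \<otimes> (real_unit s \<oplus> k) = \<one>" "(real_unit s \<oplus> k) \<otimes> r = \<one>"
      using positive_shift_inverse[OF k s] .
    define R where "R = complex_of_real (1/s) \<odot> (\<one> \<oplus> y \<otimes> r \<otimes> adj A y)"
    define g where "g = real_unit s \<ominus> m'"
    have Rc: "R \<in> carrier A" unfolding R_def using y r by auto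
    have g: "g \<in> self_adjoint A" unfolding g_def using mc(1) by blast
    note gc = self_adjointD[OF g]
    have k_eq: "k = \<ominus> (adj A y \<otimes> y)" using yk kc y by simp
    have yky: "complex_of_real s \<odot> (y \<otimes> (r \<otimes> adj A y)) \<ominus> y \<otimes> (adj A y \<otimes> (y \<otimes> (r \<otimes> adj A y))) = m'"
      (is "?l = _")
    proof -
      have "?l = y \<otimes> ((real_unit s \<oplus> k) \<otimes> r) \<otimes> adj A y" unfolding k_eq
        by (rule eq_by_functionals) (use y r in \<open>auto simp: linear_functional_simps expand_simps\<close>)
      then show ?thesis unfolding r(3) using y by (simp add: m'_def)
    qed
    have yky': "complex_of_real s \<odot> (y \<otimes> (r \<otimes> adj A y)) \<ominus> y \<otimes> (r \<otimes> (adj A y \<otimes> (y \<otimes> adj A y))) = m'"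
      (is "?l = _")
    proof -
      have "?l = y \<otimes> (r \<otimes> (real_unit s \<oplus> k)) \<otimes> adj A y" unfolding k_eq
        by (rule eq_by_functionals) (use y r in \<open>auto simp: linear_functional_simps expand_simps\<close>)
      then show ?thesis unfolding r(2) using y by (simp add: m'_def)
    qed
    have gR: "g \<otimes> R = \<one>"
    proof (rule eq_by_functionals)
      fix f assume f: "linear_functional A f"
      show "f (g \<otimes> R) = f \<one>"
        using arg_cong[OF yky, of f] s f y r unfolding g_def R_def m'_def
        by (simp add: linear_functional_simps expand_simps; simp add: field_simps)
    qed (use gc Rc in auto)
    have Rg: "R \<otimes> g = \<one>"
    proof (rule eq_by_functionals)
      fix f assume f: "linear_functional A f"
      show "f (R \<otimes> g) = f \<one>"
        using arg_cong[OF yky', of f] s f y r unfolding g_def R_def m'_def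
        by (simp add: linear_functional_simps expand_simps; simp add: field_simps)
    qed (use gc Rc in auto)
    \<comment> \<open>A left inverse and a right inverse of \<open>g\<close> coincide, so
      \<open>R\<close> equals its adjoint.\<close>
    have "adj A R \<otimes> g = \<one>" using arg_cong[OF gR, of "adj A"] gc Rc by (simp add: adj_mult)
    then have "adj A R \<otimes> (g \<otimes> R) = R" using gc Rc by (metis adj_closed l_one m_assoc)
    then have R: "R \<in> self_adjoint A" using gR Rc by (simp add: self_adjoint_def)
    have gp: "positive A g" unfolding positive_def
    proof (intro conjI exI g)
      have "real_unit s \<ominus> g = m'" unfolding g_def
        by (rule eq_by_functionals) (use mc in \<open>auto simp: linear_functional_simps\<close>)
      then show "cnorm A (real_unit s \<ominus> g) \<le> s" by (simp add: s_def)
    qed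
    \<comment> \<open>\<open>R = R^2 g\<close> is a product of commuting positive elements.\<close>
    have "positive A ((R \<otimes> R) \<otimes> g)"
      by (rule positive_mult[OF positive_square[OF R] gp]) (use Rc gc Rg gR in \<open>auto simp: m_assoc simp flip: m_assoc[of g R R]\<close>)
    then have Rp: "positive A R" using Rc gc Rg by (simp add: m_assoc)
    define \<rho> where "\<rho> = cnorm A R"
    have "R \<noteq> \<zero>" using gR gc one_neq_zero by auto
    then have rho: "\<rho> > 0" using cnorm_nonneg[OF Rc] cnorm_eq_zero[OF Rc] by (simp add: \<rho>_def)
    have "positive A (real_unit \<rho> \<ominus> R)" unfolding positive_def
    proof (intro conjI exI)
      show "real_unit \<rho> \<ominus> R \<in> self_adjoint A" using R by blast
      have "real_unit \<rho> \<ominus> (real_unit \<rho> \<ominus> R) = R"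
        by (rule eq_by_functionals) (use Rc in \<open>auto simp: linear_functional_simps\<close>)
      then show "cnorm A (real_unit \<rho> \<ominus> (real_unit \<rho> \<ominus> R)) \<le> \<rho>" by (simp add: \<rho>_def)
    qed
    \<comment> \<open>\<open>g (\<rho> - R) = \<rho> g - 1\<close> is positive, that is,
      \<open>m' <= s - 1/\<rho>\<close>, although the norm of \<open>m'\<close> is
      \<open>s\<close>.\<close>
    from positive_mult[OF gp this] have "positive A (g \<otimes> (real_unit \<rho> \<ominus> R))"
      using gc Rc gR Rg by (simp add: expand_simps)
    from positive_smult[OF this, of "1/\<rho>"] rho
    have "positive A (complex_of_real (1/\<rho>) \<odot> (g \<otimes> (real_unit \<rho> \<ominus> R)))" by simp
    moreover have "complex_of_real (1/\<rho>) \<odot> (g \<otimes> (real_unit \<rho> \<ominus> R)) = real_unit (s - 1/\<rho>) \<ominus> m'"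
    proof (rule eq_by_functionals)
      fix f assume f: "linear_functional A f"
      have fm: "f m' = of_real s * f \<one> - f g" using f mc by (simp add: g_def linear_functional_simps)
      then show "f (complex_of_real (1/\<rho>) \<odot> (g \<otimes> (real_unit \<rho> \<ominus> R))) = f (real_unit (s - 1/\<rho>) \<ominus> m')"
        using f rho gc Rc gR mc by (simp add: linear_functional_simps expand_simps fm; simp add: field_simps)
    qed (use gc Rc mc in auto)
    ultimately have 1: "positive A (real_unit (s - 1/\<rho>) \<ominus> m')" by simp
    have "real_unit (s - 1/\<rho>) \<ominus> m' \<oplus> m' = real_unit (s - 1/\<rho>)"
      by (rule eq_by_functionals) (use mc in \<open>auto simp: linear_functional_simps\<close>)
    then have "positive A (real_unit (s - 1/\<rho>))" using positive_add[OF 1 mp] by simp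
    then have 2: "positive A (real_unit (s - 1/\<rho>) \<oplus> m')" using positive_add mp by blast
    have "cnorm A m' \<le> s - 1/\<rho>" by (rule order_bound_cnorm[OF mc(1) 1 2])
    then show False using rho by (simp add: s_def)
  qed
  then have "cnorm A (y \<otimes> adj A y) = 0" by (simp add: s_def m'_def)
  then have "(cnorm A (adj A y))\<^sup>2 = 0" using cstar_identity[of "adj A y"] y by simp
  then show ?thesis using y cnorm_eq_zero by simp
qed

text \<open>With \<open>h = x* x\<close> and the negative part \<open>v\<close> of \<open>h\<close>, the element \<open>y = x v\<close> has
  \<open>y* y = - v\<^sup>3\<close>, while \<open>y* y + y y* \<ge> 0\<close>.\<close>

theorem positive_adj_mult:
  assumes x: "x \<in> carrier A" shows "positive A (adj A x \<otimes> x)"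
proof -
  define h where "h = adj A x \<otimes> x"
  have h: "h \<in> self_adjoint A" unfolding h_def self_adjoint_def using x by (auto simp: adj_mult)
  note hc = self_adjointD[OF h]
  \<comment> \<open>\<open>w\<close> is the absolute value of \<open>h\<close>; the identity
    \<open>v^2 = v w\<close> below says that the negative part \<open>v\<close> annihilates the
    positive part \<open>(w + h) / 2\<close>.\<close>
  obtain w where w: "positive A w" "w \<otimes> w = h \<otimes> h" 
    "\<And>y. \<lbrakk>y \<in> carrier A; (h \<otimes> h) \<otimes> y = y \<otimes> (h \<otimes> h)\<rbrakk> \<Longrightarrow> w \<otimes> y = y \<otimes> w"
    using positive_sqrt[OF positive_square[OF h]] by metis
  note wc = positiveD[OF w(1)]
  have wh: "w \<otimes> h = h \<otimes> w" using w(3)[of h] hc by (simp add: m_assoc)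
  define v where "v = complex_of_real (1/2) \<odot> (w \<ominus> h)"
  have v: "v \<in> self_adjoint A" unfolding v_def using wc(1) h by blast
  note vc = self_adjointD[OF v]
  have vv: "v \<otimes> v = v \<otimes> w" unfolding v_def
    by (rule eq_by_functionals)
      (use wc hc w(2) wh in \<open>auto simp: linear_functional_simps expand_simps field_simps\<close>)
  have wv: "w \<otimes> v = v \<otimes> w" unfolding v_def using wc hc wh by (simp add: expand_simps)
  have hv: "h = w \<ominus> complex_of_real 2 \<odot> v" unfolding v_def
    by (rule eq_by_functionals) (use wc hc in \<open>auto simp: linear_functional_simps field_simps\<close>)
  define k where "k = (v \<otimes> v) \<otimes> w"
  have k: "positive A k" unfolding k_def
    by (rule positive_mult[OF positive_square[OF v] w(1)]) (use vc wc wv in \<open>auto simp: m_assoc lcomm[of w v v]\<close>)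
  note kc = positiveD[OF k]
  have k3: "k = v \<otimes> (v \<otimes> v)" unfolding k_def using vc wc by (metis vv m_assoc)
  define y where "y = x \<otimes> v"
  have y: "y \<in> carrier A" unfolding y_def using x vc by auto
  have yy: "adj A y \<otimes> y = \<ominus> k"
  proof -
    have "adj A y \<otimes> y = v \<otimes> h \<otimes> v" unfolding y_def h_def using x vc by (simp add: adj_mult m_assoc)
    also have "\<dots> = \<ominus> k" unfolding hv k3
    proof (rule eq_by_functionals)
      fix f assume f: "linear_functional A f"
      have "v \<otimes> (w \<otimes> v) = v \<otimes> (v \<otimes> v)" using wv vv by simp
      then show "f (v \<otimes> (w \<ominus> complex_of_real 2 \<odot> v) \<otimes> v) = f (\<ominus> (v \<otimes> (v \<otimes> v)))"
        using f vc wc by (simp add: linear_functional_simps expand_simps)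
    qed (use vc wc in auto)
    finally show ?thesis .
  qed
  \<comment> \<open>The real and imaginary parts of \<open>y\<close> satisfy
    \<open>y* y + y y* = 2 (p^2 + q^2)\<close>, so \<open>y y* = 2 (p^2 + q^2) + k\<close> is
    positive.\<close>
  define p where "p = complex_of_real (1/2) \<odot> (y \<oplus> adj A y)"
  define q where "q = (1/(2*\<i>)) \<odot> (y \<ominus> adj A y)"
  have p: "p \<in> self_adjoint A" unfolding p_def self_adjoint_def using y by (auto simp: adj_simps a_comm)
  have q: "q \<in> self_adjoint A"
  proof (rule self_adjointI)
    show "adj A q = q" unfolding q_def
      by (rule eq_by_functionals) (use y in \<open>auto simp: adj_simps linear_functional_simps field_simps\<close>)
  qed (use y in \<open>auto simp: q_def\<close>)
  have "positive A (complex_of_real 2 \<odot> (p \<otimes> p \<oplus> q \<otimes> q) \<oplus> k)"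
    by (intro positive_add positive_smult positive_square p q k) simp
  moreover have "complex_of_real 2 \<odot> (p \<otimes> p \<oplus> q \<otimes> q) \<oplus> k = y \<otimes> adj A y"
  proof -
    have k_eq: "k = \<ominus> (adj A y \<otimes> y)" using yy kc by simp
    show ?thesis unfolding k_eq p_def q_def
      by (rule eq_by_functionals) (use y in \<open>auto simp: linear_functional_simps expand_simps field_simps\<close>)
  qed
  ultimately have "y = \<zero>" using mult_adj_eq_zero[OF y k yy] by simp
  then have "k = \<zero>" using yy kc y by (metis a_inv_closed adj_zero l_null minus_minus minus_zero zero_closed)
  \<comment> \<open>From \<open>v^3 = 0\<close> to \<open>v = 0\<close>: the C*-identity, applied
    twice to the self-adjoint \<open>v\<close>, gives
    \<open>norm (v^4) = norm v ^ 4\<close>.\<close>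
  then have "(v \<otimes> v) \<otimes> (v \<otimes> v) = \<zero>" using k3 vc by (simp add: m_assoc)
  then have "cnorm A v ^ 4 = 0"
    using cnorm_square[OF v] cnorm_square[of "v \<otimes> v"] v by (simp flip: power_mult)
  then have "v = \<zero>" using vc cnorm_eq_zero by simp
  then have "h = w" using hv wc by (simp add: minus_eq_smult)
  then show ?thesis using w(1) by (simp add: h_def)
qed

end

section \<open>States\<close>

definition re_part :: "'a cstar \<Rightarrow> 'a \<Rightarrow> 'a" where
  "re_part A x = (1 / 2) \<odot>\<^bsub>A\<^esub> (x \<oplus>\<^bsub>A\<^esub> adj A x)"

definition im_part :: "'a cstar \<Rightarrow> 'a \<Rightarrow> 'a" where
  "im_part A x = (1 / (2 * \<i>)) \<odot>\<^bsub>A\<^esub> (x \<ominus>\<^bsub>A\<^esub> adj A x)"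

context unital_cstar_algebra
begin

lemma re_part_self_adjoint [simp, intro]: "x \<in> carrier A \<Longrightarrow> re_part A x \<in> self_adjoint A"
  unfolding re_part_def self_adjoint_def by (auto simp: adj_simps a_comm)

lemma im_part_self_adjoint [simp, intro]:
  assumes "x \<in> carrier A" shows "im_part A x \<in> self_adjoint A"
proof (rule self_adjointI)
  show "adj A (im_part A x) = im_part A x" unfolding im_part_def
    by (rule eq_by_functionals) (use assms in \<open>auto simp: adj_simps linear_functional_simps field_simps\<close>)
qed (use assms in \<open>auto simp: im_part_def\<close>)

lemma part_closed [simp, intro]:
  "x \<in> carrier A \<Longrightarrow> re_part A x \<in> carrier A" "x \<in> carrier A \<Longrightarrow> im_part A x \<in> carrier A"
  by (auto simp: re_part_def im_part_def)

lemma re_im_decomposition: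
  assumes "x \<in> carrier A" shows "re_part A x \<oplus> \<i> \<odot> im_part A x = x"
  unfolding re_part_def im_part_def
  by (rule eq_by_functionals) (use assms in \<open>auto simp: linear_functional_simps field_simps\<close>)

lemma parts_of_sum:
  assumes "p \<in> self_adjoint A" "q \<in> self_adjoint A"
  shows "re_part A (p \<oplus> \<i> \<odot> q) = p" "im_part A (p \<oplus> \<i> \<odot> q) = q"
  unfolding re_part_def im_part_def
  by (rule eq_by_functionals; use assms in \<open>auto simp: adj_simps self_adjointD linear_functional_simps field_simps\<close>)+

lemma re_part_of_self_adjoint: "p \<in> self_adjoint A \<Longrightarrow> re_part A p = p"
  and im_part_of_self_adjoint: "p \<in> self_adjoint A \<Longrightarrow> im_part A p = \<zero>"
  using parts_of_sum[of p \<zero>] by (auto simp: self_adjointD)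

lemma cnorm_part_le:
  assumes "x \<in> carrier A"
  shows "cnorm A (re_part A x) \<le> cnorm A x" "cnorm A (im_part A x) \<le> cnorm A x"
  unfolding re_part_def im_part_def
  using assms cnorm_triangle[of x "adj A x"] cnorm_minus[of x "adj A x"]
  by (auto simp: cnorm_smult norm_divide norm_mult)

lemma cnorm_le_parts:
  assumes "x \<in> carrier A"
  shows "cnorm A x \<le> cnorm A (re_part A x) + cnorm A (im_part A x)"
  using re_im_decomposition[OF assms] cnorm_triangle[of "re_part A x" "\<i> \<odot> im_part A x"] assms
  by (auto simp: cnorm_smult)

text \<open>States are tested on elements \<open>a* a\<close>, while \<open>g\<close> is known to be
  nonnegative on elements that are positive in the norm sense; \<open>positive_adj_mult\<close>
  bridges the two. The formula is the complex-linear extension from the self-adjoint part.\<close>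

lemma statesI_real:
  assumes add: "\<And>x y. \<lbrakk>x \<in> self_adjoint A; y \<in> self_adjoint A\<rbrakk> \<Longrightarrow> g (x \<oplus> y) = g x + g y"
    and scale: "\<And>x t. x \<in> self_adjoint A \<Longrightarrow> g (complex_of_real t \<odot> x) = t * g x"
    and pos: "\<And>x. positive A x \<Longrightarrow> g x \<ge> 0" and one: "g \<one> = 1"
  shows "(\<lambda>x\<in>carrier A. complex_of_real (g (re_part A x)) + \<i> * complex_of_real (g (im_part A x))) \<in> states A"
proof -
  define \<phi> where "\<phi> = (\<lambda>x\<in>carrier A. complex_of_real (g (re_part A x)) + \<i> * complex_of_real (g (im_part A x)))"
  have \<phi>_eq: "\<phi> x = complex_of_real (g (re_part A x)) + \<i> * complex_of_real (g (im_part A x))" if "x \<in> carrier A" for x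
    using that by (simp add: \<phi>_def)
  have g0: "g \<zero> = 0" using scale[of \<zero> 0] by simp
  have \<phi>_add: "\<phi> (a \<oplus> b) = \<phi> a + \<phi> b" if ab: "a \<in> carrier A" "b \<in> carrier A" for a b
  proof -
    have "re_part A (a \<oplus> b) = re_part A a \<oplus> re_part A b" "im_part A (a \<oplus> b) = im_part A a \<oplus> im_part A b"
      unfolding re_part_def im_part_def
      by (rule eq_by_functionals; use ab in \<open>auto simp: adj_simps linear_functional_simps field_simps\<close>)+
    then show ?thesis using ab by (simp add: \<phi>_eq add algebra_simps)
  qed
  have \<phi>_real: "\<phi> (complex_of_real t \<odot> a) = complex_of_real t * \<phi> a" if a: "a \<in> carrier A" for a t
  proof -
    have "re_part A (complex_of_real t \<odot> a) = complex_of_real t \<odot> re_part A a"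
      "im_part A (complex_of_real t \<odot> a) = complex_of_real t \<odot> im_part A a"
      unfolding re_part_def im_part_def
      by (rule eq_by_functionals; use a in \<open>auto simp: adj_simps linear_functional_simps field_simps\<close>)+
    then show ?thesis using a by (simp add: \<phi>_eq scale algebra_simps)
  qed
  have \<phi>_i: "\<phi> (\<i> \<odot> a) = \<i> * \<phi> a" if a: "a \<in> carrier A" for a
  proof -
    have "re_part A (\<i> \<odot> a) = complex_of_real (-1) \<odot> im_part A a" "im_part A (\<i> \<odot> a) = re_part A a"
      unfolding re_part_def im_part_def
      by (rule eq_by_functionals; use a in \<open>auto simp: adj_simps linear_functional_simps field_simps\<close>)+
    then have "\<phi> (\<i> \<odot> a) = complex_of_real (g (complex_of_real (-1) \<odot> im_part A a)) + \<i> * complex_of_real (g (re_part A a))"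
      using a by (simp only: \<phi>_eq smult_closed)
    also have "\<dots> = \<i> * \<phi> a" using a scale[of "im_part A a" "-1"] by (simp add: \<phi>_eq algebra_simps)
    finally show ?thesis .
  qed
  have \<phi>_smult: "\<phi> (c \<odot> a) = c * \<phi> a" if a: "a \<in> carrier A" for a c
  proof -
    have "c \<odot> a = complex_of_real (Re c) \<odot> a \<oplus> \<i> \<odot> (complex_of_real (Im c) \<odot> a)"
      using a by (subst complex_eq[of c]) (simp add: smult_add_left smult_smult mult.commute)
    then have "\<phi> (c \<odot> a) = complex_of_real (Re c) * \<phi> a + \<i> * (complex_of_real (Im c) * \<phi> a)"
      using a by (simp add: \<phi>_add \<phi>_real \<phi>_i)
    also have "\<dots> = (complex_of_real (Re c) + \<i> * complex_of_real (Im c)) * \<phi> a" by (simp add: algebra_simps)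
    finally show ?thesis by (simp flip: complex_eq)
  qed
  have \<phi>_sa: "\<phi> p = complex_of_real (g p)" if "p \<in> self_adjoint A" for p
    using that by (simp add: \<phi>_eq self_adjointD re_part_of_self_adjoint im_part_of_self_adjoint g0)
  have "\<phi> (adj A a \<otimes> a) \<in> \<real>\<^sub>\<ge>\<^sub>0" if "a \<in> carrier A" for a
    using positive_adj_mult[OF that] positiveD pos \<phi>_sa by simp
  moreover have "\<phi> \<one> = 1" using \<phi>_sa[of \<one>] one by simp
  moreover have "\<phi> \<in> extensional (carrier A)" by (simp add: \<phi>_def)
  ultimately have "\<phi> \<in> states A" using \<phi>_add \<phi>_smult by (simp add: states_def)
  then show ?thesis by (simp add: \<phi>_def)
qed

text \<open>A maximal cone of self-adjoint elements that does not contain \<open>-1\<close> is the half space of a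
  state; this replaces the Hahn-Banach theorem.\<close>

lemma state_on_cone:
  assumes C: "C \<subseteq> self_adjoint A" "\<And>x. positive A x \<Longrightarrow> x \<in> C"
    "\<And>x y. \<lbrakk>x \<in> C; y \<in> C\<rbrakk> \<Longrightarrow> x \<oplus> y \<in> C" "\<And>x t. \<lbrakk>x \<in> C; t \<ge> 0\<rbrakk> \<Longrightarrow> complex_of_real t \<odot> x \<in> C"
    "real_unit (- 1) \<notin> C"
  obtains \<phi> where "\<phi> \<in> states A" "\<And>x. x \<in> C \<Longrightarrow> Re (\<phi> x) \<ge> 0"
proof -
  define \<S> where "\<S> = {Q. C \<subseteq> Q \<and> Q \<subseteq> self_adjoint A \<and> (\<forall>x\<in>Q. \<forall>y\<in>Q. x \<oplus> y \<in> Q) \<and>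
      (\<forall>t\<ge>0. \<forall>x\<in>Q. complex_of_real t \<odot> x \<in> Q) \<and> real_unit (- 1) \<notin> Q}"
  have "\<exists>M\<in>\<S>. \<forall>X\<in>\<S>. M \<subseteq> X \<longrightarrow> X = M"
  proof (rule subset_Zorn_nonempty)
    show "\<S> \<noteq> {}" unfolding \<S>_def using C by (intro ex_in_conv[THEN iffD1] exI[of _ C] CollectI) auto
    fix K assume K: "K \<noteq> {}" "subset.chain \<S> K"
    have sub: "K \<subseteq> \<S>" using K(2) by (simp add: subset_chain_def)
    have ch: "\<And>X Y. X \<in> K \<Longrightarrow> Y \<in> K \<Longrightarrow> X \<subseteq> Y \<or> Y \<subseteq> X"
      using K(2) by (auto simp: subset_chain_def)
    have "a \<oplus> b \<in> \<Union>K" if ab: "a \<in> \<Union>K" "b \<in> \<Union>K" for a b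
    proof -
      obtain X Y where "X \<in> K" "a \<in> X" "Y \<in> K" "b \<in> Y" using ab by blast
      then obtain Z where "Z \<in> K" "a \<in> Z" "b \<in> Z" using ch[of X Y] by blast
      then have "a \<oplus> b \<in> Z" using sub unfolding \<S>_def by blast
      then show ?thesis using \<open>Z \<in> K\<close> by blast
    qed
    moreover have "C \<subseteq> \<Union>K" "\<Union>K \<subseteq> self_adjoint A" "real_unit (- 1) \<notin> \<Union>K"
      using sub K(1) unfolding \<S>_def by blast+
    moreover have "complex_of_real t \<odot> a \<in> \<Union>K" if "a \<in> \<Union>K" "t \<ge> 0" for a t
      using that sub unfolding \<S>_def by blast
    ultimately show "\<Union>K \<in> \<S>" unfolding \<S>_def by blast
  qed
  then obtain Q where Q: "Q \<in> \<S>" and max: "\<And>X. X \<in> \<S> \<Longrightarrow> Q \<subseteq> X \<Longrightarrow> X = Q" by blast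
  have CQ: "C \<subseteq> Q" and Qs: "Q \<subseteq> self_adjoint A"
    and Qa: "\<And>x y. \<lbrakk>x \<in> Q; y \<in> Q\<rbrakk> \<Longrightarrow> x \<oplus> y \<in> Q"
    and Qt: "\<And>t x. \<lbrakk>t \<ge> 0; x \<in> Q\<rbrakk> \<Longrightarrow> complex_of_real t \<odot> x \<in> Q" and Q1: "real_unit (- 1) \<notin> Q"
    using Q unfolding \<S>_def by auto
  have Qpos: "x \<in> Q" if "positive A x" for x using C(2) CQ that by auto
  have Qc: "x \<in> Q \<Longrightarrow> x \<in> carrier A" for x using Qs self_adjointD by auto
  have unit: "real_unit t \<in> Q \<longleftrightarrow> t \<ge> 0" for t
  proof
    assume t: "real_unit t \<in> Q"
    show "t \<ge> 0"
    proof (rule ccontr)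
      assume "\<not> t \<ge> 0"
      then have "complex_of_real (1 / (- t)) \<odot> real_unit t \<in> Q" by (intro Qt t) auto
      moreover have "complex_of_real (1 / (- t)) \<odot> real_unit t = real_unit (- 1)"
        using \<open>\<not> t \<ge> 0\<close> by (simp add: smult_smult)
      ultimately show False using Q1 by simp
    qed
  qed (use Qpos positive_real_unit_iff in blast)
  \<comment> \<open>Maximality: if \<open>x\<close> is missing from \<open>Q\<close>, then
    \<open>-1 = q + t x\<close> with \<open>q\<close> in the cone and \<open>t > 0\<close>, so
    \<open>- x = (q + 1) / t\<close> belongs to it.\<close>
  have total: "\<ominus> x \<in> Q" if x: "x \<in> self_adjoint A" "x \<notin> Q" for x
  proof -
    note xc = self_adjointD[OF x(1)]
    define N where "N = {q \<oplus> complex_of_real t \<odot> x | q t. q \<in> Q \<and> t \<ge> 0}"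
    have QN: "Q \<subseteq> N"
    proof
      fix q assume "q \<in> Q"
      then show "q \<in> N" unfolding N_def using xc Qc by (intro CollectI exI[of _ q] exI[of _ 0]) auto
    qed
    have xN: "x \<in> N" unfolding N_def using xc Qpos[of \<zero>] positive_square[of \<zero>]
      by (intro CollectI exI[of _ \<zero>] exI[of _ 1]) auto
    have "N \<notin> \<S>" using max[of N] QN xN x by blast
    moreover have "C \<subseteq> N" using CQ QN by simp
    moreover have "N \<subseteq> self_adjoint A" unfolding N_def using Qs x by auto
    moreover have "a \<oplus> b \<in> N" if ab: "a \<in> N" "b \<in> N" for a b
    proof -
      obtain q t q' t' where *: "q \<in> Q" "q' \<in> Q" "t \<ge> 0" "t' \<ge> 0"
        "a = q \<oplus> complex_of_real t \<odot> x" "b = q' \<oplus> complex_of_real t' \<odot> x"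
        using ab unfolding N_def by blast
      have "a \<oplus> b = (q \<oplus> q') \<oplus> complex_of_real (t + t') \<odot> x" unfolding *(5,6)
        using xc Qc[OF *(1)] Qc[OF *(2)] by (simp add: smult_add_left a_ac)
      then show ?thesis unfolding N_def using Qa[OF *(1,2)] *(3,4) by (intro CollectI exI[of _ "q \<oplus> q'"] exI[of _ "t + t'"]) auto
    qed
    moreover have "complex_of_real s \<odot> a \<in> N" if a: "a \<in> N" "s \<ge> 0" for a s
    proof -
      obtain q t where *: "q \<in> Q" "t \<ge> 0" "a = q \<oplus> complex_of_real t \<odot> x" using a unfolding N_def by blast
      have "complex_of_real s \<odot> a = complex_of_real s \<odot> q \<oplus> complex_of_real (s * t) \<odot> x" unfolding *(3)
        using xc Qc[OF *(1)] by (simp add: smult_add_right smult_smult)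
      then show ?thesis unfolding N_def using Qt[OF a(2) *(1)] *(2) a(2)
        by (intro CollectI exI[of _ "complex_of_real s \<odot> q"] exI[of _ "s * t"]) auto
    qed
    ultimately have "real_unit (- 1) \<in> N" unfolding \<S>_def by blast
    then obtain q t where qt: "q \<in> Q" "t \<ge> 0" "real_unit (- 1) = q \<oplus> complex_of_real t \<odot> x" unfolding N_def by blast
    have "t \<noteq> 0" using qt Q1 xc Qc[OF qt(1)] by auto
    have "complex_of_real (1/t) \<odot> (q \<oplus> real_unit 1) \<in> Q" using qt Qa unit[of 1] by (intro Qt Qa) auto
    moreover have "complex_of_real (1/t) \<odot> (q \<oplus> real_unit 1) = \<ominus> x"
    proof (rule eq_by_functionals)
      fix f assume f: "linear_functional A f"
      have "- f \<one> = f q + t * f x" using arg_cong[OF qt(3), of f] f Qc[OF qt(1)] xc by (simp add: linear_functional_simps)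
      then have "f q = - f \<one> - t * f x" by (simp add: algebra_simps)
      then show "f (complex_of_real (1/t) \<odot> (q \<oplus> real_unit 1)) = f (\<ominus> x)"
        using f Qc[OF qt(1)] xc \<open>t \<noteq> 0\<close> by (simp add: linear_functional_simps)
    qed (use xc Qc[OF qt(1)] in auto)
    ultimately show ?thesis by simp
  qed
  \<comment> \<open>\<open>g x\<close> is the cut of the scalars that lie below \<open>x\<close> in
    the total preorder given by \<open>Q\<close>.\<close>
  define S where "S x = {t. x \<ominus> real_unit t \<in> Q}" for x
  define g where "g x = Sup (S x)" for x
  have S_bd: "- cnorm A x \<in> S x" "t \<in> S x \<Longrightarrow> t \<le> cnorm A x" if x: "x \<in> self_adjoint A" for x t
  proof -
    note xc = self_adjointD[OF x]
    have "positive A (real_unit (cnorm A x) \<ominus> x)" "positive A (real_unit (cnorm A x) \<oplus> x)"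
    proof -
      have "real_unit (cnorm A x) \<ominus> (real_unit (cnorm A x) \<ominus> x) = x"
        "real_unit (cnorm A x) \<ominus> (real_unit (cnorm A x) \<oplus> x) = \<ominus> x"
        by (rule eq_by_functionals; use xc in \<open>auto simp: linear_functional_simps\<close>)+
      then show "positive A (real_unit (cnorm A x) \<ominus> x)" "positive A (real_unit (cnorm A x) \<oplus> x)"
        unfolding positive_def using x xc by (auto intro!: exI[of _ "cnorm A x"])
    qed
    then have Q2: "real_unit (cnorm A x) \<ominus> x \<in> Q" "real_unit (cnorm A x) \<oplus> x \<in> Q" using Qpos by auto
    have "x \<ominus> real_unit (- cnorm A x) = real_unit (cnorm A x) \<oplus> x"
      by (rule eq_by_functionals) (use xc in \<open>auto simp: linear_functional_simps\<close>)
    then show "- cnorm A x \<in> S x" unfolding S_def using Q2 by simp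
    assume "t \<in> S x"
    then have "(x \<ominus> real_unit t) \<oplus> (real_unit (cnorm A x) \<ominus> x) \<in> Q" unfolding S_def using Q2 Qa by blast
    moreover have "(x \<ominus> real_unit t) \<oplus> (real_unit (cnorm A x) \<ominus> x) = real_unit (cnorm A x - t)"
      by (rule eq_by_functionals) (use xc in \<open>auto simp: linear_functional_simps algebra_simps\<close>)
    ultimately have "real_unit (cnorm A x - t) \<in> Q" by simp
    then show "t \<le> cnorm A x" using unit[of "cnorm A x - t"] by (simp only: diff_ge_0_iff_ge)
  qed
  have S_ne: "S x \<noteq> {}" and S_bdd: "bdd_above (S x)" if "x \<in> self_adjoint A" for x
    using S_bd[OF that] by (auto intro!: bdd_aboveI)
  have S_le: "t \<le> g x" if "x \<in> self_adjoint A" "t \<in> S x" for x t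
    unfolding g_def using cSup_upper[OF that(2) S_bdd[OF that(1)]] .
  have g_super: "g x + g y \<le> g (x \<oplus> y)" if xy: "x \<in> self_adjoint A" "y \<in> self_adjoint A" for x y
  proof -
    note c = self_adjointD[OF xy(1)] self_adjointD[OF xy(2)]
    have ST: "s + t \<le> g (x \<oplus> y)" if st: "s \<in> S x" "t \<in> S y" for s t
    proof (rule S_le)
      have "x \<oplus> y \<ominus> real_unit (s + t) = (x \<ominus> real_unit s) \<oplus> (y \<ominus> real_unit t)"
        by (rule eq_by_functionals) (use c in \<open>auto simp: linear_functional_simps algebra_simps\<close>)
      then show "s + t \<in> S (x \<oplus> y)" using st Qa unfolding S_def by simp
    qed (use xy in blast)
    have "s \<le> g (x \<oplus> y) - g y" if "s \<in> S x" for s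
    proof -
      have "g y \<le> g (x \<oplus> y) - s" unfolding g_def[of y]
        by (rule cSup_least[OF S_ne[OF xy(2)]]) (use ST[OF that] in \<open>auto simp: algebra_simps\<close>)
      then show ?thesis by simp
    qed
    then have "g x \<le> g (x \<oplus> y) - g y" unfolding g_def[of x] by (intro cSup_least S_ne xy) auto
    then show ?thesis by simp
  qed
  have g_unit: "g (real_unit t) = t" for t
  proof -
    have "real_unit t \<ominus> real_unit s = real_unit (t - s)" for s
      by (rule eq_by_functionals) (auto simp: linear_functional_simps algebra_simps)
    then have "S (real_unit t) = {..t}" unfolding S_def using unit by (auto simp del: of_real_diff)
    then show ?thesis by (simp add: g_def)
  qed
  \<comment> \<open>Superadditivity gives one inequality; for the other, totality puts
    \<open>t - x\<close> into \<open>Q\<close> as soon as \<open>t > g x\<close>.\<close>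
  have g_neg: "g (\<ominus> x) = - g x" if x: "x \<in> self_adjoint A" for x
  proof -
    note xc = self_adjointD[OF x]
    have "g x + g (\<ominus> x) \<le> g (x \<oplus> \<ominus> x)" using g_super[of x "\<ominus> x"] x by blast
    then have 1: "g x + g (\<ominus> x) \<le> 0" using g_unit[of 0] xc by (simp add: r_neg)
    have "- t \<le> g (\<ominus> x)" if t: "t > g x" for t
    proof (rule S_le)
      have "t \<notin> S x" using S_le[OF x, of t] t by auto
      then have "\<ominus> (x \<ominus> real_unit t) \<in> Q" using total[of "x \<ominus> real_unit t"] x unfolding S_def by blast
      moreover have "\<ominus> (x \<ominus> real_unit t) = \<ominus> x \<ominus> real_unit (- t)"
        by (rule eq_by_functionals) (use xc in \<open>auto simp: linear_functional_simps\<close>)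
      ultimately show "- t \<in> S (\<ominus> x)" unfolding S_def by simp
    qed (use x in blast)
    then have "- g (\<ominus> x) \<le> t" if "t > g x" for t using that[THEN \<open>\<And>t. t > g x \<Longrightarrow> - t \<le> g (\<ominus> x)\<close>] by simp
    then have "- g (\<ominus> x) \<le> g x" by (rule dense_ge)
    then show ?thesis using 1 by simp
  qed
  \<comment> \<open>Superadditivity at \<open>- x\<close> and \<open>- y\<close> is the reverse
    inequality.\<close>
  have g_add: "g (x \<oplus> y) = g x + g y" if xy: "x \<in> self_adjoint A" "y \<in> self_adjoint A" for x y
  proof -
    have "g (\<ominus> x) + g (\<ominus> y) \<le> g (\<ominus> x \<oplus> \<ominus> y)" using g_super[of "\<ominus> x" "\<ominus> y"] xy by blast
    also have "\<ominus> x \<oplus> \<ominus> y = \<ominus> (x \<oplus> y)" using xy by (simp add: self_adjointD minus_add)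
    also have "g (\<ominus> (x \<oplus> y)) = - g (x \<oplus> y)" using xy by (intro g_neg) blast
    finally show ?thesis using g_super[OF xy] g_neg[OF xy(1)] g_neg[OF xy(2)] by simp
  qed
  have g_scale_le: "t * g x \<le> g (complex_of_real t \<odot> x)" if x: "x \<in> self_adjoint A" and t: "t > 0" for x t
  proof -
    note xc = self_adjointD[OF x]
    have "s \<le> g (complex_of_real t \<odot> x) / t" if s: "s \<in> S x" for s
    proof -
      have "complex_of_real t \<odot> x \<ominus> real_unit (t * s) = complex_of_real t \<odot> (x \<ominus> real_unit s)"
        by (rule eq_by_functionals) (use xc in \<open>auto simp: linear_functional_simps algebra_simps\<close>)
      then have "t * s \<in> S (complex_of_real t \<odot> x)" using s t Qt unfolding S_def by simp
      then have "t * s \<le> g (complex_of_real t \<odot> x)" using S_le x by blast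
      then show ?thesis using t by (simp add: field_simps)
    qed
    then have "g x \<le> g (complex_of_real t \<odot> x) / t" unfolding g_def[of x] by (intro cSup_least S_ne x)
    then show ?thesis using t by (simp add: field_simps)
  qed
  have g_scale_pos: "g (complex_of_real t \<odot> x) = t * g x" if x: "x \<in> self_adjoint A" and t: "t > 0" for x t
  proof (rule antisym[OF _ g_scale_le[OF that]])
    have "complex_of_real (1/t) \<odot> (complex_of_real t \<odot> x) = x" using x t by (simp add: smult_smult self_adjointD)
    then have "1/t * g (complex_of_real t \<odot> x) \<le> g x"
      using g_scale_le[of "complex_of_real t \<odot> x" "1/t"] x t by auto
    then show "g (complex_of_real t \<odot> x) \<le> t * g x" using t by (simp add: field_simps)
  qed
  have g_scale: "g (complex_of_real t \<odot> x) = t * g x" if x: "x \<in> self_adjoint A" for x t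
  proof -
    note xc = self_adjointD[OF x]
    consider "t > 0" | "t = 0" | "t < 0" by linarith
    then show ?thesis
    proof cases
      case 2
      then show ?thesis using xc g_unit[of 0] by simp
    next
      case 3
      have "complex_of_real t \<odot> x = \<ominus> (complex_of_real (- t) \<odot> x)" using xc by (simp add: a_inv_eq_smult smult_smult)
      moreover have "g (\<ominus> (complex_of_real (- t) \<odot> x)) = - g (complex_of_real (- t) \<odot> x)" using x by (intro g_neg) blast
      ultimately show ?thesis using g_scale_pos[OF x, of "-t"] 3 by simp
    qed (use g_scale_pos x in auto)
  qed
  have gQ: "g x \<ge> 0" if "x \<in> Q" for x
    by (rule S_le) (use that Qs Qc in \<open>auto simp: S_def minus_eq_smult\<close>)
  define \<phi> where "\<phi> = (\<lambda>x\<in>carrier A. complex_of_real (g (re_part A x)) + \<i> * complex_of_real (g (im_part A x)))"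
  have "\<phi> \<in> states A" unfolding \<phi>_def
    by (rule statesI_real) (use g_add g_scale gQ Qpos g_unit[of 1] in auto)
  moreover have "Re (\<phi> x) \<ge> 0" if "x \<in> C" for x
  proof -
    have "x \<in> Q" "x \<in> self_adjoint A" using that CQ Qs by auto
    then show ?thesis using gQ[of x] by (simp add: \<phi>_def re_part_of_self_adjoint self_adjointD)
  qed
  ultimately show ?thesis using that by blast
qed

lemma linear_functional_state: "\<phi> \<in> states A \<Longrightarrow> linear_functional A \<phi>"
  by (auto simp: states_def linear_functional_def)

lemma state_one: "\<phi> \<in> states A \<Longrightarrow> \<phi> \<one> = 1"
  by (auto simp: states_def)

lemma state_positive:
  assumes \<phi>: "\<phi> \<in> states A" and x: "positive A x" shows "\<phi> x \<in> \<real>\<^sub>\<ge>\<^sub>0"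
proof -
  obtain w where w: "positive A w" "w \<otimes> w = x" using positive_sqrt[OF x] by metis
  then have "adj A w \<otimes> w = x" "w \<in> carrier A" using positiveD[OF w(1)] by auto
  then show ?thesis using \<phi> unfolding states_def by fastforce
qed

lemma state_self_adjoint:
  assumes \<phi>: "\<phi> \<in> states A" and x: "x \<in> self_adjoint A"
  shows "\<phi> x \<in> \<real>" "cmod (\<phi> x) \<le> cnorm A x"
proof -
  note xc = self_adjointD[OF x] and lf = linear_functional_state[OF \<phi>]
  define n where "n = cnorm A x"
  have "positive A (real_unit n \<ominus> x)" "positive A (real_unit n \<oplus> x)"
  proof -
    have "real_unit n \<ominus> (real_unit n \<ominus> x) = x" "real_unit n \<ominus> (real_unit n \<oplus> x) = \<ominus> x"
      by (rule eq_by_functionals; use xc in \<open>auto simp: linear_functional_simps\<close>)+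
    then show "positive A (real_unit n \<ominus> x)" "positive A (real_unit n \<oplus> x)"
      unfolding positive_def using x xc by (auto intro!: exI[of _ n] simp: n_def)
  qed
  from this[THEN state_positive[OF \<phi>]]
  have *: "complex_of_real n - \<phi> x \<in> \<real>\<^sub>\<ge>\<^sub>0" "complex_of_real n + \<phi> x \<in> \<real>\<^sub>\<ge>\<^sub>0"
    using lf xc \<phi> by (auto simp: linear_functional_simps state_one)
  then have "Im (\<phi> x) = 0" "\<bar>Re (\<phi> x)\<bar> \<le> n" by (auto simp: complex_nonneg_Reals_iff)
  then show "\<phi> x \<in> \<real>" "cmod (\<phi> x) \<le> cnorm A x"
    unfolding n_def by (auto simp: complex_is_Real_iff cmod_def)
qed

text \<open>The factor 2 stems from splitting into real and imaginary parts; any multiple of the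
  norm confines the states to a product of discs.\<close>

lemma state_bound:
  assumes \<phi>: "\<phi> \<in> states A" and x: "x \<in> carrier A" shows "cmod (\<phi> x) \<le> 2 * cnorm A x"
proof -
  note lf = linear_functional_state[OF \<phi>]
  have "\<phi> x = \<phi> (re_part A x) + \<i> * \<phi> (im_part A x)"
    using arg_cong[OF re_im_decomposition[OF x], of \<phi>] lf x by (simp add: linear_functional_simps)
  then have "cmod (\<phi> x) \<le> cmod (\<phi> (re_part A x)) + cmod (\<phi> (im_part A x))"
    by (metis norm_triangle_ineq norm_mult norm_ii mult_1)
  also have "\<dots> \<le> cnorm A x + cnorm A x"
    using state_self_adjoint(2)[OF \<phi>] cnorm_part_le[OF x] x by (meson add_mono im_part_self_adjoint order_trans re_part_self_adjoint)
  finally show ?thesis by simp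
qed

text \<open>Apply \<open>state_on_cone\<close> to the cone spanned by the positive elements and
  \<open>b - u\<close>: if it contained \<open>-1\<close>, then \<open>u - b\<close> would be
  positive. By \<open>order_bound_cnorm\<close> this fails for \<open>b = a\<close> or for
  \<open>b = - a\<close> when \<open>u < norm a\<close>.\<close>

lemma state_almost_attains_norm:
  assumes a: "a \<in> self_adjoint A" and u: "u < cnorm A a"
  obtains \<phi> where "\<phi> \<in> states A" "cmod (\<phi> a) \<ge> u"
proof -
  note ac = self_adjointD[OF a]
  have key: "\<exists>\<phi>\<in>states A. Re (\<phi> b) \<ge> u" if b: "b \<in> self_adjoint A" "\<not> positive A (real_unit u \<ominus> b)" for b
  proof -
    note bc = self_adjointD[OF b(1)]
    define C where "C = {p \<oplus> complex_of_real t \<odot> (b \<ominus> real_unit u) | p t. positive A p \<and> t \<ge> 0}"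
    have Cin: "p \<in> C" if "positive A p" for p
      unfolding C_def using that positiveD[OF that] bc by (intro CollectI exI[of _ p] exI[of _ 0]) auto
    obtain \<phi> where \<phi>: "\<phi> \<in> states A" "\<And>x. x \<in> C \<Longrightarrow> Re (\<phi> x) \<ge> 0"
    proof (rule state_on_cone[of C])
      show "C \<subseteq> self_adjoint A" unfolding C_def using b(1) positiveD(1) by auto
      show "\<And>x. positive A x \<Longrightarrow> x \<in> C" by (rule Cin)
    next
      fix x y assume "x \<in> C" "y \<in> C"
      then obtain p s q t where *: "positive A p" "positive A q" "s \<ge> 0" "t \<ge> 0"
        "x = p \<oplus> complex_of_real s \<odot> (b \<ominus> real_unit u)" "y = q \<oplus> complex_of_real t \<odot> (b \<ominus> real_unit u)"
        unfolding C_def by blast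
      have "x \<oplus> y = (p \<oplus> q) \<oplus> complex_of_real (s + t) \<odot> (b \<ominus> real_unit u)" unfolding *(5,6)
        using bc positiveD[OF *(1)] positiveD[OF *(2)] by (simp add: smult_add_left a_ac)
      then show "x \<oplus> y \<in> C" unfolding C_def using positive_add[OF *(1,2)] *(3,4)
        by (intro CollectI exI[of _ "p \<oplus> q"] exI[of _ "s + t"]) auto
    next
      fix x :: 'a and t :: real assume "x \<in> C" and t: "t \<ge> 0"
      then obtain p s where *: "positive A p" "s \<ge> 0" "x = p \<oplus> complex_of_real s \<odot> (b \<ominus> real_unit u)"
        unfolding C_def by blast
      have "complex_of_real t \<odot> x = complex_of_real t \<odot> p \<oplus> complex_of_real (t * s) \<odot> (b \<ominus> real_unit u)"
        unfolding *(3) using bc positiveD[OF *(1)] by (simp add: smult_add_right smult_smult)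
      then show "complex_of_real t \<odot> x \<in> C" unfolding C_def using positive_smult[OF *(1) t] *(2) t
        by (intro CollectI exI[of _ "complex_of_real t \<odot> p"] exI[of _ "t * s"]) auto
    next
      show "real_unit (- 1) \<notin> C"
      proof
        assume "real_unit (- 1) \<in> C"
        then obtain p t where *: "positive A p" "t \<ge> 0" "real_unit (- 1) = p \<oplus> complex_of_real t \<odot> (b \<ominus> real_unit u)"
          unfolding C_def by blast
        note pc = positiveD[OF *(1)]
        show False
        proof (cases "t = 0")
          case True
          then have "positive A (real_unit (-1))" using * bc pc by simp
          then show False using positive_real_unit_iff[of "-1"] by simp
        next
          case False
          have "positive A (complex_of_real (1/t) \<odot> (p \<oplus> real_unit 1))"
            using * positive_square[of \<one>] by (intro positive_smult positive_add) auto
          moreover have "complex_of_real (1/t) \<odot> (p \<oplus> real_unit 1) = real_unit u \<ominus> b"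
          proof (rule eq_by_functionals)
            fix f assume f: "linear_functional A f"
            have "- f \<one> = f p + t * (f b - u * f \<one>)" using arg_cong[OF *(3), of f] f pc bc by (simp add: linear_functional_simps)
            then have "f p = - f \<one> - t * (f b - u * f \<one>)" by (simp add: algebra_simps)
            then show "f (complex_of_real (1/t) \<odot> (p \<oplus> real_unit 1)) = f (real_unit u \<ominus> b)"
              using f pc bc False by (simp add: linear_functional_simps)
          qed (use pc bc in auto)
          ultimately show False using b(2) by simp
        qed
      qed
    qed blast
    have "\<zero> \<oplus> complex_of_real 1 \<odot> (b \<ominus> real_unit u) \<in> C" unfolding C_def
      using positive_square[of \<zero>] by (intro CollectI exI[of _ \<zero>] exI[of _ 1]) auto
    then have "b \<ominus> real_unit u \<in> C" using bc by simp
    from \<phi>(2)[OF this] show ?thesis using \<phi>(1) linear_functional_state[OF \<phi>(1)] bc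
      by (intro bexI[of _ \<phi>]) (auto simp: linear_functional_simps state_one)
  qed
  have "\<not> positive A (real_unit u \<ominus> a) \<or> \<not> positive A (real_unit u \<oplus> a)"
    using order_bound_cnorm[OF a] u by force
  then show ?thesis
  proof
    assume "\<not> positive A (real_unit u \<ominus> a)"
    then obtain \<phi> where "\<phi> \<in> states A" "Re (\<phi> a) \<ge> u" using key a by blast
    then show ?thesis using that complex_Re_le_cmod order_trans by blast
  next
    assume "\<not> positive A (real_unit u \<oplus> a)"
    then obtain \<phi> where \<phi>: "\<phi> \<in> states A" "Re (\<phi> (\<ominus> a)) \<ge> u" using key[of "\<ominus> a"] a ac by (auto simp: a_minus_def)
    then have "cmod (- \<phi> a) \<ge> u" using complex_Re_le_cmod[of "- \<phi> a"] linear_functional_state[OF \<phi>(1)] ac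
      by (simp add: linear_functional_simps)
    then show ?thesis using that \<phi> by simp
  qed
qed

end

section \<open>Star homomorphisms\<close>

locale star_homomorphism =
  A: unital_cstar_algebra A + B: unital_cstar_algebra B
  for A :: "'a cstar" and B :: "'b cstar" +
  fixes h :: "'a \<Rightarrow> 'b"
  assumes star_hom: "h \<in> star_hom A B"
begin

lemma hom_closed [simp, intro]: "a \<in> carrier A \<Longrightarrow> h a \<in> carrier B"
  and hom_add: "\<lbrakk>a \<in> carrier A; b \<in> carrier A\<rbrakk> \<Longrightarrow> h (a \<oplus>\<^bsub>A\<^esub> b) = h a \<oplus>\<^bsub>B\<^esub> h b"
  and hom_mult: "\<lbrakk>a \<in> carrier A; b \<in> carrier A\<rbrakk> \<Longrightarrow> h (a \<otimes>\<^bsub>A\<^esub> b) = h a \<otimes>\<^bsub>B\<^esub> h b"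
  and hom_one: "h \<one>\<^bsub>A\<^esub> = \<one>\<^bsub>B\<^esub>"
  and hom_smult: "a \<in> carrier A \<Longrightarrow> h (c \<odot>\<^bsub>A\<^esub> a) = c \<odot>\<^bsub>B\<^esub> h a"
  and hom_adj: "a \<in> carrier A \<Longrightarrow> h (adj A a) = adj B (h a)"
  using star_hom by (auto simp: star_hom_def ring_hom_def)

lemma hom_minus: "\<lbrakk>a \<in> carrier A; b \<in> carrier A\<rbrakk> \<Longrightarrow> h (a \<ominus>\<^bsub>A\<^esub> b) = h a \<ominus>\<^bsub>B\<^esub> h b"
  by (simp add: A.minus_eq_smult B.minus_eq_smult hom_add hom_smult)

lemma hom_re_part: "a \<in> carrier A \<Longrightarrow> h (re_part A a) = re_part B (h a)"
  and hom_im_part: "a \<in> carrier A \<Longrightarrow> h (im_part A a) = im_part B (h a)"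
  by (simp_all add: re_part_def im_part_def hom_smult hom_add hom_minus hom_adj)

lemma hom_self_adjoint: "a \<in> self_adjoint A \<Longrightarrow> h a \<in> self_adjoint B"
  by (auto simp: self_adjoint_def simp flip: hom_adj)

lemma state_pullback:
  assumes "\<phi> \<in> states B" shows "compose (carrier A) \<phi> h \<in> states A"
  using assms unfolding states_def
  by (auto simp: compose_def hom_add hom_smult hom_mult hom_adj hom_one)

text \<open>For self-adjoint elements, states of \<open>B\<close> compute the norm of the image and
  pull back to states of \<open>A\<close>; the C*-identity reduces the general case to
  \<open>a* a\<close>.\<close>

lemma hom_contractive:
  assumes a: "a \<in> carrier A" shows "cnorm B (h a) \<le> cnorm A a"
proof -
  have sa: "cnorm B (h x) \<le> cnorm A x" if x: "x \<in> self_adjoint A" for x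
  proof (rule dense_le)
    fix u assume "u < cnorm B (h x)"
    then obtain \<phi> where \<phi>: "\<phi> \<in> states B" "cmod (\<phi> (h x)) \<ge> u"
      using B.state_almost_attains_norm[OF hom_self_adjoint[OF x]] by blast
    then show "u \<le> cnorm A x"
      using A.state_self_adjoint(2)[OF state_pullback[OF \<phi>(1)] x] x A.self_adjointD(1)[OF x]
      by (simp add: compose_def)
  qed
  have "(cnorm B (h a))\<^sup>2 = cnorm B (h (adj A a \<otimes>\<^bsub>A\<^esub> a))"
    using B.cstar_identity[of "h a"] a by (simp add: hom_mult hom_adj)
  also have "\<dots> \<le> cnorm A (adj A a \<otimes>\<^bsub>A\<^esub> a)"
    by (rule sa) (use A.positive_adj_mult[OF a] A.positiveD in blast)
  also have "\<dots> = (cnorm A a)\<^sup>2" using A.cstar_identity[OF a] .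
  finally show ?thesis using A.cnorm_nonneg[OF a] by (rule power2_le_imp_le)
qed

end

section \<open>Quantum compact metric spaces\<close>

context unital_cstar_algebra
begin

text \<open>The argument of Banach and Alaoglu: the states form a closed subset of a product of
  compact discs.\<close>

lemma compact_space_weak_star: "compact_space (weak_star_topology A)"
proof -
  define P where "P = product_topology (\<lambda>_::'a. euclidean :: complex topology) (carrier A)"
  define S where "S = (PiE (carrier A) (\<lambda>a. cball (0::complex) (2 * cnorm A a)))"
  have co: "continuous_map P euclidean (\<lambda>\<phi>. \<phi> a)" if "a \<in> carrier A" for a
    unfolding P_def using continuous_map_product_coordinates[OF that, of "\<lambda>_. euclidean"] by simp
  have sub: "states A \<subseteq> S"
  proof
    fix \<phi> assume \<phi>: "\<phi> \<in> states A"
    then show "\<phi> \<in> S" unfolding S_def using state_bound[OF \<phi>] by (auto simp: PiE_def states_def)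
  qed
  have top: "topspace P = extensional (carrier A)" by (auto simp: P_def PiE_def)
  have "compactin P S" unfolding P_def S_def by (simp add: compactin_PiE)
  moreover have "closedin P (states A)"
  proof -
    have 1: "closedin P {\<phi> \<in> topspace P. \<phi> (a \<oplus> b) = \<phi> a + \<phi> b}" if "a \<in> carrier A" "b \<in> carrier A" for a b
    proof (rule closedin_continuous_maps_eq)
      show "continuous_map P euclidean (\<lambda>\<phi>. \<phi> (a \<oplus> b))" by (rule co) (use that in simp)
      show "continuous_map P euclidean (\<lambda>\<phi>. \<phi> a + \<phi> b)"
        by (rule continuous_map_add[OF co[OF that(1)] co[OF that(2)]])
    qed (rule Hausdorff_space_euclidean)
    have 2: "closedin P {\<phi> \<in> topspace P. \<phi> (c \<odot> a) = c * \<phi> a}" if "a \<in> carrier A" for a c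
    proof (rule closedin_continuous_maps_eq)
      show "continuous_map P euclidean (\<lambda>\<phi>. \<phi> (c \<odot> a))" by (rule co) (use that in simp)
      have "continuous_map euclidean euclidean (\<lambda>z::complex. c * z)"
        unfolding continuous_map_iff_continuous2 by (intro continuous_intros)
      from continuous_map_compose[OF co[OF that] this]
      show "continuous_map P euclidean (\<lambda>\<phi>. c * \<phi> a)" unfolding o_def .
    qed (rule Hausdorff_space_euclidean)
    have 3: "closedin P {\<phi> \<in> topspace P. \<phi> (adj A a \<otimes> a) \<in> \<real>\<^sub>\<ge>\<^sub>0}" if "a \<in> carrier A" for a
      by (rule closedin_continuous_map_preimage[OF co]) (use that closed_nonneg_Reals_complex in simp_all)
    have 4: "closedin P {\<phi> \<in> topspace P. \<phi> \<one> = 1}"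
      using closedin_continuous_map_preimage[OF co[of \<one>], of "{1}"] by simp
    let ?C = "carrier A"
    have "states A = (\<Inter>a\<in>?C. \<Inter>b\<in>?C. {\<phi> \<in> topspace P. \<phi> (a \<oplus> b) = \<phi> a + \<phi> b}) \<inter>
       (\<Inter>a\<in>?C. \<Inter>c. {\<phi> \<in> topspace P. \<phi> (c \<odot> a) = c * \<phi> a}) \<inter>
       (\<Inter>a\<in>?C. {\<phi> \<in> topspace P. \<phi> (adj A a \<otimes> a) \<in> \<real>\<^sub>\<ge>\<^sub>0}) \<inter> {\<phi> \<in> topspace P. \<phi> \<one> = 1}"
      unfolding states_def top by blast
    moreover have "?C \<noteq> {}" by blast
    ultimately show ?thesis by (simp only:) (intro closedin_Int closedin_INT 1 2 3 4 UNIV_not_empty; assumption)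
  qed
  ultimately have "compactin P (states A)" using sub closed_compactin by blast
  then show ?thesis unfolding weak_star_topology_def P_def[symmetric] by (simp add: compact_space_subtopology)
qed

lemma topspace_weak_star: "topspace (weak_star_topology A) = states A"
  unfolding weak_star_topology_def by (auto simp: states_def PiE_def)

end

section \<open>Lipschitz seminorms and norming states\<close>

locale quantum_metric =
  fixes F :: "ennreal \<Rightarrow> ennreal \<Rightarrow> ennreal \<Rightarrow> ennreal \<Rightarrow> ennreal"
    and A :: "'a cstar" (structure) and L :: "'a \<Rightarrow> ennreal"
  assumes qcms: "qcms F A L"
begin

sublocale unital_cstar_algebra A
  using qcms by (simp add: qcms_def)

lemma in_lip_dom: "\<lbrakk>a \<in> self_adjoint A; L a \<le> ennreal l\<rbrakk> \<Longrightarrow> a \<in> lip_dom A L"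
  using order_le_less_trans[of "L a" "ennreal l" \<infinity>] by (simp add: lip_dom_def)

lemma lip_real_unit: "L (real_unit t) = 0" "real_unit t \<in> lip_dom A L"
proof -
  have "{a \<in> lip_dom A L. L a = 0} = {complex_of_real t \<odot> \<one> | t. True}" using qcms by (simp add: qcms_def)
  then show "L (real_unit t) = 0" "real_unit t \<in> lip_dom A L" by blast+
qed

lemma lip_zero: "L \<zero> = 0"
  using lip_real_unit(1)[of 0] by simp

lemma lip_add:
  assumes "a \<in> self_adjoint A" "b \<in> self_adjoint A" "L a \<le> ennreal l" "L b \<le> ennreal m" "0 \<le> l" "0 \<le> m"
  shows "L (a \<oplus> b) \<le> ennreal (l + m)"
proof -
  have "L (a \<oplus> b) \<le> L a + L b" using qcms in_lip_dom assms by (simp add: qcms_def seminorm_on_dom_def)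
  also have "\<dots> \<le> ennreal l + ennreal m" using assms by (intro add_mono)
  finally show ?thesis using assms by (simp add: ennreal_plus)
qed

lemma lip_smult:
  assumes "a \<in> self_adjoint A" "L a \<le> ennreal l" "0 \<le> l"
  shows "L (complex_of_real t \<odot> a) \<le> ennreal (\<bar>t\<bar> * l)"
proof -
  have "L (complex_of_real t \<odot> a) = ennreal \<bar>t\<bar> * L a" using qcms in_lip_dom assms by (simp add: qcms_def seminorm_on_dom_def)
  also have "\<dots> \<le> ennreal \<bar>t\<bar> * ennreal l" using assms by (intro mult_left_mono) auto
  finally show ?thesis using assms by (simp add: ennreal_mult)
qed

lemma lip_minus:
  assumes "a \<in> self_adjoint A" "b \<in> self_adjoint A" "L a \<le> ennreal l" "L b \<le> ennreal m" "0 \<le> l" "0 \<le> m"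
  shows "L (a \<ominus> b) \<le> ennreal (l + m)"
  using lip_add[OF assms(1) self_adjoint_simps(5)[OF assms(2), of "-1"] assms(3) lip_smult[OF assms(2,4,6), of "-1"] assms(5)] assms
  by (simp add: minus_eq_smult self_adjointD del: ennreal_plus)

lemma lip_dense:
  assumes a: "a \<in> self_adjoint A" and e: "e > 0"
  obtains b where "b \<in> lip_dom A L" "cnorm A (a \<ominus> b) < e"
proof -
  interpret M: Metric_space "carrier A" "norm_dist A" by (rule norm_metric)
  have "a \<in> M.mtopology closure_of lip_dom A L" using qcms a by (auto simp: qcms_def norm_topology_def)
  then obtain b where b: "b \<in> lip_dom A L" "b \<in> M.mball a e" unfolding M.metric_closure_of using e by blast
  then show ?thesis using that a by (metis M.in_mball norm_dist_eq)
qed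

lemma lip_lower_semicontinuous:
  assumes F: "F' \<noteq> bot" and s: "\<And>i. s i \<in> self_adjoint A" and x: "x \<in> carrier A"
    and near: "near F' (\<lambda>_. A) s (\<lambda>_. x)" and L: "\<forall>\<^sub>F i in F'. L (s i) \<le> c"
  shows "L x \<le> c"
proof (rule ccontr)
  assume "\<not> L x \<le> c"
  then have c: "c < L x" by simp
  interpret M: Metric_space "carrier A" "norm_dist A" by (rule norm_metric)
  have xs: "x \<in> self_adjoint A" using near_self_adjoint[OF F s x near] .
  let ?T = "subtopology M.mtopology (self_adjoint A)"
  have ts: "topspace ?T = self_adjoint A" by (auto simp: self_adjointD)
  have "openin ?T {y \<in> topspace ?T. c < L y}"
    using qcms by (simp add: qcms_def lower_semicontinuous_def norm_topology_def)
  then obtain U where U: "openin M.mtopology U" "{y \<in> self_adjoint A. c < L y} = U \<inter> self_adjoint A"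
    unfolding openin_subtopology ts by blast
  then have "x \<in> U" using xs c by blast
  then obtain r where r: "r > 0" "M.mball x r \<subseteq> U" using U(1) unfolding M.openin_mtopology by blast
  have "\<forall>\<^sub>F i in F'. cnorm A (s i \<ominus> x) < r" using near r(1) unfolding near_def by (rule order_tendstoD(2))
  then have "\<forall>\<^sub>F i in F'. False" using L
  proof eventually_elim
    case (elim i)
    have "s i \<in> M.mball x r" using elim x self_adjointD(1)[OF s[of i]]
      by (simp add: norm_dist_eq cnorm_minus_commute[of x "s i"])
    then have "c < L (s i)" using r U s by blast
    then show False using elim by simp
  qed
  then show False using F by simp
qed

lemma mk_dist_bound:
  assumes a: "a \<in> self_adjoint A" "L a \<le> ennreal l" "l > 0"
    and \<phi>: "\<phi> \<in> states A" "\<psi> \<in> states A" and mk: "mk_dist A L \<phi> \<psi> \<le> ennreal e" and e: "e \<ge> 0"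
  shows "cmod (\<phi> a - \<psi> a) \<le> l * e"
proof -
  define b where "b = complex_of_real (1/l) \<odot> a"
  have b: "b \<in> self_adjoint A" unfolding b_def using a by blast
  have Lb: "L b \<le> 1" using lip_smult[OF a(1,2), of "1/l"] a(3) by (simp add: b_def)
  then have "b \<in> {a \<in> lip_dom A L. L a \<le> 1}" using b by (auto intro: in_lip_dom[of _ 1])
  then have "ennreal (cmod (\<phi> b - \<psi> b)) \<le> mk_dist A L \<phi> \<psi>" unfolding mk_dist_def by (rule SUP_upper)
  then have "ennreal (cmod (\<phi> b - \<psi> b)) \<le> ennreal e" using mk by (rule order_trans)
  then have "cmod (\<phi> b - \<psi> b) \<le> e" using e by simp
  moreover have "\<phi> b - \<psi> b = complex_of_real (1/l) * (\<phi> a - \<psi> a)" unfolding b_def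
    using linear_functional_state[OF \<phi>(1)] linear_functional_state[OF \<phi>(2)] a
    by (simp add: linear_functional_simps self_adjointD algebra_simps)
  ultimately show ?thesis using a(3) by (simp add: norm_mult norm_divide field_simps)
qed

text \<open>The Monge-Kantorovich metric induces the compact weak* topology, so finitely many states
  form an \<open>e\<close>-net; replacing a state by a neighbour changes its value at an
  \<open>l\<close>-Lipschitz element by at most \<open>l * e\<close>. The finite set
  \<open>\<Phi>\<close> reduces norm estimates on Lipschitz balls to finitely many numbers.\<close>

lemma finite_norming_states:
  assumes l: "l > 0" and \<eta>: "\<eta> > 0"
  obtains \<Phi> where "finite \<Phi>" "\<Phi> \<subseteq> states A"
    "\<And>a. \<lbrakk>a \<in> self_adjoint A; L a \<le> ennreal l\<rbrakk> \<Longrightarrow> \<exists>\<phi>\<in>\<Phi>. cnorm A a \<le> cmod (\<phi> a) + \<eta>"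
proof -
  \<comment> \<open>Half of \<open>\<eta>\<close> pays for a state that almost attains the norm,
    half for moving it into \<open>\<Phi>\<close>.\<close>
  define e where "e = \<eta> / (2 * l)"
  have e: "e > 0" using l \<eta> by (simp add: e_def)
  let ?d = "\<lambda>x y. enn2real (mk_dist A L x y)"
  have met: "Metric_space (states A) ?d" "Metric_space.mtopology (states A) ?d = weak_star_topology A"
    "\<And>x y. x \<in> states A \<Longrightarrow> y \<in> states A \<Longrightarrow> mk_dist A L x y < \<infinity>"
    using qcms by (auto simp: qcms_def metrizes_def topspace_weak_star)
  interpret M: Metric_space "states A" ?d by (rule met(1))
  have "compact_space M.mtopology" using compact_space_weak_star met(2) by simp
  then have "M.mtotally_bounded (states A)" using M.compact_space_eq_mcomplete_mtotally_bounded by blast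
  then obtain \<Phi> where \<Phi>: "finite \<Phi>" "\<Phi> \<subseteq> states A" "states A \<subseteq> (\<Union>x\<in>\<Phi>. M.mball x e)"
    unfolding M.mtotally_bounded_def using e by meson
  show ?thesis
  proof (rule that[OF \<Phi>(1,2)])
    fix a assume a: "a \<in> self_adjoint A" "L a \<le> ennreal l"
    obtain \<phi> where \<phi>: "\<phi> \<in> states A" "cmod (\<phi> a) \<ge> cnorm A a - \<eta>/2"
      using state_almost_attains_norm[OF a(1), of "cnorm A a - \<eta>/2"] \<eta> by auto
    then obtain \<psi> where \<psi>: "\<psi> \<in> \<Phi>" "\<phi> \<in> M.mball \<psi> e" using \<Phi>(3) by blast
    then have "?d \<phi> \<psi> < e" using M.commute[of \<phi> \<psi>] \<Phi> by (auto simp: M.in_mball)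
    moreover have "mk_dist A L \<phi> \<psi> < \<infinity>" using met(3) \<phi>(1) \<psi>(1) \<Phi>(2) by blast
    ultimately have "mk_dist A L \<phi> \<psi> \<le> ennreal e"
      by (metis ennreal_enn2real ennreal_leI less_imp_le infinity_ennreal_def)
    then have "cmod (\<phi> a - \<psi> a) \<le> l * e" using mk_dist_bound[OF a l \<phi>(1)] \<psi>(1) \<Phi>(2) e by (meson less_imp_le subsetD)
    moreover have "l * e = \<eta>/2" using l by (simp add: e_def)
    ultimately have "cnorm A a \<le> cmod (\<psi> a) + \<eta>" using \<phi>(2) norm_triangle_sub[of "\<phi> a" "\<psi> a"] by simp
    then show "\<exists>\<phi>\<in>\<Phi>. cnorm A a \<le> cmod (\<phi> a) + \<eta>" using \<psi>(1) by blast
  qed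
qed

text \<open>Multiplying by \<open>t\<close> brings norms and seminorms below a point where
  \<open>F\<close> is finite; both products are homogeneous of degree two, whence the division by
  \<open>t^2\<close>.\<close>

lemma leibniz_scaled:
  assumes pq: "p \<in> self_adjoint A" "q \<in> self_adjoint A" "L p \<le> ennreal l" "L q \<le> ennreal l"
      "cnorm A p \<le> l" "cnorm A q \<le> l"
    and F: "admissible F" "F x y lx ly \<le> ennreal m" "0 \<le> m"
    and t: "t > 0" "ennreal (t * l) \<le> x" "ennreal (t * l) \<le> y" "ennreal (t * l) \<le> lx" "ennreal (t * l) \<le> ly"
  shows "jordan_prod A p q \<in> self_adjoint A" "L (jordan_prod A p q) \<le> ennreal (m / t\<^sup>2)"
    "lie_prod A p q \<in> self_adjoint A" "L (lie_prod A p q) \<le> ennreal (m / t\<^sup>2)"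
proof -
  note c = self_adjointD[OF pq(1)] self_adjointD[OF pq(2)]
  have l: "l \<ge> 0" using cnorm_nonneg[OF c(1)] pq(5) by simp
  have jl: "jordan_lie_subalgebra A (lip_dom A L)" using qcms by (simp add: qcms_def)
  define tp where "tp = complex_of_real t \<odot> p"
  define tq where "tq = complex_of_real t \<odot> q"
  have L: "L tp \<le> ennreal (t * l)" "L tq \<le> ennreal (t * l)" unfolding tp_def tq_def
    using lip_smult[OF pq(1,3) l, of t] lip_smult[OF pq(2,4) l, of t] t by auto
  have N: "ennreal (cnorm A tp) \<le> ennreal (t * l)" "ennreal (cnorm A tq) \<le> ennreal (t * l)"
    unfolding tp_def tq_def using c t pq by (auto simp: cnorm_smult intro!: ennreal_leI)
  have s: "tp \<in> self_adjoint A" "tq \<in> self_adjoint A" unfolding tp_def tq_def using pq by auto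
  have dom: "tp \<in> lip_dom A L" "tq \<in> lip_dom A L" using s L in_lip_dom by auto
  have "max (L (jordan_prod A tp tq)) (L (lie_prod A tp tq)) \<le> F (ennreal (cnorm A tp)) (ennreal (cnorm A tq)) (L tp) (L tq)"
    using qcms dom by (simp add: qcms_def)
  also have "\<dots> \<le> F x y lx ly"
    using F(1) N L t unfolding admissible_def by (meson order_trans)
  also have "\<dots> \<le> ennreal m" by fact
  finally have Lt: "L (jordan_prod A tp tq) \<le> ennreal m" "L (lie_prod A tp tq) \<le> ennreal m" by auto
  have sa: "jordan_prod A tp tq \<in> self_adjoint A" "lie_prod A tp tq \<in> self_adjoint A"
    using jl dom unfolding jordan_lie_subalgebra_def lip_dom_def by blast+
  have eq: "jordan_prod A p q = complex_of_real (1/t\<^sup>2) \<odot> jordan_prod A tp tq"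
    "lie_prod A p q = complex_of_real (1/t\<^sup>2) \<odot> lie_prod A tp tq"
    unfolding jordan_prod_def lie_prod_def tp_def tq_def
    by (rule eq_by_functionals; use c t in \<open>auto simp: linear_functional_simps expand_simps field_simps power2_eq_square\<close>)+
  show "jordan_prod A p q \<in> self_adjoint A" "lie_prod A p q \<in> self_adjoint A" unfolding eq using sa by blast+
  show "L (jordan_prod A p q) \<le> ennreal (m / t\<^sup>2)" "L (lie_prod A p q) \<le> ennreal (m / t\<^sup>2)"
    unfolding eq using lip_smult[OF sa(1) Lt(1) F(3), of "1/t\<^sup>2"] lip_smult[OF sa(2) Lt(2) F(3), of "1/t\<^sup>2"] by auto
qed

end

section \<open>Lipschitz bounds for complex elements\<close>

text \<open>\<open>L\<close> lives on self-adjoint elements, but the limit of the automorphisms is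
  taken on all elements; so both parts are controlled. The norm is included because the Leibniz
  inequality for products involves it.\<close>

definition lip_bounded :: "'a cstar \<Rightarrow> ('a \<Rightarrow> ennreal) \<Rightarrow> real \<Rightarrow> 'a \<Rightarrow> bool" where
  "lip_bounded A L l d \<longleftrightarrow> d \<in> carrier A \<and> L (re_part A d) \<le> ennreal l \<and> L (im_part A d) \<le> ennreal l \<and>
     cnorm A d \<le> l"

context quantum_metric
begin

lemma lip_boundedD:
  assumes "lip_bounded A L l d"
  shows "d \<in> carrier A" "cnorm A d \<le> l" "0 \<le> l"
    "L (re_part A d) \<le> ennreal l" "L (im_part A d) \<le> ennreal l"
    "cnorm A (re_part A d) \<le> l" "cnorm A (im_part A d) \<le> l"
  using assms cnorm_nonneg[of d] cnorm_part_le[of d] by (auto simp: lip_bounded_def)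

lemma lip_bounded_self_adjoint:
  assumes "a \<in> self_adjoint A" "L a \<le> ennreal l" "cnorm A a \<le> l"
  shows "lip_bounded A L l a"
  using assms by (simp add: lip_bounded_def self_adjointD re_part_of_self_adjoint im_part_of_self_adjoint lip_zero)

lemma lip_bounded_mono: "lip_bounded A L l d \<Longrightarrow> l \<le> m \<Longrightarrow> lip_bounded A L m d"
  unfolding lip_bounded_def by (meson ennreal_leI order_trans)

lemma lip_boundedI:
  assumes "p \<in> self_adjoint A" "q \<in> self_adjoint A" "L p \<le> ennreal l" "L q \<le> ennreal l"
    "d = p \<oplus> \<i> \<odot> q" "cnorm A d \<le> l"
  shows "lip_bounded A L l d"
  using assms parts_of_sum[of p q] by (auto simp: lip_bounded_def self_adjointD)

lemma lip_bounded_add: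
  assumes "lip_bounded A L l c" "lip_bounded A L m d"
  shows "lip_bounded A L (l + m) (c \<oplus> d)"
proof (rule lip_boundedI)
  note c = lip_boundedD[OF assms(1)] and d = lip_boundedD[OF assms(2)]
  show "L (re_part A c \<oplus> re_part A d) \<le> ennreal (l + m)" "L (im_part A c \<oplus> im_part A d) \<le> ennreal (l + m)"
    using c d by (auto intro!: lip_add simp del: ennreal_plus)
  show "cnorm A (c \<oplus> d) \<le> l + m" using cnorm_triangle[of c d] c d by simp
  show "c \<oplus> d = re_part A c \<oplus> re_part A d \<oplus> \<i> \<odot> (im_part A c \<oplus> im_part A d)"
    using c d unfolding re_part_def im_part_def
    by (intro eq_by_functionals) (auto simp: linear_functional_simps field_simps)
qed (use lip_boundedD[OF assms(1)] lip_boundedD[OF assms(2)] in auto)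

text \<open>The parts of \<open>c d\<close> mix those of \<open>d\<close> with coefficients
  \<open>Re c\<close> and \<open>Im c\<close>, whose absolute values sum to at most
  \<open>2 * cmod c\<close>. This explains the lopsided \<open>l + 2 * m\<close> in
  \<open>lip_bounded_minus\<close>.\<close>

lemma lip_bounded_smult:
  assumes "lip_bounded A L l d"
  shows "lip_bounded A L (2 * cmod c * l) (c \<odot> d)"
proof (rule lip_boundedI)
  note d = lip_boundedD[OF assms]
  have re: "re_part A d \<in> self_adjoint A" and im: "im_part A d \<in> self_adjoint A" using d by auto
  have b: "\<bar>Re c\<bar> * l + \<bar>Im c\<bar> * l \<le> 2 * cmod c * l" "\<bar>Im c\<bar> * l + \<bar>Re c\<bar> * l \<le> 2 * cmod c * l"
    using abs_Re_le_cmod[of c] abs_Im_le_cmod[of c] d(3) by (auto simp flip: distrib_right intro!: mult_right_mono)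
  show "L (complex_of_real (Re c) \<odot> re_part A d \<ominus> complex_of_real (Im c) \<odot> im_part A d) \<le> ennreal (2 * cmod c * l)"
    by (rule order_trans[OF lip_minus[OF _ _ lip_smult[OF re d(4,3)] lip_smult[OF im d(5,3)]]])
      (use re im d(3) b(1) in \<open>auto intro!: ennreal_leI simp del: ennreal_plus\<close>)
  show "L (complex_of_real (Im c) \<odot> re_part A d \<oplus> complex_of_real (Re c) \<odot> im_part A d) \<le> ennreal (2 * cmod c * l)"
    by (rule order_trans[OF lip_add[OF _ _ lip_smult[OF re d(4,3)] lip_smult[OF im d(5,3)]]])
      (use re im d(3) b(2) in \<open>auto intro!: ennreal_leI simp del: ennreal_plus\<close>)
  have "cnorm A (c \<odot> d) \<le> cmod c * l" using d by (simp add: cnorm_smult mult_left_mono)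
  also have "\<dots> \<le> 2 * cmod c * l" using d by simp
  finally show "cnorm A (c \<odot> d) \<le> 2 * cmod c * l" .
  have "c \<odot> d = (complex_of_real (Re c) + \<i> * complex_of_real (Im c)) \<odot> (re_part A d \<oplus> \<i> \<odot> im_part A d)"
    using re_im_decomposition[OF d(1)] by (simp flip: complex_eq)
  also have "\<dots> = complex_of_real (Re c) \<odot> re_part A d \<ominus> complex_of_real (Im c) \<odot> im_part A d \<oplus>
    \<i> \<odot> (complex_of_real (Im c) \<odot> re_part A d \<oplus> complex_of_real (Re c) \<odot> im_part A d)"
    by (rule eq_by_functionals) (use d in \<open>auto simp: linear_functional_simps algebra_simps\<close>)
  finally show "c \<odot> d = complex_of_real (Re c) \<odot> re_part A d \<ominus> complex_of_real (Im c) \<odot> im_part A d \<oplus>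
    \<i> \<odot> (complex_of_real (Im c) \<odot> re_part A d \<oplus> complex_of_real (Re c) \<odot> im_part A d)" .
qed (use lip_boundedD[OF assms] in auto)

lemma lip_bounded_minus:
  assumes "lip_bounded A L l c" "lip_bounded A L m d"
  shows "lip_bounded A L (l + 2 * m) (c \<ominus> d)"
  using lip_bounded_add[OF assms(1) lip_bounded_smult[OF assms(2), of "-1"]] lip_boundedD[OF assms(1)] lip_boundedD[OF assms(2)]
  by (simp add: minus_eq_smult)

lemma lip_bounded_adj:
  assumes "lip_bounded A L l d"
  shows "lip_bounded A L l (adj A d)"
proof (rule lip_boundedI)
  note d = lip_boundedD[OF assms]
  show "L (re_part A d) \<le> ennreal l" by (rule d)
  show "L (complex_of_real (-1) \<odot> im_part A d) \<le> ennreal l" using lip_smult[OF _ d(5,3), of "-1"] d by auto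
  show "adj A d = re_part A d \<oplus> \<i> \<odot> (complex_of_real (-1) \<odot> im_part A d)"
    unfolding re_part_def im_part_def
    by (rule eq_by_functionals) (use d in \<open>auto simp: linear_functional_simps field_simps\<close>)
  show "complex_of_real (-1) \<odot> im_part A d \<in> self_adjoint A" using d by blast
qed (use lip_boundedD[OF assms] in auto)

text \<open>Since \<open>a b\<close> is the Jordan product plus \<open>\<i>\<close> times the Lie
  product, each part of \<open>c d\<close> is a signed sum of four such products of self-adjoint
  parts; \<open>l * l\<close> bounds the norm.\<close>

lemma lip_bounded_mult:
  assumes cd: "lip_bounded A L l c" "lip_bounded A L l d"
    and F: "admissible F" "F x y lx ly \<le> ennreal m" "0 \<le> m"
    and t: "t > 0" "ennreal (t * l) \<le> x" "ennreal (t * l) \<le> y" "ennreal (t * l) \<le> lx" "ennreal (t * l) \<le> ly"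
  shows "lip_bounded A L (4 * (m / t\<^sup>2) + l * l) (c \<otimes> d)"
proof -
  note c = lip_boundedD[OF cd(1)] and d = lip_boundedD[OF cd(2)]
  define K where "K = m / t\<^sup>2"
  have K: "K \<ge> 0" using F t by (simp add: K_def)
  define p q r s where "p = re_part A c" "q = im_part A c" "r = re_part A d" "s = im_part A d"
  note defs = this
  have sa: "p \<in> self_adjoint A" "q \<in> self_adjoint A" "r \<in> self_adjoint A" "s \<in> self_adjoint A"
    using c d by (auto simp: defs)
  have pc: "p \<in> carrier A" "q \<in> carrier A" "r \<in> carrier A" "s \<in> carrier A" using sa self_adjointD by auto
  note lei = leibniz_scaled[OF _ _ _ _ _ _ F t, folded K_def]
  have J: "jordan_prod A a b \<in> self_adjoint A" "L (jordan_prod A a b) \<le> ennreal K"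
     "lie_prod A a b \<in> self_adjoint A" "L (lie_prod A a b) \<le> ennreal K"
    if "a \<in> {p, q}" "b \<in> {r, s}" for a b
    using that c d sa by (auto simp: defs intro!: lei)
  have four: "w \<in> self_adjoint A \<Longrightarrow> x \<in> self_adjoint A \<Longrightarrow> y \<in> self_adjoint A \<Longrightarrow> z \<in> self_adjoint A \<Longrightarrow>
    L w \<le> ennreal K \<Longrightarrow> L x \<le> ennreal K \<Longrightarrow> L y \<le> ennreal K \<Longrightarrow> L z \<le> ennreal K \<Longrightarrow>
    L (w \<ominus> x \<ominus> y \<ominus> z) \<le> ennreal (K + K + K + K)" for w x y z
    using K by (intro lip_minus self_adjoint_simps) auto
  have four': "w \<in> self_adjoint A \<Longrightarrow> x \<in> self_adjoint A \<Longrightarrow> y \<in> self_adjoint A \<Longrightarrow> z \<in> self_adjoint A \<Longrightarrow>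
    L w \<le> ennreal K \<Longrightarrow> L x \<le> ennreal K \<Longrightarrow> L y \<le> ennreal K \<Longrightarrow> L z \<le> ennreal K \<Longrightarrow>
    L (w \<ominus> x \<oplus> y \<oplus> z) \<le> ennreal (K + K + K + K)" for w x y z
    using K by (intro lip_minus lip_add self_adjoint_simps) auto
  define R where "R = jordan_prod A p r \<ominus> jordan_prod A q s \<ominus> lie_prod A p s \<ominus> lie_prod A q r"
  define I where "I = lie_prod A p r \<ominus> lie_prod A q s \<oplus> jordan_prod A p s \<oplus> jordan_prod A q r"
  have Ks: "K + K + K + K \<le> 4 * K + l * l" by simp
  show ?thesis unfolding K_def[symmetric]
  proof (rule lip_boundedI)
    show "R \<in> self_adjoint A" "I \<in> self_adjoint A" unfolding R_def I_def using J by auto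
    show "L R \<le> ennreal (4 * K + l * l)" unfolding R_def
      by (rule order_trans[OF four ennreal_leI[OF Ks]]) (use J in auto)
    show "L I \<le> ennreal (4 * K + l * l)" unfolding I_def
      by (rule order_trans[OF four' ennreal_leI[OF Ks]]) (use J in auto)
    have "c = p \<oplus> \<i> \<odot> q" "d = r \<oplus> \<i> \<odot> s" using re_im_decomposition c d by (auto simp: defs)
    then show "c \<otimes> d = R \<oplus> \<i> \<odot> I" unfolding R_def I_def jordan_prod_def lie_prod_def
      by (intro eq_by_functionals) (use pc in \<open>auto simp: linear_functional_simps expand_simps field_simps\<close>)
    show "cnorm A (c \<otimes> d) \<le> 4 * K + l * l" using cnorm_mult_le[OF c(1) d(1) c(2) d(2)] K by simp
  qed
qed

end

text \<open>Every state of \<open>D\<close> is within \<open>\<epsilon>\<close> of one pulled back along \<open>\<pi>\<close>, and states norm self-adjoint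
  elements: hence the norm of a Lipschitz element is almost that of its image.\<close>

locale tunnel_leg =
  D: quantum_metric F D LD + A: quantum_metric F A LA
  for F :: "ennreal \<Rightarrow> ennreal \<Rightarrow> ennreal \<Rightarrow> ennreal \<Rightarrow> ennreal"
    and D :: "'d cstar" and LD :: "'d \<Rightarrow> ennreal" and A :: "'a cstar" and LA :: "'a \<Rightarrow> ennreal" +
  fixes \<pi> :: "'d \<Rightarrow> 'a" and \<epsilon> :: real
  assumes isometry: "quantum_isometry D LD A LA \<pi>"
    and extent: "hausdorff_dist (mk_dist D LD) (states D) (pullback_states D A \<pi>) < ennreal \<epsilon>"
begin

sublocale star_homomorphism D A \<pi>
  using isometry by unfold_locales (simp add: quantum_isometry_def)

lemma extent_pos: "\<epsilon> > 0"
proof -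
  have "0 < ennreal \<epsilon>" using extent by (rule order_le_less_trans[OF zero_le])
  then show ?thesis by simp
qed

lemma lip_image_le:
  assumes "d \<in> self_adjoint D" shows "LA (\<pi> d) \<le> LD d"
proof -
  have "LA (\<pi> d) = (INF a\<in>{a \<in> self_adjoint D. \<pi> a = \<pi> d}. LD a)"
    using isometry hom_self_adjoint[OF assms] by (simp add: quantum_isometry_def)
  also have "\<dots> \<le> LD d" by (rule INF_lower) (use assms in simp)
  finally show ?thesis .
qed

text \<open>The quotient seminorm is an infimum; a strict bound yields a lift without the question
  whether the infimum is attained. Hence the strict bounds in all lifting statements.\<close>

lemma lip_lift:
  assumes "a \<in> self_adjoint A" "LA a < l"
  obtains d where "d \<in> self_adjoint D" "\<pi> d = a" "LD d < l"
proof -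
  have "LA a = (INF d\<in>{d \<in> self_adjoint D. \<pi> d = a}. LD d)"
    using isometry assms(1) by (simp add: quantum_isometry_def)
  then have "(INF d\<in>{d \<in> self_adjoint D. \<pi> d = a}. LD d) < l" using assms(2) by simp
  then show ?thesis using that unfolding INF_less_iff by blast
qed

lemma cnorm_self_adjoint_le:
  assumes d: "d \<in> self_adjoint D" "LD d \<le> ennreal l" "l > 0"
  shows "cnorm D d \<le> cnorm A (\<pi> d) + l * \<epsilon>"
proof -
  have "cnorm D d \<le> cnorm A (\<pi> d) + l * \<epsilon> + e" if e: "e > 0" for e
  proof -
    obtain \<phi> where \<phi>: "\<phi> \<in> states D" "cmod (\<phi> d) \<ge> cnorm D d - e"
      using D.state_almost_attains_norm[OF d(1), of "cnorm D d - e"] e by auto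
    have "(INF y\<in>pullback_states D A \<pi>. mk_dist D LD \<phi> y) \<le> hausdorff_dist (mk_dist D LD) (states D) (pullback_states D A \<pi>)"
      unfolding hausdorff_dist_def by (rule order_trans[OF SUP_upper[OF \<phi>(1)] max.cobounded1])
    then have "(INF y\<in>pullback_states D A \<pi>. mk_dist D LD \<phi> y) < ennreal \<epsilon>" using extent by simp
    then obtain \<psi> where \<psi>: "\<psi> \<in> states A" "mk_dist D LD \<phi> (compose (carrier D) \<psi> \<pi>) < ennreal \<epsilon>"
      unfolding INF_less_iff pullback_states_def by blast
    have "cmod (\<phi> d - compose (carrier D) \<psi> \<pi> d) \<le> l * \<epsilon>"
      using D.mk_dist_bound[OF d \<phi>(1) state_pullback[OF \<psi>(1)]] \<psi>(2) extent_pos by simp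
    moreover have "cmod (compose (carrier D) \<psi> \<pi> d) \<le> cnorm A (\<pi> d)"
      using A.state_self_adjoint(2)[OF \<psi>(1) hom_self_adjoint[OF d(1)]] D.self_adjointD[OF d(1)] by (simp add: compose_def)
    ultimately show ?thesis using \<phi>(2) norm_triangle_sub[of "\<phi> d" "compose (carrier D) \<psi> \<pi> d"] by simp
  qed
  then show ?thesis by (rule field_le_epsilon)
qed

text \<open>Splitting into real and imaginary parts costs the factors 2. For limits it is enough
  that the factor is bounded and that the error vanishes with \<open>\<epsilon>\<close>.\<close>

lemma cnorm_le:
  assumes d: "lip_bounded D LD l d" "l > 0"
  shows "cnorm D d \<le> 2 * cnorm A (\<pi> d) + 2 * (l * \<epsilon>)"
proof -
  note dd = D.lip_boundedD[OF d(1)]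
  have "cnorm D (re_part D d) \<le> cnorm A (\<pi> d) + l * \<epsilon>" "cnorm D (im_part D d) \<le> cnorm A (\<pi> d) + l * \<epsilon>"
    using cnorm_self_adjoint_le[of "re_part D d" l] cnorm_self_adjoint_le[of "im_part D d" l] dd d(2)
      A.cnorm_part_le[of "\<pi> d"] by (auto simp: hom_re_part hom_im_part)
  then show ?thesis using D.cnorm_le_parts[OF dd(1)] by simp
qed

end

section \<open>Limits along ultrafilters\<close>

locale ultrafilter =
  fixes U :: "'i filter"
  assumes proper: "U \<noteq> bot"
    and ultra: "eventually P U \<or> eventually (\<lambda>i. \<not> P i) U"
begin

lemma not_eventually_iff: "\<not> eventually P U \<longleftrightarrow> eventually (\<lambda>i. \<not> P i) U"
proof
  assume "eventually (\<lambda>i. \<not> P i) U"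
  show "\<not> eventually P U"
  proof
    assume "eventually P U"
    with \<open>eventually (\<lambda>i. \<not> P i) U\<close> have "eventually (\<lambda>_. False) U" by eventually_elim simp
    then show False using proper by simp
  qed
qed (use ultra in blast)

lemma compact_limit:
  assumes S: "compact S" and f: "eventually (\<lambda>i. f i \<in> S) U"
  shows "\<exists>x\<in>S. (f \<longlongrightarrow> x) U"
proof -
  have "filtermap f U \<noteq> bot" "eventually (\<lambda>y. y \<in> S) (filtermap f U)"
    using proper f by (simp_all add: filtermap_bot_iff eventually_filtermap)
  then obtain x where x: "x \<in> S" "inf (nhds x) (filtermap f U) \<noteq> bot" using S unfolding compact_filter by blast
  have "(f \<longlongrightarrow> x) U"
  proof (rule topological_tendstoI)
    fix N assume N: "open N" "x \<in> N"
    show "eventually (\<lambda>i. f i \<in> N) U"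
    proof (rule ccontr)
      assume "\<not> ?thesis"
      then have "eventually (\<lambda>y. y \<notin> N) (filtermap f U)" by (simp add: not_eventually_iff eventually_filtermap)
      moreover have "eventually (\<lambda>y. y \<in> N) (nhds x)" using N by (rule eventually_nhds_in_open)
      ultimately have "eventually (\<lambda>_. False) (inf (nhds x) (filtermap f U))" unfolding eventually_inf by blast
      then show False using x(2) by simp
    qed
  qed
  then show ?thesis using x(1) by blast
qed

end

text \<open>A minimal proper filter below \<open>sequentially\<close>: it cannot be refined properly
  by a set, so each set or its complement belongs to it.\<close>

lemma nonprincipal_ultrafilter: "\<exists>U::nat filter. ultrafilter U \<and> U \<le> sequentially"
proof -
  define \<S> where "\<S> = {F::nat filter. F \<noteq> bot \<and> F \<le> sequentially}"
  have "\<exists>m\<in>\<S>. \<forall>F\<in>\<S>. F \<le> m \<longrightarrow> F = m"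
  proof (rule predicate_Zorn)
    show "partial_order_on \<S> (relation_of (\<lambda>x y. y \<le> x) \<S>)"
      by (rule partial_order_on_relation_ofI) auto
    fix C assume C: "C \<in> Chains (relation_of (\<lambda>x y. y \<le> x) \<S>)"
    then have sub: "C \<subseteq> \<S>" and tot: "\<And>F G. F \<in> C \<Longrightarrow> G \<in> C \<Longrightarrow> F \<le> G \<or> G \<le> F"
      by (auto simp: Chains_def relation_of_def)
    show "\<exists>u\<in>\<S>. \<forall>F\<in>C. u \<le> F"
    proof (cases "C = {}")
      case True
      then show ?thesis by (intro bexI[of _ sequentially]) (auto simp: \<S>_def)
    next
      case False
      \<comment> \<open>In a chain, what holds eventually for the infimum already holds eventually
        for one member; hence the infimum is proper.\<close>
      have base: "\<exists>x\<in>C. x \<le> inf F G" if FG: "F \<in> C" "G \<in> C" for F G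
        using tot[OF FG]
      proof
        assume "F \<le> G"
        then show ?thesis using FG by (intro bexI[of _ F]) simp_all
      next
        assume "G \<le> F"
        then show ?thesis using FG by (intro bexI[of _ G]) simp_all
      qed
      have "Inf C \<noteq> bot"
      proof
        assume "Inf C = bot"
        then have "eventually (\<lambda>_. False) (Inf C)" by simp
        then have "\<exists>F\<in>C. eventually (\<lambda>_. False) F"
          by (simp only: eventually_Inf_base[OF False base])
        then show False using sub by (auto simp: \<S>_def)
      qed
      moreover have "Inf C \<le> sequentially" 
      proof -
        obtain F where "F \<in> C" using False by blast
        then show ?thesis using sub by (intro Inf_lower2[of F]) (auto simp: \<S>_def)
      qed
      ultimately show ?thesis using Inf_lower[of _ C] by (intro bexI[of _ "Inf C"]) (auto simp: \<S>_def)
    qed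
  qed
  then obtain U where U: "U \<in> \<S>" and max: "\<And>F. F \<in> \<S> \<Longrightarrow> F \<le> U \<Longrightarrow> F = U" by blast
  have "eventually P U \<or> eventually (\<lambda>i. \<not> P i) U" for P
  proof (cases "inf U (principal {i. P i}) = bot")
    case True
    then have "eventually (\<lambda>_. False) (inf U (principal {i. P i}))" by simp
    then show ?thesis by (simp add: eventually_inf_principal)
  next
    case False
    then have "inf U (principal {i. P i}) = U" using U by (intro max) (auto simp: \<S>_def intro: le_infI1)
    then have "U \<le> principal {i. P i}" by (metis inf.cobounded2)
    then show ?thesis by (simp add: le_principal)
  qed
  then show ?thesis using U by (auto simp: \<S>_def ultrafilter_def)
qed

section \<open>Compactness of Lipschitz balls along ultrafilters\<close>

context quantum_metric
begin

text \<open>Finitely many states norm the differences of members of the ball up to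
  \<open>e/4\<close>, and their bounded values converge along the ultrafilter; members with close
  values are close in norm. So \<open>s\<close> is Cauchy along \<open>U\<close>.\<close>

lemma lip_ball_compact:
  assumes U: "ultrafilter U" and s: "\<And>i. s i \<in> self_adjoint A" "\<And>i. L (s i) \<le> ennreal l" "\<And>i. cnorm A (s i) \<le> r"
    and l: "l > 0"
  shows "\<exists>x\<in>self_adjoint A. L x \<le> ennreal l \<and> near U (\<lambda>_. A) s (\<lambda>_. x)"
proof -
  interpret U: ultrafilter U by fact
  note sc = self_adjointD(1)[OF s(1)]
  have cauchy: "\<exists>T. eventually T U \<and> (\<forall>i j. T i \<longrightarrow> T j \<longrightarrow> cnorm A (s i \<ominus> s j) < e)" if e: "e > 0" for e
  proof -
    obtain \<Phi> where \<Phi>: "finite \<Phi>" "\<Phi> \<subseteq> states A"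
      "\<And>a. \<lbrakk>a \<in> self_adjoint A; L a \<le> ennreal (2 * l)\<rbrakk> \<Longrightarrow> \<exists>\<phi>\<in>\<Phi>. cnorm A a \<le> cmod (\<phi> a) + e/4"
      using finite_norming_states[of "2*l" "e/4"] l e by auto
    have "\<exists>c. ((\<lambda>i. \<phi> (s i)) \<longlongrightarrow> c) U" if "\<phi> \<in> \<Phi>" for \<phi>
    proof -
      have \<phi>: "\<phi> \<in> states A" using that \<Phi>(2) by blast
      have "cmod (\<phi> (s i)) \<le> r" for i
        by (rule order_trans[OF state_self_adjoint(2)[OF \<phi> s(1)] s(3)])
      then have "\<forall>\<^sub>F i in U. \<phi> (s i) \<in> cball 0 r" by (intro always_eventually allI) (simp only: mem_cball_0)
      from U.compact_limit[OF compact_cball this] show ?thesis by blast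
    qed
    then obtain c where c: "\<And>\<phi>. \<phi> \<in> \<Phi> \<Longrightarrow> ((\<lambda>i. \<phi> (s i)) \<longlongrightarrow> c \<phi>) U" by metis
    define T where "T = (\<lambda>i. \<forall>\<phi>\<in>\<Phi>. dist (\<phi> (s i)) (c \<phi>) < e/4)"
    have "eventually T U" unfolding T_def 
      by (intro eventually_ball_finite ballI \<Phi>(1)) (rule tendstoD[OF c], use e in auto)
    moreover have "cnorm A (s i \<ominus> s j) < e" if T: "T i" "T j" for i j
    proof -
      have "L (s i \<ominus> s j) \<le> ennreal (2 * l)" 
        unfolding mult_2 using l by (intro lip_minus s) simp_all
      moreover have "s i \<ominus> s j \<in> self_adjoint A" by (intro self_adjoint_simps s(1))
      ultimately obtain \<phi> where \<phi>: "\<phi> \<in> \<Phi>" "cnorm A (s i \<ominus> s j) \<le> cmod (\<phi> (s i \<ominus> s j)) + e/4" using \<Phi>(3) by blast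
      have lf: "linear_functional A \<phi>" by (rule linear_functional_state) (use \<phi>(1) \<Phi>(2) in blast)
      have "\<phi> (s i \<ominus> s j) = \<phi> (s i) - \<phi> (s j)" by (rule linear_functional_minus[OF lf sc sc])
      then have "cmod (\<phi> (s i \<ominus> s j)) \<le> dist (\<phi> (s i)) (c \<phi>) + dist (\<phi> (s j)) (c \<phi>)"
        using dist_triangle2[of "\<phi> (s i)" "\<phi> (s j)" "c \<phi>"] by (simp add: dist_norm)
      also have "\<dots> < e/4 + e/4" using T \<phi>(1) unfolding T_def by (intro add_strict_mono) auto
      finally show ?thesis using \<phi>(2) e by simp
    qed
    ultimately show ?thesis by blast
  qed
  define \<epsilon> :: "nat \<Rightarrow> real" where "\<epsilon> k = 1 / (real k + 1)" for k
  have \<epsilon>: "\<epsilon> k > 0" for k by (simp add: \<epsilon>_def)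
  have elim: "\<epsilon> \<longlonglongrightarrow> 0" unfolding \<epsilon>_def by real_asymp
  obtain T where T: "\<And>k. eventually (T k) U" "\<And>k i j. T k i \<Longrightarrow> T k j \<Longrightarrow> cnorm A (s i \<ominus> s j) < \<epsilon> k"
    using cauchy[OF \<epsilon>] by metis
  \<comment> \<open>Completeness is stated for sequences: an index \<open>\<iota> m\<close> in the
    common part of \<open>T 0\<close>, ..., \<open>T m\<close> makes the elements
    \<open>s (\<iota> m)\<close> an ordinary Cauchy sequence.\<close>
  have "\<exists>i. \<forall>k\<le>m. T k i" for m
  proof -
    have "eventually (\<lambda>i. \<forall>k\<in>{..m}. T k i) U" using T(1) by (intro eventually_ball_finite) auto
    from eventually_happens'[OF U.proper this] show ?thesis by auto
  qed
  then obtain \<iota> where \<iota>: "\<And>m k. k \<le> m \<Longrightarrow> T k (\<iota> m)" by metis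
  have "\<exists>x\<in>carrier A. (\<lambda>m. cnorm A (s (\<iota> m) \<ominus> x)) \<longlonglongrightarrow> 0"
  proof (rule Cauchy_converges[OF sc])
    fix e :: real assume "e > 0"
    from order_tendstoD(2)[OF elim this] obtain N where "\<epsilon> N < e" by (auto simp: eventually_sequentially)
    then show "\<exists>N. \<forall>m\<ge>N. \<forall>n\<ge>N. cnorm A (s (\<iota> m) \<ominus> s (\<iota> n)) < e"
      using less_trans[OF T(2)[OF \<iota> \<iota>]] by blast
  qed
  then obtain x where x: "x \<in> carrier A" "(\<lambda>m. cnorm A (s (\<iota> m) \<ominus> x)) \<longlonglongrightarrow> 0" by blast
  have le: "cnorm A (s i \<ominus> x) \<le> \<epsilon> k" if i: "T k i" for i k
  proof (rule tendsto_lowerbound[of "\<lambda>m. \<epsilon> k + cnorm A (s (\<iota> m) \<ominus> x)" _ sequentially])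
    show "(\<lambda>m. \<epsilon> k + cnorm A (s (\<iota> m) \<ominus> x)) \<longlonglongrightarrow> \<epsilon> k" using tendsto_add[OF tendsto_const x(2)] by simp
    show "\<forall>\<^sub>F m in sequentially. cnorm A (s i \<ominus> x) \<le> \<epsilon> k + cnorm A (s (\<iota> m) \<ominus> x)"
      using eventually_ge_at_top[of k]
    proof eventually_elim
      case (elim m)
      then show ?case using T(2)[OF i \<iota>[of k m]] 
          cnorm_minus_triangle[of "s i" "s (\<iota> m)" x] sc x(1) by simp
    qed
  qed simp
  have near: "near U (\<lambda>_. A) s (\<lambda>_. x)" unfolding near_def
  proof (rule order_tendstoI)
    fix e :: real assume "0 < e"
    from order_tendstoD(2)[OF elim this] obtain k where "\<epsilon> k < e" by (auto simp: eventually_sequentially)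
    then show "eventually (\<lambda>i. cnorm A (s i \<ominus> x) < e) U"
      using order_le_less_trans[OF le] by (intro eventually_mono[OF T(1)[of k]])
  next
    fix e :: real assume "e < 0"
    then show "eventually (\<lambda>i. e < cnorm A (s i \<ominus> x)) U"
      using order_less_le_trans[OF _ cnorm_nonneg[OF minus_closed[OF sc x(1)]]] by (intro always_eventually allI)
  qed
  show ?thesis using near_self_adjoint[OF U.proper s(1) x(1) near] near
      lip_lower_semicontinuous[OF U.proper s(1) x(1) near, of "ennreal l"] s(2) by auto
qed

end

lemma (in star_homomorphism) near_hom:
  assumes "\<And>i. x i \<in> carrier A" "\<And>i. y i \<in> carrier A" "near F (\<lambda>_. A) x y"
  shows "near F (\<lambda>_. B) (\<lambda>i. h (x i)) (\<lambda>i. h (y i))"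
proof -
  interpret K: cstar_family "\<lambda>_. B" by (rule B.const_family)
  have "cnorm B (h (x i) \<ominus>\<^bsub>B\<^esub> h (y i)) \<le> cnorm A (x i \<ominus>\<^bsub>A\<^esub> y i)" for i
    using assms(1,2) hom_contractive[of "x i \<ominus>\<^bsub>A\<^esub> y i"] by (simp add: hom_minus)
  then show ?thesis
    by (intro K.near_if_bounded[OF _ _ _ assms(3)[unfolded near_def]] hom_closed assms(1,2) always_eventually allI)
qed

section \<open>Ergodic Lipschitz actions\<close>

locale lip_action =
  quantum_metric F A L + G: group G
  for F :: "ennreal \<Rightarrow> ennreal \<Rightarrow> ennreal \<Rightarrow> ennreal \<Rightarrow> ennreal"
    and A :: "'a cstar" and L :: "'a \<Rightarrow> ennreal" and G :: "'g monoid" +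
  fixes H :: "'g set" and \<alpha> :: "'g \<Rightarrow> 'a \<Rightarrow> 'a"
  assumes subgroup: "subgroup H G"
    and action: "cstar_action G H A \<alpha>"
    and lip_le: "\<lbrakk>h \<in> H; a \<in> self_adjoint A\<rbrakk> \<Longrightarrow> L (\<alpha> h a) \<le> L a"
begin

lemma act_hom: "h \<in> H \<Longrightarrow> star_homomorphism A A (\<alpha> h)"
  using action by unfold_locales (simp add: cstar_action_def)

lemma act_mult: "\<lbrakk>g \<in> H; h \<in> H; a \<in> carrier A\<rbrakk> \<Longrightarrow> \<alpha> (g \<otimes>\<^bsub>G\<^esub> h) a = \<alpha> g (\<alpha> h a)"
  using group_action.composition_rule[of "G\<lparr>carrier := H\<rparr>" "carrier A" \<alpha> a g h] action
  by (simp add: cstar_action_def)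

lemma act_one: "a \<in> carrier A \<Longrightarrow> \<alpha> \<one>\<^bsub>G\<^esub> a = a"
  using fun_cong[OF group_action.id_eq_one[of "G\<lparr>carrier := H\<rparr>" "carrier A" \<alpha>], of a] action
  by (simp add: cstar_action_def)

lemma act_closed [simp]: "\<lbrakk>h \<in> H; a \<in> carrier A\<rbrakk> \<Longrightarrow> \<alpha> h a \<in> carrier A"
  using star_homomorphism.hom_closed[OF act_hom] by blast

lemma act_minus: "\<lbrakk>h \<in> H; a \<in> carrier A; b \<in> carrier A\<rbrakk> \<Longrightarrow> \<alpha> h (a \<ominus>\<^bsub>A\<^esub> b) = \<alpha> h a \<ominus>\<^bsub>A\<^esub> \<alpha> h b"
  using star_homomorphism.hom_minus[OF act_hom] by blast

lemma act_inv: "\<lbrakk>h \<in> H; a \<in> carrier A\<rbrakk> \<Longrightarrow> \<alpha> (inv\<^bsub>G\<^esub> h) (\<alpha> h a) = a"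
  using act_mult[of "inv\<^bsub>G\<^esub> h" h a] act_one[of a] subgroup.m_inv_closed[OF subgroup, of h] subgroup.mem_carrier[OF subgroup, of h]
  by simp

lemma act_norm: assumes h: "h \<in> H" and a: "a \<in> carrier A" shows "cnorm A (\<alpha> h a) = cnorm A a"
proof (rule antisym)
  show "cnorm A (\<alpha> h a) \<le> cnorm A a" using star_homomorphism.hom_contractive[OF act_hom[OF h] a] .
  have "cnorm A (\<alpha> (inv\<^bsub>G\<^esub> h) (\<alpha> h a)) \<le> cnorm A (\<alpha> h a)"
    using star_homomorphism.hom_contractive[OF act_hom] subgroup.m_inv_closed[OF subgroup h] h a by simp
  then show "cnorm A a \<le> cnorm A (\<alpha> h a)" using act_inv[OF h a] by simp
qed

lemma act_dist: "\<lbrakk>h \<in> H; a \<in> carrier A; b \<in> carrier A\<rbrakk> \<Longrightarrow> cnorm A (\<alpha> h a \<ominus>\<^bsub>A\<^esub> \<alpha> h b) = cnorm A (a \<ominus>\<^bsub>A\<^esub> b)"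
  using act_norm[of h "a \<ominus>\<^bsub>A\<^esub> b"] by (simp add: act_minus)

lemma act_self_adjoint: "\<lbrakk>h \<in> H; a \<in> self_adjoint A\<rbrakk> \<Longrightarrow> \<alpha> h a \<in> self_adjoint A"
  using star_homomorphism.hom_self_adjoint[OF act_hom] by blast

text \<open>No Haar measure is needed: on the invariant convex set \<open>K\<close> below, a near-minimiser of
  \<open>x \<mapsto> sup\<^sub>h \<Sum>\<^sub>\<phi> \<phi>(\<alpha>\<^sup>h x)\<^sup>2\<close> is almost fixed, by the parallelogram law and the invariance of the
  functional.\<close>

lemma almost_fixed_point:
  assumes a: "a \<in> self_adjoint A" "L a \<le> ennreal l" "l > 0"
    and \<delta>: "\<And>h. h \<in> H \<Longrightarrow> cnorm A (a \<ominus>\<^bsub>A\<^esub> \<alpha> h a) \<le> \<delta>" and e: "e > 0"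
  obtains x where "x \<in> self_adjoint A" "L x \<le> ennreal l" "cnorm A x \<le> cnorm A a"
    "cnorm A (x \<ominus>\<^bsub>A\<^esub> a) \<le> \<delta>" "\<And>g. g \<in> H \<Longrightarrow> cnorm A (x \<ominus>\<^bsub>A\<^esub> \<alpha> g x) \<le> e"
proof -
  note ac = self_adjointD[OF a(1)]
  define r where "r = cnorm A a"
  define mid where "mid x y = complex_of_real (1/2) \<odot>\<^bsub>A\<^esub> (x \<oplus>\<^bsub>A\<^esub> y)" for x y
  \<comment> \<open>Elements of the Lipschitz ball within \<open>\<delta>\<close> of the whole orbit
    of \<open>a\<close>. Taking the orbit instead of \<open>a\<close> alone makes \<open>K\<close>
    invariant under \<open>H\<close>.\<close>
  define K where "K = {x \<in> self_adjoint A. L x \<le> ennreal l \<and> cnorm A x \<le> r \<and>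
    (\<forall>h\<in>H. cnorm A (x \<ominus>\<^bsub>A\<^esub> \<alpha> h a) \<le> \<delta>)}"
  have Kc: "x \<in> carrier A" "x \<in> self_adjoint A" if "x \<in> K" for x using that self_adjointD unfolding K_def by auto
  have aK: "a \<in> K" using a \<delta> by (simp add: K_def r_def)
  have oneH: "\<one>\<^bsub>G\<^esub> \<in> H" using subgroup.one_closed[OF subgroup] .
  have actK: "\<alpha> g x \<in> K" if x: "x \<in> K" and g: "g \<in> H" for x g
  proof -
    have "cnorm A (\<alpha> g x \<ominus>\<^bsub>A\<^esub> \<alpha> h a) \<le> \<delta>" if h: "h \<in> H" for h
    proof -
      have gi: "inv\<^bsub>G\<^esub> g \<in> H" using subgroup.m_inv_closed[OF subgroup g] .
      have k: "inv\<^bsub>G\<^esub> g \<otimes>\<^bsub>G\<^esub> h \<in> H" using subgroup.m_closed[OF subgroup gi h] .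
      have "g \<otimes>\<^bsub>G\<^esub> (inv\<^bsub>G\<^esub> g \<otimes>\<^bsub>G\<^esub> h) = h"
        using g h subgroup.mem_carrier[OF subgroup] by (simp flip: G.m_assoc)
      then have "\<alpha> h a = \<alpha> g (\<alpha> (inv\<^bsub>G\<^esub> g \<otimes>\<^bsub>G\<^esub> h) a)" using act_mult[OF g k ac(1)] by simp
      then show ?thesis using act_dist[OF g Kc(1)[OF x] act_closed[OF k ac(1)]] x k by (simp add: K_def)
    qed
    moreover have "L (\<alpha> g x) \<le> ennreal l" using lip_le[OF g Kc(2)[OF x]] x by (auto simp: K_def)
    ultimately show ?thesis using act_self_adjoint[OF g Kc(2)[OF x]] act_norm[OF g Kc(1)[OF x]] x by (simp add: K_def)
  qed
  have midK: "mid x y \<in> K" if xy: "x \<in> K" "y \<in> K" for x y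
  proof -
    note c = Kc[OF xy(1)] Kc[OF xy(2)]
    have "L (x \<oplus>\<^bsub>A\<^esub> y) \<le> ennreal (l + l)" using xy a(3) by (intro lip_add) (auto simp: K_def)
    then have "L (mid x y) \<le> ennreal l" unfolding mid_def using lip_smult[of "x \<oplus>\<^bsub>A\<^esub> y" "l + l" "1/2"] c a(3) by auto
    moreover have "cnorm A (mid x y) \<le> r"
    proof -
      have "cnorm A (mid x y) = 1/2 * cnorm A (x \<oplus>\<^bsub>A\<^esub> y)" unfolding mid_def using c by (subst cnorm_of_real_smult) auto
      then show ?thesis using cnorm_triangle[of x y] c xy by (simp add: K_def)
    qed
    moreover have "cnorm A (mid x y \<ominus>\<^bsub>A\<^esub> \<alpha> h a) \<le> \<delta>" if h: "h \<in> H" for h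
    proof -
      have hc: "\<alpha> h a \<in> carrier A" using h ac by simp
      have "mid x y \<ominus>\<^bsub>A\<^esub> \<alpha> h a = complex_of_real (1/2) \<odot>\<^bsub>A\<^esub> ((x \<ominus>\<^bsub>A\<^esub> \<alpha> h a) \<oplus>\<^bsub>A\<^esub> (y \<ominus>\<^bsub>A\<^esub> \<alpha> h a))" unfolding mid_def
        by (rule eq_by_functionals) (use c hc in \<open>auto simp: linear_functional_simps field_simps\<close>)
      also have "cnorm A \<dots> = 1/2 * cnorm A ((x \<ominus>\<^bsub>A\<^esub> \<alpha> h a) \<oplus>\<^bsub>A\<^esub> (y \<ominus>\<^bsub>A\<^esub> \<alpha> h a))"
        using c hc by (subst cnorm_of_real_smult) auto
      also have "\<dots> \<le> 1/2 * (\<delta> + \<delta>)"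
        using cnorm_triangle[of "x \<ominus>\<^bsub>A\<^esub> \<alpha> h a" "y \<ominus>\<^bsub>A\<^esub> \<alpha> h a"] c hc xy h by (fastforce simp: K_def)
      finally show ?thesis by simp
    qed
    moreover have "mid x y \<in> self_adjoint A" unfolding mid_def by (intro self_adjoint_simps c)
    ultimately show ?thesis by (simp add: K_def)
  qed
  obtain \<Phi> where \<Phi>: "finite \<Phi>" "\<Phi> \<subseteq> states A"
    "\<And>z. \<lbrakk>z \<in> self_adjoint A; L z \<le> ennreal (2 * l)\<rbrakk> \<Longrightarrow> \<exists>\<phi>\<in>\<Phi>. cnorm A z \<le> cmod (\<phi> z) + e/2"
  proof (rule finite_norming_states)
    show "0 < 2 * l" "0 < e / 2" using a(3) e by simp_all
  qed blast
  define \<psi> where "\<psi> x = (\<Sum>\<phi>\<in>\<Phi>. (Re (\<phi> x))\<^sup>2)" for x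
  \<comment> \<open>The supremum over \<open>H\<close> makes \<open>\<Psi>\<close> invariant under
    the action.\<close>
  define \<Psi> where "\<Psi> x = (SUP h\<in>H. \<psi> (\<alpha> h x))" for x
  have \<psi>0: "0 \<le> \<psi> x" for x by (simp add: \<psi>_def sum_nonneg)
  have \<psi>_le: "\<psi> x \<le> of_nat (card \<Phi>) * r\<^sup>2" if x: "x \<in> K" for x
  proof -
    have "(Re (\<phi> x))\<^sup>2 \<le> r\<^sup>2" if "\<phi> \<in> \<Phi>" for \<phi>
    proof -
      have "\<phi> \<in> states A" using that \<Phi>(2) by blast
      then have "cmod (\<phi> x) \<le> cnorm A x" by (rule state_self_adjoint(2)[OF _ Kc(2)[OF x]])
      also have "\<dots> \<le> r" using x by (simp add: K_def)
      finally have "cmod (\<phi> x) \<le> r" .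
      then have "\<bar>Re (\<phi> x)\<bar> \<le> \<bar>r\<bar>" using abs_Re_le_cmod[of "\<phi> x"] by linarith
      then show ?thesis by (rule abs_le_square_iff[THEN iffD1])
    qed
    then show ?thesis unfolding \<psi>_def by (rule sum_bounded_above)
  qed
  have bdd: "bdd_above ((\<lambda>h. \<psi> (\<alpha> h x)) ` H)" if "x \<in> K" for x
    using \<psi>_le[OF actK[OF that]] by (intro bdd_aboveI2)
  have \<psi>\<Psi>: "\<psi> (\<alpha> h x) \<le> \<Psi> x" if "x \<in> K" "h \<in> H" for x h
    unfolding \<Psi>_def by (rule cSUP_upper[OF that(2) bdd[OF that(1)]])
  have \<Psi>0: "0 \<le> \<Psi> x" if "x \<in> K" for x by (rule order_trans[OF \<psi>0 \<psi>\<Psi>[OF that oneH]])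
  define m where "m = (INF x\<in>K. \<Psi> x)"
  have m_le: "m \<le> \<Psi> x" if "x \<in> K" for x
    unfolding m_def by (intro cINF_lower bdd_belowI2[of _ 0] \<Psi>0 that)
  \<comment> \<open>Below, \<open>\<psi> u\<close> and \<open>\<psi> v\<close> are less than
    \<open>m + \<tau>\<close> and the value at the midpoint exceeds \<open>m - \<tau>\<close>, so
    the parallelogram law bounds the sum of the squares \<open>(Re (\<phi> z))^2\<close> by
    \<open>8 * \<tau> = (e/2)^2\<close>.\<close>
  define \<tau> where "\<tau> = e\<^sup>2 / 32"
  have \<tau>: "\<tau> > 0" using e by (simp add: \<tau>_def)
  have "\<exists>x\<in>K. \<Psi> x < m + \<tau>"
  proof (rule ccontr)
    assume "\<not> ?thesis"
    then have ge: "m + \<tau> \<le> \<Psi> x" if "x \<in> K" for x using that by (meson not_less)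
    have "m + \<tau> \<le> (INF x\<in>K. \<Psi> x)"
    proof (rule cINF_greatest)
      show "K \<noteq> {}" using aK by blast
    qed (rule ge)
    then show False using \<tau> unfolding m_def[symmetric] by simp
  qed
  then obtain x where x: "x \<in> K" "\<Psi> x < m + \<tau>" by blast
  have "cnorm A (x \<ominus>\<^bsub>A\<^esub> \<alpha> g x) \<le> e" if g: "g \<in> H" for g
  proof -
    define y where "y = \<alpha> g x"
    have y: "y \<in> K" unfolding y_def by (rule actK[OF x(1) g])
    have "m - \<tau> < \<Psi> (mid x y)" using m_le[OF midK[OF x(1) y]] \<tau> by simp
    have Hne: "H \<noteq> {}" using oneH by blast
    \<comment> \<open>Choose \<open>h\<close> near the supremum at the midpoint and move
      \<open>x\<close> and \<open>y\<close> by it: then \<open>\<psi>\<close>, without the supremum,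
      carries the argument, and \<open>\<alpha> h\<close> preserves the distance in
      question.\<close>
    have "\<exists>h\<in>H. m - \<tau> < \<psi> (\<alpha> h (mid x y))"
      using \<open>m - \<tau> < \<Psi> (mid x y)\<close> unfolding \<Psi>_def
      by (rule less_cSUP_iff[OF Hne bdd[OF midK[OF x(1) y]], THEN iffD1])
    then obtain h where h: "h \<in> H" "m - \<tau> < \<psi> (\<alpha> h (mid x y))" by blast
    interpret ah: star_homomorphism A A "\<alpha> h" by (rule act_hom[OF h(1)])
    define u where "u = \<alpha> h x"
    define v where "v = \<alpha> h y"
    have uK: "u \<in> K" and vK: "v \<in> K" unfolding u_def v_def by (rule actK[OF x(1) h(1)], rule actK[OF y h(1)])
    note uc = Kc[OF uK] and vc = Kc[OF vK]
    have \<psi>u: "\<psi> u < m + \<tau>" using \<psi>\<Psi>[OF x(1) h(1)] x(2) by (simp add: u_def)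
    have "v = \<alpha> (h \<otimes>\<^bsub>G\<^esub> g) x" unfolding v_def y_def using act_mult[OF h(1) g] Kc[OF x(1)] by simp
    then have \<psi>v: "\<psi> v < m + \<tau>" using \<psi>\<Psi>[OF x(1) subgroup.m_closed[OF subgroup h(1) g]] x(2) by simp
    have muv: "\<alpha> h (mid x y) = mid u v" unfolding mid_def u_def v_def
      using Kc[OF x(1)] Kc[OF y] by (simp add: ah.hom_smult ah.hom_add)
    define z where "z = u \<ominus>\<^bsub>A\<^esub> v"
    have z: "z \<in> self_adjoint A" unfolding z_def using uc vc by blast
    have par: "\<psi> (mid u v) + (\<Sum>\<phi>\<in>\<Phi>. (Re (\<phi> z))\<^sup>2) / 4 = (\<psi> u + \<psi> v) / 2"
    proof -
      have "(Re (\<phi> (mid u v)))\<^sup>2 + (Re (\<phi> z))\<^sup>2 / 4 = ((Re (\<phi> u))\<^sup>2 + (Re (\<phi> v))\<^sup>2) / 2" if "\<phi> \<in> \<Phi>" for \<phi>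
      proof -
        have lf: "linear_functional A \<phi>" by (rule linear_functional_state) (use that \<Phi>(2) in blast)
        have eqs: "Re (\<phi> (mid u v)) = (Re (\<phi> u) + Re (\<phi> v)) / 2" "Re (\<phi> z) = Re (\<phi> u) - Re (\<phi> v)"
          unfolding mid_def z_def using lf uc vc by (simp_all add: linear_functional_simps)
        show ?thesis unfolding eqs by (simp add: power2_eq_square field_simps)
      qed
      then have "(\<Sum>\<phi>\<in>\<Phi>. (Re (\<phi> (mid u v)))\<^sup>2 + (Re (\<phi> z))\<^sup>2 / 4) = (\<Sum>\<phi>\<in>\<Phi>. ((Re (\<phi> u))\<^sup>2 + (Re (\<phi> v))\<^sup>2) / 2)"
        by (rule sum.cong[OF refl])
      then show ?thesis by (simp only: \<psi>_def sum.distrib sum_divide_distrib[symmetric])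
    qed
    have zsum: "(\<Sum>\<phi>\<in>\<Phi>. (Re (\<phi> z))\<^sup>2) < (e/2)\<^sup>2"
      using par \<psi>u \<psi>v h(2) unfolding muv \<tau>_def by (simp add: power_divide)
    have "L z \<le> ennreal (l + l)" unfolding z_def using uK vK uc vc a(3) by (intro lip_minus) (auto simp: K_def)
    then have "L z \<le> ennreal (2 * l)" unfolding mult_2 .
    then obtain \<phi> where \<phi>: "\<phi> \<in> \<Phi>" "cnorm A z \<le> cmod (\<phi> z) + e/2" using \<Phi>(3) z by blast
    have "(Re (\<phi> z))\<^sup>2 \<le> (\<Sum>\<phi>\<in>\<Phi>. (Re (\<phi> z))\<^sup>2)" by (rule member_le_sum[OF \<phi>(1) _ \<Phi>(1)]) simp
    then have "(Re (\<phi> z))\<^sup>2 < (e/2)\<^sup>2" using zsum by simp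
    then have "\<bar>Re (\<phi> z)\<bar> < e/2" using power2_less_imp_less[of "\<bar>Re (\<phi> z)\<bar>" "e/2"] e by simp
    moreover have "\<phi> z \<in> \<real>" by (rule state_self_adjoint(1)[OF _ z]) (use \<phi>(1) \<Phi>(2) in blast)
    then have "cmod (\<phi> z) = \<bar>Re (\<phi> z)\<bar>" by (simp add: complex_is_Real_iff cmod_def)
    ultimately have "cnorm A z \<le> e" using \<phi>(2) by simp
    moreover have "cnorm A z = cnorm A (x \<ominus>\<^bsub>A\<^esub> y)" unfolding z_def u_def v_def
      by (rule act_dist[OF h(1) Kc(1)[OF x(1)] Kc(1)[OF y]])
    ultimately show ?thesis by (simp add: y_def)
  qed
  moreover have "cnorm A (x \<ominus>\<^bsub>A\<^esub> a) \<le> \<delta>" 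
  proof -
    have "cnorm A (x \<ominus>\<^bsub>A\<^esub> \<alpha> \<one>\<^bsub>G\<^esub> a) \<le> \<delta>" using x(1) oneH by (simp only: K_def mem_Collect_eq)
    then show ?thesis using act_one[OF ac(1)] by simp
  qed
  ultimately show ?thesis
  proof (intro that[of x])
    show "x \<in> self_adjoint A" "L x \<le> ennreal l" "cnorm A x \<le> cnorm A a"
      using x(1) by (simp_all add: K_def r_def)
  qed
qed

text \<open>An ultralimit of points that are fixed up to \<open>\<epsilon> k\<close> is fixed, hence
  scalar by ergodicity, and it stays within \<open>\<delta>\<close> of \<open>a\<close>.\<close>

lemma almost_invariant_near_scalar:
  assumes erg: "ergodic H A \<alpha>" and a: "a \<in> self_adjoint A" "L a \<le> ennreal l" "l > 0"
    and \<delta>: "\<And>h. h \<in> H \<Longrightarrow> cnorm A (a \<ominus>\<^bsub>A\<^esub> \<alpha> h a) \<le> \<delta>"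
  shows "\<exists>c. cnorm A (a \<ominus>\<^bsub>A\<^esub> c \<odot>\<^bsub>A\<^esub> \<one>\<^bsub>A\<^esub>) \<le> \<delta>"
proof -
  interpret K: cstar_family "\<lambda>_. A" by (rule const_family)
  note ac = self_adjointD[OF a(1)]
  define \<epsilon> :: "nat \<Rightarrow> real" where "\<epsilon> k = 1 / (real k + 1)" for k
  have \<epsilon>: "\<epsilon> k > 0" for k by (simp add: \<epsilon>_def)
  have elim: "\<epsilon> \<longlonglongrightarrow> 0" unfolding \<epsilon>_def by real_asymp
  have "\<exists>x. x \<in> self_adjoint A \<and> L x \<le> ennreal l \<and> cnorm A x \<le> cnorm A a \<and>
    cnorm A (x \<ominus>\<^bsub>A\<^esub> a) \<le> \<delta> \<and> (\<forall>g\<in>H. cnorm A (x \<ominus>\<^bsub>A\<^esub> \<alpha> g x) \<le> \<epsilon> k)" for k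
    by (rule almost_fixed_point[OF a \<delta> \<epsilon>[of k]]) blast+
  then obtain x where x: "\<And>k. x k \<in> self_adjoint A" "\<And>k. L (x k) \<le> ennreal l" "\<And>k. cnorm A (x k) \<le> cnorm A a"
    "\<And>k. cnorm A (x k \<ominus>\<^bsub>A\<^esub> a) \<le> \<delta>" "\<And>k g. g \<in> H \<Longrightarrow> cnorm A (x k \<ominus>\<^bsub>A\<^esub> \<alpha> g (x k)) \<le> \<epsilon> k" by metis
  note xc = self_adjointD(1)[OF x(1)]
  obtain U :: "nat filter" where U: "ultrafilter U" "U \<le> sequentially" using nonprincipal_ultrafilter by blast
  interpret U: ultrafilter U by fact
  obtain y where y: "y \<in> self_adjoint A" "near U (\<lambda>_. A) x (\<lambda>_. y)"
    using lip_ball_compact[of U x l "cnorm A a", OF U(1) x(1,2,3) a(3)] by blast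
  note yc = self_adjointD(1)[OF y(1)]
  have "near U (\<lambda>_. A) (\<lambda>k. x k \<ominus>\<^bsub>A\<^esub> a) (\<lambda>_. y \<ominus>\<^bsub>A\<^esub> a)"
    using K.near_minus[OF xc _ _ _ y(2) K.near_refl[of "\<lambda>_. a"]] yc ac by simp
  then have ya: "cnorm A (y \<ominus>\<^bsub>A\<^esub> a) \<le> \<delta>"
    using near_cnorm_le[OF U.proper, of "\<lambda>k. x k \<ominus>\<^bsub>A\<^esub> a" "y \<ominus>\<^bsub>A\<^esub> a" \<delta>] xc yc ac x(4) by simp
  have "\<alpha> g y = y" if g: "g \<in> H" for g
  proof -
    interpret ag: star_homomorphism A A "\<alpha> g" by (rule act_hom[OF g])
    have "near U (\<lambda>_. A) x (\<lambda>k. \<alpha> g (x k))"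
    proof (rule K.near_if_bounded[where g = \<epsilon>])
      show "\<forall>\<^sub>F k in U. cnorm A (x k \<ominus>\<^bsub>A\<^esub> \<alpha> g (x k)) \<le> \<epsilon> k" by (intro always_eventually allI x(5) g)
    qed (rule xc act_closed g tendsto_mono[OF U(2) elim])+
    moreover have "near U (\<lambda>_. A) (\<lambda>k. \<alpha> g (x k)) (\<lambda>_. \<alpha> g y)"
      using ag.near_hom[OF xc _ y(2)] yc by simp
    ultimately have "near U (\<lambda>_. A) x (\<lambda>_. \<alpha> g y)"
      using K.near_trans[of x "\<lambda>k. \<alpha> g (x k)" "\<lambda>_. \<alpha> g y"] xc yc g by simp
    then show ?thesis using near_unique[OF U.proper xc _ yc _ y(2), of "\<alpha> g y"] yc g by simp
  qed
  then obtain c where "y = c \<odot>\<^bsub>A\<^esub> \<one>\<^bsub>A\<^esub>" using erg yc unfolding ergodic_def by blast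
  then show ?thesis using ya cnorm_minus_commute[OF yc ac(1)] by auto
qed

end

section \<open>Homomorphisms with a dense domain\<close>

context unital_cstar_algebra
begin

lemma near_bounded:
  assumes "\<And>i. s i \<in> carrier A" "x \<in> carrier A" "near F (\<lambda>_. A) s (\<lambda>_. x)"
  shows "\<forall>\<^sub>F i in F. cnorm A (s i) \<le> cnorm A x + 1"
proof -
  have "\<forall>\<^sub>F i in F. cnorm A (s i) < cnorm A x + 1"
    using near_cnorm[OF assms] by (rule order_tendstoD) simp
  then show ?thesis by eventually_elim simp
qed

text \<open>Applied to differences, the bound makes the linear relation \<open>R\<close>
  single-valued and uniformly continuous, and the graph of \<open>f\<close> is its closure. Any
  constant \<open>C\<close> will do: the resulting *-homomorphism is contractive anyway.\<close>

lemma hom_from_graph: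
  assumes carrier: "\<And>x y. (x, y) \<in> R \<Longrightarrow> x \<in> carrier A" "\<And>x y. (x, y) \<in> R \<Longrightarrow> y \<in> carrier A"
    and add: "\<And>x y u v. \<lbrakk>(x, y) \<in> R; (u, v) \<in> R\<rbrakk> \<Longrightarrow> (x \<oplus> u, y \<oplus> v) \<in> R"
    and mult: "\<And>x y u v. \<lbrakk>(x, y) \<in> R; (u, v) \<in> R\<rbrakk> \<Longrightarrow> (x \<otimes> u, y \<otimes> v) \<in> R"
    and smult: "\<And>x y c. (x, y) \<in> R \<Longrightarrow> (c \<odot> x, c \<odot> y) \<in> R"
    and adj: "\<And>x y. (x, y) \<in> R \<Longrightarrow> (adj A x, adj A y) \<in> R"
    and one: "(\<one>, \<one>) \<in> R"
    and bound: "\<And>x y. (x, y) \<in> R \<Longrightarrow> cnorm A y \<le> C * cnorm A x"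
    and dense: "\<And>x e. \<lbrakk>x \<in> carrier A; e > 0\<rbrakk> \<Longrightarrow> \<exists>u v. (u, v) \<in> R \<and> cnorm A (x \<ominus> u) < e"
  obtains f where "f \<in> star_hom A A" "f \<in> extensional (carrier A)" "\<And>x y. (x, y) \<in> R \<Longrightarrow> f x = y"
proof -
  interpret K: cstar_family "\<lambda>_. A" by (rule const_family)
  have minus: "(x \<ominus> u, y \<ominus> v) \<in> R" if "(x, y) \<in> R" "(u, v) \<in> R" for x y u v
    using add[OF that(1) smult[OF that(2), of "-1"]] carrier[OF that(1)] carrier[OF that(2)]
    by (simp add: minus_eq_smult)
  define cl where "cl x y \<longleftrightarrow> x \<in> carrier A \<and> y \<in> carrier A \<and>
    (\<exists>u v. (\<forall>n::nat. (u n, v n) \<in> R) \<and> near sequentially (\<lambda>_. A) u (\<lambda>_. x) \<and> near sequentially (\<lambda>_. A) v (\<lambda>_. y))" for x y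
  have clI: "cl x y" if "x \<in> carrier A" "y \<in> carrier A" "\<And>n::nat. (u n, v n) \<in> R"
    "near sequentially (\<lambda>_. A) u (\<lambda>_. x)" "near sequentially (\<lambda>_. A) v (\<lambda>_. y)" for x y u v
    unfolding cl_def using that by (intro conjI exI[of _ u] exI[of _ v] allI)
  have cl_ex: "\<exists>y. cl x y" if x: "x \<in> carrier A" for x
  proof -
    define \<epsilon> :: "nat \<Rightarrow> real" where "\<epsilon> k = 1 / (real k + 1)" for k
    have \<epsilon>: "\<epsilon> k > 0" for k by (simp add: \<epsilon>_def)
    have elim: "\<epsilon> \<longlonglongrightarrow> 0" unfolding \<epsilon>_def by real_asymp
    have "\<forall>n. \<exists>u v. (u, v) \<in> R \<and> cnorm A (x \<ominus> u) < \<epsilon> n" by (intro allI dense x \<epsilon>)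
    then obtain u v where uv: "\<And>n. (u n, v n) \<in> R" "\<And>n. cnorm A (x \<ominus> u n) < \<epsilon> n" by metis
    note uc = carrier(1)[OF uv(1)] and vc = carrier(2)[OF uv(1)]
    have nu: "near sequentially (\<lambda>_. A) u (\<lambda>_. x)"
    proof (rule K.near_if_bounded)
      show "\<forall>\<^sub>F n in sequentially. cnorm A (u n \<ominus> x) \<le> \<epsilon> n"
        using uv(2) cnorm_minus_commute[OF x uc] by (intro always_eventually allI) (simp add: less_imp_le)
    qed (rule uc x elim)+
    have "\<exists>y\<in>carrier A. (\<lambda>n. cnorm A (v n \<ominus> y)) \<longlonglongrightarrow> 0"
    proof (rule Cauchy_converges[OF vc])
      fix e :: real assume e: "e > 0"
      have "(\<lambda>n. \<bar>C\<bar> * (\<epsilon> n + \<epsilon> n)) \<longlonglongrightarrow> \<bar>C\<bar> * (0 + 0)" by (intro tendsto_intros elim)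
      then have "\<forall>\<^sub>F n in sequentially. \<bar>C\<bar> * (\<epsilon> n + \<epsilon> n) < e" using e by (intro order_tendstoD(2)) auto
      then obtain N where N: "\<bar>C\<bar> * (\<epsilon> N + \<epsilon> N) < e" by (auto simp: eventually_sequentially)
      have mono: "\<epsilon> m \<le> \<epsilon> N" if "m \<ge> N" for m using that by (simp add: \<epsilon>_def frac_le)
      have "cnorm A (v m \<ominus> v n) < e" if "m \<ge> N" "n \<ge> N" for m n
      proof -
        have "cnorm A (v m \<ominus> v n) \<le> C * cnorm A (u m \<ominus> u n)" by (rule bound[OF minus[OF uv(1) uv(1)]])
        also have "\<dots> \<le> \<bar>C\<bar> * cnorm A (u m \<ominus> u n)"
          using cnorm_nonneg[OF minus_closed[OF uc uc]] by (intro mult_right_mono) auto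
        also have "cnorm A (u m \<ominus> u n) \<le> cnorm A (x \<ominus> u m) + cnorm A (x \<ominus> u n)"
          using cnorm_minus_triangle[OF uc[of m] x uc[of n]] cnorm_minus_commute[OF x uc[of m]] by simp
        also have "\<dots> \<le> \<epsilon> N + \<epsilon> N"
          using uv(2)[of m] uv(2)[of n] mono[OF that(1)] mono[OF that(2)] by simp
        finally show ?thesis using N by (simp add: mult_left_mono)
      qed
      then show "\<exists>N. \<forall>m\<ge>N. \<forall>n\<ge>N. cnorm A (v m \<ominus> v n) < e" by blast
    qed
    then obtain y where "y \<in> carrier A" "near sequentially (\<lambda>_. A) v (\<lambda>_. y)" unfolding near_def by blast
    then show ?thesis using clI[OF x _ uv(1) nu] by blast
  qed
  have cl_unique: "y = y'" if cl: "cl x y" "cl x y'" for x y y'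
  proof -
    obtain u v where uv: "\<And>n::nat. (u n, v n) \<in> R" "near sequentially (\<lambda>_. A) u (\<lambda>_. x)" "near sequentially (\<lambda>_. A) v (\<lambda>_. y)"
      using cl(1) unfolding cl_def by blast
    obtain u' v' where uv': "\<And>n::nat. (u' n, v' n) \<in> R" "near sequentially (\<lambda>_. A) u' (\<lambda>_. x)" "near sequentially (\<lambda>_. A) v' (\<lambda>_. y')"
      using cl(2) unfolding cl_def by blast
    have x: "x \<in> carrier A" and y: "y \<in> carrier A" "y' \<in> carrier A" using cl unfolding cl_def by blast+
    note uc = carrier(1)[OF uv(1)] carrier(1)[OF uv'(1)] and vc = carrier(2)[OF uv(1)] carrier(2)[OF uv'(1)]
    have uu: "near sequentially (\<lambda>_. A) u u'"
      by (rule K.near_trans[OF uc(1) x uc(2) uv(2) K.near_sym[OF uc(2) x uv'(2)]])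
    have "near sequentially (\<lambda>_. A) v v'"
    proof (rule K.near_if_bounded)
      show "\<forall>\<^sub>F n in sequentially. cnorm A (v n \<ominus> v' n) \<le> C * cnorm A (u n \<ominus> u' n)"
        by (intro always_eventually allI bound minus uv(1) uv'(1))
      show "(\<lambda>n. C * cnorm A (u n \<ominus> u' n)) \<longlonglongrightarrow> 0"
        using tendsto_mult_left[OF uu[unfolded near_def], of C] by simp
    qed (rule vc)+
    then have "near sequentially (\<lambda>_. A) v (\<lambda>_. y')"
      by (rule K.near_trans[OF vc y(2) _ uv'(3)])
    then show ?thesis using near_unique[OF _ vc(1) y uv(3)] by simp
  qed
  define f where "f = (\<lambda>x\<in>carrier A. THE y. cl x y)"
  have f_cl: "cl x (f x)" if "x \<in> carrier A" for x
    using theI'[of "cl x"] cl_ex[OF that] cl_unique[of x] that unfolding f_def by auto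
  have f_eq: "f x = y" if "cl x y" for x y
    using cl_unique[OF f_cl that] that unfolding cl_def by blast
  have fc: "f x \<in> carrier A" if "x \<in> carrier A" for x using f_cl[OF that] unfolding cl_def by blast
  have seqs: "\<exists>u v. (\<forall>n::nat. (u n, v n) \<in> R) \<and> near sequentially (\<lambda>_. A) u (\<lambda>_. x) \<and> near sequentially (\<lambda>_. A) v (\<lambda>_. f x)"
    if "x \<in> carrier A" for x using f_cl[OF that] unfolding cl_def by blast
  have R: "f x = y" if xy: "(x, y) \<in> R" for x y
  proof (rule f_eq)
    show "cl x y"
      by (rule clI[of x y "\<lambda>_. x" "\<lambda>_. y"]) (intro K.near_refl carrier[OF xy] xy)+
  qed
  have f_add: "f (x \<oplus> x') = f x \<oplus> f x'" and f_mult: "f (x \<otimes> x') = f x \<otimes> f x'"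
    if x: "x \<in> carrier A" "x' \<in> carrier A" for x x'
  proof -
    obtain u v where uv: "\<And>n. (u n, v n) \<in> R" "near sequentially (\<lambda>_. A) u (\<lambda>_. x)" "near sequentially (\<lambda>_. A) v (\<lambda>_. f x)"
      using seqs[OF x(1)] by blast
    obtain u' v' where uv': "\<And>n. (u' n, v' n) \<in> R" "near sequentially (\<lambda>_. A) u' (\<lambda>_. x')" "near sequentially (\<lambda>_. A) v' (\<lambda>_. f x')"
      using seqs[OF x(2)] by blast
    note uc = carrier(1)[OF uv(1)] carrier(1)[OF uv'(1)] and vc = carrier(2)[OF uv(1)] carrier(2)[OF uv'(1)]
    have "near sequentially (\<lambda>_. A) (\<lambda>n. u n \<oplus> u' n) (\<lambda>_. x \<oplus> x')"
      by (rule K.near_add[OF uc(1) x(1) uc(2) x(2) uv(2) uv'(2)])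
    moreover have "near sequentially (\<lambda>_. A) (\<lambda>n. v n \<oplus> v' n) (\<lambda>_. f x \<oplus> f x')"
      by (rule K.near_add[OF vc(1) fc[OF x(1)] vc(2) fc[OF x(2)] uv(3) uv'(3)])
    ultimately have "cl (x \<oplus> x') (f x \<oplus> f x')"
      by (intro clI[OF _ _ add[OF uv(1) uv'(1)]] a_closed x fc)
    then show "f (x \<oplus> x') = f x \<oplus> f x'" by (rule f_eq)
    \<comment> \<open>\<open>near_mult\<close> wants one constant for a sequence and for the limit
      of the other one; the summand 1 absorbs the tail of the sequence.\<close>
    have bdd: "\<forall>\<^sub>F n in sequentially. cnorm A (s n) \<le> cnorm A y + 1 + cnorm A z"
      if "\<And>n. s n \<in> carrier A" "y \<in> carrier A" "near sequentially (\<lambda>_. A) s (\<lambda>_. y)" "z \<in> carrier A" for s y z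
      using near_bounded[OF that(1,2,3)] by eventually_elim (use cnorm_nonneg[OF that(4)] in simp)
    have bd': "cnorm A z \<le> cnorm A y + 1 + cnorm A z" if "y \<in> carrier A" for y z
      using cnorm_nonneg[OF that] by simp
    have "near sequentially (\<lambda>_. A) (\<lambda>n. u n \<otimes> u' n) (\<lambda>_. x \<otimes> x')"
      by (rule K.near_mult[OF uc(1) x(1) uc(2) x(2) uv(2) uv'(2) bdd[OF uc(1) x(1) uv(2) x(2)]])
        (intro always_eventually allI bd' x(1))
    moreover have "near sequentially (\<lambda>_. A) (\<lambda>n. v n \<otimes> v' n) (\<lambda>_. f x \<otimes> f x')"
      by (rule K.near_mult[OF vc(1) fc[OF x(1)] vc(2) fc[OF x(2)] uv(3) uv'(3) bdd[OF vc(1) fc[OF x(1)] uv(3) fc[OF x(2)]]])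
        (intro always_eventually allI bd' fc x(1))
    ultimately have "cl (x \<otimes> x') (f x \<otimes> f x')"
      by (intro clI[OF _ _ mult[OF uv(1) uv'(1)]] m_closed x fc)
    then show "f (x \<otimes> x') = f x \<otimes> f x'" by (rule f_eq)
  qed
  have f_smult: "f (c \<odot> x) = c \<odot> f x" and f_adj: "f (adj A x) = adj A (f x)" if x: "x \<in> carrier A" for x c
  proof -
    obtain u v where uv: "\<And>n. (u n, v n) \<in> R" "near sequentially (\<lambda>_. A) u (\<lambda>_. x)" "near sequentially (\<lambda>_. A) v (\<lambda>_. f x)"
      using seqs[OF x(1)] by blast
    note uc = carrier(1)[OF uv(1)] and vc = carrier(2)[OF uv(1)]
    have "cl (c \<odot> x) (c \<odot> f x)"
      by (rule clI[OF _ _ smult[OF uv(1)] K.near_smult[OF uc x uv(2)] K.near_smult[OF vc fc[OF x] uv(3)]])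
        (intro smult_closed x fc)+
    then show "f (c \<odot> x) = c \<odot> f x" by (rule f_eq)
    have "cl (adj A x) (adj A (f x))"
      by (rule clI[OF _ _ adj[OF uv(1)] K.near_adj[OF uc x uv(2)] K.near_adj[OF vc fc[OF x] uv(3)]])
        (intro adj_closed x fc)+
    then show "f (adj A x) = adj A (f x)" by (rule f_eq)
  qed
  have "f \<in> ring_hom A A"
    by (rule ring_hom_memI) (simp_all add: fc f_add f_mult R[OF one])
  then have "f \<in> star_hom A A" using f_smult f_adj by (simp add: star_hom_def)
  moreover have "f \<in> extensional (carrier A)" by (simp add: f_def)
  ultimately show ?thesis using that R by blast
qed

end

text \<open>Self-adjoint elements are limits of Lipschitz ones and *-homomorphisms are contractive.
  The laws of the limit action are checked on Lipschitz elements and transferred by this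
  lemma.\<close>

lemma (in quantum_metric) star_hom_eqI:
  assumes f: "f \<in> star_hom A A" and g: "g \<in> star_hom A A"
    and eq: "\<And>a. a \<in> lip_dom A L \<Longrightarrow> f a = g a" and x: "x \<in> carrier A"
  shows "f x = g x"
proof -
  interpret f: star_homomorphism A A f using f by unfold_locales
  interpret g: star_homomorphism A A g using g by unfold_locales
  have sa: "f a = g a" if a: "a \<in> self_adjoint A" for a
  proof -
    note ac = self_adjointD(1)[OF a]
    have "cnorm A (f a \<ominus> g a) \<le> 0 + e" if e: "e > 0" for e
    proof -
      obtain b where b: "b \<in> lip_dom A L" "cnorm A (a \<ominus> b) < e/2"
        using lip_dense[OF a, of "e/2"] e by auto
      then have bc: "b \<in> carrier A" by (simp add: lip_dom_def self_adjointD)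
      have 1: "cnorm A (f a \<ominus> f b) \<le> cnorm A (a \<ominus> b)" "cnorm A (g a \<ominus> g b) \<le> cnorm A (a \<ominus> b)"
        using f.hom_contractive[of "a \<ominus> b"] g.hom_contractive[of "a \<ominus> b"] ac bc by (simp_all add: f.hom_minus g.hom_minus)
      have "cnorm A (f a \<ominus> g a) \<le> cnorm A (f a \<ominus> f b) + cnorm A (g a \<ominus> g b)"
        using cnorm_minus_triangle[of "f a" "f b" "g a"] cnorm_minus_commute[of "f b" "g a"] eq[OF b(1)] ac bc by simp
      then show ?thesis using 1 b(2) by simp
    qed
    then have "cnorm A (f a \<ominus> g a) \<le> 0" by (rule field_le_epsilon)
    then show ?thesis using cnorm_nonneg[of "f a \<ominus> g a"] cnorm_minus_eq_zero[of "f a" "g a"] ac by simp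
  qed
  have "f (re_part A x \<oplus> \<i> \<odot> im_part A x) = g (re_part A x \<oplus> \<i> \<odot> im_part A x)"
    using x sa[OF re_part_self_adjoint[OF x]] sa[OF im_part_self_adjoint[OF x]]
    by (simp add: f.hom_add g.hom_add f.hom_smult g.hom_smult)
  then show ?thesis using re_im_decomposition[OF x] by simp
qed

section \<open>Ultralimits of closed subgroups\<close>

locale compact_length_group = topological_group G T
  for G :: "'g monoid" (structure) and T :: "'g topology" +
  fixes ell :: "'g \<Rightarrow> real"
  assumes compact: "compact_space T"
    and length: "length_function G ell"
    and ell_continuous: "continuous_map T euclideanreal ell"
    and ell_conj: "\<lbrakk>g \<in> carrier G; h \<in> carrier G\<rbrakk> \<Longrightarrow> ell (h \<otimes> g \<otimes> inv h) = ell g"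
begin

lemma ell_nonneg: "g \<in> carrier G \<Longrightarrow> 0 \<le> ell g"
  and ell_eq_zero: "g \<in> carrier G \<Longrightarrow> ell g = 0 \<longleftrightarrow> g = \<one>"
  and ell_inv: "g \<in> carrier G \<Longrightarrow> ell (inv g) = ell g"
  and ell_mult: "\<lbrakk>g \<in> carrier G; h \<in> carrier G\<rbrakk> \<Longrightarrow> ell (g \<otimes> h) \<le> ell g + ell h"
  using length by (auto simp: length_function_def)

text \<open>The left-invariant distance that \<open>length_dist\<close> expresses in
  \<open>ennreal\<close>, with the arguments exchanged.\<close>

definition gap :: "'g \<Rightarrow> 'g \<Rightarrow> real" where "gap h g = ell (inv h \<otimes> g)"

lemma gap_nonneg: "\<lbrakk>g \<in> carrier G; h \<in> carrier G\<rbrakk> \<Longrightarrow> 0 \<le> gap h g"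
  unfolding gap_def by (intro ell_nonneg m_closed inv_closed)

lemma gap_refl: "g \<in> carrier G \<Longrightarrow> gap g g = 0"
  by (simp add: gap_def ell_eq_zero)

lemma gap_commute: "\<lbrakk>g \<in> carrier G; h \<in> carrier G\<rbrakk> \<Longrightarrow> gap h g = gap g h"
  using ell_inv[of "inv h \<otimes> g"] by (simp add: gap_def inv_mult_group)

lemma gap_triangle:
  assumes "g \<in> carrier G" "h \<in> carrier G" "k \<in> carrier G"
  shows "gap g k \<le> gap g h + gap h k"
proof -
  have "inv g \<otimes> k = (inv g \<otimes> h) \<otimes> (inv h \<otimes> k)" using assms by (simp add: m_assoc) (simp flip: m_assoc)
  then show ?thesis unfolding gap_def using ell_mult[of "inv g \<otimes> h" "inv h \<otimes> k"] assms by simp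
qed

lemma ell_le_gap: "\<lbrakk>g \<in> carrier G; h \<in> carrier G\<rbrakk> \<Longrightarrow> ell g \<le> ell h + gap h g"
  using ell_mult[of h "inv h \<otimes> g"] by (simp add: gap_def flip: m_assoc)

text \<open>The inverse of \<open>h g\<close> times \<open>s t\<close> is a conjugate of
  \<open>inv h s\<close> times \<open>inv g t\<close>. Here invariance of \<open>ell\<close> under
  conjugation enters, and it makes multiplication jointly continuous for the distance.\<close>

lemma gap_mult:
  assumes c: "g \<in> carrier G" "h \<in> carrier G" "s \<in> carrier G" "t \<in> carrier G"
  shows "gap (h \<otimes> g) (s \<otimes> t) \<le> gap h s + gap g t"
proof -
  have "inv (h \<otimes> g) \<otimes> (s \<otimes> t) = (inv g \<otimes> (inv h \<otimes> s) \<otimes> inv (inv g)) \<otimes> (inv g \<otimes> t)"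
  proof -
    have "g \<otimes> (inv g \<otimes> t) = t" using c by (simp flip: m_assoc)
    then show ?thesis using c by (simp add: inv_mult_group m_assoc)
  qed
  then have "gap (h \<otimes> g) (s \<otimes> t) \<le> ell (inv g \<otimes> (inv h \<otimes> s) \<otimes> inv (inv g)) + gap g t"
    unfolding gap_def using ell_mult[of "inv g \<otimes> (inv h \<otimes> s) \<otimes> inv (inv g)" "inv g \<otimes> t"] c by simp
  also have "ell (inv g \<otimes> (inv h \<otimes> s) \<otimes> inv (inv g)) = gap h s"
    unfolding gap_def by (rule ell_conj) (use c in simp_all)
  finally show ?thesis .
qed

lemma gap_continuous: assumes "g \<in> carrier G" shows "continuous_map T euclideanreal (\<lambda>x. gap g x)"
proof -
  have "continuous_map T (prod_topology T T) (\<lambda>x. (inv g, x))"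
    using assms topspace_carrier by (intro continuous_map_pairedI continuous_map_const[THEN iffD2] continuous_map_id[unfolded id_def]) auto
  from continuous_map_compose[OF continuous_map_compose[OF this continuous_mult] ell_continuous]
  show ?thesis by (simp add: o_def gap_def)
qed

lemma openin_gap_ball: "g \<in> carrier G \<Longrightarrow> openin T {x \<in> carrier G. gap g x < r}"
  using openin_continuous_map_preimage[OF gap_continuous, of g "{..<r}"] topspace_carrier by simp

end

section \<open>The ultralimit of the subgroups\<close>

locale subgroup_ultralimit =
  compact_length_group G T ell + U: ultrafilter U
  for G :: "'g monoid" (structure) and T :: "'g topology" and ell :: "'g \<Rightarrow> real" and U :: "nat filter" +
  fixes H :: "nat \<Rightarrow> 'g set"
  assumes U_sequentially: "U \<le> sequentially"
    and subgroups: "subgroup (H n) G"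
begin

lemma H_carrier: "h \<in> H n \<Longrightarrow> h \<in> carrier G"
  using subgroup.mem_carrier[OF subgroups] .

text \<open>The points of \<open>G\<close> that the \<open>H n\<close> approach along
  \<open>U\<close>. The set is seen to be a subgroup through its membership in the collection, whose
  members are subgroups.\<close>

definition limit_group :: "'g set" where
  "limit_group = {h \<in> carrier G. \<forall>e>0. \<forall>\<^sub>F n in U. \<exists>s\<in>H n. gap h s < e}"

definition converges :: "(nat \<Rightarrow> 'g) \<Rightarrow> 'g \<Rightarrow> bool" where
  "converges \<sigma> h \<longleftrightarrow> ((\<lambda>n. gap h (\<sigma> n)) \<longlongrightarrow> 0) U"

lemma limit_group_carrier: "h \<in> limit_group \<Longrightarrow> h \<in> carrier G"
  by (simp add: limit_group_def)

lemma limit_groupD: "\<lbrakk>h \<in> limit_group; e > 0\<rbrakk> \<Longrightarrow> \<forall>\<^sub>F n in U. \<exists>s\<in>H n. gap h s < e"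
  by (simp add: limit_group_def)

text \<open>Points \<open>\<sigma> n\<close> whose distance to \<open>h\<close> exceeds the infimum
  over \<open>H n\<close> by less than \<open>1 / (n + 1)\<close> serve all tolerances at
  once.\<close>

lemma limit_group_sequence:
  assumes h: "h \<in> limit_group"
  obtains \<sigma> where "\<And>n. \<sigma> n \<in> H n" "converges \<sigma> h"
proof -
  note hc = limit_group_carrier[OF h]
  define \<iota> where "\<iota> n = (INF s\<in>H n. gap h s)" for n
  define \<epsilon> :: "nat \<Rightarrow> real" where "\<epsilon> k = 1 / (real k + 1)" for k
  have \<epsilon>: "\<epsilon> k > 0" for k by (simp add: \<epsilon>_def)
  have elim: "(\<epsilon> \<longlongrightarrow> 0) U" by (rule tendsto_mono[OF U_sequentially]) (unfold \<epsilon>_def, real_asymp)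
  have bdd: "bdd_below (gap h ` H n)" for n
    by (intro bdd_belowI2[of _ 0] gap_nonneg hc H_carrier)
  have ne: "H n \<noteq> {}" for n using subgroup.one_closed[OF subgroups] by blast
  have "\<exists>s\<in>H n. gap h s < \<iota> n + \<epsilon> n" for n
  proof (rule cINF_less_iff[THEN iffD1, OF ne bdd])
    show "(INF s\<in>H n. gap h s) < \<iota> n + \<epsilon> n" using \<epsilon>[of n] by (simp add: \<iota>_def)
  qed
  then obtain \<sigma> where \<sigma>: "\<And>n. \<sigma> n \<in> H n" "\<And>n. gap h (\<sigma> n) < \<iota> n + \<epsilon> n" by metis
  have "converges \<sigma> h" unfolding converges_def
  proof (rule order_tendstoI)
    fix a :: real assume a: "a < 0"
    have "a < gap h (\<sigma> n)" for n using gap_nonneg[OF H_carrier[OF \<sigma>(1)] hc] a by (rule order_less_le_trans[rotated])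
    then show "\<forall>\<^sub>F n in U. a < gap h (\<sigma> n)" by simp
  next
    fix a :: real assume a: "0 < a"
    have 1: "\<forall>\<^sub>F n in U. \<exists>s\<in>H n. gap h s < a/2" by (rule limit_groupD[OF h]) (use a in simp)
    have 2: "\<forall>\<^sub>F n in U. \<epsilon> n < a/2" using elim a by (intro order_tendstoD) auto
    show "\<forall>\<^sub>F n in U. gap h (\<sigma> n) < a" using 1 2
    proof eventually_elim
      case (elim n)
      then obtain s where s: "s \<in> H n" "gap h s < a/2" by blast
      have "\<iota> n \<le> gap h s" unfolding \<iota>_def by (rule cINF_lower[OF bdd s(1)])
      then show ?case using \<sigma>(2)[of n] s(2) elim(2) by simp
    qed
  qed
  then show ?thesis using that[OF \<sigma>(1)] by blast
qed

text \<open>If no point were a limit, each would have a ball that \<open>\<sigma>\<close> avoids on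
  a set of the ultrafilter; finitely many of these balls cover the compact group, and then some
  \<open>\<sigma> n\<close> lies in none of them.\<close>

lemma sequence_limit:
  assumes \<sigma>: "\<And>n. \<sigma> n \<in> carrier G"
  obtains h where "h \<in> carrier G" "converges \<sigma> h"
proof (rule ccontr)
  assume "\<not> thesis"
  then have no: "\<not> converges \<sigma> h" if "h \<in> carrier G" for h using that \<open>\<And>h. h \<in> carrier G \<Longrightarrow> converges \<sigma> h \<Longrightarrow> thesis\<close> by blast
  have "\<exists>e>0. \<forall>\<^sub>F n in U. \<not> gap h (\<sigma> n) < e" if h: "h \<in> carrier G" for h
  proof (rule ccontr)
    assume "\<not> ?thesis"
    then have small: "\<forall>\<^sub>F n in U. gap h (\<sigma> n) < e" if "e > 0" for e using that U.ultra[of "\<lambda>n. gap h (\<sigma> n) < e"] by blast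
    have "converges \<sigma> h" unfolding converges_def
    proof (rule order_tendstoI)
      fix a :: real assume a: "a < 0"
      have "a < gap h (\<sigma> n)" for n using gap_nonneg[OF \<sigma> h] a by (rule order_less_le_trans[rotated])
      then show "\<forall>\<^sub>F n in U. a < gap h (\<sigma> n)" by simp
    qed (rule small)
    then show False using no[OF h] by blast
  qed
  then obtain e where e: "\<And>h. h \<in> carrier G \<Longrightarrow> e h > 0" "\<And>h. h \<in> carrier G \<Longrightarrow> \<forall>\<^sub>F n in U. \<not> gap h (\<sigma> n) < e h" by metis
  define V where "V h = {x \<in> carrier G. gap h x < e h}" for h
  have "topspace T \<subseteq> \<Union> (V ` carrier G)"
    using e(1) gap_refl topspace_carrier by (auto simp: V_def)
  moreover have "openin T W" if "W \<in> V ` carrier G" for W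
    using that openin_gap_ball unfolding V_def by blast
  ultimately obtain \<F> where \<F>: "finite \<F>" "\<F> \<subseteq> V ` carrier G" "topspace T \<subseteq> \<Union>\<F>"
    using compact unfolding compact_space_def compactin_def by meson
  obtain I where I: "finite I" "I \<subseteq> carrier G" "\<F> = V ` I" using finite_subset_image[OF \<F>(1,2)] by blast
  have "\<forall>\<^sub>F n in U. \<forall>h\<in>I. \<not> gap h (\<sigma> n) < e h"
    using e(2) I by (intro eventually_ball_finite ballI) blast+
  then obtain n where n: "\<forall>h\<in>I. \<not> gap h (\<sigma> n) < e h" using eventually_happens'[OF U.proper] by blast
  have "\<sigma> n \<in> \<Union> (V ` I)" using \<sigma>[of n] \<F>(3) I(3) topspace_carrier by blast
  then show False using n unfolding V_def by blast
qed

lemma sequence_limit_in_limit_group: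
  assumes \<sigma>: "\<And>n. \<sigma> n \<in> H n"
  obtains h where "h \<in> limit_group" "converges \<sigma> h"
proof -
  obtain h where h: "h \<in> carrier G" "converges \<sigma> h" using sequence_limit[of \<sigma>, OF H_carrier[OF \<sigma>]] by blast
  have "\<forall>\<^sub>F n in U. \<exists>s\<in>H n. gap h s < e" if "e > 0" for e
    using order_tendstoD(2)[OF h(2)[unfolded converges_def] that] by eventually_elim (use \<sigma> in blast)
  then have "h \<in> limit_group" using h(1) by (simp add: limit_group_def)
  then show ?thesis using that h(2) by blast
qed

lemma limit_group_closed_under_gap:
  assumes g: "g \<in> carrier G" and near: "\<And>e. e > 0 \<Longrightarrow> \<exists>k\<in>limit_group. gap g k < e"
  shows "g \<in> limit_group"
proof -
  have "\<forall>\<^sub>F n in U. \<exists>s\<in>H n. gap g s < e" if e: "e > 0" for e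
  proof -
    obtain k where k: "k \<in> limit_group" "gap g k < e/2" using near[of "e/2"] e by auto
    have "\<forall>\<^sub>F n in U. \<exists>s\<in>H n. gap k s < e/2" by (rule limit_groupD[OF k(1)]) (use e in simp)
    then show ?thesis
    proof eventually_elim
      case (elim n)
      then obtain s where s: "s \<in> H n" "gap k s < e/2" by blast
      then have "gap g s < e" using gap_triangle[OF g limit_group_carrier[OF k(1)] H_carrier[OF s(1)]] k(2) by simp
      then show ?case using s(1) by blast
    qed
  qed
  then show ?thesis using g by (simp add: limit_group_def)
qed

lemma closedin_limit_group: "closedin T limit_group"
  unfolding closedin_def
proof
  show "limit_group \<subseteq> topspace T" using limit_group_carrier topspace_carrier by blast
  show "openin T (topspace T - limit_group)"
  proof (subst openin_subopen, intro ballI)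
    fix g assume g: "g \<in> topspace T - limit_group"
    then have gc: "g \<in> carrier G" using topspace_carrier by blast
    obtain e where e: "e > 0" "\<And>k. k \<in> limit_group \<Longrightarrow> \<not> gap g k < e"
      using limit_group_closed_under_gap[OF gc] g by blast
    show "\<exists>V. openin T V \<and> g \<in> V \<and> V \<subseteq> topspace T - limit_group"
      using openin_gap_ball[OF gc, of e] e gc gap_refl[OF gc] topspace_carrier
      by (intro exI[of _ "{x \<in> carrier G. gap g x < e}"]) auto
  qed
qed

text \<open>Otherwise points that violate one of the two halves exist for almost all
  \<open>n\<close>; by compactness they converge along \<open>U\<close>, and their limit, which lies
  in the limit group, contradicts the choice.\<close>

lemma hausdorff_limit_group:
  assumes e: "e > 0"
  shows "\<forall>\<^sub>F n in U. hausdorff_dist (length_dist G ell) (H n) limit_group \<le> ennreal e"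
proof -
  have 1: "\<forall>\<^sub>F n in U. \<forall>s\<in>H n. \<exists>k\<in>limit_group. gap k s < e"
  proof (rule ccontr)
    assume "\<not> ?thesis"
    then have bad: "\<forall>\<^sub>F n in U. \<exists>s\<in>H n. \<forall>k\<in>limit_group. \<not> gap k s < e"
      unfolding U.not_eventually_iff by simp
    \<comment> \<open>The default \<open>\<one>\<close> keeps \<open>\<sigma> n\<close> in
      \<open>H n\<close> at indices without a violating point.\<close>
    define \<sigma> where "\<sigma> n = (if \<exists>s\<in>H n. \<forall>k\<in>limit_group. \<not> gap k s < e
      then SOME s. s \<in> H n \<and> (\<forall>k\<in>limit_group. \<not> gap k s < e) else \<one>)" for n
    have \<sigma>: "\<sigma> n \<in> H n \<and> ((\<exists>s\<in>H n. \<forall>k\<in>limit_group. \<not> gap k s < e) \<longrightarrow> (\<forall>k\<in>limit_group. \<not> gap k (\<sigma> n) < e))" for n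
    proof (cases "\<exists>s\<in>H n. \<forall>k\<in>limit_group. \<not> gap k s < e")
      case True
      then have "\<exists>s. s \<in> H n \<and> (\<forall>k\<in>limit_group. \<not> gap k s < e)" by blast
      from someI_ex[OF this] show ?thesis using True by (simp add: \<sigma>_def)
    next
      case False
      then have "\<sigma> n = \<one>" unfolding \<sigma>_def by (simp only: if_False)
      then have "\<sigma> n \<in> H n" using subgroup.one_closed[OF subgroups] by simp
      then show ?thesis using False by blast
    qed
    obtain h where h: "h \<in> limit_group" "converges \<sigma> h"
      using sequence_limit_in_limit_group[of \<sigma>, OF \<sigma>[THEN conjunct1]] by blast
    have "\<forall>\<^sub>F n in U. gap h (\<sigma> n) < e" using h(2) e unfolding converges_def by (rule order_tendstoD)
    then have "\<forall>\<^sub>F n in U. False" using bad by eventually_elim (use \<sigma> h(1) in blast)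
    then show False using U.proper by simp
  qed
  have 2: "\<forall>\<^sub>F n in U. \<forall>k\<in>limit_group. \<exists>s\<in>H n. gap k s < e"
  proof (rule ccontr)
    assume "\<not> ?thesis"
    then have bad: "\<forall>\<^sub>F n in U. \<exists>k\<in>limit_group. \<forall>s\<in>H n. \<not> gap k s < e"
      unfolding U.not_eventually_iff by simp
    \<comment> \<open>Here the violating points lie in the limit group, and the default
      \<open>\<one>\<close> just keeps the sequence in \<open>G\<close>.\<close>
    define \<sigma> where "\<sigma> n = (if \<exists>k\<in>limit_group. \<forall>s\<in>H n. \<not> gap k s < e
      then SOME k. k \<in> limit_group \<and> (\<forall>s\<in>H n. \<not> gap k s < e) else \<one>)" for n
    have \<sigma>: "\<sigma> n \<in> carrier G \<and> ((\<exists>k\<in>limit_group. \<forall>s\<in>H n. \<not> gap k s < e) \<longrightarrow> \<sigma> n \<in> limit_group \<and> (\<forall>s\<in>H n. \<not> gap (\<sigma> n) s < e))" for n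
    proof (cases "\<exists>k\<in>limit_group. \<forall>s\<in>H n. \<not> gap k s < e")
      case True
      then have "\<exists>k. k \<in> limit_group \<and> (\<forall>s\<in>H n. \<not> gap k s < e)" by blast
      from someI_ex[OF this] show ?thesis using True limit_group_carrier by (simp add: \<sigma>_def)
    next
      case False
      then have "\<sigma> n = \<one>" unfolding \<sigma>_def by (simp only: if_False)
      then have "\<sigma> n \<in> carrier G" by simp
      then show ?thesis using False by blast
    qed
    have bad': "\<forall>\<^sub>F n in U. \<sigma> n \<in> limit_group \<and> (\<forall>s\<in>H n. \<not> gap (\<sigma> n) s < e)"
      using bad by eventually_elim (use \<sigma> in blast)
    obtain k where k: "k \<in> carrier G" "converges \<sigma> k"
      using sequence_limit[of \<sigma>, OF \<sigma>[THEN conjunct1]] by blast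
    have close: "\<forall>\<^sub>F n in U. gap k (\<sigma> n) < r" if "r > 0" for r
      using k(2) that unfolding converges_def by (rule order_tendstoD)
    have kl: "k \<in> limit_group"
    proof (rule limit_group_closed_under_gap[OF k(1)])
      fix r :: real assume "r > 0"
      from eventually_happens'[OF U.proper eventually_conj[OF close[OF this] bad']]
      show "\<exists>k'\<in>limit_group. gap k k' < r" by blast
    qed
    have half: "e/2 > 0" using e by simp
    have "\<forall>\<^sub>F n in U. \<exists>s\<in>H n. gap k s < e/2" by (rule limit_groupD[OF kl half])
    then have "\<forall>\<^sub>F n in U. False" using close[OF half] bad'
    proof eventually_elim
      case (elim n)
      then obtain s where s: "s \<in> H n" "gap k s < e/2" by blast
      have "gap (\<sigma> n) s \<le> gap (\<sigma> n) k + gap k s"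
        by (rule gap_triangle[OF \<sigma>[THEN conjunct1] k(1) H_carrier[OF s(1)]])
      also have "gap (\<sigma> n) k = gap k (\<sigma> n)" by (rule gap_commute[OF k(1) \<sigma>[THEN conjunct1]])
      finally have "gap (\<sigma> n) s < e" using s(2) elim(2) by simp
      then show False using elim(3) s(1) by blast
    qed
    then show False using U.proper by simp
  qed
  show ?thesis using 1 2
  proof eventually_elim
    case (elim n)
    have "(INF y\<in>limit_group. length_dist G ell x y) \<le> ennreal e" if x: "x \<in> H n" for x
    proof -
      obtain k where k: "k \<in> limit_group" "gap k x < e" using elim(1) x by blast
      have "(INF y\<in>limit_group. length_dist G ell x y) \<le> length_dist G ell x k" by (rule INF_lower[OF k(1)])
      also have "\<dots> \<le> ennreal e" using k(2) unfolding length_dist_def gap_def by (intro ennreal_leI) simp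
      finally show ?thesis .
    qed
    moreover have "(INF x\<in>H n. length_dist G ell x y) \<le> ennreal e" if y: "y \<in> limit_group" for y
    proof -
      obtain s where s: "s \<in> H n" "gap y s < e" using elim(2) y by blast
      have "(INF x\<in>H n. length_dist G ell x y) \<le> length_dist G ell s y" by (rule INF_lower[OF s(1)])
      also have "\<dots> \<le> ennreal e" using s(2) unfolding length_dist_def gap_def by (intro ennreal_leI) simp
      finally show ?thesis .
    qed
    ultimately show ?case unfolding hausdorff_dist_def by (intro max.boundedI SUP_least)
  qed
qed

text \<open>Closedness of the collection speaks of ordinary sequences, while convergence is known
  along \<open>U\<close>. One index \<open>\<nu> k\<close> for every tolerance
  \<open>\<epsilon> k\<close> gives such a sequence, possibly with repetitions.\<close>

lemma limit_group_in_closed_collection: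
  assumes H: "\<And>n. H n \<in> \<G>" and closed: "hausdorff_closed G T ell \<G>"
  shows "limit_group \<in> \<G>"
proof -
  define \<epsilon> :: "nat \<Rightarrow> real" where "\<epsilon> k = 1 / (real k + 1)" for k
  have \<epsilon>: "\<epsilon> k > 0" for k by (simp add: \<epsilon>_def)
  have elim: "\<epsilon> \<longlonglongrightarrow> 0" unfolding \<epsilon>_def by real_asymp
  have "\<exists>n. hausdorff_dist (length_dist G ell) (H n) limit_group \<le> ennreal (\<epsilon> k)" for k
    using eventually_happens'[OF U.proper hausdorff_limit_group[OF \<epsilon>]] .
  then obtain \<nu> where \<nu>: "\<And>k. hausdorff_dist (length_dist G ell) (H (\<nu> k)) limit_group \<le> ennreal (\<epsilon> k)" by metis
  have "(\<lambda>k. hausdorff_dist (length_dist G ell) (H (\<nu> k)) limit_group) \<longlonglongrightarrow> 0"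
  proof (rule tendsto_sandwich[OF _ _ tendsto_const])
    show "(\<lambda>k. ennreal (\<epsilon> k)) \<longlonglongrightarrow> 0" using tendsto_ennrealI[OF elim] by simp
  qed (use \<nu> in simp_all)
  then show ?thesis using closed H closedin_limit_group unfolding hausdorff_closed_def
    by (elim allE[of _ "\<lambda>k. H (\<nu> k)"] allE[of _ limit_group]) simp
qed

lemma converges_mult:
  assumes \<sigma>: "\<And>n. \<sigma> n \<in> H n" "converges \<sigma> h" "h \<in> carrier G" and \<tau>: "\<And>n. \<tau> n \<in> H n" "converges \<tau> g" "g \<in> carrier G"
  shows "converges (\<lambda>n. \<sigma> n \<otimes> \<tau> n) (h \<otimes> g)"
  unfolding converges_def
proof (rule tendsto_sandwich[OF _ _ tendsto_const])
  show "((\<lambda>n. gap h (\<sigma> n) + gap g (\<tau> n)) \<longlongrightarrow> 0) U"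
    using tendsto_add[OF \<sigma>(2)[unfolded converges_def] \<tau>(2)[unfolded converges_def]] by simp
  show "\<forall>\<^sub>F n in U. gap (h \<otimes> g) (\<sigma> n \<otimes> \<tau> n) \<le> gap h (\<sigma> n) + gap g (\<tau> n)"
    by (intro always_eventually allI gap_mult \<sigma>(3) \<tau>(3) H_carrier[OF \<sigma>(1)] H_carrier[OF \<tau>(1)])
  show "\<forall>\<^sub>F n in U. 0 \<le> gap (h \<otimes> g) (\<sigma> n \<otimes> \<tau> n)"
    by (intro always_eventually allI gap_nonneg m_closed \<sigma>(3) \<tau>(3) H_carrier[OF \<sigma>(1)] H_carrier[OF \<tau>(1)])
qed

lemma converges_gap:
  assumes \<sigma>: "\<And>n. \<sigma> n \<in> H n" "converges \<sigma> h" and \<tau>: "\<And>n. \<tau> n \<in> H n" "converges \<tau> h" and h: "h \<in> carrier G"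
  shows "((\<lambda>n. gap (\<tau> n) (\<sigma> n)) \<longlongrightarrow> 0) U"
proof (rule tendsto_sandwich[OF _ _ tendsto_const])
  show "((\<lambda>n. gap h (\<tau> n) + gap h (\<sigma> n)) \<longlongrightarrow> 0) U"
    using tendsto_add[OF \<tau>(2)[unfolded converges_def] \<sigma>(2)[unfolded converges_def]] by simp
  have "gap (\<tau> n) (\<sigma> n) \<le> gap h (\<tau> n) + gap h (\<sigma> n)" for n
    using gap_triangle[OF H_carrier[OF \<tau>(1)[of n]] h H_carrier[OF \<sigma>(1)[of n]]] gap_commute[OF H_carrier[OF \<tau>(1)[of n]] h] by simp
  then show "\<forall>\<^sub>F n in U. gap (\<tau> n) (\<sigma> n) \<le> gap h (\<tau> n) + gap h (\<sigma> n)" by simp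
  show "\<forall>\<^sub>F n in U. 0 \<le> gap (\<tau> n) (\<sigma> n)"
    by (intro always_eventually allI gap_nonneg H_carrier[OF \<sigma>(1)] H_carrier[OF \<tau>(1)])
qed

lemma converges_one: "converges (\<lambda>_. \<one>) \<one>"
  by (simp add: converges_def gap_refl)

end

section \<open>Limits of actions along tunnels\<close>

lemma (in tunnel_leg) lip_bounded_image:
  assumes d: "lip_bounded D LD l d" shows "lip_bounded A LA l (\<pi> d)"
proof -
  note dd = D.lip_boundedD[OF d]
  have "LA (\<pi> (re_part D d)) \<le> ennreal l" "LA (\<pi> (im_part D d)) \<le> ennreal l"
    by (rule order_trans[OF lip_image_le[OF D.re_part_self_adjoint[OF dd(1)]] dd(4)],
        rule order_trans[OF lip_image_le[OF D.im_part_self_adjoint[OF dd(1)]] dd(5)])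
  then show ?thesis using hom_contractive[OF dd(1)] dd(1,2)
    by (simp add: lip_bounded_def hom_re_part hom_im_part)
qed

text \<open>Hypothesis (i) without the quotient, so that the unit of the group needs no separate
  treatment.\<close>

locale dominated_action = lip_action F A L G H \<alpha>
  for F :: "ennreal \<Rightarrow> ennreal \<Rightarrow> ennreal \<Rightarrow> ennreal \<Rightarrow> ennreal"
    and A :: "'a cstar" and L :: "'a \<Rightarrow> ennreal" and G :: "'g monoid"
    and H :: "'g set" and \<alpha> :: "'g \<Rightarrow> 'a \<Rightarrow> 'a" +
  fixes ell :: "'g \<Rightarrow> real"
  assumes dominated: "\<lbrakk>h \<in> H; a \<in> self_adjoint A; L a \<le> ennreal l; 0 \<le> l\<rbrakk> \<Longrightarrow>
      cnorm A (a \<ominus>\<^bsub>A\<^esub> \<alpha> h a) \<le> l * ell h"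
    and erg: "ergodic H A \<alpha>"
begin

text \<open>The two parts contribute \<open>l * ell h\<close> each, hence the factor 2; where the
  sharp constant matters, the assumption on self-adjoint elements is used directly.\<close>

lemma displacement:
  assumes x: "lip_bounded A L l x" and h: "h \<in> H"
  shows "cnorm A (x \<ominus>\<^bsub>A\<^esub> \<alpha> h x) \<le> 2 * l * ell h"
proof -
  interpret ah: star_homomorphism A A "\<alpha> h" by (rule act_hom[OF h])
  note xx = lip_boundedD[OF x]
  define y where "y = x \<ominus>\<^bsub>A\<^esub> \<alpha> h x"
  have hx: "\<alpha> h x \<in> carrier A" by (rule ah.hom_closed[OF xx(1)])
  have y: "y \<in> carrier A" unfolding y_def using xx(1) hx by simp
  have eqs: "re_part A y = re_part A x \<ominus>\<^bsub>A\<^esub> \<alpha> h (re_part A x)" "im_part A y = im_part A x \<ominus>\<^bsub>A\<^esub> \<alpha> h (im_part A x)"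
    unfolding y_def ah.hom_re_part[OF xx(1)] ah.hom_im_part[OF xx(1)]
    unfolding re_part_def im_part_def
    by (rule eq_by_functionals; use xx(1) hx in \<open>auto simp: adj_simps linear_functional_simps field_simps\<close>)+
  have "cnorm A (re_part A y) \<le> l * ell h" "cnorm A (im_part A y) \<le> l * ell h" unfolding eqs
    by (rule dominated[OF h re_part_self_adjoint[OF xx(1)] xx(4,3)],
        rule dominated[OF h im_part_self_adjoint[OF xx(1)] xx(5,3)])
  then show ?thesis using cnorm_le_parts[OF y] by (simp add: y_def)
qed

text \<open>The difference is the image under the isometry \<open>\<alpha> g\<close> of the
  displacement of \<open>x\<close> by \<open>inv g h\<close>.\<close>

lemma dist_act:
  assumes x: "lip_bounded A L l x" and gh: "g \<in> H" "h \<in> H"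
  shows "cnorm A (\<alpha> g x \<ominus>\<^bsub>A\<^esub> \<alpha> h x) \<le> 2 * l * ell (inv\<^bsub>G\<^esub> g \<otimes>\<^bsub>G\<^esub> h)"
proof -
  note xc = lip_boundedD(1)[OF x]
  have k: "inv\<^bsub>G\<^esub> g \<otimes>\<^bsub>G\<^esub> h \<in> H"
    by (rule subgroup.m_closed[OF subgroup subgroup.m_inv_closed[OF subgroup gh(1)] gh(2)])
  have "g \<otimes>\<^bsub>G\<^esub> (inv\<^bsub>G\<^esub> g \<otimes>\<^bsub>G\<^esub> h) = h"
    using gh subgroup.mem_carrier[OF subgroup] by (simp flip: G.m_assoc)
  then have "\<alpha> h x = \<alpha> g (\<alpha> (inv\<^bsub>G\<^esub> g \<otimes>\<^bsub>G\<^esub> h) x)" using act_mult[OF gh(1) k xc] by simp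
  then have "cnorm A (\<alpha> g x \<ominus>\<^bsub>A\<^esub> \<alpha> h x) = cnorm A (x \<ominus>\<^bsub>A\<^esub> \<alpha> (inv\<^bsub>G\<^esub> g \<otimes>\<^bsub>G\<^esub> h) x)"
    using act_dist[OF gh(1) xc act_closed[OF k xc]] by simp
  then show ?thesis using displacement[OF x k] by simp
qed

end

section \<open>Sequences of tunnels\<close>

text \<open>One leg of every tunnel. The two legs become two instances that share \<open>D\<close>:
  one ends in the varying \<open>A n\<close>, the other in the constant \<open>B\<close>.\<close>

locale tunnel_sequence = U: ultrafilter U for U :: "nat filter" +
  fixes F :: "ennreal \<Rightarrow> ennreal \<Rightarrow> ennreal \<Rightarrow> ennreal \<Rightarrow> ennreal"
    and D :: "nat \<Rightarrow> 'd cstar" and LD :: "nat \<Rightarrow> 'd \<Rightarrow> ennreal"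
    and A :: "nat \<Rightarrow> 'a cstar" and LA :: "nat \<Rightarrow> 'a \<Rightarrow> ennreal"
    and \<pi> :: "nat \<Rightarrow> 'd \<Rightarrow> 'a" and \<epsilon> :: "nat \<Rightarrow> real"
  assumes legs: "tunnel_leg F (D n) (LD n) (A n) (LA n) (\<pi> n) (\<epsilon> n)"
    and \<epsilon>_limit: "(\<epsilon> \<longlongrightarrow> 0) U"
begin

sublocale leg: tunnel_leg F "D n" "LD n" "A n" "LA n" "\<pi> n" "\<epsilon> n" for n by (rule legs)

sublocale FD: cstar_family D by (rule cstar_family.intro) (rule leg.D.unital_cstar_algebra_axioms)

sublocale FA: cstar_family A by (rule cstar_family.intro) (rule leg.A.unital_cstar_algebra_axioms)

lemma near_down:
  assumes c: "\<And>n. d n \<in> carrier (D n)" "\<And>n. e n \<in> carrier (D n)" and near: "near U D d e"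
  shows "near U A (\<lambda>n. \<pi> n (d n)) (\<lambda>n. \<pi> n (e n))"
proof (rule FA.near_if_bounded)
  show "\<forall>\<^sub>F n in U. cnorm (A n) (\<pi> n (d n) \<ominus>\<^bsub>A n\<^esub> \<pi> n (e n)) \<le> cnorm (D n) (d n \<ominus>\<^bsub>D n\<^esub> e n)"
  proof (intro always_eventually allI)
    fix n
    show "cnorm (A n) (\<pi> n (d n) \<ominus>\<^bsub>A n\<^esub> \<pi> n (e n)) \<le> cnorm (D n) (d n \<ominus>\<^bsub>D n\<^esub> e n)"
      using leg.hom_contractive[OF leg.D.minus_closed[OF c(1)[of n] c(2)[of n]]] leg.hom_minus[OF c(1)[of n] c(2)[of n]] by simp
  qed
  show "((\<lambda>n. cnorm (D n) (d n \<ominus>\<^bsub>D n\<^esub> e n)) \<longlongrightarrow> 0) U" using near by (simp add: near_def)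
qed (rule leg.hom_closed c)+

text \<open>Images determine Lipschitz lifts up to null sequences: the difference has Lipschitz
  constant \<open>l + 2 * l\<close>, and the error in the norm estimate of the leg vanishes with
  \<open>\<epsilon> n\<close>.\<close>

lemma near_up:
  assumes d: "\<And>n. lip_bounded (D n) (LD n) l (d n)" and e: "\<And>n. lip_bounded (D n) (LD n) l (e n)" and l: "l > 0"
    and near: "near U A (\<lambda>n. \<pi> n (d n)) (\<lambda>n. \<pi> n (e n))"
  shows "near U D d e"
proof -
  note c = leg.D.lip_boundedD(1)[OF d] leg.D.lip_boundedD(1)[OF e]
  show ?thesis
  proof (rule FD.near_if_bounded)
    show "\<forall>\<^sub>F n in U. cnorm (D n) (d n \<ominus>\<^bsub>D n\<^esub> e n)
      \<le> 2 * cnorm (A n) (\<pi> n (d n) \<ominus>\<^bsub>A n\<^esub> \<pi> n (e n)) + 2 * ((l + 2 * l) * \<epsilon> n)"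
    proof (intro always_eventually allI)
      fix n
      have "cnorm (D n) (d n \<ominus>\<^bsub>D n\<^esub> e n) \<le> 2 * cnorm (A n) (\<pi> n (d n \<ominus>\<^bsub>D n\<^esub> e n)) + 2 * ((l + 2 * l) * \<epsilon> n)"
        by (rule leg.cnorm_le[OF leg.D.lip_bounded_minus[OF d e]]) (use l in simp)
      then show "cnorm (D n) (d n \<ominus>\<^bsub>D n\<^esub> e n) \<le> 2 * cnorm (A n) (\<pi> n (d n) \<ominus>\<^bsub>A n\<^esub> \<pi> n (e n)) + 2 * ((l + 2 * l) * \<epsilon> n)"
        unfolding leg.hom_minus[OF c(1)[of n] c(2)[of n]] .
    qed
    have "((\<lambda>n. 2 * cnorm (A n) (\<pi> n (d n) \<ominus>\<^bsub>A n\<^esub> \<pi> n (e n)) + 2 * ((l + 2 * l) * \<epsilon> n)) \<longlongrightarrow> 2 * 0 + 2 * ((l + 2 * l) * 0)) U"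
      by (intro tendsto_add tendsto_mult tendsto_const near[unfolded near_def] \<epsilon>_limit)
    then show "((\<lambda>n. 2 * cnorm (A n) (\<pi> n (d n) \<ominus>\<^bsub>A n\<^esub> \<pi> n (e n)) + 2 * ((l + 2 * l) * \<epsilon> n)) \<longlongrightarrow> 0) U" by simp
  qed (rule c)+
qed

end

section \<open>The limit relation\<close>

locale action_limit =
  subgroup_ultralimit G T ell U H +
  L: tunnel_sequence U F D LD A LA \<pi>A \<epsilon> +
  R: tunnel_sequence U F D LD "\<lambda>_. B" "\<lambda>_. LB" \<pi>B \<epsilon>
  for G :: "'g monoid" (structure) and T :: "'g topology" and ell :: "'g \<Rightarrow> real" and U :: "nat filter"
    and H :: "nat \<Rightarrow> 'g set"
    and F :: "ennreal \<Rightarrow> ennreal \<Rightarrow> ennreal \<Rightarrow> ennreal \<Rightarrow> ennreal"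
    and D :: "nat \<Rightarrow> 'd cstar" and LD :: "nat \<Rightarrow> 'd \<Rightarrow> ennreal"
    and A :: "nat \<Rightarrow> 'a cstar" and LA :: "nat \<Rightarrow> 'a \<Rightarrow> ennreal"
    and B :: "'b cstar" and LB :: "'b \<Rightarrow> ennreal"
    and \<pi>A :: "nat \<Rightarrow> 'd \<Rightarrow> 'a" and \<pi>B :: "nat \<Rightarrow> 'd \<Rightarrow> 'b" and \<epsilon> :: "nat \<Rightarrow> real" +
  fixes \<alpha> :: "nat \<Rightarrow> 'g \<Rightarrow> 'a \<Rightarrow> 'a"
  assumes actions: "dominated_action F (A n) (LA n) G (H n) (\<alpha> n) ell"
    and F_admissible: "admissible F"
    and F_nondegenerate: "\<exists>x>0. \<exists>y>0. \<exists>lx>0. \<exists>ly>0. F x y lx ly < \<infinity>"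
    and \<epsilon>_le: "\<epsilon> n \<le> 1"
begin

sublocale act: dominated_action F "A n" "LA n" G "H n" "\<alpha> n" ell for n by (rule actions)

definition lifts :: "real \<Rightarrow> (nat \<Rightarrow> 'd) \<Rightarrow> bool" where
  "lifts l d \<longleftrightarrow> (\<forall>n. lip_bounded (D n) (LD n) l (d n))"

lemma liftsD:
  assumes "lifts l d"
  shows "lip_bounded (D n) (LD n) l (d n)" "d n \<in> carrier (D n)" "\<pi>A n (d n) \<in> carrier (A n)" "\<pi>B n (d n) \<in> carrier B"
proof -
  show l: "lip_bounded (D n) (LD n) l (d n)" using assms by (simp add: lifts_def)
  show c: "d n \<in> carrier (D n)" by (rule L.leg.D.lip_boundedD(1)[OF l])
  show "\<pi>A n (d n) \<in> carrier (A n)" "\<pi>B n (d n) \<in> carrier B" by (rule L.leg.hom_closed[OF c], rule R.leg.hom_closed[OF c])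
qed

lemma lifts_mono: "lifts l d \<Longrightarrow> l \<le> m \<Longrightarrow> lifts m d"
  unfolding lifts_def using L.leg.D.lip_bounded_mono by blast

text \<open>\<open>K\<close> is built from \<open>l\<close> and one finite value of
  \<open>F\<close>, so it is the same for all \<open>n\<close>.\<close>

lemma lifts_mult:
  assumes l: "l > 0"
  shows "\<exists>K>0. \<forall>c d. lifts l c \<longrightarrow> lifts l d \<longrightarrow> lifts K (\<lambda>n. c n \<otimes>\<^bsub>D n\<^esub> d n)"
proof -
  obtain x y lx ly where F: "x > 0" "y > 0" "lx > 0" "ly > 0" "F x y lx ly < \<infinity>" using F_nondegenerate by blast
  obtain m where m: "F x y lx ly = ennreal m" "0 \<le> m" using F(5) by (cases "F x y lx ly") auto
  have ex: "\<exists>r>0. ennreal r \<le> z" if "z > 0" for z :: ennreal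
  proof (cases z)
    case (real r)
    then show ?thesis using that by (intro exI[of _ r]) auto
  next
    case top
    then show ?thesis by (intro exI[of _ 1]) auto
  qed
  obtain r1 r2 r3 r4 where r: "r1 > 0" "ennreal r1 \<le> x" "r2 > 0" "ennreal r2 \<le> y" "r3 > 0" "ennreal r3 \<le> lx" "r4 > 0" "ennreal r4 \<le> ly"
    using ex[OF F(1)] ex[OF F(2)] ex[OF F(3)] ex[OF F(4)] by blast
  \<comment> \<open>The \<open>r1\<close>, ..., \<open>r4\<close> are real thresholds below the
    possibly infinite coordinates; \<open>t * l\<close> stays under all four.\<close>
  define t where "t = min (min r1 r2) (min r3 r4) / l"
  have t: "t > 0" "t * l \<le> r1" "t * l \<le> r2" "t * l \<le> r3" "t * l \<le> r4" using r l by (auto simp: t_def)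
  have tl: "ennreal (t * l) \<le> x" "ennreal (t * l) \<le> y" "ennreal (t * l) \<le> lx" "ennreal (t * l) \<le> ly"
    by (rule order_trans[OF ennreal_leI[OF t(2)] r(2)], rule order_trans[OF ennreal_leI[OF t(3)] r(4)],
        rule order_trans[OF ennreal_leI[OF t(4)] r(6)], rule order_trans[OF ennreal_leI[OF t(5)] r(8)])
  have le: "F x y lx ly \<le> ennreal m" using m by simp
  have "lifts (4 * (m / t\<^sup>2) + l * l) (\<lambda>n. c n \<otimes>\<^bsub>D n\<^esub> d n)" if cd: "lifts l c" "lifts l d" for c d
    unfolding lifts_def
  proof
    fix n
    show "lip_bounded (D n) (LD n) (4 * (m / t\<^sup>2) + l * l) (c n \<otimes>\<^bsub>D n\<^esub> d n)"
      by (rule L.leg.D.lip_bounded_mult[OF liftsD(1)[OF cd(1)] liftsD(1)[OF cd(2)] F_admissible le m(2) t(1) tl])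
  qed
  moreover have "4 * (m / t\<^sup>2) + l * l > 0" using m(2) l t(1) by (intro add_nonneg_pos) auto
  ultimately show ?thesis by blast
qed

text \<open>The graph of the limit of the automorphisms \<open>\<alpha>\<^sub>n\<^sup>\<sigma>\<^sup>n\<close>: both sides are read off from Lipschitz
  elements of the tunnels.\<close>

definition limit_rel :: "(nat \<Rightarrow> 'g) \<Rightarrow> ('b \<times> 'b) set" where
  "limit_rel \<sigma> = {(b, b'). b \<in> carrier B \<and> b' \<in> carrier B \<and> (\<exists>l d d'. 0 < l \<and> lifts l d \<and> lifts l d' \<and>
     near U (\<lambda>_. B) (\<lambda>n. \<pi>B n (d n)) (\<lambda>_. b) \<and> near U (\<lambda>_. B) (\<lambda>n. \<pi>B n (d' n)) (\<lambda>_. b') \<and>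
     near U A (\<lambda>n. \<alpha> n (\<sigma> n) (\<pi>A n (d n))) (\<lambda>n. \<pi>A n (d' n)))}"

lemma limit_relI:
  assumes "b \<in> carrier B" "b' \<in> carrier B" "0 < l" "lifts l d" "lifts l d'"
    "near U (\<lambda>_. B) (\<lambda>n. \<pi>B n (d n)) (\<lambda>_. b)" "near U (\<lambda>_. B) (\<lambda>n. \<pi>B n (d' n)) (\<lambda>_. b')"
    "near U A (\<lambda>n. \<alpha> n (\<sigma> n) (\<pi>A n (d n))) (\<lambda>n. \<pi>A n (d' n))"
  shows "(b, b') \<in> limit_rel \<sigma>"
  unfolding limit_rel_def using assms by blast

lemma limit_relE:
  assumes "(b, b') \<in> limit_rel \<sigma>"
  obtains l d d' where "0 < l" "lifts l d" "lifts l d'"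
    "near U (\<lambda>_. B) (\<lambda>n. \<pi>B n (d n)) (\<lambda>_. b)" "near U (\<lambda>_. B) (\<lambda>n. \<pi>B n (d' n)) (\<lambda>_. b')"
    "near U A (\<lambda>n. \<alpha> n (\<sigma> n) (\<pi>A n (d n))) (\<lambda>n. \<pi>A n (d' n))"
  using assms unfolding limit_rel_def by blast

lemma limit_rel_carrier: "(b, b') \<in> limit_rel \<sigma> \<Longrightarrow> b \<in> carrier B" "(b, b') \<in> limit_rel \<sigma> \<Longrightarrow> b' \<in> carrier B"
  by (auto simp: limit_rel_def)

lemma act_carrier:
  assumes "\<sigma> n \<in> H n" "lifts l d" shows "\<alpha> n (\<sigma> n) (\<pi>A n (d n)) \<in> carrier (A n)"
  by (rule act.act_closed[OF assms(1) liftsD(3)[OF assms(2)]])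

lemma limit_rel_add:
  assumes \<sigma>: "\<And>n. \<sigma> n \<in> H n" and b: "(b, b') \<in> limit_rel \<sigma>" and c: "(c, c') \<in> limit_rel \<sigma>"
  shows "(b \<oplus>\<^bsub>B\<^esub> c, b' \<oplus>\<^bsub>B\<^esub> c') \<in> limit_rel \<sigma>"
proof -
  obtain l d d' where d: "0 < l" "lifts l d" "lifts l d'"
    "near U (\<lambda>_. B) (\<lambda>n. \<pi>B n (d n)) (\<lambda>_. b)" "near U (\<lambda>_. B) (\<lambda>n. \<pi>B n (d' n)) (\<lambda>_. b')"
    "near U A (\<lambda>n. \<alpha> n (\<sigma> n) (\<pi>A n (d n))) (\<lambda>n. \<pi>A n (d' n))" by (rule limit_relE[OF b])
  obtain m e e' where e: "0 < m" "lifts m e" "lifts m e'"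
    "near U (\<lambda>_. B) (\<lambda>n. \<pi>B n (e n)) (\<lambda>_. c)" "near U (\<lambda>_. B) (\<lambda>n. \<pi>B n (e' n)) (\<lambda>_. c')"
    "near U A (\<lambda>n. \<alpha> n (\<sigma> n) (\<pi>A n (e n))) (\<lambda>n. \<pi>A n (e' n))" by (rule limit_relE[OF c])
  note bc = limit_rel_carrier[OF b] limit_rel_carrier[OF c]
  note dc = liftsD[OF d(2)] liftsD[OF d(3)] and ec = liftsD[OF e(2)] liftsD[OF e(3)]
  show ?thesis
  proof (rule limit_relI[of _ _ "l + m" "\<lambda>n. d n \<oplus>\<^bsub>D n\<^esub> e n" "\<lambda>n. d' n \<oplus>\<^bsub>D n\<^esub> e' n"])
    show "lifts (l + m) (\<lambda>n. d n \<oplus>\<^bsub>D n\<^esub> e n)" "lifts (l + m) (\<lambda>n. d' n \<oplus>\<^bsub>D n\<^esub> e' n)"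
      unfolding lifts_def by (intro allI L.leg.D.lip_bounded_add dc ec)+
    have "near U (\<lambda>_. B) (\<lambda>n. \<pi>B n (d n) \<oplus>\<^bsub>B\<^esub> \<pi>B n (e n)) (\<lambda>_. b \<oplus>\<^bsub>B\<^esub> c)"
      by (rule R.FA.near_add[OF dc(4) bc(1) ec(4) bc(3) d(4) e(4)])
    then show "near U (\<lambda>_. B) (\<lambda>n. \<pi>B n (d n \<oplus>\<^bsub>D n\<^esub> e n)) (\<lambda>_. b \<oplus>\<^bsub>B\<^esub> c)"
      by (simp only: R.leg.hom_add[OF dc(2) ec(2)])
    have "near U (\<lambda>_. B) (\<lambda>n. \<pi>B n (d' n) \<oplus>\<^bsub>B\<^esub> \<pi>B n (e' n)) (\<lambda>_. b' \<oplus>\<^bsub>B\<^esub> c')"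
      by (rule R.FA.near_add[OF dc(8) bc(2) ec(8) bc(4) d(5) e(5)])
    then show "near U (\<lambda>_. B) (\<lambda>n. \<pi>B n (d' n \<oplus>\<^bsub>D n\<^esub> e' n)) (\<lambda>_. b' \<oplus>\<^bsub>B\<^esub> c')"
      by (simp only: R.leg.hom_add[OF dc(6) ec(6)])
    have "near U A (\<lambda>n. \<alpha> n (\<sigma> n) (\<pi>A n (d n)) \<oplus>\<^bsub>A n\<^esub> \<alpha> n (\<sigma> n) (\<pi>A n (e n))) (\<lambda>n. \<pi>A n (d' n) \<oplus>\<^bsub>A n\<^esub> \<pi>A n (e' n))"
      by (rule L.FA.near_add[OF act_carrier[of \<sigma>, OF \<sigma> d(2)] dc(7) act_carrier[of \<sigma>, OF \<sigma> e(2)] ec(7) d(6) e(6)])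
    then show "near U A (\<lambda>n. \<alpha> n (\<sigma> n) (\<pi>A n (d n \<oplus>\<^bsub>D n\<^esub> e n))) (\<lambda>n. \<pi>A n (d' n \<oplus>\<^bsub>D n\<^esub> e' n))"
      by (simp only: L.leg.hom_add[OF dc(2) ec(2)] L.leg.hom_add[OF dc(6) ec(6)]
        star_homomorphism.hom_add[OF act.act_hom[OF \<sigma>] dc(3) ec(3)])
  qed (use bc d(1) e(1) in auto)
qed

lemma limit_rel_mult:
  assumes \<sigma>: "\<And>n. \<sigma> n \<in> H n" and b: "(b, b') \<in> limit_rel \<sigma>" and c: "(c, c') \<in> limit_rel \<sigma>"
  shows "(b \<otimes>\<^bsub>B\<^esub> c, b' \<otimes>\<^bsub>B\<^esub> c') \<in> limit_rel \<sigma>"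
proof -
  obtain l0 d d' where d0: "0 < l0" "lifts l0 d" "lifts l0 d'" and d:
    "near U (\<lambda>_. B) (\<lambda>n. \<pi>B n (d n)) (\<lambda>_. b)" "near U (\<lambda>_. B) (\<lambda>n. \<pi>B n (d' n)) (\<lambda>_. b')"
    "near U A (\<lambda>n. \<alpha> n (\<sigma> n) (\<pi>A n (d n))) (\<lambda>n. \<pi>A n (d' n))" by (rule limit_relE[OF b])
  obtain m e e' where e0: "0 < m" "lifts m e" "lifts m e'" and e:
    "near U (\<lambda>_. B) (\<lambda>n. \<pi>B n (e n)) (\<lambda>_. c)" "near U (\<lambda>_. B) (\<lambda>n. \<pi>B n (e' n)) (\<lambda>_. c')"
    "near U A (\<lambda>n. \<alpha> n (\<sigma> n) (\<pi>A n (e n))) (\<lambda>n. \<pi>A n (e' n))" by (rule limit_relE[OF c])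
  note bc = limit_rel_carrier[OF b] limit_rel_carrier[OF c]
  \<comment> \<open>\<open>near_mult\<close> bounds the left sequence and the limit of the right
    one, hence the norms of \<open>c\<close> and \<open>c'\<close>.\<close>
  define l where "l = l0 + m + cnorm B c + cnorm B c'"
  have nn: "0 \<le> cnorm B c" "0 \<le> cnorm B c'" by (rule R.leg.A.cnorm_nonneg[OF bc(3)], rule R.leg.A.cnorm_nonneg[OF bc(4)])
  have l: "l > 0" "l0 \<le> l" "m \<le> l" "cnorm B c \<le> l" "cnorm B c' \<le> l" unfolding l_def using d0(1) e0(1) nn by auto
  have dl: "lifts l d" "lifts l d'" "lifts l e" "lifts l e'"
    by (rule lifts_mono[OF d0(2) l(2)], rule lifts_mono[OF d0(3) l(2)], rule lifts_mono[OF e0(2) l(3)], rule lifts_mono[OF e0(3) l(3)])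
  note dc = liftsD[OF dl(1)] liftsD[OF dl(2)] and ec = liftsD[OF dl(3)] liftsD[OF dl(4)]
  have bA: "cnorm (A n) (\<pi>A n (x n)) \<le> l" and bB: "cnorm B (\<pi>B n (x n)) \<le> l" if "lifts l x" for x n
    by (rule order_trans[OF L.leg.hom_contractive[OF liftsD(2)[OF that]] L.leg.D.lip_boundedD(2)[OF liftsD(1)[OF that]]],
        rule order_trans[OF R.leg.hom_contractive[OF liftsD(2)[OF that]] L.leg.D.lip_boundedD(2)[OF liftsD(1)[OF that]]])
  have bact: "cnorm (A n) (\<alpha> n (\<sigma> n) (\<pi>A n (x n))) \<le> l" if "lifts l x" for x n
    using act.act_norm[OF \<sigma> liftsD(3)[OF that], of n] bA[OF that, of n] by simp
  obtain K where K: "K > 0" "\<And>c d. lifts l c \<Longrightarrow> lifts l d \<Longrightarrow> lifts K (\<lambda>n. c n \<otimes>\<^bsub>D n\<^esub> d n)"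
    using lifts_mult[OF l(1)] by blast
  show ?thesis
  proof (rule limit_relI[of _ _ K "\<lambda>n. d n \<otimes>\<^bsub>D n\<^esub> e n" "\<lambda>n. d' n \<otimes>\<^bsub>D n\<^esub> e' n"])
    show "lifts K (\<lambda>n. d n \<otimes>\<^bsub>D n\<^esub> e n)" "lifts K (\<lambda>n. d' n \<otimes>\<^bsub>D n\<^esub> e' n)" by (intro K(2) dl)+
    have "near U (\<lambda>_. B) (\<lambda>n. \<pi>B n (d n) \<otimes>\<^bsub>B\<^esub> \<pi>B n (e n)) (\<lambda>_. b \<otimes>\<^bsub>B\<^esub> c)"
      by (rule R.FA.near_mult[OF dc(4) bc(1) ec(4) bc(3) d(1) e(1), of l]) (intro always_eventually allI bB dl l)+
    then show "near U (\<lambda>_. B) (\<lambda>n. \<pi>B n (d n \<otimes>\<^bsub>D n\<^esub> e n)) (\<lambda>_. b \<otimes>\<^bsub>B\<^esub> c)"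
      by (simp only: R.leg.hom_mult[OF dc(2) ec(2)])
    have "near U (\<lambda>_. B) (\<lambda>n. \<pi>B n (d' n) \<otimes>\<^bsub>B\<^esub> \<pi>B n (e' n)) (\<lambda>_. b' \<otimes>\<^bsub>B\<^esub> c')"
      by (rule R.FA.near_mult[OF dc(8) bc(2) ec(8) bc(4) d(2) e(2), of l]) (intro always_eventually allI bB dl l)+
    then show "near U (\<lambda>_. B) (\<lambda>n. \<pi>B n (d' n \<otimes>\<^bsub>D n\<^esub> e' n)) (\<lambda>_. b' \<otimes>\<^bsub>B\<^esub> c')"
      by (simp only: R.leg.hom_mult[OF dc(6) ec(6)])
    have "near U A (\<lambda>n. \<alpha> n (\<sigma> n) (\<pi>A n (d n)) \<otimes>\<^bsub>A n\<^esub> \<alpha> n (\<sigma> n) (\<pi>A n (e n))) (\<lambda>n. \<pi>A n (d' n) \<otimes>\<^bsub>A n\<^esub> \<pi>A n (e' n))"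
      by (rule L.FA.near_mult[OF act_carrier[of \<sigma>, OF \<sigma> dl(1)] dc(7) act_carrier[of \<sigma>, OF \<sigma> dl(3)] ec(7) d(3) e(3), of l])
        (intro always_eventually allI bact bA dl)+
    then show "near U A (\<lambda>n. \<alpha> n (\<sigma> n) (\<pi>A n (d n \<otimes>\<^bsub>D n\<^esub> e n))) (\<lambda>n. \<pi>A n (d' n \<otimes>\<^bsub>D n\<^esub> e' n))"
      by (simp only: L.leg.hom_mult[OF dc(2) ec(2)] L.leg.hom_mult[OF dc(6) ec(6)]
        star_homomorphism.hom_mult[OF act.act_hom[OF \<sigma>] dc(3) ec(3)])
  qed (use bc K(1) in auto)
qed

lemma limit_rel_smult:
  assumes \<sigma>: "\<And>n. \<sigma> n \<in> H n" and b: "(b, b') \<in> limit_rel \<sigma>"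
  shows "(z \<odot>\<^bsub>B\<^esub> b, z \<odot>\<^bsub>B\<^esub> b') \<in> limit_rel \<sigma>"
proof -
  obtain l d d' where d: "0 < l" "lifts l d" "lifts l d'"
    "near U (\<lambda>_. B) (\<lambda>n. \<pi>B n (d n)) (\<lambda>_. b)" "near U (\<lambda>_. B) (\<lambda>n. \<pi>B n (d' n)) (\<lambda>_. b')"
    "near U A (\<lambda>n. \<alpha> n (\<sigma> n) (\<pi>A n (d n))) (\<lambda>n. \<pi>A n (d' n))" by (rule limit_relE[OF b])
  note bc = limit_rel_carrier[OF b]
  note dc = liftsD[OF d(2)] liftsD[OF d(3)]
  have le: "2 * cmod z * l \<le> 2 * cmod z * l + 1" by simp
  show ?thesis
  proof (rule limit_relI[of _ _ "2 * cmod z * l + 1" "\<lambda>n. z \<odot>\<^bsub>D n\<^esub> d n" "\<lambda>n. z \<odot>\<^bsub>D n\<^esub> d' n"])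
    show "lifts (2 * cmod z * l + 1) (\<lambda>n. z \<odot>\<^bsub>D n\<^esub> d n)" "lifts (2 * cmod z * l + 1) (\<lambda>n. z \<odot>\<^bsub>D n\<^esub> d' n)"
      unfolding lifts_def by (intro allI L.leg.D.lip_bounded_mono[OF L.leg.D.lip_bounded_smult le] dc)+
    have "near U (\<lambda>_. B) (\<lambda>n. z \<odot>\<^bsub>B\<^esub> \<pi>B n (d n)) (\<lambda>_. z \<odot>\<^bsub>B\<^esub> b)" by (rule R.FA.near_smult[OF dc(4) bc(1) d(4)])
    then show "near U (\<lambda>_. B) (\<lambda>n. \<pi>B n (z \<odot>\<^bsub>D n\<^esub> d n)) (\<lambda>_. z \<odot>\<^bsub>B\<^esub> b)" by (simp only: R.leg.hom_smult[OF dc(2)])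
    have "near U (\<lambda>_. B) (\<lambda>n. z \<odot>\<^bsub>B\<^esub> \<pi>B n (d' n)) (\<lambda>_. z \<odot>\<^bsub>B\<^esub> b')" by (rule R.FA.near_smult[OF dc(8) bc(2) d(5)])
    then show "near U (\<lambda>_. B) (\<lambda>n. \<pi>B n (z \<odot>\<^bsub>D n\<^esub> d' n)) (\<lambda>_. z \<odot>\<^bsub>B\<^esub> b')" by (simp only: R.leg.hom_smult[OF dc(6)])
    have "near U A (\<lambda>n. z \<odot>\<^bsub>A n\<^esub> \<alpha> n (\<sigma> n) (\<pi>A n (d n))) (\<lambda>n. z \<odot>\<^bsub>A n\<^esub> \<pi>A n (d' n))"
      by (rule L.FA.near_smult[OF act_carrier[of \<sigma>, OF \<sigma> d(2)] dc(7) d(6)])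
    then show "near U A (\<lambda>n. \<alpha> n (\<sigma> n) (\<pi>A n (z \<odot>\<^bsub>D n\<^esub> d n))) (\<lambda>n. \<pi>A n (z \<odot>\<^bsub>D n\<^esub> d' n))"
      by (simp only: L.leg.hom_smult[OF dc(2)] L.leg.hom_smult[OF dc(6)] star_homomorphism.hom_smult[OF act.act_hom[OF \<sigma>] dc(3)])
    show "0 < 2 * cmod z * l + 1" using d(1) by (intro add_nonneg_pos mult_nonneg_nonneg) auto
  qed (use bc in auto)
qed

lemma limit_rel_adj:
  assumes \<sigma>: "\<And>n. \<sigma> n \<in> H n" and b: "(b, b') \<in> limit_rel \<sigma>"
  shows "(adj B b, adj B b') \<in> limit_rel \<sigma>"
proof -
  obtain l d d' where d: "0 < l" "lifts l d" "lifts l d'"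
    "near U (\<lambda>_. B) (\<lambda>n. \<pi>B n (d n)) (\<lambda>_. b)" "near U (\<lambda>_. B) (\<lambda>n. \<pi>B n (d' n)) (\<lambda>_. b')"
    "near U A (\<lambda>n. \<alpha> n (\<sigma> n) (\<pi>A n (d n))) (\<lambda>n. \<pi>A n (d' n))" by (rule limit_relE[OF b])
  note bc = limit_rel_carrier[OF b]
  note dc = liftsD[OF d(2)] liftsD[OF d(3)]
  show ?thesis
  proof (rule limit_relI[of _ _ l "\<lambda>n. adj (D n) (d n)" "\<lambda>n. adj (D n) (d' n)"])
    show "lifts l (\<lambda>n. adj (D n) (d n))" "lifts l (\<lambda>n. adj (D n) (d' n))"
      unfolding lifts_def by (intro allI L.leg.D.lip_bounded_adj dc)+
    have "near U (\<lambda>_. B) (\<lambda>n. adj B (\<pi>B n (d n))) (\<lambda>_. adj B b)" by (rule R.FA.near_adj[OF dc(4) bc(1) d(4)])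
    then show "near U (\<lambda>_. B) (\<lambda>n. \<pi>B n (adj (D n) (d n))) (\<lambda>_. adj B b)" by (simp only: R.leg.hom_adj[OF dc(2)])
    have "near U (\<lambda>_. B) (\<lambda>n. adj B (\<pi>B n (d' n))) (\<lambda>_. adj B b')" by (rule R.FA.near_adj[OF dc(8) bc(2) d(5)])
    then show "near U (\<lambda>_. B) (\<lambda>n. \<pi>B n (adj (D n) (d' n))) (\<lambda>_. adj B b')" by (simp only: R.leg.hom_adj[OF dc(6)])
    have "near U A (\<lambda>n. adj (A n) (\<alpha> n (\<sigma> n) (\<pi>A n (d n)))) (\<lambda>n. adj (A n) (\<pi>A n (d' n)))"
      by (rule L.FA.near_adj[OF act_carrier[of \<sigma>, OF \<sigma> d(2)] dc(7) d(6)])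
    then show "near U A (\<lambda>n. \<alpha> n (\<sigma> n) (\<pi>A n (adj (D n) (d n)))) (\<lambda>n. \<pi>A n (adj (D n) (d' n)))"
      by (simp only: L.leg.hom_adj[OF dc(2)] L.leg.hom_adj[OF dc(6)] star_homomorphism.hom_adj[OF act.act_hom[OF \<sigma>] dc(3)])
  qed (use bc d(1) in auto)
qed

text \<open>Up to \<open>D\<close> along the leg over \<open>B\<close>, then down to
  \<open>A\<close>. This is the independence of the limit relation from the chosen lifts.\<close>

lemma near_B_to_A:
  assumes d: "lifts l d" and e: "lifts l e" and l: "l > 0" and b: "b \<in> carrier B"
    and near: "near U (\<lambda>_. B) (\<lambda>n. \<pi>B n (d n)) (\<lambda>_. b)" "near U (\<lambda>_. B) (\<lambda>n. \<pi>B n (e n)) (\<lambda>_. b)"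
  shows "near U A (\<lambda>n. \<pi>A n (d n)) (\<lambda>n. \<pi>A n (e n))"
proof -
  have "near U (\<lambda>_. B) (\<lambda>n. \<pi>B n (d n)) (\<lambda>n. \<pi>B n (e n))"
    by (rule R.FA.near_trans[OF liftsD(4)[OF d] b liftsD(4)[OF e] near(1) R.FA.near_sym[OF liftsD(4)[OF e] b near(2)]])
  then have "near U D d e" by (rule R.near_up[OF liftsD(1)[OF d] liftsD(1)[OF e] l])
  then show ?thesis by (rule L.near_down[OF liftsD(2)[OF d] liftsD(2)[OF e]])
qed

text \<open>The norm of \<open>b'\<close> is followed through \<open>D\<close>, \<open>A\<close>,
  \<open>D\<close> and back to \<open>b\<close>. Each of the two passages from \<open>D\<close> to
  an image costs a factor 2, and the action is isometric. Any constant suffices for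
  \<open>hom_from_graph\<close>.\<close>

lemma limit_rel_bound:
  assumes \<sigma>: "\<And>n. \<sigma> n \<in> H n" and b: "(b, b') \<in> limit_rel \<sigma>"
  shows "cnorm B b' \<le> 4 * cnorm B b"
proof -
  obtain l d d' where d: "0 < l" "lifts l d" "lifts l d'"
    "near U (\<lambda>_. B) (\<lambda>n. \<pi>B n (d n)) (\<lambda>_. b)" "near U (\<lambda>_. B) (\<lambda>n. \<pi>B n (d' n)) (\<lambda>_. b')"
    "near U A (\<lambda>n. \<alpha> n (\<sigma> n) (\<pi>A n (d n))) (\<lambda>n. \<pi>A n (d' n))" by (rule limit_relE[OF b])
  note bc = limit_rel_carrier[OF b]
  note dc = liftsD[OF d(2)] liftsD[OF d(3)]
  define \<delta> where "\<delta> n = cnorm (A n) (\<alpha> n (\<sigma> n) (\<pi>A n (d n)) \<ominus>\<^bsub>A n\<^esub> \<pi>A n (d' n))" for n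
  have \<delta>: "(\<delta> \<longlongrightarrow> 0) U" using d(6) by (simp add: near_def \<delta>_def[abs_def])
  have le: "cnorm B (\<pi>B n (d' n)) \<le> 2 * (2 * cnorm B (\<pi>B n (d n)) + 2 * (l * \<epsilon> n) + \<delta> n) + 2 * (l * \<epsilon> n)" for n
  proof -
    have "cnorm B (\<pi>B n (d' n)) \<le> cnorm (D n) (d' n)" by (rule R.leg.hom_contractive[OF dc(6)])
    also have "\<dots> \<le> 2 * cnorm (A n) (\<pi>A n (d' n)) + 2 * (l * \<epsilon> n)" by (rule L.leg.cnorm_le[OF dc(5) d(1)])
    finally have 1: "cnorm B (\<pi>B n (d' n)) \<le> 2 * cnorm (A n) (\<pi>A n (d' n)) + 2 * (l * \<epsilon> n)" .
    have ac: "\<alpha> n (\<sigma> n) (\<pi>A n (d n)) \<in> carrier (A n)" by (rule act_carrier[of \<sigma>, OF \<sigma> d(2)])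
    have "cnorm (A n) (\<pi>A n (d' n)) \<le> cnorm (A n) (\<alpha> n (\<sigma> n) (\<pi>A n (d n))) + \<delta> n"
      using L.leg.A.cnorm_triangle_diff[OF dc(7)[of n] ac] L.leg.A.cnorm_minus_commute[OF dc(7)[of n] ac] by (simp add: \<delta>_def)
    also have "cnorm (A n) (\<alpha> n (\<sigma> n) (\<pi>A n (d n))) = cnorm (A n) (\<pi>A n (d n))" by (rule act.act_norm[OF \<sigma> dc(3)])
    also have "\<dots> \<le> cnorm (D n) (d n)" by (rule L.leg.hom_contractive[OF dc(2)])
    also have "\<dots> \<le> 2 * cnorm B (\<pi>B n (d n)) + 2 * (l * \<epsilon> n)" by (rule R.leg.cnorm_le[OF dc(1) d(1)])
    finally show ?thesis using 1 by simp
  qed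
  have lim: "((\<lambda>n. 2 * (2 * cnorm B (\<pi>B n (d n)) + 2 * (l * \<epsilon> n) + \<delta> n) + 2 * (l * \<epsilon> n))
    \<longlongrightarrow> 2 * (2 * cnorm B b + 2 * (l * 0) + 0) + 2 * (l * 0)) U"
    by (intro tendsto_add tendsto_mult tendsto_const \<delta> L.\<epsilon>_limit R.leg.A.near_cnorm[OF dc(4) bc(1) d(4)])
  have "cnorm B b' \<le> 2 * (2 * cnorm B b + 2 * (l * 0) + 0) + 2 * (l * 0)"
    by (rule tendsto_le[OF U.proper lim R.leg.A.near_cnorm[OF dc(8) bc(2) d(5)]]) (intro always_eventually allI le)
  then show ?thesis by simp
qed

text \<open>The middle element \<open>b'\<close> comes with two different lifts, one from each
  relation; \<open>near_B_to_A\<close> identifies their images in \<open>A n\<close>.\<close>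

lemma limit_rel_trans:
  assumes \<sigma>: "\<And>n. \<sigma> n \<in> H n" and \<tau>: "\<And>n. \<tau> n \<in> H n"
    and b: "(b, b') \<in> limit_rel \<tau>" and b': "(b', b'') \<in> limit_rel \<sigma>"
  shows "(b, b'') \<in> limit_rel (\<lambda>n. \<sigma> n \<otimes> \<tau> n)"
proof -
  obtain l0 d d' where d0: "0 < l0" "lifts l0 d" "lifts l0 d'" and d:
    "near U (\<lambda>_. B) (\<lambda>n. \<pi>B n (d n)) (\<lambda>_. b)" "near U (\<lambda>_. B) (\<lambda>n. \<pi>B n (d' n)) (\<lambda>_. b')"
    "near U A (\<lambda>n. \<alpha> n (\<tau> n) (\<pi>A n (d n))) (\<lambda>n. \<pi>A n (d' n))" by (rule limit_relE[OF b])
  obtain m e e' where e0: "0 < m" "lifts m e" "lifts m e'" and e: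
    "near U (\<lambda>_. B) (\<lambda>n. \<pi>B n (e n)) (\<lambda>_. b')" "near U (\<lambda>_. B) (\<lambda>n. \<pi>B n (e' n)) (\<lambda>_. b'')"
    "near U A (\<lambda>n. \<alpha> n (\<sigma> n) (\<pi>A n (e n))) (\<lambda>n. \<pi>A n (e' n))" by (rule limit_relE[OF b'])
  note bc = limit_rel_carrier[OF b] limit_rel_carrier[OF b']
  define l where "l = l0 + m"
  have l: "l > 0" "l0 \<le> l" "m \<le> l" unfolding l_def using d0(1) e0(1) by auto
  have dl: "lifts l d" "lifts l d'" "lifts l e" "lifts l e'"
    by (rule lifts_mono[OF d0(2) l(2)], rule lifts_mono[OF d0(3) l(2)], rule lifts_mono[OF e0(2) l(3)], rule lifts_mono[OF e0(3) l(3)])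
  note dc = liftsD[OF dl(1)] liftsD[OF dl(2)] and ec = liftsD[OF dl(3)] liftsD[OF dl(4)]
  note sc = act.act_closed[OF \<sigma>] and tc = act.act_closed[OF \<tau>]
  have act_near: "near U A (\<lambda>n. \<alpha> n (\<sigma> n) (x n)) (\<lambda>n. \<alpha> n (\<sigma> n) (y n))"
    if "\<And>n. x n \<in> carrier (A n)" "\<And>n. y n \<in> carrier (A n)" "near U A x y" for x y
    using that(3) unfolding near_def act.act_dist[OF \<sigma> that(1,2)] .
  have 1: "near U A (\<lambda>n. \<alpha> n (\<sigma> n) (\<alpha> n (\<tau> n) (\<pi>A n (d n)))) (\<lambda>n. \<alpha> n (\<sigma> n) (\<pi>A n (d' n)))"
    by (rule act_near[OF tc[OF dc(3)] dc(7) d(3)])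
  have 2: "near U A (\<lambda>n. \<alpha> n (\<sigma> n) (\<pi>A n (d' n))) (\<lambda>n. \<alpha> n (\<sigma> n) (\<pi>A n (e n)))"
    by (rule act_near[OF dc(7) ec(3) near_B_to_A[OF dl(2,3) l(1) bc(2) d(2) e(1)]])
  have "near U A (\<lambda>n. \<alpha> n (\<sigma> n) (\<alpha> n (\<tau> n) (\<pi>A n (d n)))) (\<lambda>n. \<pi>A n (e' n))"
    by (rule L.FA.near_trans[OF sc[OF tc[OF dc(3)]] sc[OF dc(7)] ec(7) 1
        L.FA.near_trans[OF sc[OF dc(7)] sc[OF ec(3)] ec(7) 2 e(3)]])
  then have "near U A (\<lambda>n. \<alpha> n (\<sigma> n \<otimes> \<tau> n) (\<pi>A n (d n))) (\<lambda>n. \<pi>A n (e' n))"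
    by (simp only: act.act_mult[OF \<sigma> \<tau> dc(3)])
  then show ?thesis by (rule limit_relI[OF bc(1) bc(4) l(1) dl(1) dl(4) d(1) e(2)])
qed

text \<open>Hypothesis (i) bounds the distance of the two translates of a lift in \<open>A n\<close>
  by \<open>2 * l * gap\<close>. Hence the relation depends on the limit of the sequence
  alone.\<close>

lemma limit_rel_close:
  assumes \<sigma>: "\<And>n. \<sigma> n \<in> H n" and \<tau>: "\<And>n. \<tau> n \<in> H n"
    and close: "((\<lambda>n. gap (\<tau> n) (\<sigma> n)) \<longlongrightarrow> 0) U" and b: "(b, b') \<in> limit_rel \<sigma>"
  shows "(b, b') \<in> limit_rel \<tau>"
proof -
  obtain l d d' where d: "0 < l" "lifts l d" "lifts l d'"
    "near U (\<lambda>_. B) (\<lambda>n. \<pi>B n (d n)) (\<lambda>_. b)" "near U (\<lambda>_. B) (\<lambda>n. \<pi>B n (d' n)) (\<lambda>_. b')"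
    "near U A (\<lambda>n. \<alpha> n (\<sigma> n) (\<pi>A n (d n))) (\<lambda>n. \<pi>A n (d' n))" by (rule limit_relE[OF b])
  note bc = limit_rel_carrier[OF b]
  note dc = liftsD[OF d(2)] liftsD[OF d(3)]
  note sc = act.act_closed[OF \<sigma> dc(3)] and tc = act.act_closed[OF \<tau> dc(3)]
  have "near U A (\<lambda>n. \<alpha> n (\<tau> n) (\<pi>A n (d n))) (\<lambda>n. \<alpha> n (\<sigma> n) (\<pi>A n (d n)))"
  proof (rule L.FA.near_if_bounded[OF tc sc])
    show "\<forall>\<^sub>F n in U. cnorm (A n) (\<alpha> n (\<tau> n) (\<pi>A n (d n)) \<ominus>\<^bsub>A n\<^esub> \<alpha> n (\<sigma> n) (\<pi>A n (d n))) \<le> 2 * l * gap (\<tau> n) (\<sigma> n)"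
      unfolding gap_def by (intro always_eventually allI act.dist_act[OF L.leg.lip_bounded_image[OF dc(1)] \<tau> \<sigma>])
    show "((\<lambda>n. 2 * l * gap (\<tau> n) (\<sigma> n)) \<longlongrightarrow> 0) U" by (rule tendsto_mult_right_zero[OF close])
  qed
  then have "near U A (\<lambda>n. \<alpha> n (\<tau> n) (\<pi>A n (d n))) (\<lambda>n. \<pi>A n (d' n))"
    by (rule L.FA.near_trans[OF tc sc dc(7) _ d(6)])
  then show ?thesis by (rule limit_relI[OF bc d(1-5)])
qed

text \<open>The bound \<open>\<epsilon> n <= 1\<close> makes the norms of the lifts at most
  \<open>norm b + l\<close>, uniformly in \<open>n\<close>.\<close>

lemma lift_exact:
  assumes b: "b \<in> self_adjoint B" "LB b < ennreal l" and l: "l > 0"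
  obtains d where "lifts (cnorm B b + l) d" "\<And>n. \<pi>B n (d n) = b" "\<And>n. d n \<in> self_adjoint (D n)" "\<And>n. LD n (d n) \<le> ennreal l"
proof -
  have "\<exists>d. d \<in> self_adjoint (D n) \<and> \<pi>B n d = b \<and> LD n d < ennreal l" for n
    by (rule R.leg.lip_lift[OF b]) blast
  then obtain d where d: "\<And>n. d n \<in> self_adjoint (D n)" "\<And>n. \<pi>B n (d n) = b" "\<And>n. LD n (d n) < ennreal l" by metis
  have Ld: "LD n (d n) \<le> ennreal l" for n using d(3)[of n] by simp
  have "lip_bounded (D n) (LD n) (cnorm B b + l) (d n)" for n
  proof (rule L.leg.D.lip_bounded_self_adjoint[OF d(1)])
    show "LD n (d n) \<le> ennreal (cnorm B b + l)"
      by (rule order_trans[OF Ld ennreal_leI]) (use R.leg.A.cnorm_nonneg[OF R.leg.A.self_adjointD(1)[OF b(1)]] in simp)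
    have "cnorm (D n) (d n) \<le> cnorm B b + l * \<epsilon> n" using R.leg.cnorm_self_adjoint_le[OF d(1) Ld l, of n] d(2)[of n] by simp
    also have "\<dots> \<le> cnorm B b + l" using l \<epsilon>_le[of n] by simp
    finally show "cnorm (D n) (d n) \<le> cnorm B b + l" .
  qed
  then have "lifts (cnorm B b + l) d" by (simp add: lifts_def)
  then show ?thesis by (rule that[of d, OF _ d(2) d(1) Ld])
qed

lemma limit_rel_refl:
  assumes b: "b \<in> self_adjoint B" "LB b < ennreal l" and l: "l > 0"
  shows "(b, b) \<in> limit_rel (\<lambda>_. \<one>)"
proof -
  note bc = R.leg.A.self_adjointD(1)[OF b(1)]
  obtain d where d: "lifts (cnorm B b + l) d" "\<And>n. \<pi>B n (d n) = b" by (rule lift_exact[OF b l], rule that)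
  have l': "0 < cnorm B b + l" using l R.leg.A.cnorm_nonneg[OF bc] by simp
  have "near U (\<lambda>_. B) (\<lambda>n. \<pi>B n (d n)) (\<lambda>_. b)" unfolding d(2) by (rule R.FA.near_refl[OF bc])
  moreover have "near U A (\<lambda>n. \<alpha> n \<one> (\<pi>A n (d n))) (\<lambda>n. \<pi>A n (d n))"
    unfolding act.act_one[OF liftsD(3)[OF d(1)]] by (rule L.FA.near_refl[OF liftsD(3)[OF d(1)]])
  ultimately show ?thesis by (intro limit_relI[OF bc bc l' d(1) d(1)])
qed

text \<open>Lift \<open>b\<close> to \<open>D n\<close>, descend to \<open>A n\<close>, act, lift
  and descend to \<open>B\<close>: the results stay in one Lipschitz ball of \<open>B\<close>, whose
  compactness supplies \<open>b'\<close>. The last clause follows this path with self-adjoint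
  estimates, since hypothesis (i) has to pass to the limit without loss in the constant.\<close>

lemma limit_rel_lip:
  assumes \<sigma>: "\<And>n. \<sigma> n \<in> H n" and b: "b \<in> self_adjoint B" "LB b < ennreal l" and l: "l > 0"
  obtains b' where "(b, b') \<in> limit_rel \<sigma>" "b' \<in> self_adjoint B" "LB b' \<le> ennreal l"
    "\<And>r. \<forall>\<^sub>F n in U. ell (\<sigma> n) \<le> r \<Longrightarrow> cnorm B (b \<ominus>\<^bsub>B\<^esub> b') \<le> l * r"
proof -
  note bc = R.leg.A.self_adjointD(1)[OF b(1)]
  have "\<exists>d. d \<in> self_adjoint (D n) \<and> \<pi>B n d = b \<and> LD n d < ennreal l" for n
    by (rule R.leg.lip_lift[OF b]) blast
  then obtain d where d: "\<And>n. d n \<in> self_adjoint (D n)" "\<And>n. \<pi>B n (d n) = b" "\<And>n. LD n (d n) < ennreal l" by metis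
  have Ld: "LD n (d n) \<le> ennreal l" for n using d(3)[of n] by simp
  have nd: "cnorm (D n) (d n) \<le> cnorm B b + l" for n
  proof -
    have "cnorm (D n) (d n) \<le> cnorm B b + l * \<epsilon> n" using R.leg.cnorm_self_adjoint_le[OF d(1) Ld l, of n] d(2)[of n] by simp
    also have "\<dots> \<le> cnorm B b + l" using l \<epsilon>_le[of n] by simp
    finally show ?thesis .
  qed
  note dc = L.leg.D.self_adjointD(1)[OF d(1)]
  define a where "a n = \<alpha> n (\<sigma> n) (\<pi>A n (d n))" for n
  have pa: "\<pi>A n (d n) \<in> self_adjoint (A n)" for n by (rule L.leg.hom_self_adjoint[OF d(1)])
  note pac = L.leg.A.self_adjointD(1)[OF pa]
  have a: "a n \<in> self_adjoint (A n)" for n unfolding a_def by (rule act.act_self_adjoint[OF \<sigma> pa])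
  have "LA n (a n) < ennreal l" for n
  proof -
    have "LA n (a n) \<le> LA n (\<pi>A n (d n))" unfolding a_def by (rule act.lip_le[OF \<sigma> pa])
    also have "\<dots> \<le> LD n (d n)" by (rule L.leg.lip_image_le[OF d(1)])
    finally show ?thesis using d(3)[of n] by simp
  qed
  then have "\<exists>d'. d' \<in> self_adjoint (D n) \<and> \<pi>A n d' = a n \<and> LD n d' < ennreal l" for n
    by (rule L.leg.lip_lift[OF a]) blast
  then obtain d' where d': "\<And>n. d' n \<in> self_adjoint (D n)" "\<And>n. \<pi>A n (d' n) = a n" "\<And>n. LD n (d' n) < ennreal l" by metis
  have Ld': "LD n (d' n) \<le> ennreal l" for n using d'(3)[of n] by simp
  note dc' = L.leg.D.self_adjointD(1)[OF d'(1)]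
  have nd': "cnorm (D n) (d' n) \<le> cnorm B b + l + l" for n
  proof -
    have "cnorm (D n) (d' n) \<le> cnorm (A n) (a n) + l * \<epsilon> n" using L.leg.cnorm_self_adjoint_le[OF d'(1) Ld' l, of n] d'(2)[of n] by simp
    also have "cnorm (A n) (a n) = cnorm (A n) (\<pi>A n (d n))" unfolding a_def by (rule act.act_norm[OF \<sigma> pac])
    also have "\<dots> \<le> cnorm (D n) (d n)" by (rule L.leg.hom_contractive[OF dc])
    also have "\<dots> \<le> cnorm B b + l" by (rule nd)
    also have "l * \<epsilon> n \<le> l" using l \<epsilon>_le[of n] by simp
    finally show ?thesis by simp
  qed
  define m where "m = cnorm B b + l + l"
  have m: "m > 0" "l \<le> m" "cnorm B b + l \<le> m" unfolding m_def using l R.leg.A.cnorm_nonneg[OF bc] by auto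
  have good: "lifts m d" "lifts m d'" unfolding lifts_def
    by (intro allI L.leg.D.lip_bounded_self_adjoint[OF d(1) order_trans[OF Ld ennreal_leI[OF m(2)]] order_trans[OF nd m(3)]],
      intro allI L.leg.D.lip_bounded_self_adjoint[OF d'(1) order_trans[OF Ld' ennreal_leI[OF m(2)]] nd'[folded m_def]])
  have ps: "\<pi>B n (d' n) \<in> self_adjoint B" for n by (rule R.leg.hom_self_adjoint[OF d'(1)])
  have pL: "LB (\<pi>B n (d' n)) \<le> ennreal l" for n by (rule order_trans[OF R.leg.lip_image_le[OF d'(1)] Ld'])
  have pn: "cnorm B (\<pi>B n (d' n)) \<le> m" for n unfolding m_def by (rule order_trans[OF R.leg.hom_contractive[OF dc'] nd'])
  obtain b' where b': "b' \<in> self_adjoint B" "LB b' \<le> ennreal l" "near U (\<lambda>_. B) (\<lambda>n. \<pi>B n (d' n)) (\<lambda>_. b')"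
    using R.leg.A.lip_ball_compact[of U "\<lambda>n. \<pi>B n (d' n)" l m, OF U.ultrafilter_axioms ps pL pn l] by blast
  note bc' = R.leg.A.self_adjointD(1)[OF b'(1)]
  have "near U (\<lambda>_. B) (\<lambda>n. \<pi>B n (d n)) (\<lambda>_. b)" unfolding d(2) by (rule R.FA.near_refl[OF bc])
  moreover have "near U A (\<lambda>n. \<alpha> n (\<sigma> n) (\<pi>A n (d n))) (\<lambda>n. \<pi>A n (d' n))"
    unfolding d'(2) a_def[symmetric] by (rule L.FA.near_refl[OF L.leg.A.self_adjointD(1)[OF a]])
  ultimately have rel: "(b, b') \<in> limit_rel \<sigma>" using b'(3) by (intro limit_relI[OF bc bc' m(1) good])
  have bound: "cnorm B (b \<ominus>\<^bsub>B\<^esub> b') \<le> l * r" if r: "\<forall>\<^sub>F n in U. ell (\<sigma> n) \<le> r" for r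
  proof -
    \<comment> \<open>The difference of the two lifts has Lipschitz constant \<open>l + l\<close>,
      so its norm exceeds that of its image in \<open>A n\<close> by at most
      \<open>(l + l) * \<epsilon> n\<close>; this image is a displacement, of norm at most
      \<open>l * r\<close>.\<close>
    have le: "cnorm B (b \<ominus>\<^bsub>B\<^esub> \<pi>B n (d' n)) \<le> l * r + (l + l) * \<epsilon> n" if n: "ell (\<sigma> n) \<le> r" for n
    proof -
      have sa: "d n \<ominus>\<^bsub>D n\<^esub> d' n \<in> self_adjoint (D n)" by (rule L.leg.D.self_adjoint_simps(4)[OF d(1) d'(1)])
      have Lm: "LD n (d n \<ominus>\<^bsub>D n\<^esub> d' n) \<le> ennreal (l + l)"
        by (rule L.leg.D.lip_minus[OF d(1) d'(1) Ld Ld']) (use l in simp_all)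
      have "b \<ominus>\<^bsub>B\<^esub> \<pi>B n (d' n) = \<pi>B n (d n \<ominus>\<^bsub>D n\<^esub> d' n)" using R.leg.hom_minus[OF dc[of n] dc'[of n]] d(2)[of n] by simp
      then have "cnorm B (b \<ominus>\<^bsub>B\<^esub> \<pi>B n (d' n)) \<le> cnorm (D n) (d n \<ominus>\<^bsub>D n\<^esub> d' n)"
        using R.leg.hom_contractive[OF L.leg.D.self_adjointD(1)[OF sa]] by simp
      also have "\<dots> \<le> cnorm (A n) (\<pi>A n (d n \<ominus>\<^bsub>D n\<^esub> d' n)) + (l + l) * \<epsilon> n"
        by (rule L.leg.cnorm_self_adjoint_le[OF sa Lm]) (use l in simp)
      also have "\<pi>A n (d n \<ominus>\<^bsub>D n\<^esub> d' n) = \<pi>A n (d n) \<ominus>\<^bsub>A n\<^esub> \<alpha> n (\<sigma> n) (\<pi>A n (d n))"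
        using L.leg.hom_minus[OF dc[of n] dc'[of n]] d'(2)[of n] by (simp add: a_def)
      also have "cnorm (A n) \<dots> \<le> l * ell (\<sigma> n)"
        by (rule act.dominated[OF \<sigma> pa order_trans[OF L.leg.lip_image_le[OF d(1)] Ld]]) (use l in simp)
      also have "l * ell (\<sigma> n) \<le> l * r" using n l by simp
      finally show ?thesis by simp
    qed
    have near_diff: "near U (\<lambda>_. B) (\<lambda>n. b \<ominus>\<^bsub>B\<^esub> \<pi>B n (d' n)) (\<lambda>_. b \<ominus>\<^bsub>B\<^esub> b')"
      by (rule R.FA.near_minus[OF bc bc R.leg.A.self_adjointD(1)[OF ps] bc' R.FA.near_refl[OF bc] b'(3)])
    have lim1: "((\<lambda>n. cnorm B (b \<ominus>\<^bsub>B\<^esub> \<pi>B n (d' n))) \<longlongrightarrow> cnorm B (b \<ominus>\<^bsub>B\<^esub> b')) U"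
      by (rule R.leg.A.near_cnorm[OF R.leg.A.minus_closed[OF bc R.leg.A.self_adjointD(1)[OF ps]] R.leg.A.minus_closed[OF bc bc'] near_diff])
    have lim2: "((\<lambda>n. l * r + (l + l) * \<epsilon> n) \<longlongrightarrow> l * r + (l + l) * 0) U" by (intro tendsto_add tendsto_mult tendsto_const L.\<epsilon>_limit)
    have "cnorm B (b \<ominus>\<^bsub>B\<^esub> b') \<le> l * r + (l + l) * 0"
      by (rule tendsto_le[OF U.proper lim2 lim1]) (rule eventually_mono[OF r le])
    then show ?thesis by simp
  qed
  show ?thesis by (rule that[OF rel b'(1,2) bound])
qed

end

section \<open>Extension of the limit relation to homomorphisms\<close>

lemma star_hom_compose:
  "\<lbrakk>f \<in> star_hom A B; g \<in> star_hom B C\<rbrakk> \<Longrightarrow> (\<lambda>x. g (f x)) \<in> star_hom A C"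
  using ring_hom_trans[of f A B g C] by (auto simp: star_hom_def o_def ring_hom_closed)

lemma star_hom_id: "(\<lambda>x. x) \<in> star_hom A A"
  by (auto simp: star_hom_def ring_hom_def)

lemma ennreal_finite_bound:
  fixes x :: ennreal assumes "x < \<infinity>" obtains l where "l > 0" "x < ennreal l"
proof (cases x)
  case (real r)
  then have "x < ennreal (r + 1)" by (simp add: ennreal_less_iff)
  then show ?thesis using that[of "r + 1"] real by simp
next
  case top
  then show ?thesis using assms by simp
qed

lemma (in quantum_metric) lip_dense_complex:
  assumes x: "x \<in> carrier A" and e: "e > 0"
  obtains p q l where "p \<in> self_adjoint A" "q \<in> self_adjoint A" "L p < ennreal l" "L q < ennreal l" "l > 0"
    "cnorm A (x \<ominus> (p \<oplus> \<i> \<odot> q)) < e"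
proof -
  have e2: "e/2 > 0" using e by simp
  obtain p where p: "p \<in> lip_dom A L" "cnorm A (re_part A x \<ominus> p) < e/2"
    by (rule lip_dense[OF re_part_self_adjoint[OF x] e2])
  obtain q where q: "q \<in> lip_dom A L" "cnorm A (im_part A x \<ominus> q) < e/2"
    by (rule lip_dense[OF im_part_self_adjoint[OF x] e2])
  have ps: "p \<in> self_adjoint A" "L p < \<infinity>" and qs: "q \<in> self_adjoint A" "L q < \<infinity>" using p(1) q(1) by (auto simp: lip_dom_def)
  obtain l where l: "l > 0" "L p < ennreal l" by (rule ennreal_finite_bound[OF ps(2)])
  obtain m where m: "m > 0" "L q < ennreal m" by (rule ennreal_finite_bound[OF qs(2)])
  note pc = self_adjointD(1)[OF ps(1)] and qc = self_adjointD(1)[OF qs(1)]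
  have rc: "re_part A x \<in> carrier A" "im_part A x \<in> carrier A" using x by auto
  have "x \<ominus> (p \<oplus> \<i> \<odot> q) = (re_part A x \<oplus> \<i> \<odot> im_part A x) \<ominus> (p \<oplus> \<i> \<odot> q)" using re_im_decomposition[OF x] by simp
  also have "\<dots> = (re_part A x \<ominus> p) \<oplus> \<i> \<odot> (im_part A x \<ominus> q)"
    by (rule eq_by_functionals) (use rc pc qc in \<open>auto simp: linear_functional_simps algebra_simps\<close>)
  also have "cnorm A \<dots> \<le> cnorm A (re_part A x \<ominus> p) + cnorm A (im_part A x \<ominus> q)"
    using cnorm_triangle[of "re_part A x \<ominus> p" "\<i> \<odot> (im_part A x \<ominus> q)"] rc pc qc by (simp add: cnorm_smult)
  also have "\<dots> < e" using p(2) q(2) by simp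
  finally have "cnorm A (x \<ominus> (p \<oplus> \<i> \<odot> q)) < e" .
  moreover have "L p < ennreal (max l m)" "L q < ennreal (max l m)"
    using order_less_le_trans[OF l(2) ennreal_leI[of l "max l m"]] order_less_le_trans[OF m(2) ennreal_leI[of m "max l m"]] by simp_all
  ultimately show ?thesis using that[OF ps(1) qs(1), of "max l m"] l(1) by simp
qed

context action_limit
begin

lemma limit_rel_one:
  assumes \<sigma>: "\<And>n. \<sigma> n \<in> H n" shows "(\<one>\<^bsub>B\<^esub>, \<one>\<^bsub>B\<^esub>) \<in> limit_rel \<sigma>"
proof -
  have "lip_bounded (D n) (LD n) 1 \<one>\<^bsub>D n\<^esub>" for n
  proof (rule L.leg.D.lip_bounded_self_adjoint)
    show "\<one>\<^bsub>D n\<^esub> \<in> self_adjoint (D n)" by (rule L.leg.D.self_adjoint_simps(2))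
    show "LD n \<one>\<^bsub>D n\<^esub> \<le> ennreal 1" using L.leg.D.lip_real_unit(1)[of n 1] L.leg.D.smult_one[OF L.leg.D.one_closed[of n]] by simp
    show "cnorm (D n) \<one>\<^bsub>D n\<^esub> \<le> 1" using L.leg.D.cnorm_one[of n] by simp
  qed
  then have l: "lifts 1 (\<lambda>n. \<one>\<^bsub>D n\<^esub>)" by (simp add: lifts_def)
  have one: "\<one>\<^bsub>B\<^esub> \<in> carrier B" by (rule R.leg.A.one_closed)
  have "near U (\<lambda>_. B) (\<lambda>n. \<pi>B n \<one>\<^bsub>D n\<^esub>) (\<lambda>_. \<one>\<^bsub>B\<^esub>)" unfolding R.leg.hom_one by (rule R.FA.near_refl[OF one])
  moreover have "near U A (\<lambda>n. \<alpha> n (\<sigma> n) (\<pi>A n \<one>\<^bsub>D n\<^esub>)) (\<lambda>n. \<pi>A n \<one>\<^bsub>D n\<^esub>)"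
    unfolding L.leg.hom_one star_homomorphism.hom_one[OF act.act_hom[OF \<sigma>]] by (rule L.FA.near_refl[OF L.leg.A.one_closed])
  ultimately show ?thesis by (intro limit_relI[OF one one _ l l]) simp
qed

text \<open>The domain of the relation contains all \<open>p + \<i> q\<close> with self-adjoint
  Lipschitz \<open>p\<close> and \<open>q\<close>, and these are dense; the constant 4 is that of
  \<open>limit_rel_bound\<close>.\<close>

lemma limit_hom:
  assumes \<sigma>: "\<And>n. \<sigma> n \<in> H n"
  shows "\<exists>f. f \<in> star_hom B B \<and> f \<in> extensional (carrier B) \<and> (\<forall>b b'. (b, b') \<in> limit_rel \<sigma> \<longrightarrow> f b = b')"
proof -
  obtain f where f: "f \<in> star_hom B B" "f \<in> extensional (carrier B)" "\<And>b b'. (b, b') \<in> limit_rel \<sigma> \<Longrightarrow> f b = b'"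
  proof (rule R.leg.A.hom_from_graph[of "limit_rel \<sigma>" 4])
    fix x :: 'b and e :: real assume x: "x \<in> carrier B" and e: "e > 0"
    obtain p q l where pq: "p \<in> self_adjoint B" "q \<in> self_adjoint B" "LB p < ennreal l" "LB q < ennreal l" "l > 0"
      "cnorm B (x \<ominus>\<^bsub>B\<^esub> (p \<oplus>\<^bsub>B\<^esub> \<i> \<odot>\<^bsub>B\<^esub> q)) < e" by (rule R.leg.A.lip_dense_complex[OF x e])
    obtain p' where p': "(p, p') \<in> limit_rel \<sigma>" by (rule limit_rel_lip[of \<sigma>, OF \<sigma> pq(1,3,5)])
    obtain q' where q': "(q, q') \<in> limit_rel \<sigma>" by (rule limit_rel_lip[of \<sigma>, OF \<sigma> pq(2,4,5)])
    have "(p \<oplus>\<^bsub>B\<^esub> \<i> \<odot>\<^bsub>B\<^esub> q, p' \<oplus>\<^bsub>B\<^esub> \<i> \<odot>\<^bsub>B\<^esub> q') \<in> limit_rel \<sigma>"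
      by (rule limit_rel_add[of \<sigma>, OF \<sigma> p' limit_rel_smult[of \<sigma>, OF \<sigma> q']])
    then show "\<exists>u v. (u, v) \<in> limit_rel \<sigma> \<and> cnorm B (x \<ominus>\<^bsub>B\<^esub> u) < e" using pq(6) by blast
  next
    fix f assume "f \<in> star_hom B B" "f \<in> extensional (carrier B)" "\<And>b b'. (b, b') \<in> limit_rel \<sigma> \<Longrightarrow> f b = b'"
    then show thesis by (rule that)
  qed (rule limit_rel_carrier limit_rel_add[of \<sigma>, OF \<sigma>] limit_rel_mult[of \<sigma>, OF \<sigma>] limit_rel_smult[of \<sigma>, OF \<sigma>]
      limit_rel_adj[of \<sigma>, OF \<sigma>] limit_rel_one[of \<sigma>, OF \<sigma>] limit_rel_bound[of \<sigma>, OF \<sigma>]; assumption)+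
  then show ?thesis by (intro exI[of _ f] conjI allI impI)
qed

end

section \<open>The limit action\<close>

text \<open>\<open>s h\<close> is a chosen sequence converging to \<open>h\<close>, and
  \<open>\<beta> h\<close> extends the relation of this sequence; \<open>limit_rel_close\<close>
  allows other sequences with the same limit to be used in its place.\<close>

locale limit_action =
  action_limit G T ell U H F D LD A LA B LB \<pi>A \<pi>B \<epsilon> \<alpha>
  for G :: "'g monoid" (structure) and T :: "'g topology" and ell :: "'g \<Rightarrow> real" and U :: "nat filter"
    and H :: "nat \<Rightarrow> 'g set"
    and F :: "ennreal \<Rightarrow> ennreal \<Rightarrow> ennreal \<Rightarrow> ennreal \<Rightarrow> ennreal"
    and D :: "nat \<Rightarrow> 'd cstar" and LD :: "nat \<Rightarrow> 'd \<Rightarrow> ennreal"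
    and A :: "nat \<Rightarrow> 'a cstar" and LA :: "nat \<Rightarrow> 'a \<Rightarrow> ennreal"
    and B :: "'b cstar" and LB :: "'b \<Rightarrow> ennreal"
    and \<pi>A :: "nat \<Rightarrow> 'd \<Rightarrow> 'a" and \<pi>B :: "nat \<Rightarrow> 'd \<Rightarrow> 'b" and \<epsilon> :: "nat \<Rightarrow> real"
    and \<alpha> :: "nat \<Rightarrow> 'g \<Rightarrow> 'a \<Rightarrow> 'a" +
  fixes s :: "'g \<Rightarrow> nat \<Rightarrow> 'g" and \<beta> :: "'g \<Rightarrow> 'b \<Rightarrow> 'b"
  assumes K: "subgroup limit_group G"
    and s_mem: "h \<in> limit_group \<Longrightarrow> s h n \<in> H n"
    and s_converges: "h \<in> limit_group \<Longrightarrow> converges (s h) h"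
    and \<beta>_hom: "h \<in> limit_group \<Longrightarrow> \<beta> h \<in> star_hom B B"
    and \<beta>_ext: "h \<in> limit_group \<Longrightarrow> \<beta> h \<in> extensional (carrier B)"
    and \<beta>_rel: "\<lbrakk>h \<in> limit_group; (b, b') \<in> limit_rel (s h)\<rbrakk> \<Longrightarrow> \<beta> h b = b'"
begin

lemma \<beta>_star_homomorphism: "h \<in> limit_group \<Longrightarrow> star_homomorphism B B (\<beta> h)"
  by (intro star_homomorphism.intro star_homomorphism_axioms.intro R.leg.A.unital_cstar_algebra_axioms \<beta>_hom)

lemma \<beta>_closed: "\<lbrakk>h \<in> limit_group; x \<in> carrier B\<rbrakk> \<Longrightarrow> \<beta> h x \<in> carrier B"
  by (rule star_homomorphism.hom_closed[OF \<beta>_star_homomorphism])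

lemma \<beta>_minus: "\<lbrakk>h \<in> limit_group; x \<in> carrier B; y \<in> carrier B\<rbrakk> \<Longrightarrow> \<beta> h (x \<ominus>\<^bsub>B\<^esub> y) = \<beta> h x \<ominus>\<^bsub>B\<^esub> \<beta> h y"
  by (rule star_homomorphism.hom_minus[OF \<beta>_star_homomorphism])

lemma \<beta>_contractive: "\<lbrakk>h \<in> limit_group; x \<in> carrier B\<rbrakk> \<Longrightarrow> cnorm B (\<beta> h x) \<le> cnorm B x"
  by (rule star_homomorphism.hom_contractive[OF \<beta>_star_homomorphism])

lemma \<beta>_lip:
  assumes h: "h \<in> limit_group" and b: "b \<in> self_adjoint B" "LB b < ennreal l" and l: "l > 0"
  shows "(b, \<beta> h b) \<in> limit_rel (s h)" "\<beta> h b \<in> self_adjoint B" "LB (\<beta> h b) \<le> ennreal l"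
    "cnorm B (b \<ominus>\<^bsub>B\<^esub> \<beta> h b) \<le> l * ell h"
proof -
  note hc = limit_group_carrier[OF h]
  obtain b' where b': "(b, b') \<in> limit_rel (s h)" "b' \<in> self_adjoint B" "LB b' \<le> ennreal l"
    "\<And>r. \<forall>\<^sub>F n in U. ell (s h n) \<le> r \<Longrightarrow> cnorm B (b \<ominus>\<^bsub>B\<^esub> b') \<le> l * r"
    by (rule limit_rel_lip[of "s h", OF s_mem[OF h] b l], rule that)
  have eq: "\<beta> h b = b'" by (rule \<beta>_rel[OF h b'(1)])
  show "(b, \<beta> h b) \<in> limit_rel (s h)" "\<beta> h b \<in> self_adjoint B" "LB (\<beta> h b) \<le> ennreal l" using b' eq by simp_all
  show "cnorm B (b \<ominus>\<^bsub>B\<^esub> \<beta> h b) \<le> l * ell h" unfolding eq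
  proof (rule field_le_epsilon)
    \<comment> \<open>\<open>ell (s h n)\<close> exceeds \<open>ell h\<close> by at most the gap,
      which is eventually below \<open>e / l\<close>; the factor \<open>l\<close> turns this into
      \<open>e\<close>.\<close>
    fix e :: real assume e: "e > 0"
    have "\<forall>\<^sub>F n in U. gap h (s h n) < e / l"
      by (rule order_tendstoD(2)[OF s_converges[OF h, unfolded converges_def]]) (use e l in simp)
    then have "\<forall>\<^sub>F n in U. ell (s h n) \<le> ell h + e / l"
    proof eventually_elim
      case (elim n)
      then show ?case using ell_le_gap[OF H_carrier[OF s_mem[OF h]] hc, of n] by simp
    qed
    from b'(4)[OF this] show "cnorm B (b \<ominus>\<^bsub>B\<^esub> b') \<le> l * ell h + e" using l by (simp add: distrib_left)
  qed
qed

lemma \<beta>_one: assumes x: "x \<in> carrier B" shows "\<beta> \<one> x = x"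
proof (rule R.leg.A.star_hom_eqI[OF \<beta>_hom star_hom_id _ x])
  have K1: "\<one> \<in> limit_group" by (rule subgroup.one_closed[OF K])
  then show "\<one> \<in> limit_group" .
  fix b assume "b \<in> lip_dom B LB"
  then have b: "b \<in> self_adjoint B" "LB b < \<infinity>" by (auto simp: lip_dom_def)
  obtain l where l: "l > 0" "LB b < ennreal l" by (rule ennreal_finite_bound[OF b(2)])
  note one = subgroup.one_closed[OF subgroups]
  have "(b, b) \<in> limit_rel (s \<one>)"
    by (rule limit_rel_close[of "\<lambda>_. \<one>" "s \<one>", OF one s_mem[OF K1]
        converges_gap[of "\<lambda>_. \<one>" \<one> "s \<one>", OF one converges_one s_mem[OF K1] s_converges[OF K1] one_closed]
        limit_rel_refl[OF b(1) l(2,1)]])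
  then show "\<beta> \<one> b = b" by (rule \<beta>_rel[OF K1])
qed

text \<open>The products of the chosen sequences converge to \<open>h g\<close>, so they may replace
  the sequence chosen for \<open>h g\<close>; on Lipschitz elements their relation contains the
  composite of the two relations.\<close>

lemma \<beta>_mult:
  assumes h: "h \<in> limit_group" and g: "g \<in> limit_group" and x: "x \<in> carrier B"
  shows "\<beta> (h \<otimes> g) x = \<beta> h (\<beta> g x)"
proof (rule R.leg.A.star_hom_eqI[OF \<beta>_hom star_hom_compose[OF \<beta>_hom[OF g] \<beta>_hom[OF h]] _ x])
  have hg: "h \<otimes> g \<in> limit_group" by (rule subgroup.m_closed[OF K h g])
  then show "h \<otimes> g \<in> limit_group" .
  fix b assume "b \<in> lip_dom B LB"
  then have b: "b \<in> self_adjoint B" "LB b < \<infinity>" by (auto simp: lip_dom_def)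
  obtain l where l: "l > 0" "LB b < ennreal l" by (rule ennreal_finite_bound[OF b(2)])
  \<comment> \<open>\<open>\<beta> g b\<close> satisfies the weak bound \<open>l\<close>, while
    \<open>\<beta>_lip\<close> wants a strict one, hence \<open>l + 1\<close>.\<close>
  have l1: "0 < l + 1" "LB (\<beta> g b) < ennreal (l + 1)" using l(1)
      order_le_less_trans[OF \<beta>_lip(3)[OF g b(1) l(2,1)], of "ennreal (l + 1)"] by (simp_all add: ennreal_less_iff)
  have prod: "s h n \<otimes> s g n \<in> H n" for n by (rule subgroup.m_closed[OF subgroups s_mem[OF h] s_mem[OF g]])
  have conv: "converges (\<lambda>n. s h n \<otimes> s g n) (h \<otimes> g)"
    by (rule converges_mult[of "s h" h "s g" g, OF s_mem[OF h] s_converges[OF h] limit_group_carrier[OF h]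
        s_mem[OF g] s_converges[OF g] limit_group_carrier[OF g]])
  have "(b, \<beta> h (\<beta> g b)) \<in> limit_rel (\<lambda>n. s h n \<otimes> s g n)"
    by (rule limit_rel_trans[of "s h" "s g", OF s_mem[OF h] s_mem[OF g] \<beta>_lip(1)[OF g b(1) l(2,1)]
        \<beta>_lip(1)[OF h \<beta>_lip(2)[OF g b(1) l(2,1)] l1(2,1)]])
  then have "(b, \<beta> h (\<beta> g b)) \<in> limit_rel (s (h \<otimes> g))"
    by (rule limit_rel_close[of "\<lambda>n. s h n \<otimes> s g n" "s (h \<otimes> g)", OF prod s_mem[OF hg]
        converges_gap[of "\<lambda>n. s h n \<otimes> s g n" "h \<otimes> g" "s (h \<otimes> g)", OF prod conv s_mem[OF hg] s_converges[OF hg] limit_group_carrier[OF hg]]])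
  then show "\<beta> (h \<otimes> g) b = \<beta> h (\<beta> g b)" by (rule \<beta>_rel[OF hg])
qed

lemma \<beta>_inv: assumes h: "h \<in> limit_group" and x: "x \<in> carrier B" shows "\<beta> (inv h) (\<beta> h x) = x" "\<beta> h (\<beta> (inv h) x) = x"
  using \<beta>_mult[OF subgroup.m_inv_closed[OF K h] h x] \<beta>_mult[OF h subgroup.m_inv_closed[OF K h] x] \<beta>_one[OF x]
    limit_group_carrier[OF h] by simp_all

lemma \<beta>_action: "cstar_action G limit_group B \<beta>"
  unfolding cstar_action_def
proof (intro conjI ballI \<beta>_hom)
  have Bij: "\<beta> h \<in> Bij (carrier B)" if h: "h \<in> limit_group" for h
  proof -
    have hi: "inv h \<in> limit_group" by (rule subgroup.m_inv_closed[OF K h])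
    have "bij_betw (\<beta> h) (carrier B) (carrier B)"
      by (rule bij_betw_byWitness[where f' = "\<beta> (inv h)"])
        (use \<beta>_inv[OF h] \<beta>_closed[OF h] \<beta>_closed[OF hi] in \<open>simp_all add: image_subset_iff\<close>)
    then show ?thesis using \<beta>_ext[OF h] by (simp add: Bij_def)
  qed
  have "group_hom (G\<lparr>carrier := limit_group\<rparr>) (BijGroup (carrier B)) \<beta>"
  proof (intro group_hom.intro group_hom_axioms.intro)
    show "group (G\<lparr>carrier := limit_group\<rparr>)" by (rule subgroup.subgroup_is_group[OF K is_group])
    show "group (BijGroup (carrier B))" by (rule group_BijGroup)
    show "\<beta> \<in> hom (G\<lparr>carrier := limit_group\<rparr>) (BijGroup (carrier B))"
    proof (rule homI)
      fix h assume "h \<in> carrier (G\<lparr>carrier := limit_group\<rparr>)"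
      then show "\<beta> h \<in> carrier (BijGroup (carrier B))" using Bij by (simp add: BijGroup_def)
    next
      fix h g assume "h \<in> carrier (G\<lparr>carrier := limit_group\<rparr>)" "g \<in> carrier (G\<lparr>carrier := limit_group\<rparr>)"
      then have hg: "h \<in> limit_group" "g \<in> limit_group" by simp_all
      have "\<beta> (h \<otimes> g) = compose (carrier B) (\<beta> h) (\<beta> g)"
        by (rule extensionalityI[OF \<beta>_ext[OF subgroup.m_closed[OF K hg]] compose_extensional])
          (simp add: compose_def \<beta>_mult[OF hg])
      then show "\<beta> (h \<otimes>\<^bsub>G\<lparr>carrier := limit_group\<rparr>\<^esub> g) = \<beta> h \<otimes>\<^bsub>BijGroup (carrier B)\<^esub> \<beta> g"
        using Bij[OF hg(1)] Bij[OF hg(2)] by (simp add: BijGroup_def)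
    qed
  qed
  then show "group_action (G\<lparr>carrier := limit_group\<rparr>) (carrier B) \<beta>" by (rule group_action.intro)
qed

lemma \<beta>_modulus:
  assumes x: "x \<in> carrier B" and e: "e > 0"
  obtains \<delta> where "\<delta> > 0" "\<And>h g. \<lbrakk>h \<in> limit_group; g \<in> limit_group; gap h g < \<delta>\<rbrakk> \<Longrightarrow> cnorm B (\<beta> h x \<ominus>\<^bsub>B\<^esub> \<beta> g x) < e"
proof -
  have e4: "e/4 > 0" using e by simp
  obtain p q l where pq: "p \<in> self_adjoint B" "q \<in> self_adjoint B" "LB p < ennreal l" "LB q < ennreal l" "l > 0"
    "cnorm B (x \<ominus>\<^bsub>B\<^esub> (p \<oplus>\<^bsub>B\<^esub> \<i> \<odot>\<^bsub>B\<^esub> q)) < e/4" by (rule R.leg.A.lip_dense_complex[OF x e4])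
  define y where "y = p \<oplus>\<^bsub>B\<^esub> \<i> \<odot>\<^bsub>B\<^esub> q"
  note pc = R.leg.A.self_adjointD(1)[OF pq(1)] and qc = R.leg.A.self_adjointD(1)[OF pq(2)]
  have y: "y \<in> carrier B" unfolding y_def using pc qc by simp
  show ?thesis
  proof (rule that)
    \<comment> \<open>Two parts, each displaced by at most \<open>l * ell k\<close>, move
      \<open>y\<close> by less than \<open>e/2\<close>; replacing \<open>x\<close> by
      \<open>y\<close> at both ends costs \<open>e/4\<close> each.\<close>
    show "e / (4 * l) > 0" using e pq(5) by simp
    fix h g assume h: "h \<in> limit_group" and g: "g \<in> limit_group" and gap: "gap h g < e / (4 * l)"
    define k where "k = inv h \<otimes> g"
    have k: "k \<in> limit_group" unfolding k_def by (rule subgroup.m_closed[OF K subgroup.m_inv_closed[OF K h] g])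
    have hk: "h \<otimes> k = g" unfolding k_def using limit_group_carrier[OF h] limit_group_carrier[OF g] by (simp flip: m_assoc)
    interpret k: star_homomorphism B B "\<beta> k" by (rule \<beta>_star_homomorphism[OF k])
    have kc: "\<beta> k p \<in> carrier B" "\<beta> k q \<in> carrier B" "\<beta> k y \<in> carrier B" using pc qc y by (auto intro: k.hom_closed)
    have "y \<ominus>\<^bsub>B\<^esub> \<beta> k y = (p \<ominus>\<^bsub>B\<^esub> \<beta> k p) \<oplus>\<^bsub>B\<^esub> \<i> \<odot>\<^bsub>B\<^esub> (q \<ominus>\<^bsub>B\<^esub> \<beta> k q)"
    proof -
      have "\<beta> k y = \<beta> k p \<oplus>\<^bsub>B\<^esub> \<i> \<odot>\<^bsub>B\<^esub> \<beta> k q" unfolding y_def using pc qc by (simp add: k.hom_add k.hom_smult)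
      then show ?thesis unfolding y_def
        by (intro R.leg.A.eq_by_functionals) (use pc qc kc in \<open>auto simp: R.leg.A.linear_functional_simps algebra_simps\<close>)
    qed
    then have "cnorm B (y \<ominus>\<^bsub>B\<^esub> \<beta> k y) \<le> cnorm B (p \<ominus>\<^bsub>B\<^esub> \<beta> k p) + cnorm B (q \<ominus>\<^bsub>B\<^esub> \<beta> k q)"
      using R.leg.A.cnorm_triangle[of "p \<ominus>\<^bsub>B\<^esub> \<beta> k p" "\<i> \<odot>\<^bsub>B\<^esub> (q \<ominus>\<^bsub>B\<^esub> \<beta> k q)"] pc qc kc by (simp add: R.leg.A.cnorm_smult)
    also have "\<dots> \<le> l * ell k + l * ell k"
      by (rule add_mono[OF \<beta>_lip(4)[OF k pq(1,3,5)] \<beta>_lip(4)[OF k pq(2,4,5)]])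
    also have "\<dots> < e/2" using gap pq(5) unfolding gap_def k_def by (simp add: field_simps)
    finally have 1: "cnorm B (y \<ominus>\<^bsub>B\<^esub> \<beta> k y) < e/2" .
    have gy: "\<beta> g y = \<beta> h (\<beta> k y)" using \<beta>_mult[OF h k y] hk by simp
    have "cnorm B (\<beta> h y \<ominus>\<^bsub>B\<^esub> \<beta> g y) \<le> cnorm B (y \<ominus>\<^bsub>B\<^esub> \<beta> k y)"
      using \<beta>_contractive[OF h R.leg.A.minus_closed[OF y kc(3)]] \<beta>_minus[OF h y kc(3)] gy by simp
    then have 2: "cnorm B (\<beta> h y \<ominus>\<^bsub>B\<^esub> \<beta> g y) < e/2" using 1 by simp
    have xy: "cnorm B (\<beta> h x \<ominus>\<^bsub>B\<^esub> \<beta> h y) < e/4" "cnorm B (\<beta> g x \<ominus>\<^bsub>B\<^esub> \<beta> g y) < e/4"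
      using \<beta>_contractive[OF h R.leg.A.minus_closed[OF x y]] \<beta>_contractive[OF g R.leg.A.minus_closed[OF x y]]
        \<beta>_minus[OF h x y] \<beta>_minus[OF g x y] pq(6) by (simp_all add: y_def)
    note c = \<beta>_closed[OF h x] \<beta>_closed[OF h y] \<beta>_closed[OF g x] \<beta>_closed[OF g y]
    show "cnorm B (\<beta> h x \<ominus>\<^bsub>B\<^esub> \<beta> g x) < e"
      using R.leg.A.cnorm_minus_triangle[OF c(1,2,3)] R.leg.A.cnorm_minus_triangle[OF c(2,4,3)]
        R.leg.A.cnorm_minus_commute[OF c(4,3)] xy 2 by simp
  qed
qed

lemma \<beta>_strongly_continuous: "strongly_continuous T limit_group B \<beta>"
  unfolding strongly_continuous_def
proof
  fix x assume x: "x \<in> carrier B"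
  interpret M: Metric_space "carrier B" "norm_dist B" by (rule R.leg.A.norm_metric)
  have "continuous_map (subtopology T limit_group) M.mtopology (\<lambda>h. \<beta> h x)"
    unfolding M.continuous_map_to_metric
  proof (intro ballI allI impI)
    fix h and e :: real assume "h \<in> topspace (subtopology T limit_group)" and e: "e > 0"
    then have h: "h \<in> limit_group" by simp
    note hc = limit_group_carrier[OF h]
    obtain \<delta> where \<delta>: "\<delta> > 0" "\<And>h g. \<lbrakk>h \<in> limit_group; g \<in> limit_group; gap h g < \<delta>\<rbrakk> \<Longrightarrow> cnorm B (\<beta> h x \<ominus>\<^bsub>B\<^esub> \<beta> g x) < e"
      by (rule \<beta>_modulus[OF x e], rule that)
    define V where "V = {g \<in> carrier G. gap h g < \<delta>} \<inter> limit_group"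
    have "openin (subtopology T limit_group) V"
      unfolding V_def openin_subtopology using openin_gap_ball[OF hc, of \<delta>] by blast
    moreover have "h \<in> V" using h hc gap_refl[OF hc] \<delta>(1) by (simp add: V_def)
    moreover have "\<beta> g x \<in> M.mball (\<beta> h x) e" if "g \<in> V" for g
    proof -
      have g: "g \<in> limit_group" "gap h g < \<delta>" using that by (auto simp: V_def)
      show ?thesis using \<delta>(2)[OF h g] \<beta>_closed[OF h x] \<beta>_closed[OF g(1) x]
        by (simp add: M.in_mball R.leg.A.norm_dist_eq)
    qed
    ultimately show "\<exists>V. openin (subtopology T limit_group) V \<and> h \<in> V \<and> (\<forall>g\<in>V. \<beta> g x \<in> M.mball (\<beta> h x) e)" by blast
  qed
  then show "continuous_map (subtopology T limit_group) (norm_topology B) (\<lambda>h. \<beta> h x)" by (simp add: norm_topology_def)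
qed

text \<open>A fixed element is close to a Lipschitz element \<open>p\<close> that hardly moves; by compactness, the
  lifts of \<open>p\<close> to \<open>A n\<close> hardly move for \<open>U\<close>-almost all \<open>n\<close>, so they are almost scalar by
  ergodicity.\<close>

lemma fixed_near_scalar:
  assumes b: "b \<in> self_adjoint B" and fixed: "\<And>h. h \<in> limit_group \<Longrightarrow> \<beta> h b = b" and e: "e > 0"
  shows "\<exists>t. cnorm B (b \<ominus>\<^bsub>B\<^esub> R.leg.A.real_unit t) \<le> 7 * e"
proof -
  note bc = R.leg.A.self_adjointD(1)[OF b]
  obtain p where p0: "p \<in> lip_dom B LB" "cnorm B (b \<ominus>\<^bsub>B\<^esub> p) < e" by (rule R.leg.A.lip_dense[OF b e])
  then have p: "p \<in> self_adjoint B" "LB p < \<infinity>" by (auto simp: lip_dom_def)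
  note pc = R.leg.A.self_adjointD(1)[OF p(1)]
  obtain l where l: "l > 0" "LB p < ennreal l" by (rule ennreal_finite_bound[OF p(2)])
  \<comment> \<open>\<open>p\<close> is within \<open>e\<close> of the fixed element
    \<open>b\<close>, and so is \<open>\<beta> h p\<close> because \<open>\<beta> h\<close> is
    contractive.\<close>
  have move: "cnorm B (p \<ominus>\<^bsub>B\<^esub> \<beta> h p) \<le> 2 * e" if h: "h \<in> limit_group" for h
  proof -
    have "cnorm B (b \<ominus>\<^bsub>B\<^esub> \<beta> h p) \<le> cnorm B (b \<ominus>\<^bsub>B\<^esub> p)"
      using \<beta>_contractive[OF h R.leg.A.minus_closed[OF bc pc]] \<beta>_minus[OF h bc pc] fixed[OF h] by simp
    then show ?thesis using R.leg.A.cnorm_minus_triangle[OF pc bc \<beta>_closed[OF h pc]]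
      R.leg.A.cnorm_minus_commute[OF pc bc] p0(2) by simp
  qed
  obtain d where d: "lifts (cnorm B p + l) d" "\<And>n. \<pi>B n (d n) = p" "\<And>n. d n \<in> self_adjoint (D n)"
    "\<And>n. LD n (d n) \<le> ennreal l" by (rule lift_exact[OF p(1) l(2,1)], rule that)
  note dc = liftsD[OF d(1)]
  \<comment> \<open>The threshold leaves room above \<open>4 * e\<close>: a displacement of
    \<open>2 * e\<close> in \<open>B\<close> may double on the way to \<open>A n\<close>, as the
    lifts in the limit relation are not known to be self-adjoint.\<close>
  define bad where "bad n g \<longleftrightarrow> \<not> cnorm (A n) (\<pi>A n (d n) \<ominus>\<^bsub>A n\<^esub> \<alpha> n g (\<pi>A n (d n))) \<le> 5 * e" for n g
  have inv: "\<forall>\<^sub>F n in U. \<forall>g\<in>H n. \<not> bad n g"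
  proof (rule ccontr)
    assume "\<not> ?thesis"
    then have ev: "\<forall>\<^sub>F n in U. \<exists>g\<in>H n. bad n g" unfolding U.not_eventually_iff by simp
    \<comment> \<open>A bad element is chosen where one exists, and any element of
      \<open>H n\<close> elsewhere.\<close>
    have "\<exists>g. g \<in> H n \<and> ((\<exists>g\<in>H n. bad n g) \<longrightarrow> bad n g)" for n
      using subgroup.one_closed[OF subgroups[of n]] by blast
    then obtain \<sigma> where \<sigma>: "\<And>n. \<sigma> n \<in> H n" "\<And>n. (\<exists>g\<in>H n. bad n g) \<longrightarrow> bad n (\<sigma> n)" by metis
    obtain h where h: "h \<in> limit_group" "converges \<sigma> h" by (rule sequence_limit_in_limit_group[of \<sigma>, OF \<sigma>(1)])
    have rel: "(p, \<beta> h p) \<in> limit_rel \<sigma>"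
      by (rule limit_rel_close[of "s h" \<sigma>, OF s_mem[OF h(1)] \<sigma>(1)
          converges_gap[of "s h" h \<sigma>, OF s_mem[OF h(1)] s_converges[OF h(1)] \<sigma>(1) h(2) limit_group_carrier[OF h(1)]]
          \<beta>_lip(1)[OF h(1) p(1) l(2,1)]])
    \<comment> \<open>The relation brings its own lifts \<open>f\<close> of \<open>p\<close>; in
      \<open>A n\<close> they agree with those of \<open>d\<close> up to a null sequence.\<close>
    obtain m f f' where f0: "0 < m" "lifts m f" "lifts m f'" and f:
      "near U (\<lambda>_. B) (\<lambda>n. \<pi>B n (f n)) (\<lambda>_. p)" "near U (\<lambda>_. B) (\<lambda>n. \<pi>B n (f' n)) (\<lambda>_. \<beta> h p)"
      "near U A (\<lambda>n. \<alpha> n (\<sigma> n) (\<pi>A n (f n))) (\<lambda>n. \<pi>A n (f' n))" by (rule limit_relE[OF rel])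
    define w where "w = cnorm B p + l + m"
    have w: "w > 0" "m \<le> w" "cnorm B p + l \<le> w" unfolding w_def using f0(1) l(1) R.leg.A.cnorm_nonneg[OF pc] by auto
    have wl: "lifts w d" "lifts w f" "lifts w f'"
      by (rule lifts_mono[OF d(1) w(3)], rule lifts_mono[OF f0(2) w(2)], rule lifts_mono[OF f0(3) w(2)])
    note fc = liftsD[OF wl(2)] liftsD[OF wl(3)]
    have "near U (\<lambda>_. B) (\<lambda>n. \<pi>B n (d n)) (\<lambda>_. p)" unfolding d(2) by (rule R.FA.near_refl[OF pc])
    then have df: "near U A (\<lambda>n. \<pi>A n (d n)) (\<lambda>n. \<pi>A n (f n))" by (rule near_B_to_A[OF wl(1,2) w(1) pc _ f(1)])
    have adf: "near U A (\<lambda>n. \<alpha> n (\<sigma> n) (\<pi>A n (d n))) (\<lambda>n. \<alpha> n (\<sigma> n) (\<pi>A n (f n)))"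
      using df unfolding near_def act.act_dist[OF \<sigma>(1) dc(3) fc(3)] .
    note ac = act.act_closed[OF \<sigma>(1) dc(3)] act.act_closed[OF \<sigma>(1) fc(3)]
    have "near U A (\<lambda>n. \<alpha> n (\<sigma> n) (\<pi>A n (d n))) (\<lambda>n. \<pi>A n (f' n))"
      by (rule L.FA.near_trans[OF ac(1) ac(2) fc(7) adf f(3)])
    then have "near U A (\<lambda>n. \<pi>A n (d n) \<ominus>\<^bsub>A n\<^esub> \<alpha> n (\<sigma> n) (\<pi>A n (d n))) (\<lambda>n. \<pi>A n (f n) \<ominus>\<^bsub>A n\<^esub> \<pi>A n (f' n))"
      by (rule L.FA.near_minus[OF dc(3) fc(3) ac(1) fc(7) df])
    then have lim1: "((\<lambda>n. cnorm (A n) (\<pi>A n (d n) \<ominus>\<^bsub>A n\<^esub> \<alpha> n (\<sigma> n) (\<pi>A n (d n))) - cnorm (A n) (\<pi>A n (f n) \<ominus>\<^bsub>A n\<^esub> \<pi>A n (f' n))) \<longlongrightarrow> 0) U"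
      by (rule L.FA.near_cnorm_diff[OF L.leg.A.minus_closed[OF dc(3) ac(1)] L.leg.A.minus_closed[OF fc(3) fc(7)]])
    have ff: "near U (\<lambda>_. B) (\<lambda>n. \<pi>B n (f n) \<ominus>\<^bsub>B\<^esub> \<pi>B n (f' n)) (\<lambda>_. p \<ominus>\<^bsub>B\<^esub> \<beta> h p)"
      by (rule R.FA.near_minus[OF fc(4) pc fc(8) \<beta>_closed[OF h(1) pc] f(1,2)])
    have lim2: "((\<lambda>n. cnorm B (\<pi>B n (f n) \<ominus>\<^bsub>B\<^esub> \<pi>B n (f' n))) \<longlongrightarrow> cnorm B (p \<ominus>\<^bsub>B\<^esub> \<beta> h p)) U"
      by (rule R.leg.A.near_cnorm[OF R.leg.A.minus_closed[OF fc(4) fc(8)] R.leg.A.minus_closed[OF pc \<beta>_closed[OF h(1) pc]] ff])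
    have lim: "((\<lambda>n. (cnorm (A n) (\<pi>A n (d n) \<ominus>\<^bsub>A n\<^esub> \<alpha> n (\<sigma> n) (\<pi>A n (d n))) - cnorm (A n) (\<pi>A n (f n) \<ominus>\<^bsub>A n\<^esub> \<pi>A n (f' n)))
        + (2 * cnorm B (\<pi>B n (f n) \<ominus>\<^bsub>B\<^esub> \<pi>B n (f' n)) + 2 * ((w + 2 * w) * \<epsilon> n)))
      \<longlongrightarrow> 0 + (2 * cnorm B (p \<ominus>\<^bsub>B\<^esub> \<beta> h p) + 2 * ((w + 2 * w) * 0))) U"
      by (rule tendsto_add[OF lim1 tendsto_add[OF tendsto_mult[OF tendsto_const lim2] tendsto_mult[OF tendsto_const tendsto_mult[OF tendsto_const L.\<epsilon>_limit]]]])
    have "0 + (2 * cnorm B (p \<ominus>\<^bsub>B\<^esub> \<beta> h p) + 2 * ((w + 2 * w) * 0)) < 5 * e" using move[OF h(1)] e by simp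
    from order_tendstoD(2)[OF lim this] ev have "\<forall>\<^sub>F n in U. False"
    proof eventually_elim
      case (elim n)
      have "cnorm (A n) (\<pi>A n (f n) \<ominus>\<^bsub>A n\<^esub> \<pi>A n (f' n)) = cnorm (A n) (\<pi>A n (f n \<ominus>\<^bsub>D n\<^esub> f' n))"
        using L.leg.hom_minus[OF fc(2)[of n] fc(6)[of n]] by simp
      also have "\<dots> \<le> cnorm (D n) (f n \<ominus>\<^bsub>D n\<^esub> f' n)" by (rule L.leg.hom_contractive[OF L.leg.D.minus_closed[OF fc(2) fc(6)]])
      also have "\<dots> \<le> 2 * cnorm B (\<pi>B n (f n \<ominus>\<^bsub>D n\<^esub> f' n)) + 2 * ((w + 2 * w) * \<epsilon> n)"
        by (rule R.leg.cnorm_le[OF L.leg.D.lip_bounded_minus[OF fc(1) fc(5)]]) (use w(1) in simp)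
      also have "\<pi>B n (f n \<ominus>\<^bsub>D n\<^esub> f' n) = \<pi>B n (f n) \<ominus>\<^bsub>B\<^esub> \<pi>B n (f' n)" by (rule R.leg.hom_minus[OF fc(2) fc(6)])
      finally have "cnorm (A n) (\<pi>A n (d n) \<ominus>\<^bsub>A n\<^esub> \<alpha> n (\<sigma> n) (\<pi>A n (d n))) \<le> 5 * e" using elim(1) by simp
      then have "\<not> bad n (\<sigma> n)" by (simp add: bad_def)
      then show False using \<sigma>(2)[of n] elim(2) by blast
    qed
    then show False using U.proper by simp
  qed
  have "((\<lambda>n. l * \<epsilon> n) \<longlongrightarrow> l * 0) U" by (rule tendsto_mult[OF tendsto_const L.\<epsilon>_limit])
  then have "\<forall>\<^sub>F n in U. l * \<epsilon> n < e" by (rule order_tendstoD(2)) (use e in simp)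
  from eventually_happens'[OF U.proper eventually_conj[OF this inv]]
  obtain n where n: "l * \<epsilon> n < e" "\<And>g. g \<in> H n \<Longrightarrow> \<not> bad n g" by blast
  define a where "a = \<pi>A n (d n)"
  have a: "a \<in> self_adjoint (A n)" unfolding a_def by (rule L.leg.hom_self_adjoint[OF d(3)])
  note ac = L.leg.A.self_adjointD(1)[OF a]
  have La: "LA n a \<le> ennreal l" unfolding a_def by (rule order_trans[OF L.leg.lip_image_le[OF d(3)] d(4)])
  have "\<exists>c. cnorm (A n) (a \<ominus>\<^bsub>A n\<^esub> c \<odot>\<^bsub>A n\<^esub> \<one>\<^bsub>A n\<^esub>) \<le> 5 * e"
  proof (rule act.almost_invariant_near_scalar[OF act.erg a La l(1)])
    fix g assume "g \<in> H n"
    from n(2)[OF this] show "cnorm (A n) (a \<ominus>\<^bsub>A n\<^esub> \<alpha> n g a) \<le> 5 * e" by (simp add: bad_def a_def)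
  qed
  then obtain c where c: "cnorm (A n) (a \<ominus>\<^bsub>A n\<^esub> c \<odot>\<^bsub>A n\<^esub> \<one>\<^bsub>A n\<^esub>) \<le> 5 * e" by blast
  \<comment> \<open>As \<open>a\<close> is self-adjoint, the real part of \<open>a - c\<close> is
    \<open>a - Re c\<close>, and taking it does not increase the norm.\<close>
  define t where "t = Re c"
  have oneA: "\<one>\<^bsub>A n\<^esub> \<in> carrier (A n)" by (rule L.leg.A.one_closed)
  have ca: "a \<ominus>\<^bsub>A n\<^esub> c \<odot>\<^bsub>A n\<^esub> \<one>\<^bsub>A n\<^esub> \<in> carrier (A n)" by (rule L.leg.A.minus_closed[OF ac L.leg.A.smult_closed[OF oneA]])
  have "re_part (A n) (a \<ominus>\<^bsub>A n\<^esub> c \<odot>\<^bsub>A n\<^esub> \<one>\<^bsub>A n\<^esub>) = a \<ominus>\<^bsub>A n\<^esub> complex_of_real t \<odot>\<^bsub>A n\<^esub> \<one>\<^bsub>A n\<^esub>"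
  proof -
    define m where "m = - Im c"
    have c_eq: "c = complex_of_real t - \<i> * complex_of_real m" unfolding t_def m_def by (simp add: complex_eq_iff)
    have "a \<ominus>\<^bsub>A n\<^esub> c \<odot>\<^bsub>A n\<^esub> \<one>\<^bsub>A n\<^esub> = (a \<ominus>\<^bsub>A n\<^esub> complex_of_real t \<odot>\<^bsub>A n\<^esub> \<one>\<^bsub>A n\<^esub>) \<oplus>\<^bsub>A n\<^esub> \<i> \<odot>\<^bsub>A n\<^esub> (complex_of_real m \<odot>\<^bsub>A n\<^esub> \<one>\<^bsub>A n\<^esub>)"
      unfolding c_eq by (rule L.leg.A.eq_by_functionals[where n = n]) (use ac oneA in \<open>simp_all add: L.leg.A.linear_functional_simps algebra_simps\<close>)
    moreover have "a \<ominus>\<^bsub>A n\<^esub> complex_of_real t \<odot>\<^bsub>A n\<^esub> \<one>\<^bsub>A n\<^esub> \<in> self_adjoint (A n)" "complex_of_real m \<odot>\<^bsub>A n\<^esub> \<one>\<^bsub>A n\<^esub> \<in> self_adjoint (A n)"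
      by (intro L.leg.A.self_adjoint_simps a)+
    ultimately show ?thesis by (simp only: L.leg.A.parts_of_sum(1))
  qed
  then have a_t: "cnorm (A n) (a \<ominus>\<^bsub>A n\<^esub> complex_of_real t \<odot>\<^bsub>A n\<^esub> \<one>\<^bsub>A n\<^esub>) \<le> 5 * e"
    using L.leg.A.cnorm_part_le(1)[OF ca] c by simp
  define z where "z = d n \<ominus>\<^bsub>D n\<^esub> complex_of_real t \<odot>\<^bsub>D n\<^esub> \<one>\<^bsub>D n\<^esub>"
  have oneD: "\<one>\<^bsub>D n\<^esub> \<in> carrier (D n)" by (rule L.leg.D.one_closed)
  have unit: "complex_of_real t \<odot>\<^bsub>D n\<^esub> \<one>\<^bsub>D n\<^esub> \<in> self_adjoint (D n)" by (intro L.leg.D.self_adjoint_simps)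
  have uc: "complex_of_real t \<odot>\<^bsub>D n\<^esub> \<one>\<^bsub>D n\<^esub> \<in> carrier (D n)" by (rule L.leg.D.self_adjointD(1)[OF unit])
  have z: "z \<in> self_adjoint (D n)" unfolding z_def by (rule L.leg.D.self_adjoint_simps(4)[OF d(3) unit])
  \<comment> \<open>Scalars have seminorm 0, so \<open>z\<close> keeps the bound of
    \<open>d n\<close>. The self-adjoint estimate then adds \<open>l * \<epsilon> n < e\<close> to
    \<open>5 * e\<close>, and one more \<open>e\<close> leads from \<open>p\<close> to
    \<open>b\<close>.\<close>
  have Lz: "LD n z \<le> ennreal (l + 0)" unfolding z_def
    by (rule L.leg.D.lip_minus[OF d(3) unit d(4)]) (use l(1) L.leg.D.lip_real_unit(1) in simp_all)
  have zA: "\<pi>A n z = a \<ominus>\<^bsub>A n\<^esub> complex_of_real t \<odot>\<^bsub>A n\<^esub> \<one>\<^bsub>A n\<^esub>" unfolding z_def a_def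
    using L.leg.hom_minus[OF dc(2) uc] L.leg.hom_smult[OF oneD] L.leg.hom_one by simp
  have zB: "\<pi>B n z = p \<ominus>\<^bsub>B\<^esub> R.leg.A.real_unit t" unfolding z_def
    using R.leg.hom_minus[OF dc(2) uc] R.leg.hom_smult[OF oneD] R.leg.hom_one d(2) by simp
  have "cnorm (D n) z \<le> cnorm (A n) (\<pi>A n z) + (l + 0) * \<epsilon> n"
    by (rule L.leg.cnorm_self_adjoint_le[OF z Lz]) (use l(1) in simp)
  then have "cnorm (D n) z \<le> 6 * e" using a_t n(1) unfolding zA by simp
  then have pt: "cnorm B (p \<ominus>\<^bsub>B\<^esub> R.leg.A.real_unit t) \<le> 6 * e"
    using R.leg.hom_contractive[OF L.leg.D.self_adjointD(1)[OF z]] unfolding zB by simp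
  have "cnorm B (b \<ominus>\<^bsub>B\<^esub> R.leg.A.real_unit t) \<le> cnorm B (b \<ominus>\<^bsub>B\<^esub> p) + cnorm B (p \<ominus>\<^bsub>B\<^esub> R.leg.A.real_unit t)"
    by (rule R.leg.A.cnorm_minus_triangle[OF bc pc R.leg.A.smult_closed[OF R.leg.A.one_closed]])
  then have "cnorm B (b \<ominus>\<^bsub>B\<^esub> R.leg.A.real_unit t) \<le> 7 * e" using pt p0(2) by simp
  then show ?thesis by blast
qed

text \<open>The approximating scalars are bounded, so they converge along the ultrafilter, and their
  limit equals \<open>b\<close>.\<close>

lemma fixed_self_adjoint_scalar:
  assumes b: "b \<in> self_adjoint B" and fixed: "\<And>h. h \<in> limit_group \<Longrightarrow> \<beta> h b = b"
  shows "\<exists>t. b = R.leg.A.real_unit t"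
proof -
  note bc = R.leg.A.self_adjointD(1)[OF b]
  note uc = R.leg.A.smult_closed[OF R.leg.A.one_closed]
  \<comment> \<open>The 7 cancels the one in \<open>fixed_near_scalar\<close>, so that the errors
    are at most 1.\<close>
  define \<eta> :: "nat \<Rightarrow> real" where "\<eta> k = 1 / (7 * (real k + 1))" for k
  have \<eta>: "\<eta> k > 0" for k by (simp add: \<eta>_def)
  have elim: "(\<eta> \<longlongrightarrow> 0) U" by (rule tendsto_mono[OF U_sequentially]) (unfold \<eta>_def, real_asymp)
  have "\<forall>k. \<exists>t. cnorm B (b \<ominus>\<^bsub>B\<^esub> R.leg.A.real_unit t) \<le> 7 * \<eta> k" by (intro allI fixed_near_scalar b fixed \<eta>)
  then obtain t where t: "\<And>k. cnorm B (b \<ominus>\<^bsub>B\<^esub> R.leg.A.real_unit (t k)) \<le> 7 * \<eta> k" by metis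
  have "\<bar>t k\<bar> \<le> cnorm B b + 1" for k
  proof -
    have "7 * \<eta> k \<le> 1" by (simp add: \<eta>_def)
    moreover have "cnorm B (R.leg.A.real_unit (t k)) \<le> cnorm B b + cnorm B (R.leg.A.real_unit (t k) \<ominus>\<^bsub>B\<^esub> b)"
      by (rule R.leg.A.cnorm_triangle_diff[OF uc bc])
    ultimately show ?thesis using t[of k] R.leg.A.cnorm_minus_commute[OF uc bc, of "complex_of_real (t k)"]
      unfolding R.leg.A.cnorm_real_unit by linarith
  qed
  then have "\<forall>\<^sub>F k in U. t k \<in> cball 0 (cnorm B b + 1)" by (intro always_eventually allI) (simp add: mem_cball_0)
  from U.compact_limit[OF compact_cball this] obtain r where r: "(t \<longlongrightarrow> r) U" by blast
  have le: "cnorm B (b \<ominus>\<^bsub>B\<^esub> R.leg.A.real_unit r) \<le> 7 * \<eta> k + \<bar>t k - r\<bar>" for k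
  proof -
    have eq: "R.leg.A.real_unit (t k) \<ominus>\<^bsub>B\<^esub> R.leg.A.real_unit r = R.leg.A.real_unit (t k - r)"
      by (rule R.leg.A.eq_by_functionals) (use R.leg.A.one_closed in \<open>auto simp: R.leg.A.linear_functional_simps algebra_simps\<close>)
    have "cnorm B (b \<ominus>\<^bsub>B\<^esub> R.leg.A.real_unit r) \<le> cnorm B (b \<ominus>\<^bsub>B\<^esub> R.leg.A.real_unit (t k)) + cnorm B (R.leg.A.real_unit (t k) \<ominus>\<^bsub>B\<^esub> R.leg.A.real_unit r)"
      by (rule R.leg.A.cnorm_minus_triangle[OF bc uc uc])
    then show ?thesis using t[of k] unfolding eq R.leg.A.cnorm_real_unit by simp
  qed
  have lim: "((\<lambda>k. 7 * \<eta> k + \<bar>t k - r\<bar>) \<longlongrightarrow> 7 * 0 + \<bar>r - r\<bar>) U"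
    by (rule tendsto_add[OF tendsto_mult[OF tendsto_const elim] tendsto_rabs[OF tendsto_diff[OF r tendsto_const]]])
  have "cnorm B (b \<ominus>\<^bsub>B\<^esub> R.leg.A.real_unit r) \<le> 7 * 0 + \<bar>r - r\<bar>"
    by (rule tendsto_lowerbound[OF lim always_eventually[OF allI[OF le]] U.proper])
  then have "cnorm B (b \<ominus>\<^bsub>B\<^esub> R.leg.A.real_unit r) = 0"
    using R.leg.A.cnorm_nonneg[OF R.leg.A.minus_closed[OF bc uc], of "complex_of_real r"] by simp
  then have "b = R.leg.A.real_unit r" using R.leg.A.cnorm_minus_eq_zero[OF bc uc[of "complex_of_real r"]] by simp
  then show ?thesis by (rule exI)
qed

lemma \<beta>_ergodic: "ergodic limit_group B \<beta>"
  unfolding ergodic_def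
proof (intro equalityI subsetI)
  fix c assume "c \<in> {a \<in> carrier B. \<forall>h\<in>limit_group. \<beta> h a = a}"
  then have c: "c \<in> carrier B" "\<And>h. h \<in> limit_group \<Longrightarrow> \<beta> h c = c" by auto
  have re: "\<beta> h (re_part B c) = re_part B c" and im: "\<beta> h (im_part B c) = im_part B c" if h: "h \<in> limit_group" for h
    using star_homomorphism.hom_re_part[OF \<beta>_star_homomorphism[OF h] c(1)]
      star_homomorphism.hom_im_part[OF \<beta>_star_homomorphism[OF h] c(1)] c(2)[OF h] by simp_all
  have "\<exists>t. re_part B c = R.leg.A.real_unit t"
    by (rule fixed_self_adjoint_scalar[OF R.leg.A.re_part_self_adjoint[OF c(1)]]) (rule re)
  then obtain t where t: "re_part B c = R.leg.A.real_unit t" by (elim exE)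
  have "\<exists>r. im_part B c = R.leg.A.real_unit r"
    by (rule fixed_self_adjoint_scalar[OF R.leg.A.im_part_self_adjoint[OF c(1)]]) (rule im)
  then obtain r where r: "im_part B c = R.leg.A.real_unit r" by (elim exE)
  have "c = R.leg.A.real_unit t \<oplus>\<^bsub>B\<^esub> \<i> \<odot>\<^bsub>B\<^esub> R.leg.A.real_unit r"
    using R.leg.A.re_im_decomposition[OF c(1)] unfolding t r by simp
  also have "\<dots> = (complex_of_real t + \<i> * complex_of_real r) \<odot>\<^bsub>B\<^esub> \<one>\<^bsub>B\<^esub>"
    using R.leg.A.one_closed by (simp add: R.leg.A.smult_add_left R.leg.A.smult_smult)
  finally show "c \<in> {c \<odot>\<^bsub>B\<^esub> \<one>\<^bsub>B\<^esub> | c. True}" by blast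
next
  fix c assume "c \<in> {c \<odot>\<^bsub>B\<^esub> \<one>\<^bsub>B\<^esub> | c. True}"
  then obtain z where z: "c = z \<odot>\<^bsub>B\<^esub> \<one>\<^bsub>B\<^esub>" by blast
  have "\<beta> h c = c" if h: "h \<in> limit_group" for h
    unfolding z star_homomorphism.hom_smult[OF \<beta>_star_homomorphism[OF h] R.leg.A.one_closed]
      star_homomorphism.hom_one[OF \<beta>_star_homomorphism[OF h]] ..
  then show "c \<in> {a \<in> carrier B. \<forall>h\<in>limit_group. \<beta> h a = a}"
    unfolding z using R.leg.A.smult_closed[OF R.leg.A.one_closed] by blast
qed

text \<open>\<open>\<beta>_lip\<close> asks for strict upper bounds of the seminorm, so
  \<open>r + e\<close> replaces its value \<open>r\<close>; at elements of infinite seminorm there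
  is nothing to show.\<close>

lemma \<beta>_lip_le:
  assumes h: "h \<in> limit_group" and a: "a \<in> self_adjoint B" shows "LB (\<beta> h a) \<le> LB a"
proof (cases "LB a")
  case (real r)
  show ?thesis
  proof (rule ennreal_le_epsilon)
    fix e :: real assume e: "0 < e"
    have "LB a < ennreal (r + e)" using real e by (simp add: ennreal_less_iff)
    then have "LB (\<beta> h a) \<le> ennreal (r + e)" by (rule \<beta>_lip(3)[OF h a]) (use real e in simp)
    then show "LB (\<beta> h a) \<le> LB a + ennreal e" using real e by (simp add: ennreal_plus)
  qed
next
  case top
  then show ?thesis by simp
qed

lemma \<beta>_dominated:
  assumes a: "a \<in> self_adjoint B"
  shows "LB a \<ge> (SUP h\<in>limit_group - {\<one>}. ennreal (cnorm B (a \<ominus>\<^bsub>B\<^esub> \<beta> h a) / ell h))"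
proof (cases "LB a")
  case (real r)
  show ?thesis
  proof (rule SUP_least)
    fix h assume "h \<in> limit_group - {\<one>}"
    then have h: "h \<in> limit_group" "h \<noteq> \<one>" by auto
    note hc = limit_group_carrier[OF h(1)]
    have ell: "ell h > 0" using ell_nonneg[OF hc] ell_eq_zero[OF hc] h(2) by simp
    have "cnorm B (a \<ominus>\<^bsub>B\<^esub> \<beta> h a) / ell h \<le> r"
    proof (rule field_le_epsilon)
      fix e :: real assume e: "0 < e"
      have "LB a < ennreal (r + e)" using real e by (simp add: ennreal_less_iff)
      then have "cnorm B (a \<ominus>\<^bsub>B\<^esub> \<beta> h a) \<le> (r + e) * ell h" by (rule \<beta>_lip(4)[OF h(1) a]) (use real e in simp)
      then show "cnorm B (a \<ominus>\<^bsub>B\<^esub> \<beta> h a) / ell h \<le> r + e" using ell by (simp add: field_simps)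
    qed
    then show "ennreal (cnorm B (a \<ominus>\<^bsub>B\<^esub> \<beta> h a) / ell h) \<le> LB a" using real by (simp add: ennreal_leI)
  qed
next
  case top
  then show ?thesis by simp
qed

end

theorem (in action_limit) limit_action_exists:
  assumes K: "subgroup limit_group G"
  shows "\<exists>\<beta>. cstar_action G limit_group B \<beta> \<and> strongly_continuous T limit_group B \<beta> \<and> ergodic limit_group B \<beta> \<and>
    (\<forall>a\<in>self_adjoint B. LB a \<ge> (SUP h\<in>limit_group - {\<one>}. ennreal (cnorm B (a \<ominus>\<^bsub>B\<^esub> \<beta> h a) / ell h))) \<and>
    (\<forall>h\<in>limit_group. \<forall>a\<in>self_adjoint B. LB (\<beta> h a) \<le> LB a)"
proof -
  have "\<forall>h\<in>limit_group. \<exists>\<sigma>. (\<forall>n. \<sigma> n \<in> H n) \<and> converges \<sigma> h"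
  proof
    fix h assume h: "h \<in> limit_group"
    obtain \<sigma> where "\<And>n. \<sigma> n \<in> H n" "converges \<sigma> h" by (rule limit_group_sequence[OF h], rule that)
    then show "\<exists>\<sigma>. (\<forall>n. \<sigma> n \<in> H n) \<and> converges \<sigma> h" by (intro exI[of _ \<sigma>] conjI allI)
  qed
  from bchoice[OF this] obtain s where s: "\<forall>h\<in>limit_group. (\<forall>n. s h n \<in> H n) \<and> converges (s h) h" by blast
  then have s': "\<And>h n. h \<in> limit_group \<Longrightarrow> s h n \<in> H n" "\<And>h. h \<in> limit_group \<Longrightarrow> converges (s h) h" by simp_all
  have "\<forall>h\<in>limit_group. \<exists>f. f \<in> star_hom B B \<and> f \<in> extensional (carrier B) \<and> (\<forall>b b'. (b, b') \<in> limit_rel (s h) \<longrightarrow> f b = b')"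
    by (intro ballI limit_hom s'(1))
  from bchoice[OF this] obtain \<beta> where \<beta>: "\<forall>h\<in>limit_group. \<beta> h \<in> star_hom B B \<and> \<beta> h \<in> extensional (carrier B) \<and>
      (\<forall>b b'. (b, b') \<in> limit_rel (s h) \<longrightarrow> \<beta> h b = b')" by blast
  interpret limit_action G T ell U H F D LD A LA B LB \<pi>A \<pi>B \<epsilon> \<alpha> s \<beta>
    by (intro limit_action.intro action_limit_axioms limit_action_axioms.intro K s') (use \<beta> in simp_all)
  show ?thesis
    by (intro exI[of _ \<beta>] conjI ballI \<beta>_action \<beta>_strongly_continuous \<beta>_ergodic \<beta>_dominated \<beta>_lip_le)
qed

section \<open>The algebra of scalars\<close>

definition scalar_algebra :: "(complex \<Rightarrow> 'a) \<Rightarrow> 'a cstar" where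
  "scalar_algebra e = \<lparr>carrier = range e, mult = (\<lambda>x y. e (inv_into UNIV e x * inv_into UNIV e y)), one = e 1, zero = e 0,
     add = (\<lambda>x y. e (inv_into UNIV e x + inv_into UNIV e y)), smult = (\<lambda>c x. e (c * inv_into UNIV e x)),
     adj = (\<lambda>x. e (cnj (inv_into UNIV e x))), cnorm = (\<lambda>x. cmod (inv_into UNIV e x))\<rparr>"

lemma scalar_algebra_simps [simp]:
  "carrier (scalar_algebra e) = range e"
  "x \<otimes>\<^bsub>scalar_algebra e\<^esub> y = e (inv_into UNIV e x * inv_into UNIV e y)"
  "\<one>\<^bsub>scalar_algebra e\<^esub> = e 1" "\<zero>\<^bsub>scalar_algebra e\<^esub> = e 0"
  "x \<oplus>\<^bsub>scalar_algebra e\<^esub> y = e (inv_into UNIV e x + inv_into UNIV e y)"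
  "c \<odot>\<^bsub>scalar_algebra e\<^esub> x = e (c * inv_into UNIV e x)"
  "adj (scalar_algebra e) x = e (cnj (inv_into UNIV e x))" "cnorm (scalar_algebra e) x = cmod (inv_into UNIV e x)"
  by (simp_all add: scalar_algebra_def)

locale scalar_embedding = fixes e :: "complex \<Rightarrow> 'a" assumes inj: "inj e"
begin

lemma inv_e [simp]: "inv_into UNIV e (e z) = z" by (rule inv_f_f[OF inj])

lemma e_eq [simp]: "e z = e w \<longleftrightarrow> z = w" using inj by (simp add: inj_eq)

lemma scalar_abelian_group: "abelian_group (scalar_algebra e)"
proof (rule abelian_groupI)
  fix x assume "x \<in> carrier (scalar_algebra e)"
  then obtain z where "x = e z" by auto
  then show "\<exists>y\<in>carrier (scalar_algebra e). y \<oplus>\<^bsub>scalar_algebra e\<^esub> x = \<zero>\<^bsub>scalar_algebra e\<^esub>"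
    by (intro bexI[of _ "e (- z)"]) simp_all
qed (auto simp: algebra_simps)

lemma scalar_ring: "ring (scalar_algebra e)"
proof (rule ringI[OF scalar_abelian_group])
  show "monoid (scalar_algebra e)" by (rule monoidI) (auto simp: algebra_simps)
qed (auto simp: algebra_simps)

lemma complex_cring: "cring complex_ring"
proof (rule cringI)
  show "abelian_group complex_ring"
  proof (rule abelian_groupI)
    fix x assume "x \<in> carrier complex_ring"
    show "\<exists>y\<in>carrier complex_ring. y \<oplus>\<^bsub>complex_ring\<^esub> x = \<zero>\<^bsub>complex_ring\<^esub>"
      by (intro bexI[of _ "- x"]) simp_all
  qed simp_all
  show "comm_monoid complex_ring" by (rule comm_monoidI) simp_all
qed (simp_all add: algebra_simps)

lemma scalar_module: "module complex_ring (scalar_algebra e)"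
  by (rule moduleI[OF complex_cring scalar_abelian_group]) (auto simp: algebra_simps)

lemma scalar_minus: "e z \<ominus>\<^bsub>scalar_algebra e\<^esub> e w = e (z - w)"
proof -
  interpret R: ring "scalar_algebra e" by (rule scalar_ring)
  have "\<ominus>\<^bsub>scalar_algebra e\<^esub> e w = e (- w)" by (rule R.minus_equality) simp_all
  then show ?thesis unfolding a_minus_def by simp
qed

lemma scalar_norm_dist: "norm_dist (scalar_algebra e) (e z) (e w) = cmod (z - w)"
  by (simp add: norm_dist_def scalar_minus)

lemma scalar_metric: "Metric_space (range e) (norm_dist (scalar_algebra e))"
proof
  fix x y z
  show "0 \<le> norm_dist (scalar_algebra e) x y" by (simp add: norm_dist_def)
  show "norm_dist (scalar_algebra e) x y = norm_dist (scalar_algebra e) y x"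
  proof (cases "x \<in> range e \<and> y \<in> range e")
    case True
    then obtain u v where "x = e u" "y = e v" by blast
    then show ?thesis by (simp add: scalar_norm_dist norm_minus_commute)
  next
    case False
    then have "norm_dist (scalar_algebra e) x y = 0" "norm_dist (scalar_algebra e) y x = 0"
      unfolding norm_dist_def by auto
    then show ?thesis by simp
  qed
  assume xy: "x \<in> range e" "y \<in> range e"
  then obtain u v where uv: "x = e u" "y = e v" by blast
  show "norm_dist (scalar_algebra e) x y = 0 \<longleftrightarrow> x = y" unfolding uv by (simp add: scalar_norm_dist)
  assume "z \<in> range e"
  then obtain w where w: "z = e w" by blast
  show "norm_dist (scalar_algebra e) x z \<le> norm_dist (scalar_algebra e) x y + norm_dist (scalar_algebra e) y z"
    unfolding uv w scalar_norm_dist using norm_triangle_ineq[of "u - v" "v - w"] by simp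
qed

lemma scalar_complete: "Metric_space.mcomplete (range e) (norm_dist (scalar_algebra e))"
proof -
  interpret M: Metric_space "range e" "norm_dist (scalar_algebra e)" by (rule scalar_metric)
  show ?thesis unfolding M.mcomplete_def
  proof (intro allI impI)
    fix \<sigma> assume \<sigma>: "M.MCauchy \<sigma>"
    then have rng: "range \<sigma> \<subseteq> range e" by (simp add: M.MCauchy_def)
    define \<tau> where "\<tau> n = inv_into UNIV e (\<sigma> n)" for n
    have \<sigma>\<tau>: "\<sigma> n = e (\<tau> n)" for n using rng unfolding \<tau>_def by (metis f_inv_into_f range_subsetD)
    have "Cauchy \<tau>"
    proof (rule metric_CauchyI)
      fix r :: real assume "r > 0"
      then obtain N where "\<And>m n. N \<le> m \<Longrightarrow> N \<le> n \<Longrightarrow> norm_dist (scalar_algebra e) (\<sigma> m) (\<sigma> n) < r"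
        using \<sigma> unfolding M.MCauchy_def by blast
      then show "\<exists>M. \<forall>m\<ge>M. \<forall>n\<ge>M. dist (\<tau> m) (\<tau> n) < r" unfolding \<sigma>\<tau> scalar_norm_dist dist_norm by blast
    qed
    then obtain z where z: "\<tau> \<longlonglongrightarrow> z" using Cauchy_convergent_iff convergent_def by blast
    have "limitin M.mtopology \<sigma> (e z) sequentially"
      unfolding M.limit_metric_sequentially \<sigma>\<tau> scalar_norm_dist
      using z unfolding lim_sequentially dist_norm by blast
    then show "\<exists>x. limitin M.mtopology \<sigma> x sequentially" by blast
  qed
qed

lemma scalar_unital_cstar_algebra: "unital_cstar_algebra (scalar_algebra e)"
proof (intro unital_cstar_algebra.intro unital_cstar_algebra_axioms.intro scalar_ring scalar_module)
  show "Metric_space.mcomplete (carrier (scalar_algebra e)) (norm_dist (scalar_algebra e))"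
    using scalar_complete by simp
qed (auto simp: norm_mult norm_triangle_ineq power2_eq_square)

sublocale S: unital_cstar_algebra "scalar_algebra e" by (rule scalar_unital_cstar_algebra)

lemma scalar_self_adjoint: "self_adjoint (scalar_algebra e) = range (\<lambda>r. e (complex_of_real r))"
proof (intro equalityI subsetI)
  fix x assume "x \<in> self_adjoint (scalar_algebra e)"
  then obtain z where z: "x = e z" "cnj z = z" by (auto simp: self_adjoint_def)
  then have "z = complex_of_real (Re z)" by (simp add: complex_eq_iff)
  then show "x \<in> range (\<lambda>r. e (complex_of_real r))" using z(1) by (intro range_eqI[of _ _ "Re z"]) simp
qed (auto simp: self_adjoint_def)

lemma scalar_states_unique:
  assumes "\<phi> \<in> states (scalar_algebra e)" "\<psi> \<in> states (scalar_algebra e)" shows "\<phi> = \<psi>"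
proof -
  have val: "\<phi> (e z) = z" if "\<phi> \<in> states (scalar_algebra e)" for \<phi> z
    using S.linear_functional_smult[OF S.linear_functional_state[OF that], of "e 1" z] S.state_one[OF that] by simp
  show ?thesis
  proof (rule extensionalityI)
    show "\<phi> \<in> extensional (range e)" "\<psi> \<in> extensional (range e)" using assms by (auto simp: states_def)
    fix x assume "x \<in> range e"
    then show "\<phi> x = \<psi> x" using val[OF assms(1)] val[OF assms(2)] by auto
  qed
qed

lemma scalar_jordan_lie:
  "jordan_prod (scalar_algebra e) (e z) (e w) = e (z * w)" "lie_prod (scalar_algebra e) (e z) (e w) = e 0"
  by (simp_all add: jordan_prod_def lie_prod_def scalar_minus)

text \<open>At most one state exists, so all distances vanish and any two topologies on the state
  space coincide.\<close>

lemma scalar_metrizes: "metrizes (mk_dist (scalar_algebra e) (\<lambda>_. 0)) (weak_star_topology (scalar_algebra e))"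
proof -
  let ?S = "states (scalar_algebra e)" and ?d = "mk_dist (scalar_algebra e) (\<lambda>_. 0)"
  have d0: "?d x y = 0" if "x \<in> ?S" "y \<in> ?S" for x y
  proof -
    have "x = y" by (rule scalar_states_unique[OF that])
    then have "?d x y \<le> 0" unfolding mk_dist_def by (intro SUP_least) simp
    then show ?thesis by simp
  qed
  interpret M: Metric_space ?S "\<lambda>x y. enn2real (?d x y)"
  proof
    fix x y
    show "enn2real (?d x y) = enn2real (?d y x)" unfolding mk_dist_def by (simp add: norm_minus_commute)
    assume "x \<in> ?S" "y \<in> ?S"
    then show "enn2real (?d x y) = 0 \<longleftrightarrow> x = y" using d0[of x y] scalar_states_unique[of x y] by simp
    fix z assume "z \<in> ?S"
    then show "enn2real (?d x z) \<le> enn2real (?d x y) + enn2real (?d y z)"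
      using d0[OF \<open>x \<in> ?S\<close> \<open>z \<in> ?S\<close>] by simp
  qed simp
  have "M.mtopology = weak_star_topology (scalar_algebra e)"
  proof (rule topology_eq[THEN iffD2], rule allI)
    fix V
    have sub: "V = {} \<or> V = ?S" if "V \<subseteq> ?S" using that scalar_states_unique by blast
    have 1: "openin M.mtopology V \<longleftrightarrow> V = {} \<or> V = ?S"
      using sub openin_subset[of M.mtopology V] openin_topspace[of M.mtopology] by auto
    have 2: "openin (weak_star_topology (scalar_algebra e)) V \<longleftrightarrow> V = {} \<or> V = ?S"
      using sub openin_subset[of "weak_star_topology (scalar_algebra e)" V]
        openin_topspace[of "weak_star_topology (scalar_algebra e)"] S.topspace_weak_star by auto
    show "openin M.mtopology V = openin (weak_star_topology (scalar_algebra e)) V" unfolding 1 2 ..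
  qed
  then show ?thesis unfolding metrizes_def S.topspace_weak_star using d0 M.Metric_space_axioms by simp
qed

lemma scalar_qcms: "qcms F (scalar_algebra e) (\<lambda>_. 0)"
proof -
  have dom: "lip_dom (scalar_algebra e) (\<lambda>_. 0) = self_adjoint (scalar_algebra e)" by (simp add: lip_dom_def)
  have "jordan_lie_subalgebra (scalar_algebra e) (self_adjoint (scalar_algebra e))"
    unfolding jordan_lie_subalgebra_def
  proof (intro conjI ballI allI S.self_adjoint_simps(1))
    fix a b assume ab: "a \<in> self_adjoint (scalar_algebra e)" "b \<in> self_adjoint (scalar_algebra e)"
    then obtain r t where rt: "a = e (complex_of_real r)" "b = e (complex_of_real t)" unfolding scalar_self_adjoint by blast
    show "a \<oplus>\<^bsub>scalar_algebra e\<^esub> b \<in> self_adjoint (scalar_algebra e)" by (rule S.self_adjoint_simps(3)[OF ab])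
    show "jordan_prod (scalar_algebra e) a b \<in> self_adjoint (scalar_algebra e)"
      "lie_prod (scalar_algebra e) a b \<in> self_adjoint (scalar_algebra e)"
      unfolding rt scalar_jordan_lie by (simp_all add: self_adjoint_def)
  qed (auto intro: S.self_adjoint_simps(5) simp del: scalar_algebra_simps)
  moreover have "self_adjoint (scalar_algebra e) \<subseteq> norm_topology (scalar_algebra e) closure_of self_adjoint (scalar_algebra e)"
  proof (rule closure_of_subset)
    interpret M: Metric_space "carrier (scalar_algebra e)" "norm_dist (scalar_algebra e)" by (rule S.norm_metric)
    show "self_adjoint (scalar_algebra e) \<subseteq> topspace (norm_topology (scalar_algebra e))"
      unfolding norm_topology_def M.topspace_mtopology using S.self_adjointD(1) by blast
  qed
  moreover have "{a \<in> self_adjoint (scalar_algebra e). (0::ennreal) = 0} = {complex_of_real t \<odot>\<^bsub>scalar_algebra e\<^esub> \<one>\<^bsub>scalar_algebra e\<^esub> | t. True}"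
    unfolding scalar_self_adjoint by auto
  ultimately show ?thesis
    unfolding qcms_def dom seminorm_on_dom_def lower_semicontinuous_def
    using scalar_unital_cstar_algebra scalar_metrizes by (simp del: scalar_algebra_simps)
qed

text \<open>The identity is restricted to the carrier because group actions consist of extensional
  maps; the trivial action is ergodic as every element is a scalar.\<close>

lemma scalar_trivial_action:
  assumes G: "group G" and H: "subgroup H G"
  shows "cstar_action G H (scalar_algebra e) (\<lambda>_. \<lambda>x\<in>range e. x)"
    and "strongly_continuous T H (scalar_algebra e) (\<lambda>_. \<lambda>x\<in>range e. x)"
    and "ergodic H (scalar_algebra e) (\<lambda>_. \<lambda>x\<in>range e. x)"
proof -
  have "group_hom (G\<lparr>carrier := H\<rparr>) (BijGroup (range e)) (\<lambda>_. \<lambda>x\<in>range e. x)"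
  proof (intro group_hom.intro group_hom_axioms.intro)
    show "group (G\<lparr>carrier := H\<rparr>)" by (rule subgroup.subgroup_is_group[OF H G])
    show "group (BijGroup (range e))" by (rule group_BijGroup)
    have one: "(\<lambda>x\<in>range e. x) = \<one>\<^bsub>BijGroup (range e)\<^esub>" by (simp add: BijGroup_def)
    interpret B: group "BijGroup (range e)" by (rule group_BijGroup)
    show "(\<lambda>_. \<lambda>x\<in>range e. x) \<in> hom (G\<lparr>carrier := H\<rparr>) (BijGroup (range e))"
      unfolding one by (rule homI) simp_all
  qed
  then have "group_action (G\<lparr>carrier := H\<rparr>) (carrier (scalar_algebra e)) (\<lambda>_. \<lambda>x\<in>range e. x)"
    by (simp add: group_action.intro)
  moreover have "(\<lambda>x\<in>range e. x) \<in> star_hom (scalar_algebra e) (scalar_algebra e)"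
    by (auto simp: star_hom_def ring_hom_def)
  ultimately show "cstar_action G H (scalar_algebra e) (\<lambda>_. \<lambda>x\<in>range e. x)" by (simp add: cstar_action_def)
  interpret M: Metric_space "carrier (scalar_algebra e)" "norm_dist (scalar_algebra e)" by (rule S.norm_metric)
  show "strongly_continuous T H (scalar_algebra e) (\<lambda>_. \<lambda>x\<in>range e. x)"
    unfolding strongly_continuous_def norm_topology_def
  proof
    fix a assume a: "a \<in> carrier (scalar_algebra e)"
    then have eq: "(\<lambda>x\<in>range e. x) a = a" by simp
    have "a \<in> topspace M.mtopology" unfolding M.topspace_mtopology by (rule a)
    then show "continuous_map (subtopology T H) M.mtopology (\<lambda>h. (\<lambda>x\<in>range e. x) a)"
      unfolding eq continuous_map_const by (rule disjI2)
  qed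
  show "ergodic H (scalar_algebra e) (\<lambda>_. \<lambda>x\<in>range e. x)"
    unfolding ergodic_def by auto
qed

lemma scalar_in_ergodic_lipschitz_class:
  assumes G: "group G" and H: "H \<in> \<G>" "subgroup H G"
  shows "(scalar_algebra e, \<lambda>_. 0) \<in> ergodic_lipschitz_class G T ell \<G> F"
proof -
  have "(SUP h\<in>H - {\<one>\<^bsub>G\<^esub>}. ennreal (cnorm (scalar_algebra e) (a \<ominus>\<^bsub>scalar_algebra e\<^esub> (\<lambda>x\<in>range e. x) a) / ell h)) \<le> 0"
    if a: "a \<in> self_adjoint (scalar_algebra e)" for a
  proof (rule SUP_least)
    fix h
    obtain r where "a = e (complex_of_real r)" using a unfolding scalar_self_adjoint by blast
    then show "ennreal (cnorm (scalar_algebra e) (a \<ominus>\<^bsub>scalar_algebra e\<^esub> (\<lambda>x\<in>range e. x) a) / ell h) \<le> 0"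
      by (simp add: scalar_minus)
  qed
  then show ?thesis unfolding ergodic_lipschitz_class_def
    using scalar_qcms H scalar_trivial_action[OF G H(2)]
    by (intro CollectI case_prodI conjI bexI[of _ H] exI[of _ "\<lambda>_. \<lambda>x\<in>range e. x"] ballI) simp_all
qed

end

text \<open>The hypothesis on the type concerns the reals, while the embedding starts from complex
  numbers; an infinite set is equipotent to its square.\<close>

lemma complex_lepoll_real: "(UNIV :: complex set) \<lesssim> (UNIV :: real set)"
proof -
  have "\<exists>f :: real \<times> real \<Rightarrow> real. inj_on f (UNIV \<times> UNIV) \<and> f ` (UNIV \<times> UNIV) \<subseteq> UNIV"
    by (rule iffD2[OF card_of_ordLeq ordIso_imp_ordLeq[OF card_of_Times_same_infinite[OF infinite_UNIV_char_0]]])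
  then obtain f :: "real \<times> real \<Rightarrow> real" where f: "inj_on f (UNIV \<times> UNIV)" by (elim exE conjE)
  have "inj (\<lambda>z. f (Re z, Im z))"
  proof (rule injI)
    fix z w assume "f (Re z, Im z) = f (Re w, Im w)"
    then have "(Re z, Im z) = (Re w, Im w)" by (rule inj_onD[OF f]) simp_all
    then show "z = w" by (simp add: complex_eq_iff)
  qed
  then show ?thesis unfolding lepoll_def by (intro exI conjI) simp_all
qed

section \<open>Closedness\<close>

lemma (in compact_length_group) dominated_actionI:
  assumes A: "qcms F A L" and H: "subgroup H G" and \<alpha>: "cstar_action G H A \<alpha>" "ergodic H A \<alpha>"
    and dom: "\<forall>a\<in>self_adjoint A. L a \<ge> (SUP h\<in>H - {\<one>}. ennreal (cnorm A (a \<ominus>\<^bsub>A\<^esub> \<alpha> h a) / ell h))"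
    and le: "\<forall>h\<in>H. \<forall>a\<in>self_adjoint A. L (\<alpha> h a) \<le> L a"
  shows "dominated_action F A L G H \<alpha> ell"
proof -
  \<comment> \<open>Kept under another name: the interpretation below reuses
    \<open>one_closed\<close> for the unit of the algebra.\<close>
  note one_mem = one_closed
  interpret lip_action F A L G H \<alpha>
    by (intro lip_action.intro quantum_metric.intro A is_group lip_action_axioms.intro H \<alpha>(1)) (use le in blast)
  have "cnorm A (a \<ominus>\<^bsub>A\<^esub> \<alpha> h a) \<le> l * ell h" if h: "h \<in> H" and a: "a \<in> self_adjoint A" "L a \<le> ennreal l" "0 \<le> l" for h a l
  proof (cases "h = \<one>")
    case True
    note ac = self_adjointD(1)[OF a(1)]
    have "cnorm A (a \<ominus>\<^bsub>A\<^esub> \<alpha> h a) = 0" using act_one[OF ac] cnorm_minus_eq_zero[OF ac ac] True by simp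
    then show ?thesis using a(3) ell_nonneg[OF one_mem] True by simp
  next
    case False
    have hc: "h \<in> carrier G" by (rule subgroup.mem_carrier[OF H h])
    have ell: "ell h > 0" using ell_nonneg[OF hc] ell_eq_zero[OF hc] False by simp
    have "ennreal (cnorm A (a \<ominus>\<^bsub>A\<^esub> \<alpha> h a) / ell h) \<le> (SUP h\<in>H - {\<one>}. ennreal (cnorm A (a \<ominus>\<^bsub>A\<^esub> \<alpha> h a) / ell h))"
      by (rule SUP_upper) (use h False in blast)
    also have "\<dots> \<le> L a" using dom a(1) by blast
    also have "\<dots> \<le> ennreal l" by (rule a(2))
    finally have "cnorm A (a \<ominus>\<^bsub>A\<^esub> \<alpha> h a) / ell h \<le> l" using a(3) by simp
    then show ?thesis using ell by (simp add: field_simps)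
  qed
  then show ?thesis
    by (intro dominated_action.intro lip_action_axioms dominated_action_axioms.intro \<alpha>(2))
qed

lemma (in compact_length_group) propinquity_closed_ergodic_lipschitz_class:
  assumes subgroups: "\<And>H. H \<in> \<G> \<Longrightarrow> subgroup H G" and closed: "hausdorff_closed G T ell \<G>"
    and F: "admissible F" "\<exists>x>0. \<exists>y>0. \<exists>lx>0. \<exists>ly>0. F x y lx ly < \<infinity>"
  shows "propinquity_closed F (ergodic_lipschitz_class G T ell \<G> F :: ('a cstar \<times> ('a \<Rightarrow> ennreal)) set)"
  unfolding propinquity_closed_def
proof (intro allI impI, elim conjE)
  fix A :: "nat \<Rightarrow> 'a cstar" and LA B LB
  assume cls: "\<forall>n. (A n, LA n) \<in> ergodic_lipschitz_class G T ell \<G> F" and B: "qcms F B LB"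
    and lim: "(\<lambda>n. dual_propinquity F (A n) (LA n) B LB) \<longlonglongrightarrow> 0"
  define \<epsilon> :: "nat \<Rightarrow> real" where "\<epsilon> k = 1 / (real k + 1)" for k
  have \<epsilon>: "\<epsilon> k > 0" "\<epsilon> k \<le> 1" for k by (simp_all add: \<epsilon>_def)
  have elim: "\<epsilon> \<longlonglongrightarrow> 0" unfolding \<epsilon>_def by real_asymp
  define good where "good k X LX D LD p q H \<alpha> \<longleftrightarrow> tunnel_leg F D LD X LX p (\<epsilon> k) \<and> tunnel_leg F D LD B LB q (\<epsilon> k) \<and>
    H \<in> \<G> \<and> dominated_action F X LX G H \<alpha> ell"
    for k and X :: "'a cstar" and LX and D :: "'a cstar" and LD and p q :: "'a \<Rightarrow> 'a" and H and \<alpha> :: "'g \<Rightarrow> 'a \<Rightarrow> 'a"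
  \<comment> \<open>For every \<open>k\<close>, a member of the sequence with a tunnel of extent
    below \<open>\<epsilon> k\<close>; the sequence is re-indexed by \<open>k\<close>, possibly with
    repetitions.\<close>
  have ex: "\<exists>X LX D LD p q H \<alpha>. good k X LX D LD p q H \<alpha>" for k
  proof -
    have "\<forall>\<^sub>F n in sequentially. dual_propinquity F (A n) (LA n) B LB < ennreal (\<epsilon> k)"
      by (rule order_tendstoD(2)[OF lim]) (use \<epsilon> in simp)
    then obtain n where "dual_propinquity F (A n) (LA n) B LB < ennreal (\<epsilon> k)"
      using eventually_happens'[OF sequentially_bot] by blast
    then obtain \<tau> :: "'a cstar \<times> ('a \<Rightarrow> ennreal) \<times> ('a \<Rightarrow> 'a) \<times> ('a \<Rightarrow> 'a)"
      where \<tau>: "\<tau> \<in> tunnels F (A n) (LA n) B LB" "extent (A n) B \<tau> < ennreal (\<epsilon> k)"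
      unfolding dual_propinquity_def INF_less_iff by blast
    obtain D LD p q where \<tau>_eq: "\<tau> = (D, LD, p, q)" by (cases \<tau>)
    have tun: "qcms F D LD" "quantum_isometry D LD (A n) (LA n) p" "quantum_isometry D LD B LB q"
      using \<tau>(1) unfolding \<tau>_eq tunnels_def by simp_all
    have ext: "hausdorff_dist (mk_dist D LD) (states D) (pullback_states D (A n) p) < ennreal (\<epsilon> k)"
      "hausdorff_dist (mk_dist D LD) (states D) (pullback_states D B q) < ennreal (\<epsilon> k)"
      using \<tau>(2) unfolding \<tau>_eq extent_def by simp_all
    have "(A n, LA n) \<in> ergodic_lipschitz_class G T ell \<G> F" using cls by blast
    then obtain H \<alpha> where H: "qcms F (A n) (LA n)" "H \<in> \<G>" "cstar_action G H (A n) \<alpha>" "ergodic H (A n) \<alpha>"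
      "\<forall>a\<in>self_adjoint (A n). LA n a \<ge> (SUP h\<in>H - {\<one>}. ennreal (cnorm (A n) (a \<ominus>\<^bsub>A n\<^esub> \<alpha> h a) / ell h))"
      "\<forall>h\<in>H. \<forall>a\<in>self_adjoint (A n). LA n (\<alpha> h a) \<le> LA n a"
      unfolding ergodic_lipschitz_class_def by blast
    have "good k (A n) (LA n) D LD p q H \<alpha>" unfolding good_def
      by (intro conjI tunnel_leg.intro tunnel_leg_axioms.intro quantum_metric.intro tun ext B H
          dominated_actionI[OF H(1) subgroups[OF H(2)] H(3-6)])
    then show ?thesis by blast
  qed
  obtain X LX D LD p q H \<alpha> where good: "\<And>k. good k (X k) (LX k) (D k) (LD k) (p k) (q k) (H k) (\<alpha> k)"
    using ex by metis
  obtain U :: "nat filter" where U: "ultrafilter U" "U \<le> sequentially" using nonprincipal_ultrafilter by blast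
  have HG: "H k \<in> \<G>" for k using good[of k] by (simp add: good_def)
  have legs: "tunnel_leg F (D k) (LD k) (X k) (LX k) (p k) (\<epsilon> k)" "tunnel_leg F (D k) (LD k) B LB (q k) (\<epsilon> k)"
    "dominated_action F (X k) (LX k) G (H k) (\<alpha> k) ell" for k using good[of k] by (simp_all add: good_def)
  have elimU: "(\<epsilon> \<longlongrightarrow> 0) U" by (rule tendsto_mono[OF U(2) elim])
  \<comment> \<open>The interpretation that follows reuses the name \<open>subgroups\<close> for the
    groups \<open>H n\<close>.\<close>
  note sub = subgroups
  interpret action_limit G T ell U H F D LD X LX B LB p q \<epsilon> \<alpha>
    by (intro action_limit.intro subgroup_ultralimit.intro compact_length_group_axioms U subgroup_ultralimit_axioms.intro
        subgroups HG tunnel_sequence.intro tunnel_sequence_axioms.intro legs elimU action_limit_axioms.intro F \<epsilon>(2))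
  \<comment> \<open>Members of the collection are subgroups, which supplies the assumption of
    \<open>limit_action_exists\<close>.\<close>
  have KG: "limit_group \<in> \<G>" by (rule limit_group_in_closed_collection[OF HG closed])
  then show "(B, LB) \<in> ergodic_lipschitz_class G T ell \<G> F"
    unfolding ergodic_lipschitz_class_def
    using B limit_action_exists[OF sub[OF KG]] by blast
qed

theorem corollary3p12:
  fixes G :: "'g monoid" and T :: "'g topology" and ell :: "'g \<Rightarrow> real"
    and \<G> :: "'g set set"
    and F :: "ennreal \<Rightarrow> ennreal \<Rightarrow> ennreal \<Rightarrow> ennreal \<Rightarrow> ennreal"
    and \<C> :: "('a cstar \<times> ('a \<Rightarrow> ennreal)) set"
  assumes universe: "(UNIV :: real set) \<lesssim> (UNIV :: 'a set)"
    and group: "topological_group G T"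
    and compact: "compact_space T"
    and length: "length_function G ell"
    and length_continuous: "continuous_map T euclideanreal ell"
    and length_invariant:
      "\<forall>g\<in>carrier G. \<forall>h\<in>carrier G. ell (h \<otimes>\<^bsub>G\<^esub> g \<otimes>\<^bsub>G\<^esub> inv\<^bsub>G\<^esub> h) = ell g"
    and collection_nonempty: "\<G> \<noteq> {}"
    and closed_subgroups: "\<forall>H\<in>\<G>. subgroup H G \<and> closedin T H"
    and collection_closed: "hausdorff_closed G T ell \<G>"
    and F_admissible: "admissible F"
    and F_nondegenerate: "\<exists>x>0. \<exists>y>0. \<exists>lx>0. \<exists>ly>0. F x y lx ly < \<infinity>"
    and class_def: "\<C> = ergodic_lipschitz_class G T ell \<G> F"
  shows "\<C> \<noteq> {} \<and> propinquity_closed F \<C>"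
proof
  have grp: "group G" using group by (simp add: topological_group_def)
  obtain e :: "complex \<Rightarrow> 'a" where "inj e"
    using lepoll_trans[OF complex_lepoll_real universe] unfolding lepoll_def by blast
  then interpret scalar_embedding e by (rule scalar_embedding.intro)
  obtain H where "H \<in> \<G>" using collection_nonempty by blast
  then show "\<C> \<noteq> {}"
    using scalar_in_ergodic_lipschitz_class[OF grp] closed_subgroups unfolding class_def by blast
  interpret compact_length_group G T ell
    by (intro compact_length_group.intro compact_length_group_axioms.intro group compact length length_continuous)
      (use length_invariant in blast)
  show "propinquity_closed F \<C>" unfolding class_def
    by (rule propinquity_closed_ergodic_lipschitz_class) (use closed_subgroups collection_closed F_admissible F_nondegenerate in blast)+
qed

end
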